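(* Let $n\ge 1$, and let either $0<p<\infty$ and $0<q\le\infty$, or $p=\infty$ and $0<q\le 2$. Set $r:=\max\{1,p\}$, let $r'$ be the conjugate exponent of $r$ (so $1/r'=1-1/r$, with $1/r'=0$ if $r=1$ and $1/r'=1$ if $r=\infty$), and let $w(t)=(1+\log_+ (1/t))^{1/r'}$ for $t>0$. Then the continuous embedding $$F^{n/p}_{p,q}(\mathbb{R}^n)\hookrightarrow X_w(\mathbb{R}^n)$$ holds (where $n/p=0$ if $p=\infty$); that is, every $f\in F^{n/p}_{p,q}(\mathbb{R}^n)$ belongs to $X_w(\mathbb{R}^n)$ and there is a constant $C>0$ with $\|f\|_{X_w(\mathbb{R}^n)}\le C\|f\|_{F^{n/p}_{p,q}(\mathbb{R}^n)}$ for all such $f$.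
   Context: Notation: $\log_+ t=\max\{\log t,0\}$; $\widehat f(\xi)=\int_{\mathbb{R}^n} f(x)e^{-ix\xi}\,dx$; for a symbol $a$, $a(tD)f$ is the inverse Fourier transform of $a(t\xi)\widehat f(\xi)$, i.e. $a(tD)f(x)=(2\pi)^{-n}\int a(t\xi)\widehat f(\xi)e^{ix\xi}\,d\xi$, and $a(D)$ is the case $t=1$. $\mathrm{BMO}(\mathbb{R}^n)$: locally integrable $f$ with $\|f\|_{\mathrm{BMO}}=\sup_Q \frac1{|Q|}\int_Q|f-f_Q|\,dx<\infty$, the supremum being over cubes with sides parallel to the axes, $f_Q$ the average of $f$ over $Q$. Spaces $X_w$: let $w:(0,\infty)\to(0,\infty)$ satisfy (I) for every compact interval $I\subseteq(0,\infty)$, $0<\inf_{t\in I}\inf_{s>0}\frac{w(st)}{w(s)}\le \sup_{t\in I}\sup_{s>0}\frac{w(st)}{w(s)}<\infty$; (II) there is $N>0$ with $\sup_{t>0}w(t)(1+1/t)^{-N}<\infty$; (III) $\inf_{t>0}w(t)>0$. Let $\phi$ be a Schwartz function supported in $\{|\xi|\le2\}$ and identically one on $\{|\xi|\le1\}$. Then $X_w(\mathbb{R}^n)$ is the set of locally integrable $f$ with $\|f\|_{X_w(\mathbb{R}^n)}:=\|f\|_{\mathrm{BMO}(\mathbb{R}^n)}+\sup_{t>0}\frac{\|\phi(tD)f\|_\infty}{w(t)}<\infty$ (different choices of $\phi$ give equivalent norms). Triebel–Lizorkin spaces: let $\varphi_0$ be a nonnegative radially decreasing Schwartz function supported in $\{|\xi|\le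 3/2\}$, identically one on $\{|\xi|\le1\}$; $\varphi(\xi)=\varphi_0(\xi)-\varphi_0(2\xi)$, $\varphi_j(\xi)=\varphi(2^{-j}\xi)$ for $j\ge1$. For $s\in\mathbb{R}$, $0<p<\infty$, $0<q\le\infty$, $F^s_{p,q}(\mathbb{R}^n)$ is the set of tempered distributions $f$ with $\|f\|_{F^s_{p,q}}=\big\|\big(\sum_{j\ge0}2^{jsq}|\varphi_j(D)f|^q\big)^{1/q}\big\|_{L^p}<\infty$ (usual modification if $q=\infty$). For $p=\infty$, $0<q<\infty$, $F^s_{\infty,q}(\mathbb{R}^n)$ is the set of tempered distributions $f$ with $$\|f\|_{F^s_{\infty,q}}=\|\varphi_0(D)f\|_\infty+\sup_{Q}\Big(\frac1{|Q|}\int_Q\sum_{j=-\log_2\ell(Q)}^\infty2^{sjq}|\varphi_j(D)f(x)|^q\,dx\Big)^{1/q}<\infty,$$ the supremum being over dyadic cubes $Q$ with side length $\ell(Q)\le1$. *)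

theory Defs
  imports "HOL-Probability.Essential_Supremum" "HOL-Analysis.Analysis"
begin

definition partial_deriv :: "'n \<Rightarrow> (real^'n \<Rightarrow> complex) \<Rightarrow> real^'n \<Rightarrow> complex" where
  "partial_deriv i f x = frechet_derivative f (at x) (axis i 1)"

text \<open>The derivatives \<open>\<partial>\<^sup>\<alpha>\<close> are written as iterated partial derivatives along a list of coordinate
  directions, so that the order is the length of the list.\<close>

fun partial_derivs :: "'n list \<Rightarrow> (real^'n \<Rightarrow> complex) \<Rightarrow> real^'n \<Rightarrow> complex" where
  "partial_derivs [] f = f"
| "partial_derivs (i # is) f = partial_deriv i (partial_derivs is f)"

definition smooth :: "(real^'n \<Rightarrow> complex) \<Rightarrow> bool" where
  "smooth f \<longleftrightarrow> (\<forall>is x. partial_derivs is f differentiable (at x))"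

definition schwartz :: "(real^'n \<Rightarrow> complex) \<Rightarrow> bool" where
  "schwartz f \<longleftrightarrow> smooth f \<and>
     (\<forall>k is. bounded (range (\<lambda>x. norm x ^ k *\<^sub>R partial_derivs is f x)))"

definition schwartz_seminorm :: "nat \<Rightarrow> 'n list \<Rightarrow> (real^'n \<Rightarrow> complex) \<Rightarrow> real" where
  "schwartz_seminorm k is f = (SUP x. norm x ^ k * norm (partial_derivs is f x))"

text \<open>A tempered distribution is a functional on all functions of which only the values at Schwartz
  functions matter. Continuity on the Schwartz space is the usual seminorm estimate.\<close>

definition tempered :: "((real^'n \<Rightarrow> complex) \<Rightarrow> complex) \<Rightarrow> bool" where
  "tempered u \<longleftrightarrow>
     (\<forall>g h. schwartz g \<longrightarrow> schwartz h \<longrightarrow> u (\<lambda>x. g x + h x) = u g + u h) \<and>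
     (\<forall>c g. schwartz g \<longrightarrow> u (\<lambda>x. c * g x) = c * u g) \<and>
     (\<exists>C N. \<forall>g. schwartz g \<longrightarrow>
        norm (u g) \<le> C * (\<Sum>k\<le>N. \<Sum>is | length is \<le> N. schwartz_seminorm k is g))"

definition dist_of_fun :: "(real^'n \<Rightarrow> complex) \<Rightarrow> (real^'n \<Rightarrow> complex) \<Rightarrow> complex" where
  "dist_of_fun f g = (LINT x|lebesgue. f x * g x)"

definition represents :: "(real^'n \<Rightarrow> complex) \<Rightarrow> ((real^'n \<Rightarrow> complex) \<Rightarrow> complex) \<Rightarrow> bool" where
  "represents f u \<longleftrightarrow>
     (\<forall>g. schwartz g \<longrightarrow> integrable lebesgue (\<lambda>x. f x * g x) \<and> u g = dist_of_fun f g)"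

definition fourier :: "(real^'n \<Rightarrow> complex) \<Rightarrow> real^'n \<Rightarrow> complex" where
  "fourier g \<xi> = (LINT x|lebesgue. g x * exp (- \<i> * complex_of_real (x \<bullet> \<xi>)))"

definition fourier_dist ::
    "((real^'n \<Rightarrow> complex) \<Rightarrow> complex) \<Rightarrow> (real^'n \<Rightarrow> complex) \<Rightarrow> complex" where
  "fourier_dist u g = u (fourier g)"

text \<open>For a Schwartz symbol \<open>a\<close> and a tempered distribution \<open>u\<close>, the distribution \<open>a(tD)u\<close> is the
  smooth function below: the integral over \<open>\<xi>\<close> in Fourier inversion is the pairing of the
  Fourier transform of \<open>u\<close> with the Schwartz function that sends \<open>\<xi>\<close> to \<open>a(t\<xi>) e\<^bsup>ix\<xi>\<^esup>\<close>.\<close>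

definition multiplier ::
    "(real^'n \<Rightarrow> complex) \<Rightarrow> real \<Rightarrow> ((real^'n \<Rightarrow> complex) \<Rightarrow> complex) \<Rightarrow> real^'n \<Rightarrow> complex" where
  "multiplier a t u x =
     fourier_dist u (\<lambda>\<xi>. a (t *\<^sub>R \<xi>) * exp (\<i> * complex_of_real (x \<bullet> \<xi>)))
       / complex_of_real ((2 * pi) ^ CARD('n))"

text \<open>The value at \<open>\<infinity>\<close> is the right one for \<open>a > 0\<close>, the only case used.\<close>

definition epowr :: "ennreal \<Rightarrow> real \<Rightarrow> ennreal" where
  "epowr x a = (if x = \<infinity> then \<infinity> else ennreal (enn2real x powr a))"

definition Lp_norm :: "real \<Rightarrow> (real^'n \<Rightarrow> ennreal) \<Rightarrow> ennreal" where
  "Lp_norm p g = epowr (\<integral>\<^sup>+x. epowr (g x) p \<partial>lebesgue) (1 / p)"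

definition Linf_norm :: "(real^'n \<Rightarrow> complex) \<Rightarrow> ennreal" where
  "Linf_norm f = esssup lebesgue (\<lambda>x. ennreal (norm (f x)))"

definition locally_integrable :: "(real^'n \<Rightarrow> complex) \<Rightarrow> bool" where
  "locally_integrable f \<longleftrightarrow> (\<forall>K. compact K \<longrightarrow> f absolutely_integrable_on K)"

definition cubes :: "(real^'n) set set" where
  "cubes = {cbox a (a + l *\<^sub>R (\<chi> i. 1)) | a l. l > 0}"

definition average :: "(real^'n) set \<Rightarrow> (real^'n \<Rightarrow> complex) \<Rightarrow> complex" where
  "average Q f = (LINT x:Q|lebesgue. f x) /\<^sub>R measure lebesgue Q"

definition BMO_norm :: "(real^'n \<Rightarrow> complex) \<Rightarrow> ennreal" where
  "BMO_norm f =
     (SUP Q\<in>cubes. (\<integral>\<^sup>+x\<in>Q. ennreal (norm (f x - average Q f)) \<partial>lebesgue) / emeasure lebesgue Q)"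

definition admissible_weight :: "(real \<Rightarrow> real) \<Rightarrow> bool" where
  "admissible_weight w \<longleftrightarrow>
     (\<forall>t>0. w t > 0) \<and>
     (\<forall>a b. 0 < a \<longrightarrow> a \<le> b \<longrightarrow>
        0 < (INF t\<in>{a..b}. INF s\<in>{0<..}. ennreal (w (s * t) / w s)) \<and>
        (SUP t\<in>{a..b}. SUP s\<in>{0<..}. ennreal (w (s * t) / w s)) < \<infinity>) \<and>
     (\<exists>N>0. (SUP t\<in>{0<..}. ennreal (w t * (1 + 1 / t) powr - N)) < \<infinity>) \<and>
     0 < (INF t\<in>{0<..}. ennreal (w t))"

definition X_cutoff :: "(real^'n \<Rightarrow> complex) \<Rightarrow> bool" where
  "X_cutoff \<phi> \<longleftrightarrow> schwartz \<phi> \<and> closure {\<xi>. \<phi> \<xi> \<noteq> 0} \<subseteq> cball 0 2 \<and> (\<forall>\<xi>\<in>cball 0 1. \<phi> \<xi> = 1)"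

definition X_norm :: "(real^'n \<Rightarrow> complex) \<Rightarrow> (real \<Rightarrow> real) \<Rightarrow> (real^'n \<Rightarrow> complex) \<Rightarrow> ennreal" where
  "X_norm \<phi> w f =
     BMO_norm f + (SUP t\<in>{0<..}. Linf_norm (multiplier \<phi> t (dist_of_fun f)) / ennreal (w t))"

text \<open>\<open>\<phi>(tD)f\<close> is meaningful because a function with finite BMO norm induces a tempered
  distribution. The parameters are meant to satisfy \<open>X_cutoff \<phi>\<close> and \<open>admissible_weight w\<close>.\<close>

definition X_space :: "(real^'n \<Rightarrow> complex) \<Rightarrow> (real \<Rightarrow> real) \<Rightarrow> (real^'n \<Rightarrow> complex) set" where
  "X_space \<phi> w = {f. locally_integrable f \<and> X_norm \<phi> w f < \<infinity>}"

definition log_plus :: "real \<Rightarrow> real" where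
  "log_plus t = max (ln t) 0"

text \<open>The logarithmic weights are admissible, so that \<open>X_space\<close> may be formed with them.\<close>

lemma log_plus_mult:
  assumes "x > 0" "y > 0"
  shows "1 + log_plus (x * y) \<le> (1 + log_plus x) * (1 + log_plus y)"
proof -
  have "log_plus (x * y) \<le> log_plus x + log_plus y"
    using assms unfolding log_plus_def ln_mult_pos[OF assms] by linarith
  moreover have "0 \<le> log_plus x * log_plus y"
    by (simp add: log_plus_def)
  ultimately show ?thesis by (simp add: algebra_simps)
qed

lemma log_plus_mono: "0 < x \<Longrightarrow> x \<le> y \<Longrightarrow> log_plus x \<le> log_plus y"
  by (auto simp: log_plus_def max_def)

lemma log_plus_nonneg: "0 \<le> log_plus x"
  by (simp add: log_plus_def)

lemma admissible_log_weight:
  assumes "\<theta> \<ge> 0"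
  shows "admissible_weight (\<lambda>t. (1 + log_plus (1 / t)) powr \<theta>)"
proof -
  define v where "v t = 1 + log_plus (1 / t)" for t
  define w where "w t = v t powr \<theta>" for t
  have v1: "v t \<ge> 1" for t by (simp add: v_def log_plus_nonneg)
  have w1: "w t \<ge> 1" for t using v1[of t] assms by (simp add: w_def ge_one_powr_ge_zero)
  have vmult: "v (s * t) \<le> v s * v t" if "s > 0" "t > 0" for s t
    using log_plus_mult[of "1 / s" "1 / t"] that by (simp add: v_def)
  have wmult: "w (s * t) \<le> w s * w t" if "s > 0" "t > 0" for s t
  proof -
    have "w (s * t) \<le> (v s * v t) powr \<theta>"
      unfolding w_def using vmult[OF that] v1[of "s * t"] assms by (intro powr_mono2) auto
    then show ?thesis using v1[of s] v1[of t] by (simp add: w_def powr_mult)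
  qed
  have wanti: "w t \<le> w s" if "0 < s" "s \<le> t" for s t
    unfolding w_def using that assms v1[of t]
    by (intro powr_mono2) (auto simp: v_def intro!: log_plus_mono divide_left_mono)
  have wpos: "w t > 0" for t using w1[of t] by linarith
  have I: "0 < (INF t\<in>{a..b}. INF s\<in>{0<..}. ennreal (w (s * t) / w s)) \<and>
           (SUP t\<in>{a..b}. SUP s\<in>{0<..}. ennreal (w (s * t) / w s)) < \<infinity>" if ab: "0 < a" "a \<le> b" for a b
  proof
    have lower: "ennreal (1 / w (1 / b)) \<le> ennreal (w (s * t) / w s)"
      if "t \<in> {a..b}" "s \<in> {0<..}" for s t
    proof -
      have t: "t > 0" "s > 0" using that ab by auto
      have "w s \<le> w (s * t) * w (1 / t)" using wmult[of "s * t" "1 / t"] t by simp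
      also have "\<dots> \<le> w (s * t) * w (1 / b)"
        using wanti[of "1 / b" "1 / t"] that ab t wpos[of "s * t"]
        by (intro mult_left_mono) (auto simp: field_simps)
      finally show ?thesis using wpos[of s] wpos[of "1 / b"]
        by (intro ennreal_leI) (simp add: field_simps)
    qed
    have "0 < ennreal (1 / w (1 / b))" using wpos by simp
    also have "\<dots> \<le> (INF t\<in>{a..b}. INF s\<in>{0<..}. ennreal (w (s * t) / w s))"
      using lower by (intro INF_greatest) auto
    finally show "0 < (INF t\<in>{a..b}. INF s\<in>{0<..}. ennreal (w (s * t) / w s))" .
    have upper: "ennreal (w (s * t) / w s) \<le> ennreal (w a)"
      if "t \<in> {a..b}" "s \<in> {0<..}" for s t
    proof -
      have t: "t > 0" "s > 0" using that ab by auto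
      have "w (s * t) \<le> w s * w t" using wmult t by simp
      also have "\<dots> \<le> w s * w a"
        using wanti[of a t] that ab wpos[of s] by (intro mult_left_mono) auto
      finally show ?thesis using wpos[of s] by (intro ennreal_leI) (simp add: field_simps)
    qed
    have "(SUP t\<in>{a..b}. SUP s\<in>{0<..}. ennreal (w (s * t) / w s)) \<le> ennreal (w a)"
      using upper by (intro SUP_least) auto
    also have "\<dots> < \<infinity>" by simp
    finally show "(SUP t\<in>{a..b}. SUP s\<in>{0<..}. ennreal (w (s * t) / w s)) < \<infinity>" .
  qed
  have II: "(SUP t\<in>{0<..}. ennreal (w t * (1 + 1 / t) powr - (\<theta> + 1))) < \<infinity>"
  proof -
    have "ennreal (w t * (1 + 1 / t) powr - (\<theta> + 1)) \<le> ennreal 1" if "t \<in> {0<..}" for t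
    proof -
      have t: "t > 0" using that by simp
      have "v t \<le> 1 + 1 / t"
        using ln_le_minus_one[of "1 / t"] t by (auto simp: v_def log_plus_def max_def)
      then have "w t \<le> (1 + 1 / t) powr \<theta>"
        unfolding w_def using v1[of t] assms by (intro powr_mono2) auto
      also have "\<dots> \<le> (1 + 1 / t) powr (\<theta> + 1)"
        using t by (intro powr_mono) auto
      finally have "w t \<le> (1 + 1 / t) powr (\<theta> + 1)" .
      moreover have "(1 + 1 / t) powr (\<theta> + 1) > 0" using divide_pos_pos[OF zero_less_one t] by (metis add_pos_pos zero_less_one powr_gt_zero less_irrefl)
      ultimately have "w t * (1 + 1 / t) powr - (\<theta> + 1) \<le> 1"
        by (subst powr_minus) (simp add: divide_inverse[symmetric])
      then show ?thesis by (rule ennreal_leI)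
    qed
    then have "(SUP t\<in>{0<..}. ennreal (w t * (1 + 1 / t) powr - (\<theta> + 1))) \<le> ennreal 1"
      by (intro SUP_least) auto
    also have "\<dots> < \<infinity>" by simp
    finally show ?thesis .
  qed
  have III: "0 < (INF t\<in>{0<..}. ennreal (w t))"
  proof -
    have "0 < ennreal 1" by simp
    also have "\<dots> \<le> (INF t\<in>{0<..}. ennreal (w t))"
      using w1 by (intro INF_greatest ennreal_leI) auto
    finally show ?thesis .
  qed
  have "admissible_weight w"
    unfolding admissible_weight_def
    using wpos I II III assms by (auto intro!: exI[of _ "\<theta> + 1"])
  then show ?thesis by (simp add: w_def[abs_def] v_def[abs_def])
qed

definition TL_generator :: "(real^'n \<Rightarrow> real) \<Rightarrow> bool" where
  "TL_generator \<phi>0 \<longleftrightarrow> schwartz (\<lambda>\<xi>. complex_of_real (\<phi>0 \<xi>)) \<and> (\<forall>\<xi>. 0 \<le> \<phi>0 \<xi>) \<and>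
     (\<forall>\<xi> \<eta>. norm \<xi> \<le> norm \<eta> \<longrightarrow> \<phi>0 \<eta> \<le> \<phi>0 \<xi>) \<and>
     closure {\<xi>. \<phi>0 \<xi> \<noteq> 0} \<subseteq> cball 0 (3/2) \<and> (\<forall>\<xi>\<in>cball 0 1. \<phi>0 \<xi> = 1)"

definition TL_symbol :: "(real^'n \<Rightarrow> real) \<Rightarrow> nat \<Rightarrow> real^'n \<Rightarrow> real" where
  "TL_symbol \<phi>0 j \<xi> =
     (if j = 0 then \<phi>0 \<xi> else \<phi>0 ((1 / 2 ^ j) *\<^sub>R \<xi>) - \<phi>0 (2 *\<^sub>R (1 / 2 ^ j) *\<^sub>R \<xi>))"

definition TL_piece ::
    "(real^'n \<Rightarrow> real) \<Rightarrow> nat \<Rightarrow> ((real^'n \<Rightarrow> complex) \<Rightarrow> complex) \<Rightarrow> real^'n \<Rightarrow> complex" where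
  "TL_piece \<phi>0 j u = multiplier (\<lambda>\<xi>. complex_of_real (TL_symbol \<phi>0 j \<xi>)) 1 u"

definition TL_norm_fin ::
    "(real^'n \<Rightarrow> real) \<Rightarrow> real \<Rightarrow> real \<Rightarrow> ennreal \<Rightarrow> ((real^'n \<Rightarrow> complex) \<Rightarrow> complex) \<Rightarrow> ennreal" where
  "TL_norm_fin \<phi>0 s p q u = Lp_norm p (\<lambda>x.
     if q = \<infinity> then (SUP j. ennreal (2 powr (real j * s) * norm (TL_piece \<phi>0 j u x)))
     else epowr (\<Sum>j. ennreal (2 powr (real j * s * enn2real q) *
                               norm (TL_piece \<phi>0 j u x) powr enn2real q)) (1 / enn2real q))"

definition dyadic_cube :: "nat \<Rightarrow> ('n \<Rightarrow> int) \<Rightarrow> (real^'n) set" where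
  "dyadic_cube k m =
     {x. \<forall>i. of_int (m i) / 2 ^ k \<le> x $ i \<and> x $ i < (of_int (m i) + 1) / 2 ^ k}"

text \<open>A dyadic cube of side length at most 1 has side length \<open>2\<^sup>-\<^sup>k\<close> with \<open>k \<ge> 0\<close>, so the sum over
  \<open>j\<close> starts at \<open>k\<close>; below it is shifted to start at 0.\<close>

definition TL_norm_inf ::
    "(real^'n \<Rightarrow> real) \<Rightarrow> real \<Rightarrow> real \<Rightarrow> ((real^'n \<Rightarrow> complex) \<Rightarrow> complex) \<Rightarrow> ennreal" where
  "TL_norm_inf \<phi>0 s q u = Linf_norm (TL_piece \<phi>0 0 u) +
     (SUP (k, m) \<in> UNIV. epowr (
        (\<integral>\<^sup>+x\<in>dyadic_cube k m. (\<Sum>j. ennreal (2 powr (real (k + j) * s * q) *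
            norm (TL_piece \<phi>0 (k + j) u x) powr q)) \<partial>lebesgue)
        / emeasure lebesgue (dyadic_cube k m)) (1 / q))"

text \<open>For \<open>p = q = \<infinity>\<close> the value is meaningless: only \<open>q < \<infinity>\<close> is considered when \<open>p = \<infinity>\<close>.\<close>

definition TL_norm ::
    "(real^'n \<Rightarrow> real) \<Rightarrow> real \<Rightarrow> ennreal \<Rightarrow> ennreal \<Rightarrow> ((real^'n \<Rightarrow> complex) \<Rightarrow> complex) \<Rightarrow> ennreal" where
  "TL_norm \<phi>0 s p q u =
     (if p = \<infinity> then TL_norm_inf \<phi>0 s (enn2real q) u else TL_norm_fin \<phi>0 s (enn2real p) q u)"

definition TL_space ::
    "(real^'n \<Rightarrow> real) \<Rightarrow> real \<Rightarrow> ennreal \<Rightarrow> ennreal \<Rightarrow> ((real^'n \<Rightarrow> complex) \<Rightarrow> complex) set" where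
  "TL_space \<phi>0 s p q = {u. tempered u \<and> TL_norm \<phi>0 s p q u < \<infinity>}"

end

theory Submission
  imports Defs "HOL-Probability.Probability"
begin

text \<open>The pieces \<open>f\<^sub>j = \<phi>\<^sub>j(D)u\<close> are band limited at scale \<open>2\<^sup>j\<close>, so \<open>|f\<^sub>j|\<close> is comparable to its value at a
  point on some ball of radius comparable to \<open>2\<^sup>-\<^sup>j\<close>. This gives \<open>\<parallel>f\<^sub>j\<parallel>\<^sub>\<infinity> \<le> M\<close> with \<open>M\<close> a multiple of the
  Triebel--Lizorkin norm and, for finite \<open>p\<close>, Jawerth's bound \<open>\<Sum>\<^sub>j \<parallel>f\<^sub>j\<parallel>\<^sub>\<infinity>\<^sup>p \<le> M\<^sup>p\<close>; as \<open>\<phi>(tD)u\<close> only sees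
  about \<open>1 + log\<^sub>+ (1/t)\<close> pieces, Hoelder's inequality produces the weight \<open>w(t)\<close>. For the BMO norm on a
  cube of side comparable to \<open>2\<^sup>-\<^sup>k\<close>, the pieces with \<open>j \<le> k\<close> form a function of small oscillation since
  \<open>f\<^sub>j\<close> is Lipschitz with constant of order \<open>2\<^sup>j M\<close>, while the pieces with \<open>j > k\<close> are almost orthogonal
  against a nonnegative bump with spectrum in a ball of radius comparable to \<open>2\<^sup>k\<close>, so their sum is
  controlled in \<open>L\<^sup>2\<close> by the local square function.\<close>

section \<open>Functions of rapid decay and Schwartz functions\<close>

text \<open>The obstacle is that \<open>u\<close> is only a functional bounded by finitely many
  seminorms: its pieces are smooth functions of polynomial growth, and neither the convergence of
  their sum nor any boundedness is known beforehand. Hence every exchange of \<open>u\<close> with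
  an integral goes through explicit bounds on translates of one Schwartz kernel, and two pieces are
  shown to be orthogonal by moving both multipliers off \<open>u\<close> onto the bump, where
  separated supports make the result vanish. The bump is the squared modulus of a dilated Fourier
  transform of \<open>\<phi>0\<close>: squaring gives positivity, and the spectrum stays compact.
  The ball on which a piece is comparable to its value at \<open>x\<close> is centred not at
  \<open>x\<close> but at a near maximum of the piece divided by a slowly growing weight; only the
  size of the ball matters. For p = \<infinity> the bound q \<le> 2 enters through
  \<open>|f\<^sub>j|^2 \<le> M^(2-q) |f\<^sub>j|^q\<close>. The sum of the pieces is built as a
  limit in L^1 with the weight \<open>wt\<close>, which suffices both for pairing with Schwartz
  functions and for local integrability.\<close>

definition wt :: "real^'n \<Rightarrow> real" where
  "wt x = inverse ((1 + norm x) ^ (2 * CARD('n)))"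

lemma wt_pos: "wt x > 0"
  by (simp add: wt_def add_pos_nonneg)

lemma continuous_on_wt [continuous_intros]:
  assumes "continuous_on S f" shows "continuous_on S (\<lambda>x. wt (f x))"
proof -
  have "1 + norm (f x) \<noteq> 0" for x
    using norm_ge_zero[of "f x"] by linarith
  then show ?thesis
    unfolding wt_def by (intro continuous_intros assms) auto
qed

lemma borel_measurable_wt [measurable]: "wt \<in> borel_measurable borel"
  by (intro borel_measurable_continuous_onI continuous_intros)

text \<open>Moving a point by \<open>D\<close> changes \<open>1 + norm\<close> by a factor of at
  most 1 + D. Thus \<open>wt\<close> is essentially constant on unit balls and on cubes of bounded
  size, which is what averaging arguments need.\<close>

lemma wt_compare:
  fixes x y :: "real^'n"
  assumes "dist x y \<le> D"
  shows "wt x \<le> (1 + D) ^ (2 * CARD('n)) * wt y"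
proof -
  have D: "D \<ge> 0" using assms zero_le_dist order_trans by blast
  have "norm y \<le> norm x + D"
    using assms norm_triangle_ineq[of x "y - x"] by (simp add: dist_norm norm_minus_commute)
  moreover have "0 \<le> D * norm x" using D by simp
  ultimately have "1 + norm y \<le> (1 + D) * (1 + norm x)"
    by (simp add: algebra_simps)
  then have "(1 + norm y) ^ (2 * CARD('n)) \<le> ((1 + D) * (1 + norm x)) ^ (2 * CARD('n))"
    by (intro power_mono) auto
  then have "(1 + norm y) ^ (2 * CARD('n)) \<le> (1 + D) ^ (2 * CARD('n)) * (1 + norm x) ^ (2 * CARD('n))"
    by (simp only: power_mult_distrib)
  moreover have "1 + norm x > 0" "1 + norm y > 0" by (simp_all add: add_pos_nonneg)
  ultimately show ?thesis
    unfolding wt_def by (simp add: field_simps)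
qed

text \<open>The exponent \<open>2 * CARD('n)\<close> leaves one factor (1 + |x|)^2 for each
  coordinate, and each dominates 1 + (x \<bullet> b)^2. So \<open>wt\<close> lies below a tensor
  product of one-dimensional functions 1 / (1 + t^2), whose integral factorises.\<close>

lemma integrable_wt: "integrable lborel (wt :: real^'n \<Rightarrow> real)"
proof (rule integrableI_bounded)
  show "(wt :: real^'n \<Rightarrow> real) \<in> borel_measurable lborel" by simp
  have pw: "wt x \<le> (\<Prod>b\<in>Basis. inverse (1 + (x \<bullet> b)\<^sup>2))" for x :: "real^'n"
  proof -
    have p: "0 < 1 + (x \<bullet> b)\<^sup>2" for b by (simp add: add_pos_nonneg)
    have "(\<Prod>b\<in>Basis. 1 + (x \<bullet> b)\<^sup>2) \<le> (\<Prod>b\<in>(Basis::(real^'n) set). (1 + norm x)\<^sup>2)"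
    proof (intro prod_mono conjI)
      fix b :: "real^'n" assume b: "b \<in> Basis"
      have "\<bar>x \<bullet> b\<bar> \<le> norm x" using Basis_le_norm[OF b, of x] by simp
      then have "(x \<bullet> b)\<^sup>2 \<le> (norm x)\<^sup>2"
        by (metis abs_ge_zero power2_abs power_mono)
      then show "1 + (x \<bullet> b)\<^sup>2 \<le> (1 + norm x)\<^sup>2"
      proof -
        have e: "(1 + norm x)\<^sup>2 = 1 + 2 * norm x + (norm x)\<^sup>2"
          by (simp add: power2_eq_square algebra_simps)
        assume "(x \<bullet> b)\<^sup>2 \<le> (norm x)\<^sup>2"
        then show ?thesis unfolding e using norm_ge_zero[of x] by linarith
      qed
    qed (use p less_imp_le in auto)
    then have "(\<Prod>b\<in>Basis. 1 + (x \<bullet> b)\<^sup>2) \<le> (1 + norm x) ^ (2 * CARD('n))"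
      by (simp add: DIM_cart power_mult)
    then have "inverse ((1 + norm x) ^ (2 * CARD('n))) \<le> inverse (\<Prod>b\<in>Basis. 1 + (x \<bullet> b)\<^sup>2)"
      using p by (intro le_imp_inverse_le prod_pos) auto
    then show ?thesis by (simp add: wt_def prod_inversef[symmetric] comp_def)
  qed
  have one: "(\<integral>\<^sup>+x. ennreal (inverse (1 + x\<^sup>2)) \<partial>lborel) < \<infinity>"
  proof -
    have "integrable lborel (\<lambda>x::real. inverse (1 + x\<^sup>2))"
      using integrable_inverse_1_plus_square by (simp add: set_integrable_def)
    then show ?thesis
      by (subst nn_integral_eq_integral) (auto simp: add_nonneg_nonneg)
  qed
  have "(\<integral>\<^sup>+x. ennreal (norm (wt x)) \<partial>(lborel::(real^'n) measure))
      \<le> (\<integral>\<^sup>+x. (\<Prod>b\<in>Basis. ennreal (inverse (1 + (x \<bullet> b)\<^sup>2))) \<partial>(lborel::(real^'n) measure))"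
  proof (intro nn_integral_mono)
    fix x :: "real^'n"
    have "(\<Prod>b\<in>Basis. ennreal (inverse (1 + (x \<bullet> b)\<^sup>2))) = ennreal (\<Prod>b\<in>Basis. inverse (1 + (x \<bullet> b)\<^sup>2))"
      by (rule prod_ennreal) (simp add: add_nonneg_nonneg)
    then show "ennreal (norm (wt x)) \<le> (\<Prod>b\<in>Basis. ennreal (inverse (1 + (x \<bullet> b)\<^sup>2)))"
      using pw[of x] wt_pos[of x] by (simp add: abs_of_pos ennreal_leI)
  qed
  also have "\<dots> = (\<Prod>b\<in>(Basis::(real^'n) set). \<integral>\<^sup>+x. ennreal (inverse (1 + x\<^sup>2)) \<partial>lborel)"
    by (rule nn_integral_lborel_prod[of "\<lambda>b x. ennreal (inverse (1 + x\<^sup>2))"]) auto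
  also have "\<dots> < \<infinity>"
    using one by (simp add: power_less_top_ennreal)
  finally show "(\<integral>\<^sup>+x. ennreal (norm (wt x :: real)) \<partial>(lborel::(real^'n) measure)) < \<infinity>" .
qed

text \<open>All orders of decay but no smoothness: this is what the right factor of a convolution
  has to provide, since derivatives fall on the Schwartz factor. Measurability is built in so that
  decay alone yields integrability.\<close>

definition rapid :: "(real^'n \<Rightarrow> complex) \<Rightarrow> bool" where
  "rapid g \<longleftrightarrow> g \<in> borel_measurable borel \<and> (\<forall>N. \<exists>C. \<forall>x. norm (g x) * (1 + norm x) ^ N \<le> C)"

lemma rapid_measurable [measurable_dest]: "rapid g \<Longrightarrow> g \<in> borel_measurable borel"
  by (simp add: rapid_def)

lemma one_plus_norm_pos [simp]: "0 < 1 + norm x" "1 + norm x \<noteq> 0" "0 \<le> 1 + norm x"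
  by (simp_all add: add_pos_nonneg add_nonneg_eq_0_iff)

lemma rapidE:
  fixes g :: "real^'n \<Rightarrow> complex"
  assumes "rapid g"
  obtains C where "C \<ge> 0" "\<And>x. norm (g x) * (1 + norm x) ^ N \<le> C * wt x"
proof -
  obtain C where C: "\<And>x. norm (g x) * (1 + norm x) ^ (N + 2 * CARD('n)) \<le> C"
    using assms unfolding rapid_def by blast
  have "C \<ge> 0" using C[of 0] by (meson norm_ge_zero mult_nonneg_nonneg one_plus_norm_pos(3) order_trans zero_le_power)
  moreover have "norm (g x) * (1 + norm x) ^ N \<le> C * wt x" for x
    using C[of x] by (simp add: wt_def power_add field_simps)
  ultimately show thesis using that by blast
qed

lemma rapid_integrable_moment:
  assumes "rapid g"
  shows "integrable lborel (\<lambda>x. norm (g x) * (1 + norm x) ^ N)"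
proof -
  obtain C where C: "C \<ge> 0" "\<And>x. norm (g x) * (1 + norm x) ^ N \<le> C * wt x"
    using rapidE[OF assms] by blast
  have [measurable]: "g \<in> borel_measurable borel" using assms by (rule rapid_measurable)
  show ?thesis
    by (rule Bochner_Integration.integrable_bound[OF integrable_mult_right[OF integrable_wt, of C]])
      (use C in \<open>auto simp: abs_mult abs_of_pos wt_pos\<close>)
qed

lemma rapid_integrable: "rapid g \<Longrightarrow> integrable lborel g"
  using rapid_integrable_moment[of g 0] rapid_measurable[of g]
  by (simp add: integrable_norm_iff)

lemma rapid_mult_poly:
  assumes "rapid g" "h \<in> borel_measurable borel" "\<And>x. norm (h x) \<le> C * (1 + norm x) ^ M"
  shows "rapid (\<lambda>x. h x * g x)"
  unfolding rapid_def
proof (intro conjI allI)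
  show "(\<lambda>x. h x * g x) \<in> borel_measurable borel"
    using assms(1,2) rapid_measurable by (intro borel_measurable_times) auto
  fix N
  obtain D where D: "\<And>x. norm (g x) * (1 + norm x) ^ (M + N) \<le> D"
    using assms(1) unfolding rapid_def by blast
  have C: "C \<ge> 0" using order_trans[OF norm_ge_zero assms(3)[of 0]] by simp
  have "norm (h x * g x) * (1 + norm x) ^ N \<le> C * D" for x
  proof -
    have "norm (h x * g x) * (1 + norm x) ^ N \<le> C * (1 + norm x) ^ M * norm (g x) * (1 + norm x) ^ N"
      using assms(3)[of x] by (simp add: norm_mult mult_right_mono)
    also have "\<dots> = C * (norm (g x) * (1 + norm x) ^ (M + N))"
      by (simp add: power_add)
    also have "\<dots> \<le> C * D" using D C by (intro mult_left_mono) auto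
    finally show ?thesis .
  qed
  then show "\<exists>D. \<forall>x. norm (h x * g x) * (1 + norm x) ^ N \<le> D" by blast
qed

lemma rapid_mult_bounded:
  assumes "rapid g" "h \<in> borel_measurable borel" "\<And>x. norm (h x) \<le> C"
  shows "rapid (\<lambda>x. h x * g x)"
  using rapid_mult_poly[OF assms(1,2), of C 0] assms(3) by simp

section \<open>Partial derivatives and closure properties of Schwartz functions\<close>

lemma partial_derivs_append:
  "partial_derivs (is @ js) f = partial_derivs is (partial_derivs js f)"
  by (induction "is") auto

lemma has_derivative_partial:
  fixes f :: "real^'n \<Rightarrow> complex"
  assumes "f differentiable (at x)"
  shows "(f has_derivative (\<lambda>h. \<Sum>i\<in>UNIV. h $ i *\<^sub>R partial_deriv i f x)) (at x)"
proof -
  let ?D = "frechet_derivative f (at x)"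
  have D: "(f has_derivative ?D) (at x)" using assms by (simp add: frechet_derivative_works)
  then have lin: "linear ?D" by (rule has_derivative_linear)
  have "?D h = (\<Sum>i\<in>UNIV. h $ i *\<^sub>R partial_deriv i f x)" for h
  proof -
    have "h = (\<Sum>i\<in>UNIV. h $ i *\<^sub>R axis i 1)"
      using basis_expansion[of h] by (simp add: scalar_mult_eq_scaleR)
    then have "?D h = ?D (\<Sum>i\<in>UNIV. h $ i *\<^sub>R axis i 1)" by simp
    also have "\<dots> = (\<Sum>i\<in>UNIV. h $ i *\<^sub>R partial_deriv i f x)"
      using lin by (simp add: linear_sum linear_scale partial_deriv_def)
    finally show ?thesis .
  qed
  then have "?D = (\<lambda>h. \<Sum>i\<in>UNIV. h $ i *\<^sub>R partial_deriv i f x)" by blast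
  then show ?thesis using D by simp
qed

lemma partial_deriv_eqI:
  assumes "(f has_derivative f') (at x)"
  shows "partial_deriv i f x = f' (axis i 1)"
  using frechet_derivative_at[OF assms] by (simp add: partial_deriv_def)

lemma partial_deriv_eqI':
  assumes "(f has_derivative (\<lambda>h. \<Sum>i\<in>UNIV. h $ i *\<^sub>R d i)) (at x)"
  shows "partial_deriv i f x = d i"
proof -
  have "partial_deriv i f x = (\<Sum>j\<in>UNIV. if j = i then d j else 0)"
    unfolding partial_deriv_eqI[OF assms] by (intro sum.cong) (auto simp: axis_def)
  then show ?thesis by simp
qed

text \<open>A second-order remainder replaces dominated convergence in differentiation under the
  integral: convolutions and Fourier transforms inherit such a remainder from their
  integrands.\<close>

lemma has_derivative_quadratic:
  fixes f :: "'a::real_normed_vector \<Rightarrow> 'b::real_normed_vector"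
  assumes "bounded_linear f'"
    and "\<And>h. norm h \<le> 1 \<Longrightarrow> norm (f (x + h) - f x - f' h) \<le> C * (norm h)\<^sup>2"
  shows "(f has_derivative f') (at x)"
  unfolding has_derivative_at
proof (intro conjI assms(1))
  have "\<forall>\<^sub>F h in at 0. norm (norm (f (x + h) - f x - f' h) / norm h) \<le> C * norm h"
    unfolding eventually_at
  proof (intro exI[of _ 1] conjI ballI impI)
    fix h :: 'a assume "h \<noteq> 0 \<and> dist h 0 < 1"
    then show "norm (norm (f (x + h) - f x - f' h) / norm h) \<le> C * norm h"
      using assms(2)[of h] by (simp add: divide_le_eq power2_eq_square mult.assoc)
  qed simp
  moreover have "((\<lambda>h::'a. C * norm h) \<longlongrightarrow> 0) (at 0)"
    by (rule tendsto_eq_intros tendsto_norm_zero tendsto_ident_at | simp)+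
  ultimately show "(\<lambda>h. norm (f (x + h) - f x - f' h) / norm h) \<midarrow>0\<rightarrow> 0"
    by (rule Lim_null_comparison)
qed

text \<open>Induction on the list of directions never leaves an invariant class \<open>X\<close>, so
  it is enough to differentiate once and to bound once. Closure properties then reduce to naming a
  class that is stable under one partial derivative.\<close>

lemma schwartz_coinduct:
  assumes "X f"
    and diff: "\<And>f x. X f \<Longrightarrow> f differentiable (at x)"
    and decay: "\<And>f N. X f \<Longrightarrow> \<exists>C. \<forall>x. norm (f x) * (1 + norm x) ^ N \<le> C"
    and step: "\<And>f i. X f \<Longrightarrow> X (partial_deriv i f)"
  shows "schwartz f"
proof -
  have X: "X (partial_derivs is f)" for "is"
    by (induction "is") (use assms(1) step in auto)
  have "bounded (range (\<lambda>x. norm x ^ k *\<^sub>R partial_derivs is f x))" for k "is"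
  proof -
    obtain C where C: "\<And>x. norm (partial_derivs is f x) * (1 + norm x) ^ k \<le> C"
      using decay[OF X[of "is"]] by blast
    have "norm (norm x ^ k *\<^sub>R partial_derivs is f x) \<le> C" for x
    proof -
      have "norm x ^ k * norm (partial_derivs is f x) \<le> (1 + norm x) ^ k * norm (partial_derivs is f x)"
        by (intro mult_right_mono power_mono) auto
      then show ?thesis using C[of x] by (simp add: mult.commute)
    qed
    then show ?thesis unfolding bounded_iff by blast
  qed
  then show ?thesis using X diff unfolding schwartz_def smooth_def by blast
qed

lemma schwartz_differentiable: "schwartz f \<Longrightarrow> f differentiable (at x)"
  unfolding schwartz_def smooth_def by (metis partial_derivs.simps(1))

lemma schwartz_partials: "schwartz f \<Longrightarrow> schwartz (partial_derivs is f)"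
  unfolding schwartz_def smooth_def partial_derivs_append[symmetric] by auto

lemma schwartz_partial: "schwartz f \<Longrightarrow> schwartz (partial_deriv i f)"
  using schwartz_partials[of f "[i]"] by simp

lemma schwartz_decay:
  assumes "schwartz f"
  shows "\<exists>C. \<forall>x. norm (f x) * (1 + norm x) ^ N \<le> C"
proof -
  have "bounded (range (\<lambda>x. norm x ^ k *\<^sub>R f x))" for k
    using assms unfolding schwartz_def by (metis partial_derivs.simps(1))
  then have "\<forall>k. \<exists>B. \<forall>x. norm (norm x ^ k *\<^sub>R f x) \<le> B"
    unfolding bounded_iff by blast
  from choice[OF this] obtain B where B: "\<And>k x. norm (norm x ^ k *\<^sub>R f x) \<le> B k"
    by blast
  have "norm (f x) * (1 + norm x) ^ N \<le> 2 ^ N * (B 0 + B N)" for x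
  proof -
    have "(1 + norm x) ^ N \<le> 2 ^ N * (1 + norm x ^ N)"
    proof (cases "norm x \<le> 1")
      case True
      then have "(1 + norm x) ^ N \<le> 2 ^ N" by (intro power_mono) auto
      also have "\<dots> \<le> 2 ^ N * (1 + norm x ^ N)" by simp
      finally show ?thesis .
    next
      case False
      then have "(1 + norm x) ^ N \<le> (2 * norm x) ^ N" by (intro power_mono) auto
      also have "\<dots> \<le> 2 ^ N * (1 + norm x ^ N)" by (simp add: power_mult_distrib)
      finally show ?thesis .
    qed
    then have "norm (f x) * (1 + norm x) ^ N \<le> norm (f x) * (2 ^ N * (1 + norm x ^ N))"
      by (rule mult_left_mono) simp
    also have "\<dots> = 2 ^ N * (norm (norm x ^ 0 *\<^sub>R f x) + norm (norm x ^ N *\<^sub>R f x))"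
      by (simp add: algebra_simps)
    also have "\<dots> \<le> 2 ^ N * (B 0 + B N)" using B[of x 0] B[of x N] by (intro mult_left_mono) auto
    finally show ?thesis .
  qed
  then show ?thesis by blast
qed

lemma schwartz_continuous: "schwartz f \<Longrightarrow> continuous_on S f"
  by (simp add: continuous_at_imp_continuous_on differentiable_imp_continuous_within schwartz_differentiable)

lemma schwartz_rapid: "schwartz f \<Longrightarrow> rapid f"
  unfolding rapid_def
  by (simp add: schwartz_decay borel_measurable_continuous_onI schwartz_continuous)

lemma schwartz_measurable [measurable_dest]: "schwartz f \<Longrightarrow> f \<in> borel_measurable borel"
  by (simp add: schwartz_rapid rapid_measurable)

lemma schwartz_has_derivative:
  "schwartz f \<Longrightarrow> (f has_derivative (\<lambda>h. \<Sum>i\<in>UNIV. h $ i *\<^sub>R partial_deriv i f x)) (at x)"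
  by (simp add: has_derivative_partial schwartz_differentiable)

lemma partial_deriv_add:
  assumes "f differentiable (at x)" "g differentiable (at x)"
  shows "partial_deriv i (\<lambda>x. f x + g x) x = partial_deriv i f x + partial_deriv i g x"
  by (rule partial_deriv_eqI')
    (use has_derivative_add[OF assms[THEN has_derivative_partial]] in \<open>simp add: sum.distrib scaleR_add_right\<close>)

lemma partial_deriv_cmult:
  assumes "f differentiable (at x)"
  shows "partial_deriv i (\<lambda>x. c * f x) x = c * partial_deriv i f x"
  by (rule partial_deriv_eqI')
    (use has_derivative_mult_right[OF has_derivative_partial[OF assms], of c] in
      \<open>simp add: sum_distrib_left\<close>)

lemma partial_derivs_add:
  assumes "schwartz f" "schwartz g"
  shows "partial_derivs is (\<lambda>x. f x + g x) = (\<lambda>x. partial_derivs is f x + partial_derivs is g x)"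
proof (induction "is")
  case (Cons i "is")
  show ?case unfolding partial_derivs.simps Cons.IH
    using assms by (intro ext partial_deriv_add schwartz_differentiable schwartz_partials)
qed simp

lemma partial_derivs_cmult:
  assumes "schwartz f"
  shows "partial_derivs is (\<lambda>x. c * f x) = (\<lambda>x. c * partial_derivs is f x)"
proof (induction "is")
  case (Cons i "is")
  show ?case unfolding partial_derivs.simps Cons.IH
    using assms by (intro ext partial_deriv_cmult schwartz_differentiable schwartz_partials)
qed simp

lemma schwartz_add:
  assumes "schwartz f" "schwartz g" shows "schwartz (\<lambda>x. f x + g x)"
proof (rule schwartz_coinduct[where X = "\<lambda>h. \<exists>f g. schwartz f \<and> schwartz g \<and> h = (\<lambda>x. f x + g x)"])
  fix h N assume "\<exists>f g. schwartz f \<and> schwartz g \<and> h = (\<lambda>x. f x + g x)"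
  then obtain f g where h: "schwartz f" "schwartz g" "h = (\<lambda>x. f x + g x)" by blast
  show "h differentiable at x" for x
    using h by (simp add: schwartz_differentiable)
  obtain C D where "\<And>x. norm (f x) * (1 + norm x) ^ N \<le> C" "\<And>x. norm (g x) * (1 + norm x) ^ N \<le> D"
    using schwartz_decay[OF h(1), of N] schwartz_decay[OF h(2), of N] by blast
  moreover have "norm (h x) * (1 + norm x) ^ N \<le> norm (f x) * (1 + norm x) ^ N + norm (g x) * (1 + norm x) ^ N" for x
    unfolding h(3) distrib_right[symmetric] by (intro mult_right_mono norm_triangle_ineq) simp
  ultimately have "norm (h x) * (1 + norm x) ^ N \<le> C + D" for x
    by (meson add_mono order_trans)
  then show "\<exists>C. \<forall>x. norm (h x) * (1 + norm x) ^ N \<le> C" by blast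
  show "\<exists>f g. schwartz f \<and> schwartz g \<and> partial_deriv i h = (\<lambda>x. f x + g x)" for i
    by (rule exI[of _ "partial_deriv i f"], rule exI[of _ "partial_deriv i g"])
      (use h partial_derivs_add[OF h(1,2), of "[i]"] in \<open>simp add: schwartz_partial\<close>)
qed (rule exI[of _ f], rule exI[of _ g], simp add: assms)

lemma schwartz_cmult:
  assumes "schwartz f" shows "schwartz (\<lambda>x. c * f x)"
proof (rule schwartz_coinduct[where X = "\<lambda>h. \<exists>f. schwartz f \<and> h = (\<lambda>x. c * f x)"])
  fix h N assume "\<exists>f. schwartz f \<and> h = (\<lambda>x. c * f x)"
  then obtain f where h: "schwartz f" "h = (\<lambda>x. c * f x)" by blast
  show "h differentiable at x" for x
    using h by (simp add: schwartz_differentiable)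
  obtain C where C: "\<And>x. norm (f x) * (1 + norm x) ^ N \<le> C"
    using schwartz_decay[OF h(1), of N] by blast
  then have "norm (h x) * (1 + norm x) ^ N \<le> norm c * C" for x
    unfolding h(2) by (simp add: norm_mult mult_left_mono mult.assoc)
  then show "\<exists>C. \<forall>x. norm (h x) * (1 + norm x) ^ N \<le> C" by blast
  show "\<exists>f. schwartz f \<and> partial_deriv i h = (\<lambda>x. c * f x)" for i
    by (rule exI[of _ "partial_deriv i f"])
      (use h partial_derivs_cmult[OF h(1), of "[i]"] in \<open>simp add: schwartz_partial\<close>)
qed (rule exI[of _ f], simp add: assms)

lemma schwartz_diff: "schwartz f \<Longrightarrow> schwartz g \<Longrightarrow> schwartz (\<lambda>x. f x - g x)"
  using schwartz_add[of f "\<lambda>x. -1 * g x"] schwartz_cmult[of g "-1"] by simp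

lemma partial_derivs_diff:
  assumes "schwartz f" "schwartz g"
  shows "partial_derivs is (\<lambda>x. f x - g x) = (\<lambda>x. partial_derivs is f x - partial_derivs is g x)"
  using partial_derivs_add[OF assms(1) schwartz_cmult[OF assms(2), of "-1"], of "is"]
    partial_derivs_cmult[OF assms(2), of "is" "-1"] by simp

lemma has_derivative_affine:
  fixes f :: "real^'n \<Rightarrow> complex"
  assumes "f differentiable (at (c *\<^sub>R x + y))"
  shows "((\<lambda>x. f (c *\<^sub>R x + y)) has_derivative
    (\<lambda>h. \<Sum>i\<in>UNIV. h $ i *\<^sub>R (c *\<^sub>R partial_deriv i f (c *\<^sub>R x + y)))) (at x)"
proof -
  have "((\<lambda>x. c *\<^sub>R x + y) has_derivative (\<lambda>h. c *\<^sub>R h)) (at x)"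
    by (auto intro!: derivative_eq_intros)
  from has_derivative_compose[OF this has_derivative_partial[OF assms]]
  show ?thesis by (simp add: algebra_simps)
qed

lemma partial_derivs_affine:
  fixes f :: "real^'n \<Rightarrow> complex"
  assumes "schwartz f"
  shows "partial_derivs is (\<lambda>x. f (c *\<^sub>R x + y)) =
    (\<lambda>x. complex_of_real (c ^ length is) * partial_derivs is f (c *\<^sub>R x + y))"
proof (induction "is")
  case (Cons i "is")
  have s: "schwartz (partial_derivs is f)" using assms by (rule schwartz_partials)
  note d = has_derivative_affine[OF schwartz_differentiable[OF s]]
  have diff: "(\<lambda>x. partial_derivs is f (c *\<^sub>R x + y)) differentiable (at x)" for x
    by (rule differentiableI[OF d])
  show ?case unfolding partial_derivs.simps Cons.IH
    by (rule ext, subst partial_deriv_cmult[OF diff], subst partial_deriv_eqI'[OF d])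
      (simp add: scaleR_conv_of_real)
qed simp

lemma schwartz_affine:
  fixes f :: "real^'n \<Rightarrow> complex"
  assumes "schwartz f" "c \<noteq> 0"
  shows "schwartz (\<lambda>x. f (c *\<^sub>R x + y))"
proof (rule schwartz_coinduct[where X = "\<lambda>h. \<exists>f. schwartz f \<and> h = (\<lambda>x. f (c *\<^sub>R x + y))"])
  fix h N assume "\<exists>f. schwartz f \<and> h = (\<lambda>x. f (c *\<^sub>R x + y))"
  then obtain f where f: "schwartz f" and h: "h = (\<lambda>x. f (c *\<^sub>R x + y))" by blast
  note d = has_derivative_affine[OF schwartz_differentiable[OF f], where c = c and y = y]
  show "h differentiable at x" for x
    unfolding h by (rule differentiableI[OF d])
  obtain C where C: "\<And>x. norm (f x) * (1 + norm x) ^ N \<le> C"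
    using schwartz_decay[OF f, of N] by blast
  \<comment> \<open>With z = c x + y one has |x| \<le> (|z| + |y|) / |c| \<le> (1 + |y|) / |c| (1 +
    |z|), hence 1 + |x| \<le> K (1 + |z|).\<close>
  define K where "K = 1 + (1 + norm y) / \<bar>c\<bar>"
  have "norm (h x) * (1 + norm x) ^ N \<le> K ^ N * C" for x
  proof -
    let ?z = "c *\<^sub>R x + y"
    have "\<bar>c\<bar> * norm x \<le> norm ?z + norm y"
      using norm_triangle_ineq4[of ?z y] by simp
    then have "norm x \<le> (norm ?z + norm y) / \<bar>c\<bar>"
      using assms(2) by (simp add: field_simps)
    also have "\<dots> \<le> (1 + norm y) / \<bar>c\<bar> * (1 + norm ?z)"
      using assms(2) by (simp add: field_simps mult_nonneg_nonneg add_nonneg_nonneg)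
    finally have A: "norm x \<le> (1 + norm y) / \<bar>c\<bar> * (1 + norm ?z)" .
    have B: "1 \<le> 1 * (1 + norm ?z)" by simp
    have "1 + norm x \<le> K * (1 + norm ?z)"
      using add_mono[OF B A] unfolding K_def distrib_right[of 1] .
    then have "(1 + norm x) ^ N \<le> (K * (1 + norm ?z)) ^ N" by (intro power_mono) auto
    then have "norm (h x) * (1 + norm x) ^ N \<le> norm (f ?z) * (K * (1 + norm ?z)) ^ N"
      unfolding h by (rule mult_left_mono) simp
    also have "\<dots> = K ^ N * (norm (f ?z) * (1 + norm ?z) ^ N)"
      by (simp add: power_mult_distrib)
    also have "\<dots> \<le> K ^ N * C" using C by (intro mult_left_mono zero_le_power) (auto simp: K_def)
    finally show ?thesis .
  qed
  then show "\<exists>C. \<forall>x. norm (h x) * (1 + norm x) ^ N \<le> C" by blast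
  fix i
  have "partial_deriv i h = (\<lambda>x. (\<lambda>z. of_real c * partial_deriv i f z) (c *\<^sub>R x + y))"
    unfolding h by (rule ext, subst partial_deriv_eqI'[OF d]) (simp add: scaleR_conv_of_real)
  moreover have "schwartz (\<lambda>z. of_real c * partial_deriv i f z)"
    using f by (intro schwartz_cmult schwartz_partial)
  ultimately show "\<exists>f. schwartz f \<and> partial_deriv i h = (\<lambda>x. f (c *\<^sub>R x + y))"
    by (intro exI[of _ "\<lambda>z. of_real c * partial_deriv i f z"] conjI)
qed (rule exI[of _ f], simp add: assms)

lemma schwartz_translate: "schwartz f \<Longrightarrow> schwartz (\<lambda>x. f (x - y))"
  using schwartz_affine[of f 1 "- y"] by simp

lemma schwartz_dilate: "schwartz f \<Longrightarrow> c \<noteq> 0 \<Longrightarrow> schwartz (\<lambda>x. f (c *\<^sub>R x))"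
  using schwartz_affine[of f c 0] by simp

lemma partial_derivs_translate:
  "schwartz f \<Longrightarrow> partial_derivs is (\<lambda>x. f (x - y)) = (\<lambda>x. partial_derivs is f (x - y))"
  using partial_derivs_affine[of f "is" 1 "- y"] by simp

text \<open>Differentiating x_i f in direction i leaves an extra term f, so the products alone are
  not invariant. The class of functions x_i f + g with f and g Schwartz is, and it is entered with g
  = 0 f.\<close>

lemma schwartz_coord:
  fixes f :: "real^'n \<Rightarrow> complex"
  assumes "schwartz f"
  shows "schwartz (\<lambda>x. of_real (x $ i) * f x)"
proof -
  let ?X = "\<lambda>h. \<exists>f g. schwartz f \<and> schwartz g \<and> h = (\<lambda>x. of_real (x $ i) * f x + g x)"
  have "schwartz (\<lambda>x. of_real (x $ i) * f x + 0 * f x)"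
  proof (rule schwartz_coinduct[where X = ?X])
    fix h N assume "?X h"
    then obtain f g where fg: "schwartz f" "schwartz g" and h: "h = (\<lambda>x. of_real (x $ i) * f x + g x)" by blast
    have d: "(h has_derivative (\<lambda>v. \<Sum>j\<in>UNIV. v $ j *\<^sub>R
       (of_real (x $ i) * partial_deriv j f x + ((if j = i then f x else 0) + partial_deriv j g x)))) (at x)" for x
    proof -
      have "((\<lambda>x. complex_of_real (x $ i)) has_derivative (\<lambda>v. of_real (v $ i))) (at x)"
        by (intro bounded_linear_imp_has_derivative bounded_linear_compose[OF bounded_linear_of_real] bounded_linear_vec_nth)
      from has_derivative_add[OF has_derivative_mult[OF this schwartz_has_derivative[OF fg(1)]] schwartz_has_derivative[OF fg(2)]]
      have "(h has_derivative (\<lambda>v. of_real (x $ i) * (\<Sum>j\<in>UNIV. v $ j *\<^sub>R partial_deriv j f x) +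
          of_real (v $ i) * f x + (\<Sum>j\<in>UNIV. v $ j *\<^sub>R partial_deriv j g x))) (at x)"
        unfolding h .
      moreover have "of_real (v $ i) * f x = (\<Sum>j\<in>UNIV. v $ j *\<^sub>R (if j = i then f x else 0))" for v :: "real^'n"
      proof -
        have "(\<Sum>j\<in>UNIV. v $ j *\<^sub>R (if j = i then f x else 0)) = (\<Sum>j\<in>UNIV. if j = i then v $ j *\<^sub>R f x else 0)"
          by (intro sum.cong) auto
        then show ?thesis by (simp add: scaleR_conv_of_real)
      qed
      ultimately show ?thesis
        by (simp add: scaleR_add_right sum.distrib sum_distrib_left add.assoc)
    qed
    then show "h differentiable at x" for x
      using differentiable_def by blast
    obtain C D where C: "\<And>x. norm (f x) * (1 + norm x) ^ (Suc N) \<le> C"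
      and D: "\<And>x. norm (g x) * (1 + norm x) ^ N \<le> D"
      using schwartz_decay[OF fg(1), of "Suc N"] schwartz_decay[OF fg(2), of N] by blast
    have "norm (h x) * (1 + norm x) ^ N \<le> C + D" for x
    proof -
      have "norm (h x) \<le> \<bar>x $ i\<bar> * norm (f x) + norm (g x)"
        unfolding h by (rule order_trans[OF norm_triangle_ineq]) (simp add: norm_mult)
      also have "\<dots> \<le> (1 + norm x) * norm (f x) + norm (g x)"
        using component_le_norm_cart[of x i] by (intro add_right_mono mult_right_mono) auto
      finally have "norm (h x) * (1 + norm x) ^ N \<le> ((1 + norm x) * norm (f x) + norm (g x)) * (1 + norm x) ^ N"
        by (rule mult_right_mono) simp
      also have "\<dots> = norm (f x) * (1 + norm x) ^ Suc N + norm (g x) * (1 + norm x) ^ N"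
        by (simp add: algebra_simps)
      also have "\<dots> \<le> C + D" using C D by (intro add_mono)
      finally show ?thesis .
    qed
    then show "\<exists>C. \<forall>x. norm (h x) * (1 + norm x) ^ N \<le> C" by blast
    fix j
    have "partial_deriv j h = (\<lambda>x. of_real (x $ i) * partial_deriv j f x + ((if j = i then 1 else 0) * f x + partial_deriv j g x))"
      by (rule ext, subst partial_deriv_eqI'[OF d]) auto
    moreover have "schwartz (\<lambda>x. (if j = i then 1 else 0) * f x + partial_deriv j g x)"
      using fg by (intro schwartz_add schwartz_cmult schwartz_partial)
    ultimately show "?X (partial_deriv j h)"
      using schwartz_partial[OF fg(1), of j] by (intro exI conjI)
  qed (rule exI[of _ f], rule exI[of _ "\<lambda>x. 0 * f x"], simp add: assms schwartz_cmult[OF assms, of 0, simplified])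
  then show ?thesis by simp
qed

section \<open>Weighted difference and Taylor estimates\<close>

lemma one_plus_norm_shift:
  assumes "norm h \<le> 1"
  shows "1 + norm x \<le> 2 * (1 + norm (x + h))"
  using norm_triangle_ineq4[of "x + h" h] assms norm_ge_zero[of "x + h"] by (simp add: algebra_simps del: norm_ge_zero)

text \<open>Within the unit ball about \<open>x\<close> the weights at \<open>x\<close> and at the
  intermediate point differ by at most 2^N, so the mean value inequality transfers the decay of the
  first partial derivatives to the increment.\<close>

lemma schwartz_lipschitz:
  fixes k :: "real^'n \<Rightarrow> complex"
  assumes "schwartz k"
  shows "\<exists>C\<ge>0. \<forall>x h. norm h \<le> 1 \<longrightarrow> norm (k (x + h) - k x) * (1 + norm x) ^ N \<le> C * norm h"
proof -
  have "\<forall>i. \<exists>B. \<forall>x. norm (partial_deriv i k x) * (1 + norm x) ^ N \<le> B"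
    using schwartz_decay[OF schwartz_partial[OF assms]] by blast
  from choice[OF this] obtain B where B: "\<And>i x. norm (partial_deriv i k x) * (1 + norm x) ^ N \<le> B i"
    by blast
  have B0: "B i \<ge> 0" for i by (rule order_trans[OF _ B[of i 0]]) simp
  define C where "C = (\<Sum>i\<in>UNIV. B i * 2 ^ N)"
  have C0: "C \<ge> 0" unfolding C_def using B0 by (intro sum_nonneg) auto
  show ?thesis
  proof (intro exI[of _ C] conjI C0 allI impI)
    fix x h :: "real^'n" assume h: "norm h \<le> 1"
    let ?W = "(1 + norm x) ^ N"
    have W: "?W > 0" by simp
    have "norm (k (x + h) - k x) \<le> (C / ?W) * norm (x + h - x)"
    proof (rule differentiable_bound[of "cball x 1"])
      show "(k has_derivative (\<lambda>h. \<Sum>i\<in>UNIV. h $ i *\<^sub>R partial_deriv i k y)) (at y within cball x 1)" for y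
        using schwartz_has_derivative[OF assms] by (rule has_derivative_at_withinI)
      fix y assume y: "y \<in> cball x 1"
      have "norm (y - x) \<le> 1" using y by (simp add: dist_norm norm_minus_commute)
      from one_plus_norm_shift[OF this, of x] have "?W \<le> (2 * (1 + norm y)) ^ N"
        by (intro power_mono) auto
      then have yW: "?W \<le> 2 ^ N * (1 + norm y) ^ N" by (simp only: power_mult_distrib)
      have bd: "norm (partial_deriv i k y) \<le> B i * 2 ^ N / ?W" for i
      proof -
        have "norm (partial_deriv i k y) * ?W \<le> norm (partial_deriv i k y) * (2 ^ N * (1 + norm y) ^ N)"
          by (intro mult_left_mono yW) auto
        also have "\<dots> = 2 ^ N * (norm (partial_deriv i k y) * (1 + norm y) ^ N)" by simp
        also have "\<dots> \<le> 2 ^ N * B i" using B by (intro mult_left_mono) auto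
        finally show ?thesis using W by (simp add: field_simps)
      qed
      show "onorm (\<lambda>h. \<Sum>i\<in>UNIV. h $ i *\<^sub>R partial_deriv i k y) \<le> C / ?W"
      proof (rule onorm_le)
        fix v :: "real^'n"
        have "norm (\<Sum>i\<in>UNIV. v $ i *\<^sub>R partial_deriv i k y) \<le> (\<Sum>i\<in>UNIV. norm v * (B i * 2 ^ N / ?W))"
          by (intro sum_norm_le, unfold norm_scaleR) (intro mult_mono bd component_le_norm_cart; simp)
        also have "\<dots> = C / ?W * norm v"
          by (simp add: C_def sum_distrib_left[symmetric] sum_divide_distrib[symmetric] mult.commute)
        finally show "norm (\<Sum>i\<in>UNIV. v $ i *\<^sub>R partial_deriv i k y) \<le> C / ?W * norm v" .
      qed
    qed (use h in \<open>auto simp: dist_norm\<close>)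
    then show "norm (k (x + h) - k x) * ?W \<le> C * norm h" using W by (simp add: field_simps)
  qed
qed

text \<open>The linearised mean value inequality needs only the variation of the first partial
  derivatives on the ball of radius |h|, and this is the previous estimate applied to them.\<close>

lemma schwartz_taylor:
  fixes k :: "real^'n \<Rightarrow> complex"
  assumes "schwartz k"
  shows "\<exists>C\<ge>0. \<forall>x h. norm h \<le> 1 \<longrightarrow>
    norm (k (x + h) - k x - (\<Sum>i\<in>UNIV. h $ i *\<^sub>R partial_deriv i k x)) * (1 + norm x) ^ N \<le> C * (norm h)\<^sup>2"
proof -
  have "\<forall>i. \<exists>B. B \<ge> 0 \<and> (\<forall>x h. norm h \<le> 1 \<longrightarrow>
      norm (partial_deriv i k (x + h) - partial_deriv i k x) * (1 + norm x) ^ N \<le> B * norm h)"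
    by (intro allI schwartz_lipschitz[OF schwartz_partial[OF assms]])
  from choice[OF this] obtain B where BB: "\<forall>i. B i \<ge> 0 \<and> (\<forall>x h. norm h \<le> 1 \<longrightarrow>
      norm (partial_deriv i k (x + h) - partial_deriv i k x) * (1 + norm x) ^ N \<le> B i * norm h)" ..
  then have B0: "\<And>i. B i \<ge> 0"
    and B: "\<And>i x h. norm h \<le> 1 \<Longrightarrow>
      norm (partial_deriv i k (x + h) - partial_deriv i k x) * (1 + norm x) ^ N \<le> B i * norm h"
    by simp_all
  define C where "C = (\<Sum>i\<in>UNIV. B i)"
  have C0: "C \<ge> 0" unfolding C_def using B0 by (intro sum_nonneg) auto
  show ?thesis
  proof (intro exI[of _ C] conjI C0 allI impI)
    fix x h :: "real^'n" assume h: "norm h \<le> 1"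
    let ?W = "(1 + norm x) ^ N"
    have W: "?W > 0" by simp
    let ?D = "\<lambda>y h. \<Sum>i\<in>UNIV. h $ i *\<^sub>R partial_deriv i k y"
    have "norm (k (x + h) - k x - ?D x (x + h - x)) \<le> norm (x + h - x) * (C * norm h / ?W)"
    proof (rule differentiable_bound_linearization[of x "x + h" "cball x (norm h)" k ?D x])
      show "x + t *\<^sub>R (x + h - x) \<in> cball x (norm h)" if "t \<in> {0..1}" for t
        using that by (simp add: dist_norm mult_left_le_one_le)
      show "(k has_derivative ?D y) (at y within cball x (norm h))" for y
        using schwartz_has_derivative[OF assms] by (rule has_derivative_at_withinI)
      fix y assume "y \<in> cball x (norm h)"
      then have y: "norm (y - x) \<le> norm h" by (simp add: dist_norm norm_minus_commute)
      have bd: "norm (partial_deriv i k y - partial_deriv i k x) \<le> B i * norm h / ?W" for i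
      proof -
        have "norm (partial_deriv i k y - partial_deriv i k x) * ?W \<le> B i * norm (y - x)"
          using B[of "y - x" i x] y h by simp
        also have "\<dots> \<le> B i * norm h" using y B0 by (intro mult_left_mono) auto
        finally show ?thesis using W by (simp add: field_simps)
      qed
      show "onorm (?D y - ?D x) \<le> C * norm h / ?W"
      proof (rule onorm_le)
        fix v :: "real^'n"
        have "norm ((?D y - ?D x) v) = norm (\<Sum>i\<in>UNIV. v $ i *\<^sub>R (partial_deriv i k y - partial_deriv i k x))"
          by (simp add: sum_subtractf scaleR_diff_right)
        also have "\<dots> \<le> (\<Sum>i\<in>UNIV. norm v * (B i * norm h / ?W))"
          by (intro sum_norm_le, unfold norm_scaleR) (intro mult_mono bd component_le_norm_cart; simp)
        also have "\<dots> = C * norm h / ?W * norm v"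
          by (simp add: C_def sum_distrib_left[symmetric] sum_divide_distrib[symmetric] sum_distrib_right[symmetric] mult.commute)
        finally show "norm ((?D y - ?D x) v) \<le> C * norm h / ?W * norm v" .
      qed
    qed simp
    then show "norm (k (x + h) - k x - (\<Sum>i\<in>UNIV. h $ i *\<^sub>R partial_deriv i k x)) * ?W \<le> C * (norm h)\<^sup>2"
      using W by (simp add: field_simps power2_eq_square)
  qed
qed

section \<open>Affine substitutions, integral bounds and polynomial weights\<close>

lemma lborel_affine':
  fixes t :: "real^'n"
  assumes "c \<noteq> 0"
  shows "lborel = density (distr lborel borel (\<lambda>x. t + c *\<^sub>R x)) (\<lambda>_. ennreal (\<bar>c\<bar> ^ CARD('n)))"
  using lborel_affine[OF assms, of t] by (simp add: DIM_cart)

lemma nn_integral_affine: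
  fixes f :: "real^'n \<Rightarrow> ennreal"
  assumes "c \<noteq> 0" and [measurable]: "f \<in> borel_measurable borel"
  shows "(\<integral>\<^sup>+x. f x \<partial>lborel) = ennreal (\<bar>c\<bar> ^ CARD('n)) * (\<integral>\<^sup>+x. f (t + c *\<^sub>R x) \<partial>lborel)"
  by (subst lborel_affine'[OF assms(1), of t])
    (simp add: nn_integral_density nn_integral_distr nn_integral_cmult)

lemma integrable_affine_iff:
  fixes f :: "real^'n \<Rightarrow> 'b::{banach, second_countable_topology}"
  assumes "c \<noteq> 0" and [measurable]: "f \<in> borel_measurable borel"
  shows "integrable lborel (\<lambda>x. f (t + c *\<^sub>R x)) \<longleftrightarrow> integrable lborel f"
proof -
  have p: "ennreal (\<bar>c\<bar> ^ CARD('n)) \<noteq> 0" "ennreal (\<bar>c\<bar> ^ CARD('n)) \<noteq> \<infinity>"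
    using assms(1) by (simp_all add: ennreal_eq_0_iff not_le)
  show ?thesis
    unfolding integrable_iff_bounded
    using nn_integral_affine[OF assms(1), of "\<lambda>x. ennreal (norm (f x))" t] p
    by (auto simp: ennreal_mult_less_top less_top)
qed

lemma integral_affine:
  fixes f :: "real^'n \<Rightarrow> 'b::{banach, second_countable_topology}"
  assumes "c \<noteq> 0" and [measurable]: "f \<in> borel_measurable borel"
  shows "(\<integral>x. f (t + c *\<^sub>R x) \<partial>lborel) = (\<integral>x. f x \<partial>lborel) /\<^sub>R \<bar>c\<bar> ^ CARD('n)"
proof -
  have "(\<integral>x. f x \<partial>lborel) = \<bar>c\<bar> ^ CARD('n) *\<^sub>R (\<integral>x. f (t + c *\<^sub>R x) \<partial>lborel)"
    by (subst lborel_affine'[OF assms(1), of t])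
      (simp add: integral_density integral_distr)
  then show ?thesis using assms(1) by simp
qed

lemma norm_integral_le:
  fixes f :: "'a \<Rightarrow> 'b::{banach, second_countable_topology}"
  assumes "integrable M f" "integrable M g" "\<And>x. norm (f x) \<le> g x"
  shows "norm (\<integral>x. f x \<partial>M) \<le> (\<integral>x. g x \<partial>M)"
  using assms by (intro order_trans[OF integral_norm_bound] integral_mono integrable_norm)

text \<open>Peetre's inequality: it distributes a polynomial weight over the two factors of a
  convolution.\<close>

lemma weight_split:
  "(1 + norm z) ^ N \<le> (1 + norm (z - y)) ^ N * (1 + norm y) ^ N" for y z :: "'a::real_normed_vector"
proof -
  have "norm z \<le> norm (z - y) + norm y" by (metis diff_add_cancel norm_triangle_ineq)
  moreover have "0 \<le> norm (z - y) * norm y" by simp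
  ultimately have "1 + norm z \<le> (1 + norm (z - y)) * (1 + norm y)"
    unfolding distrib_left distrib_right mult_1 mult_1_right using norm_ge_zero[of "z - y"] by linarith
  then have "(1 + norm z) ^ N \<le> ((1 + norm (z - y)) * (1 + norm y)) ^ N" by (intro power_mono) auto
  then show ?thesis by (simp only: power_mult_distrib)
qed

section \<open>Convolution\<close>

definition conv :: "(real^'n \<Rightarrow> complex) \<Rightarrow> (real^'n \<Rightarrow> complex) \<Rightarrow> real^'n \<Rightarrow> complex" where
  "conv k g z = (\<integral>y. k (z - y) * g y \<partial>lborel)"

lemma rapid_shift_mult:
  assumes "rapid k" "rapid g"
  shows "rapid (\<lambda>y. k (z - y) * g y)"
proof -
  have [measurable]: "k \<in> borel_measurable borel" using assms by (rule_tac rapid_measurable)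
  obtain C where C: "\<And>x. norm (k x) * (1 + norm x) ^ 0 \<le> C"
    using assms(1) unfolding rapid_def by blast
  show ?thesis
    by (rule rapid_mult_bounded[OF assms(2), where C = C]) (use C in auto)
qed

lemma integrable_conv: "rapid k \<Longrightarrow> rapid g \<Longrightarrow> integrable lborel (\<lambda>y. k (z - y) * g y)"
  by (rule rapid_integrable[OF rapid_shift_mult])

lemma conv_decay:
  assumes "rapid k" "rapid g"
  shows "\<exists>C. \<forall>z. norm (conv k g z) * (1 + norm z) ^ N \<le> C"
proof -
  obtain B where B: "\<And>x. norm (k x) * (1 + norm x) ^ N \<le> B"
    using assms(1) unfolding rapid_def by blast
  let ?I = "\<integral>y. B * (norm (g y) * (1 + norm y) ^ N) \<partial>lborel"
  have "norm (conv k g z) * (1 + norm z) ^ N \<le> ?I" for z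
  proof -
    have "norm (conv k g z) * (1 + norm z) ^ N = norm (\<integral>y. (1 + norm z) ^ N *\<^sub>R (k (z - y) * g y) \<partial>lborel)"
      by (simp add: conv_def mult.commute)
    also have "\<dots> \<le> ?I"
    proof (rule norm_integral_le)
      show "integrable lborel (\<lambda>y. (1 + norm z) ^ N *\<^sub>R (k (z - y) * g y))"
        by (intro integrable_scaleR_right integrable_conv assms)
      show "integrable lborel (\<lambda>y. B * (norm (g y) * (1 + norm y) ^ N))"
        by (intro integrable_mult_right rapid_integrable_moment assms)
      fix y
      have "norm ((1 + norm z) ^ N *\<^sub>R (k (z - y) * g y)) = (1 + norm z) ^ N * (norm (k (z - y)) * norm (g y))"
        by (simp add: norm_mult)
      also have "\<dots> \<le> ((1 + norm (z - y)) ^ N * (1 + norm y) ^ N) * (norm (k (z - y)) * norm (g y))"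
        by (intro mult_right_mono weight_split) auto
      also have "\<dots> = (norm (k (z - y)) * (1 + norm (z - y)) ^ N) * (norm (g y) * (1 + norm y) ^ N)"
        by (simp add: algebra_simps)
      also have "\<dots> \<le> B * (norm (g y) * (1 + norm y) ^ N)"
        by (intro mult_right_mono B) auto
      finally show "norm ((1 + norm z) ^ N *\<^sub>R (k (z - y) * g y)) \<le> B * (norm (g y) * (1 + norm y) ^ N)" .
    qed
    finally show ?thesis .
  qed
  then show ?thesis by blast
qed

text \<open>The Taylor remainder of \<open>k\<close> is bounded uniformly in the base point and is
  integrated against |g|. All derivatives fall on \<open>k\<close>, so \<open>g\<close> enters only
  through its decay.\<close>

lemma conv_has_derivative:
  assumes k: "schwartz k" and g: "rapid g"
  shows "(conv k g has_derivative (\<lambda>h. \<Sum>i\<in>UNIV. h $ i *\<^sub>R conv (partial_deriv i k) g z)) (at z)"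
proof -
  obtain C where C: "C \<ge> 0" "\<And>x h. norm h \<le> 1 \<Longrightarrow>
      norm (k (x + h) - k x - (\<Sum>i\<in>UNIV. h $ i *\<^sub>R partial_deriv i k x)) * (1 + norm x) ^ 0 \<le> C * (norm h)\<^sup>2"
    using schwartz_taylor[OF k, of 0] by blast
  have ki: "rapid k" "\<And>i. rapid (partial_deriv i k)"
    using k by (simp_all add: schwartz_rapid schwartz_partial)
  show ?thesis
  proof (rule has_derivative_quadratic[where C = "C * (\<integral>y. norm (g y) \<partial>lborel)"])
    show "bounded_linear (\<lambda>h. \<Sum>i\<in>UNIV. h $ i *\<^sub>R conv (partial_deriv i k) g z)"
      by (intro bounded_linear_sum bounded_linear_scaleR_const bounded_linear_vec_nth)
    fix h :: "real^'a" assume h: "norm h \<le> 1"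
    have "conv k g (z + h) - conv k g z - (\<Sum>i\<in>UNIV. h $ i *\<^sub>R conv (partial_deriv i k) g z) =
      (\<integral>y. k (z + h - y) * g y - k (z - y) * g y - (\<Sum>i\<in>UNIV. h $ i *\<^sub>R (partial_deriv i k (z - y) * g y)) \<partial>lborel)"
      unfolding conv_def
      by (simp add: integrable_conv ki g Bochner_Integration.integral_diff Bochner_Integration.integrable_diff
          Bochner_Integration.integrable_sum)
    also have "norm \<dots> \<le> (\<integral>y. C * (norm h)\<^sup>2 * norm (g y) \<partial>lborel)"
    proof (rule norm_integral_le)
      fix y
      have "k (z + h - y) * g y - k (z - y) * g y - (\<Sum>i\<in>UNIV. h $ i *\<^sub>R (partial_deriv i k (z - y) * g y))
         = (k ((z - y) + h) - k (z - y) - (\<Sum>i\<in>UNIV. h $ i *\<^sub>R partial_deriv i k (z - y))) * g y"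
        by (simp add: algebra_simps sum_distrib_left)
      then show "norm (k (z + h - y) * g y - k (z - y) * g y - (\<Sum>i\<in>UNIV. h $ i *\<^sub>R (partial_deriv i k (z - y) * g y)))
          \<le> C * (norm h)\<^sup>2 * norm (g y)"
        using C(2)[OF h, of "z - y"] by (simp add: norm_mult mult_right_mono)
    next
      show "integrable lborel (\<lambda>y. k (z + h - y) * g y - k (z - y) * g y -
          (\<Sum>i\<in>UNIV. h $ i *\<^sub>R (partial_deriv i k (z - y) * g y)))"
        by (intro Bochner_Integration.integrable_diff Bochner_Integration.integrable_sum integrable_scaleR_right
          integrable_conv ki g)
    qed (intro integrable_mult_right integrable_norm rapid_integrable g)
    finally show "norm (conv k g (z + h) - conv k g z - (\<Sum>i\<in>UNIV. h $ i *\<^sub>R conv (partial_deriv i k) g z))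
        \<le> C * (\<integral>y. norm (g y) \<partial>lborel) * (norm h)\<^sup>2" by (simp add: mult_ac)
  qed
qed

lemma partial_derivs_conv:
  assumes "schwartz k" "rapid g"
  shows "partial_derivs is (conv k g) = conv (partial_derivs is k) g"
proof (induction "is")
  case (Cons i "is")
  show ?case unfolding partial_derivs.simps Cons.IH
    by (rule ext, rule partial_deriv_eqI', rule conv_has_derivative)
      (use assms in \<open>auto intro: schwartz_partials\<close>)
qed simp

lemma schwartz_conv:
  assumes "schwartz k" "rapid g"
  shows "schwartz (conv k g)"
proof (rule schwartz_coinduct[where X = "\<lambda>h. \<exists>k. schwartz k \<and> h = conv k g"])
  fix h N assume "\<exists>k. schwartz k \<and> h = conv k g"
  then obtain k where k: "schwartz k" and h: "h = conv k g" by blast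
  show "h differentiable at x" for x
    unfolding h by (rule differentiableI[OF conv_has_derivative[OF k assms(2)]])
  show "\<exists>C. \<forall>x. norm (h x) * (1 + norm x) ^ N \<le> C"
    unfolding h by (rule conv_decay[OF schwartz_rapid[OF k] assms(2)])
  show "\<exists>k. schwartz k \<and> partial_deriv i h = conv k g" for i
    using partial_derivs_conv[OF k assms(2), of "[i]"] k
    by (intro exI[of _ "partial_deriv i k"]) (simp add: h schwartz_partial)
qed (use assms in \<open>intro exI[of _ k] conjI refl\<close>)

section \<open>The Fourier transform\<close>

definition chi :: "real^'n \<Rightarrow> real^'n \<Rightarrow> complex" where
  "chi x \<xi> = exp (\<i> * complex_of_real (x \<bullet> \<xi>))"

lemma norm_chi [simp]: "norm (chi x \<xi>) = 1" by (simp add: chi_def)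
lemma chi_0 [simp]: "chi 0 \<xi> = 1" "chi x 0 = 1" by (simp_all add: chi_def)
lemma chi_commute: "chi x \<xi> = chi \<xi> x" by (simp add: chi_def inner_commute)
lemma chi_add: "chi (x + y) \<xi> = chi x \<xi> * chi y \<xi>"
  by (simp add: chi_def inner_add_left distrib_left exp_add)
lemma chi_add_right: "chi x (\<xi> + \<eta>) = chi x \<xi> * chi x \<eta>"
  by (simp add: chi_def inner_add_right distrib_left exp_add)
lemma chi_minus: "chi (- x) \<xi> = chi x (- \<xi>)" by (simp add: chi_def)
lemma chi_diff: "chi (x - y) \<xi> = chi x \<xi> * chi (- y) \<xi>"
  using chi_add[of x "- y"] by simp
lemma chi_scale: "chi (c *\<^sub>R x) \<xi> = chi x (c *\<^sub>R \<xi>)" by (simp add: chi_def)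
lemma chi_cancel [simp]: "chi (- y) \<xi> * chi y \<xi> = 1" "chi y \<xi> * chi (- y) \<xi> = 1"
  using chi_add[of "- y" y \<xi>] chi_add[of y "- y" \<xi>] by simp_all
lemma cnj_chi: "cnj (chi x \<xi>) = chi (- x) \<xi>"
  by (simp add: chi_def exp_cnj)

lemma continuous_on_chi [continuous_intros]:
  "continuous_on S f \<Longrightarrow> continuous_on S g \<Longrightarrow> continuous_on S (\<lambda>x. chi (f x) (g x))"
  unfolding chi_def by (intro continuous_intros)

lemma borel_measurable_chi [measurable]:
  assumes "f \<in> borel_measurable M" "g \<in> borel_measurable M"
  shows "(\<lambda>x. chi (f x) (g x)) \<in> borel_measurable M"
  unfolding chi_def using assms by measurable

lemma fourier_eq_lborel:
  assumes [measurable]: "g \<in> borel_measurable borel"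
  shows "fourier g \<xi> = (\<integral>x. g x * chi (- x) \<xi> \<partial>lborel)"
  unfolding fourier_def by (subst integral_completion) (simp_all add: chi_def)

lemma integrable_mult_chi:
  assumes "integrable lborel g"
  shows "integrable lborel (\<lambda>x. g x * chi (c *\<^sub>R x + y) \<xi>)"
    "integrable lborel (\<lambda>x. g x * chi x \<xi>)"
    "integrable lborel (\<lambda>x. g x * chi (- x) \<xi>)"
proof -
  have [measurable]: "g \<in> borel_measurable borel" using borel_measurable_integrable[OF assms] by simp
  show "integrable lborel (\<lambda>x. g x * chi (c *\<^sub>R x + y) \<xi>)"
    "integrable lborel (\<lambda>x. g x * chi x \<xi>)"
    "integrable lborel (\<lambda>x. g x * chi (- x) \<xi>)"
    by (rule Bochner_Integration.integrable_bound[OF assms]; simp add: norm_mult)+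
qed

lemma norm_fourier_le:
  assumes "integrable lborel g"
  shows "norm (fourier g \<xi>) \<le> (\<integral>x. norm (g x) \<partial>lborel)"
proof -
  have [measurable]: "g \<in> borel_measurable borel" using borel_measurable_integrable[OF assms] by simp
  show ?thesis unfolding fourier_eq_lborel[OF \<open>g \<in> borel_measurable borel\<close>]
    by (rule norm_integral_le)
      (use assms in \<open>auto simp: norm_mult integrable_mult_chi\<close>)
qed

lemma chi_taylor:
  "norm (chi x (\<xi> + h) - chi x \<xi> - \<i> * of_real (x \<bullet> h) * chi x \<xi>) \<le> (norm x)\<^sup>2 * (norm h)\<^sup>2"
proof -
  have "chi x (\<xi> + h) - chi x \<xi> - \<i> * of_real (x \<bullet> h) * chi x \<xi> =
     chi x \<xi> * (iexp (x \<bullet> h) - (\<Sum>k\<le>1. (\<i> * of_real (x \<bullet> h)) ^ k / fact k))"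
    by (simp add: chi_add_right algebra_simps) (simp add: chi_def)
  then have "norm (chi x (\<xi> + h) - chi x \<xi> - \<i> * of_real (x \<bullet> h) * chi x \<xi>) \<le> \<bar>x \<bullet> h\<bar> ^ Suc 1 / fact (Suc 1)"
    using iexp_approx1[of "x \<bullet> h" 1] by (simp add: norm_mult)
  also have "\<dots> \<le> \<bar>x \<bullet> h\<bar>\<^sup>2" by (simp add: power2_eq_square)
  also have "\<dots> \<le> (norm x * norm h)\<^sup>2"
    by (intro power_mono Cauchy_Schwarz_ineq2) simp
  finally show ?thesis by (simp add: power_mult_distrib)
qed

lemma rapid_coord:
  fixes g :: "real^'n \<Rightarrow> complex"
  shows "rapid g \<Longrightarrow> rapid (\<lambda>x. of_real (x $ i) * g x)"
proof (rule rapid_mult_poly[where C = 1 and M = 1])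
  fix x :: "real^'n" show "norm (complex_of_real (x $ i)) \<le> 1 * (1 + norm x) ^ 1"
    using component_le_norm_cart[of x i] by simp
qed simp_all

lemma fourier_has_derivative:
  assumes g: "rapid g"
  shows "(fourier g has_derivative
    (\<lambda>h. \<Sum>i\<in>UNIV. h $ i *\<^sub>R fourier (\<lambda>x. - \<i> * (of_real (x $ i) * g x)) \<xi>)) (at \<xi>)"
proof (rule has_derivative_quadratic[where C = "\<integral>x. norm (g x) * (1 + norm x) ^ 2 \<partial>lborel"])
  show "bounded_linear (\<lambda>h. \<Sum>i\<in>UNIV. h $ i *\<^sub>R fourier (\<lambda>x. - \<i> * (of_real (x $ i) * g x)) \<xi>)"
    by (intro bounded_linear_sum bounded_linear_scaleR_const bounded_linear_vec_nth)
  fix h :: "real^'a"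
  have [measurable]: "g \<in> borel_measurable borel" using g by (rule rapid_measurable)
  define G where "G i = (\<lambda>x. - \<i> * (of_real (x $ i) * g x))" for i
  have int: "integrable lborel (G i)" for i
    unfolding G_def by (intro integrable_mult_right rapid_integrable rapid_coord g)
  then have [measurable]: "G i \<in> borel_measurable borel" for i
    using borel_measurable_integrable by fastforce
  note intg = rapid_integrable[OF g]
  have "fourier g (\<xi> + h) - fourier g \<xi> - (\<Sum>i\<in>UNIV. h $ i *\<^sub>R fourier (G i) \<xi>) =
    (\<integral>x. g x * chi (- x) (\<xi> + h) - g x * chi (- x) \<xi> - (\<Sum>i\<in>UNIV. h $ i *\<^sub>R (G i x * chi (- x) \<xi>)) \<partial>lborel)"
    by (simp add: fourier_eq_lborel integrable_mult_chi(3)[OF int] integrable_mult_chi(3)[OF intg]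
      Bochner_Integration.integral_diff Bochner_Integration.integrable_diff Bochner_Integration.integrable_sum)
  also have "norm \<dots> \<le> (\<integral>x. (norm h)\<^sup>2 * (norm (g x) * (1 + norm x) ^ 2) \<partial>lborel)"
  proof (rule norm_integral_le)
    fix x :: "real^'a"
    have xh: "x \<bullet> h = (\<Sum>i\<in>UNIV. x $ i * h $ i)" by (simp add: inner_vec_def)
    have "g x * chi (- x) (\<xi> + h) - g x * chi (- x) \<xi> -
      (\<Sum>i\<in>UNIV. h $ i *\<^sub>R (G i x * chi (- x) \<xi>)) =
      g x * (chi (- x) (\<xi> + h) - chi (- x) \<xi> - \<i> * of_real (- x \<bullet> h) * chi (- x) \<xi>)"
      by (simp add: xh G_def algebra_simps sum_distrib_left sum_negf scaleR_conv_of_real)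
    then have "norm (g x * chi (- x) (\<xi> + h) - g x * chi (- x) \<xi> -
      (\<Sum>i\<in>UNIV. h $ i *\<^sub>R (G i x * chi (- x) \<xi>))) \<le> norm (g x) * ((norm x)\<^sup>2 * (norm h)\<^sup>2)"
      using chi_taylor[of "- x" \<xi> h] by (simp only: norm_mult norm_minus_cancel mult_left_mono norm_ge_zero)
    also have "\<dots> \<le> norm (g x) * ((1 + norm x)\<^sup>2 * (norm h)\<^sup>2)"
      by (intro mult_left_mono mult_right_mono power_mono) auto
    finally show "norm (g x * chi (- x) (\<xi> + h) - g x * chi (- x) \<xi> -
      (\<Sum>i\<in>UNIV. h $ i *\<^sub>R (G i x * chi (- x) \<xi>))) \<le> (norm h)\<^sup>2 * (norm (g x) * (1 + norm x)\<^sup>2)"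
      by (simp add: mult_ac)
  qed (intro Bochner_Integration.integrable_diff Bochner_Integration.integrable_sum integrable_scaleR_right
      integrable_mult_chi int intg integrable_mult_right rapid_integrable_moment g)+
  finally show "norm (fourier g (\<xi> + h) - fourier g \<xi> -
      (\<Sum>i\<in>UNIV. h $ i *\<^sub>R fourier (G i) \<xi>))
     \<le> (\<integral>x. norm (g x) * (1 + norm x) ^ 2 \<partial>lborel) * (norm h)\<^sup>2"
    unfolding G_def integral_mult_right_zero by (simp only: mult.commute)
qed

lemma fourier_translate:
  assumes [measurable]: "g \<in> borel_measurable borel"
  shows "fourier (\<lambda>x. g (x + a)) \<xi> = chi a \<xi> * fourier g \<xi>"
proof -
  have "fourier (\<lambda>x. g (x + a)) \<xi> = (\<integral>x. g (x + a) * chi (- x) \<xi> \<partial>lborel)"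
    by (rule fourier_eq_lborel) measurable
  also have "\<dots> = (\<integral>x. (\<lambda>x. chi a \<xi> * (g x * chi (- x) \<xi>)) (a + 1 *\<^sub>R x) \<partial>lborel)"
    by (intro Bochner_Integration.integral_cong refl)
      (use chi_diff[of "- _" a \<xi>] chi_cancel in \<open>simp add: add.commute chi_diff mult.left_commute[of "chi a \<xi>"] mult.assoc[symmetric]\<close>)
  also have "\<dots> = chi a \<xi> * fourier g \<xi>"
    by (subst integral_affine) (simp_all add: fourier_eq_lborel)
  finally show ?thesis .
qed

text \<open>Integration by parts is avoided: the increment of \<open>g\<close> along a small step t
  in direction i has the exact transform (chi - 1) times the transform of \<open>g\<close>.
  Comparing both sides with their linear parts leaves errors of order t^2; division by t and t
  \<rightarrow> 0 give the identity.\<close>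

lemma fourier_partial:
  fixes g :: "real^'n \<Rightarrow> complex"
  assumes g: "schwartz g"
  shows "fourier (partial_deriv i g) \<xi> = \<i> * of_real (\<xi> $ i) * fourier g \<xi>"
proof -
  obtain C where C: "C \<ge> 0" "\<And>x h. norm h \<le> 1 \<Longrightarrow>
      norm (g (x + h) - g x - (\<Sum>i\<in>UNIV. h $ i *\<^sub>R partial_deriv i g x)) * (1 + norm x) ^ (2 * CARD('n)) \<le> C * (norm h)\<^sup>2"
    using schwartz_taylor[OF g, of "2 * CARD('n)"] by blast
  have [measurable]: "g \<in> borel_measurable borel" "partial_deriv i g \<in> borel_measurable borel"
    using g by (simp_all add: schwartz_measurable schwartz_partial)
  have intg: "integrable lborel g" "integrable lborel (partial_deriv i g)"
    using g by (simp_all add: rapid_integrable schwartz_rapid schwartz_partial)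
  \<comment> \<open>The two summands are the Taylor errors of \<open>g\<close> and of the
    character.\<close>
  define K where "K = C * (\<integral>x. wt x \<partial>(lborel::(real^'n) measure)) + (norm \<xi>)\<^sup>2 * norm (fourier g \<xi>)"
  let ?d = "fourier (partial_deriv i g) \<xi> - \<i> * of_real (\<xi> $ i) * fourier g \<xi>"
  have bound: "norm ?d \<le> K * t" if t: "0 < t" "t \<le> 1" for t
  proof -
    define e where "e = t *\<^sub>R (axis i 1 :: real^'n)"
    have e: "norm e = t" using t by (simp add: e_def)
    have es: "(\<Sum>j\<in>UNIV. e $ j *\<^sub>R partial_deriv j g x) = t *\<^sub>R partial_deriv i g x" for x
    proof -
      have "(\<Sum>j\<in>UNIV. e $ j *\<^sub>R partial_deriv j g x) = (\<Sum>j\<in>UNIV. if j = i then t *\<^sub>R partial_deriv j g x else 0)"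
        by (intro sum.cong) (auto simp: e_def axis_def)
      then show ?thesis by simp
    qed
    have intge: "integrable lborel (\<lambda>x. g (x + e))"
      using integrable_affine_iff[of 1 g e] intg by (simp add: add.commute)
    have "norm (chi e \<xi> * fourier g \<xi> - fourier g \<xi> - of_real t * fourier (partial_deriv i g) \<xi>)
       = norm (\<integral>x. (g (x + e) - g x - t *\<^sub>R partial_deriv i g x) * chi (- x) \<xi> \<partial>lborel)"
    proof -
      have "chi e \<xi> * fourier g \<xi> - fourier g \<xi> - of_real t * fourier (partial_deriv i g) \<xi> =
        (\<integral>x. g (x + e) * chi (- x) \<xi> - g x * chi (- x) \<xi> - t *\<^sub>R (partial_deriv i g x * chi (- x) \<xi>) \<partial>lborel)"
        by (subst fourier_translate[symmetric])
          (simp_all add: fourier_eq_lborel integrable_mult_chi intg intge scaleR_conv_of_real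
            Bochner_Integration.integral_diff Bochner_Integration.integrable_diff)
      then show ?thesis by (simp add: algebra_simps)
    qed
    also have "\<dots> \<le> (\<integral>x. C * t\<^sup>2 * wt x \<partial>(lborel::(real^'n) measure))"
    proof (rule norm_integral_le)
      fix x :: "real^'n"
      show "norm ((g (x + e) - g x - t *\<^sub>R partial_deriv i g x) * chi (- x) \<xi>) \<le> C * t\<^sup>2 * wt x"
        using C(2)[of e x] e t unfolding norm_mult norm_chi es by (simp add: wt_def field_simps)
    qed (intro integrable_mult_chi Bochner_Integration.integrable_diff integrable_scaleR_right intg intge
        integrable_mult_right integrable_wt)+
    finally have 1: "norm (chi e \<xi> * fourier g \<xi> - fourier g \<xi> - of_real t * fourier (partial_deriv i g) \<xi>)
        \<le> C * t\<^sup>2 * (\<integral>x. wt x \<partial>(lborel::(real^'n) measure))" by simp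
    have "e \<bullet> \<xi> = t * \<xi> $ i" by (simp add: e_def inner_axis' )
    then have 2: "norm (chi e \<xi> - 1 - \<i> * of_real (t * \<xi> $ i)) \<le> (norm \<xi>)\<^sup>2 * t\<^sup>2"
      using chi_taylor[of \<xi> 0 e] e by (simp add: chi_commute inner_commute)
    have "of_real t * ?d = (chi e \<xi> - 1 - \<i> * of_real (t * \<xi> $ i)) * fourier g \<xi> -
       (chi e \<xi> * fourier g \<xi> - fourier g \<xi> - of_real t * fourier (partial_deriv i g) \<xi>)"
      by (simp add: algebra_simps)
    then have "norm (of_real t * ?d) \<le> norm ((chi e \<xi> - 1 - \<i> * of_real (t * \<xi> $ i)) * fourier g \<xi>) +
        norm (chi e \<xi> * fourier g \<xi> - fourier g \<xi> - of_real t * fourier (partial_deriv i g) \<xi>)"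
      by (simp only: norm_triangle_ineq4)
    also have "\<dots> \<le> (norm \<xi>)\<^sup>2 * t\<^sup>2 * norm (fourier g \<xi>) + C * t\<^sup>2 * (\<integral>x. wt x \<partial>(lborel::(real^'n) measure))"
      using 1 2 by (intro add_mono) (auto simp: norm_mult mult_right_mono)
    also have "\<dots> = t * (K * t)" by (simp add: K_def algebra_simps power2_eq_square)
    finally have "t * norm ?d \<le> t * (K * t)" using t by (simp add: norm_mult)
    then show ?thesis using t by simp
  qed
  have "((\<lambda>t. K * t) \<longlongrightarrow> K * 0) (at_right 0)" by (intro tendsto_intros)
  moreover have "eventually (\<lambda>t. norm ?d \<le> K * t) (at_right 0)"
    using bound eventually_at_right_less[of 0] eventually_at_right_real[of 0 1]
    by (auto elim!: eventually_mono)
  ultimately have "norm ?d \<le> K * 0"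
    by (intro tendsto_lowerbound) auto
  then show ?thesis by simp
qed

text \<open>One more power of 1 + |\<xi>| is bounded by 1 plus the sum of the |\<xi>_i|, and each
  \<xi>_i is absorbed into a partial derivative of \<open>g\<close>. Hence the induction generalises
  over \<open>g\<close>.\<close>

lemma fourier_decay:
  fixes g :: "real^'n \<Rightarrow> complex"
  assumes "schwartz g"
  shows "\<exists>C. \<forall>\<xi>. norm (fourier g \<xi>) * (1 + norm \<xi>) ^ N \<le> C"
  using assms
proof (induction N arbitrary: g)
  case 0
  then show ?case using norm_fourier_le[OF rapid_integrable[OF schwartz_rapid[OF 0]]] by auto
next
  case (Suc N)
  obtain C where C: "\<And>\<xi>. norm (fourier g \<xi>) * (1 + norm \<xi>) ^ N \<le> C" using Suc by blast
  have "\<forall>i. \<exists>C. \<forall>\<xi>. norm (fourier (partial_deriv i g) \<xi>) * (1 + norm \<xi>) ^ N \<le> C"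
    by (intro allI Suc.IH schwartz_partial Suc.prems)
  from choice[OF this] obtain D where
    D: "\<forall>i. \<forall>\<xi>. norm (fourier (partial_deriv i g) \<xi>) * (1 + norm \<xi>) ^ N \<le> D i" ..
  have "norm (fourier g \<xi>) * (1 + norm \<xi>) ^ Suc N \<le> C + (\<Sum>i\<in>UNIV. D i)" for \<xi>
  proof -
    have "norm (fourier g \<xi>) * (1 + norm \<xi>) ^ Suc N = norm (fourier g \<xi>) * (1 + norm \<xi>) ^ N * (1 + norm \<xi>)"
      by simp
    also have "\<dots> \<le> norm (fourier g \<xi>) * (1 + norm \<xi>) ^ N * (1 + (\<Sum>i\<in>UNIV. \<bar>\<xi> $ i\<bar>))"
      by (intro mult_left_mono add_left_mono norm_le_l1_cart) auto
    also have "\<dots> = norm (fourier g \<xi>) * (1 + norm \<xi>) ^ N +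
       (\<Sum>i\<in>UNIV. norm (fourier (partial_deriv i g) \<xi>) * (1 + norm \<xi>) ^ N)"
      by (simp add: fourier_partial[OF Suc.prems] norm_mult distrib_left sum_distrib_left mult_ac)
    also have "\<dots> \<le> C + (\<Sum>i\<in>UNIV. D i)"
      using D by (intro add_mono C sum_mono) blast
    finally show ?thesis .
  qed
  then show ?case by blast
qed

lemma schwartz_fourier:
  assumes "schwartz g"
  shows "schwartz (fourier g)"
proof (rule schwartz_coinduct[where X = "\<lambda>h. \<exists>g. schwartz g \<and> h = fourier g"])
  fix h N assume "\<exists>g. schwartz g \<and> h = fourier g"
  then obtain g where g: "schwartz g" and h: "h = fourier g" by blast
  note d = fourier_has_derivative[OF schwartz_rapid[OF g]]
  show "h differentiable at x" for x
    unfolding h by (rule differentiableI[OF d])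
  show "\<exists>C. \<forall>x. norm (h x) * (1 + norm x) ^ N \<le> C"
    unfolding h by (rule fourier_decay[OF g])
  show "\<exists>g. schwartz g \<and> partial_deriv i h = fourier g" for i
    unfolding h
    by (intro exI[of _ "\<lambda>x. - \<i> * (of_real (x $ i) * g x)"] conjI schwartz_cmult schwartz_coord g ext partial_deriv_eqI'[OF d])
qed (use assms in \<open>intro exI[of _ g] conjI refl\<close>)

section \<open>Gaussians and Fourier inversion\<close>

lemma lborel_integral_prod:
  fixes f :: "'a::euclidean_space \<Rightarrow> real \<Rightarrow> complex"
  assumes int: "\<And>b. b \<in> Basis \<Longrightarrow> integrable lborel (f b)"
  shows "integrable lborel (\<lambda>x. \<Prod>b\<in>Basis. f b (x \<bullet> b))"
    and "(\<integral>x. (\<Prod>b\<in>Basis. f b (x \<bullet> b)) \<partial>lborel) = (\<Prod>b\<in>Basis. \<integral>t. f b t \<partial>lborel)"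
proof -
  interpret product_sigma_finite "\<lambda>_::'a. lborel :: real measure" by standard
  have m: "f b \<in> borel_measurable borel" if "b \<in> Basis" for b
    using borel_measurable_integrable[OF int[OF that]] by simp
  have [measurable]: "(\<lambda>x. \<Prod>b\<in>Basis. f b (x \<bullet> b)) \<in> borel_measurable borel"
    by (intro borel_measurable_prod measurable_compose[OF _ m]) auto
  let ?P = "\<Pi>\<^sub>M b\<in>Basis. lborel :: ('a \<Rightarrow> real) measure"
  have T: "(\<lambda>g. \<Sum>b\<in>Basis. g b *\<^sub>R b) \<in> measurable ?P (borel :: 'a measure)"
    by measurable
  have eq: "(\<Prod>b\<in>Basis. f b ((\<Sum>c\<in>Basis. g c *\<^sub>R c) \<bullet> b)) = (\<Prod>b\<in>Basis. f b (g b))" for g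
    by (intro prod.cong refl) simp
  show "integrable lborel (\<lambda>x. \<Prod>b\<in>Basis. f b (x \<bullet> b))"
    unfolding lborel_eq[where 'a = 'a]
    by (subst integrable_distr_eq[OF T]) (simp_all add: eq product_integrable_prod int)
  show "(\<integral>x. (\<Prod>b\<in>Basis. f b (x \<bullet> b)) \<partial>lborel) = (\<Prod>b\<in>Basis. \<integral>t. f b t \<partial>lborel)"
    unfolding lborel_eq[where 'a = 'a]
    by (subst integral_distr[OF T]) (simp_all add: eq product_integral_prod int lborel_eq[symmetric, where 'a = real] )
qed

definition gauss :: "real^'n \<Rightarrow> complex" where
  "gauss x = of_real (exp (- (norm x)\<^sup>2 / 2))"

lemma borel_measurable_gauss [measurable]: "gauss \<in> borel_measurable borel"
  unfolding gauss_def by measurable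

lemma continuous_gauss: "isCont gauss x"
  unfolding gauss_def by (intro continuous_intros) simp

lemma norm_gauss_le [simp]: "norm (gauss x) \<le> 1"
  by (simp add: gauss_def)

text \<open>Up to the factor sqrt (2 \<pi>) this is the characteristic function of the standard
  normal distribution.\<close>

lemma gaussian_fourier_1d:
  "integrable lborel (\<lambda>t. complex_of_real (exp (- t\<^sup>2 / 2)) * iexp (s * t))"
  "(\<integral>t. complex_of_real (exp (- t\<^sup>2 / 2)) * iexp (s * t) \<partial>lborel) = of_real (sqrt (2 * pi) * exp (- s\<^sup>2 / 2))"
proof -
  have eq: "complex_of_real (exp (- t\<^sup>2 / 2)) * iexp (s * t) =
      of_real (sqrt (2 * pi)) * (std_normal_density t *\<^sub>R iexp (s * t))" for t
    by (simp add: std_normal_density_def scaleR_conv_of_real)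
  have "integrable lborel (\<lambda>t. std_normal_density t *\<^sub>R iexp (s * t))"
    by (rule Bochner_Integration.integrable_bound[OF integrable_normal_density[of 1 0]]) auto
  then show "integrable lborel (\<lambda>t. complex_of_real (exp (- t\<^sup>2 / 2)) * iexp (s * t))"
    unfolding eq by (rule integrable_mult_right)
  have "char std_normal_distribution s = (\<integral>t. std_normal_density t *\<^sub>R iexp (s * t) \<partial>lborel)"
    unfolding char_def by (subst integral_density) auto
  then have "(\<integral>t. std_normal_density t *\<^sub>R iexp (s * t) \<partial>lborel) = of_real (exp (- s\<^sup>2 / 2))"
    by (simp add: char_std_normal_distribution)
  then show "(\<integral>t. complex_of_real (exp (- t\<^sup>2 / 2)) * iexp (s * t) \<partial>lborel) = of_real (sqrt (2 * pi) * exp (- s\<^sup>2 / 2))"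
    unfolding eq integral_mult_right_zero by simp
qed

lemma gaussian_fourier:
  fixes \<xi> :: "real^'n"
  shows "integrable lborel (gauss :: real^'n \<Rightarrow> complex)"
    and "(\<integral>x. gauss x * chi x \<xi> \<partial>lborel) = of_real (sqrt (2 * pi) ^ CARD('n)) * gauss \<xi>"
proof -
  have nrm: "(norm x)\<^sup>2 = (\<Sum>b\<in>Basis. (x \<bullet> b)\<^sup>2)" for x :: "real^'n"
    unfolding power2_norm_eq_inner euclidean_inner[of x x] by (simp add: power2_eq_square)
  have g: "gauss x = (\<Prod>b\<in>Basis. complex_of_real (exp (- (x \<bullet> b)\<^sup>2 / 2)))" for x :: "real^'n"
    by (simp add: gauss_def nrm exp_sum[symmetric] sum_negf sum_divide_distrib flip: of_real_prod)
  have eq: "gauss x * chi x \<xi> = (\<Prod>b\<in>Basis. complex_of_real (exp (- (x \<bullet> b)\<^sup>2 / 2)) * iexp ((\<xi> \<bullet> b) * (x \<bullet> b)))"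
    for x \<xi> :: "real^'n"
    unfolding g chi_def prod.distrib
    by (subst euclidean_inner) (simp add: exp_sum[symmetric] sum_distrib_left mult.commute)
  have int: "integrable lborel (\<lambda>x. gauss x * chi x \<xi>)" for \<xi> :: "real^'n"
    unfolding eq by (rule lborel_integral_prod(1)) (rule gaussian_fourier_1d)
  show "integrable lborel (gauss :: real^'n \<Rightarrow> complex)"
    using int[of 0] by simp
  have "(\<integral>x. gauss x * chi x \<xi> \<partial>lborel) =
      (\<Prod>b\<in>(Basis::(real^'n) set). of_real (sqrt (2 * pi) * exp (- (\<xi> \<bullet> b)\<^sup>2 / 2)))"
    unfolding eq
    by (subst lborel_integral_prod(2)) (simp_all only: gaussian_fourier_1d)
  also have "\<dots> = of_real (sqrt (2 * pi) ^ CARD('n)) * gauss \<xi>"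
    by (simp add: g prod.distrib of_real_mult DIM_cart)
  finally show "(\<integral>x. gauss x * chi x \<xi> \<partial>lborel) = of_real (sqrt (2 * pi) ^ CARD('n)) * gauss \<xi>" .
qed

text \<open>The kernel has modulus at most 1, so the double integrand is dominated by the product of
  |f| and |g|. At every use the kernel is a character.\<close>

lemma Fubini_bounded_kernel:
  fixes f g :: "real^'n \<Rightarrow> complex" and e :: "real^'n \<Rightarrow> real^'n \<Rightarrow> complex"
  assumes f: "integrable lborel f" and g: "integrable lborel g"
    and e: "(\<lambda>(x, y). e x y) \<in> borel_measurable (borel \<Otimes>\<^sub>M borel)" "\<And>x y. norm (e x y) \<le> 1"
  shows "(\<integral>x. f x * (\<integral>y. g y * e x y \<partial>lborel) \<partial>lborel) = (\<integral>y. g y * (\<integral>x. f x * e x y \<partial>lborel) \<partial>lborel)"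
proof -
  have [measurable]: "f \<in> borel_measurable borel" "g \<in> borel_measurable borel"
    using borel_measurable_integrable[OF f] borel_measurable_integrable[OF g] by simp_all
  have [measurable]: "(\<lambda>p. e (fst p) (snd p)) \<in> borel_measurable (borel \<Otimes>\<^sub>M borel)"
    using e(1) by (simp add: case_prod_beta')
  let ?F = "\<lambda>(x, y). f x * (g y * e x y)"
  have meas: "?F \<in> borel_measurable (lborel \<Otimes>\<^sub>M lborel)"
    by (simp add: case_prod_beta')
  have "integrable (lborel \<Otimes>\<^sub>M lborel) ?F"
  proof (rule integrableI_bounded[OF meas])
    have "(\<integral>\<^sup>+p. ennreal (norm (?F p)) \<partial>(lborel \<Otimes>\<^sub>M lborel)) \<le>
       (\<integral>\<^sup>+p. ennreal (norm (f (fst p))) * ennreal (norm (g (snd p))) \<partial>(lborel \<Otimes>\<^sub>M lborel))"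
    proof (intro nn_integral_mono)
      fix p :: "(real^'n) \<times> (real^'n)"
      have "norm (?F p) \<le> norm (f (fst p)) * norm (g (snd p))"
        using e(2)[of "fst p" "snd p"]
        by (simp add: case_prod_beta norm_mult mult_left_mono mult_right_le_one_le)
      then show "ennreal (norm (?F p)) \<le> ennreal (norm (f (fst p))) * ennreal (norm (g (snd p)))"
        by (simp add: ennreal_leI flip: ennreal_mult)
    qed
    also have "\<dots> = (\<integral>\<^sup>+x. \<integral>\<^sup>+y. ennreal (norm (f x)) * ennreal (norm (g y)) \<partial>lborel \<partial>lborel)"
      by (subst lborel.nn_integral_fst[symmetric]) simp_all
    also have "\<dots> = (\<integral>\<^sup>+x. ennreal (norm (f x)) \<partial>lborel) * (\<integral>\<^sup>+y. ennreal (norm (g y)) \<partial>lborel)"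
      by (simp add: nn_integral_cmult nn_integral_multc)
    also have "\<dots> < \<infinity>"
      using f g by (simp add: integrable_iff_bounded ennreal_mult_less_top)
    finally show "(\<integral>\<^sup>+p. ennreal (norm (?F p)) \<partial>(lborel \<Otimes>\<^sub>M lborel)) < \<infinity>" .
  qed
  then have F: "(\<integral>y. \<integral>x. f x * (g y * e x y) \<partial>lborel \<partial>lborel) = (\<integral>x. \<integral>y. f x * (g y * e x y) \<partial>lborel \<partial>lborel)"
    by (intro lborel_pair.Fubini_integral) (simp add: case_prod_beta')
  have 1: "(\<integral>x. f x * (\<integral>y. g y * e x y \<partial>lborel) \<partial>lborel) = (\<integral>x. \<integral>y. f x * (g y * e x y) \<partial>lborel \<partial>lborel)"
    by simp
  have 2: "(\<integral>y. g y * (\<integral>x. f x * e x y \<partial>lborel) \<partial>lborel) = (\<integral>y. \<integral>x. f x * (g y * e x y) \<partial>lborel \<partial>lborel)"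
  proof -
    have "(\<integral>y. g y * (\<integral>x. f x * e x y \<partial>lborel) \<partial>lborel) = (\<integral>y. \<integral>x. g y * (f x * e x y) \<partial>lborel \<partial>lborel)"
      by simp
    also have "\<dots> = (\<integral>y. \<integral>x. f x * (g y * e x y) \<partial>lborel \<partial>lborel)"
      by (intro Bochner_Integration.integral_cong refl mult.left_commute)
    finally show ?thesis .
  qed
  show ?thesis unfolding 1 2 by (rule F[symmetric])
qed

lemma schwartz_fourier_integrable: "schwartz g \<Longrightarrow> integrable lborel (fourier g)"
  by (intro rapid_integrable schwartz_rapid schwartz_fourier)

text \<open>Gaussian summation: the factor \<open>gauss (\<epsilon> m *\<^sub>R \<xi>)\<close> makes
  the double integral absolutely convergent, and dominated convergence removes it on both sides. The
  constant (2 \<pi>)^(n/2) appears twice, as the factor in the transform of the Gaussian and as its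
  total mass.\<close>

theorem fourier_inversion:
  fixes g :: "real^'n \<Rightarrow> complex"
  assumes "schwartz g"
  shows "(\<integral>\<xi>. fourier g \<xi> * chi x \<xi> \<partial>lborel) = of_real ((2 * pi) ^ CARD('n)) * g x"
proof -
  define c where "c = complex_of_real (sqrt (2 * pi) ^ CARD('n))"
  have c2: "c * c = of_real ((2 * pi) ^ CARD('n))"
  proof -
    have "sqrt (2 * pi) ^ CARD('n) * sqrt (2 * pi) ^ CARD('n) = (sqrt (2 * pi) * sqrt (2 * pi)) ^ CARD('n)"
      by (rule power_mult_distrib[symmetric])
    also have "sqrt (2 * pi) * sqrt (2 * pi) = 2 * pi" by (rule real_sqrt_mult_self[THEN trans]) simp
    finally show ?thesis unfolding c_def of_real_mult[symmetric] by (rule arg_cong)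
  qed
  have [measurable]: "g \<in> borel_measurable borel" using assms by (rule schwartz_measurable)
  have [measurable]: "fourier g \<in> borel_measurable borel"
    using assms by (intro schwartz_measurable schwartz_fourier)
  note intg = rapid_integrable[OF schwartz_rapid[OF assms]]
  note intF = schwartz_fourier_integrable[OF assms]
  define \<epsilon> where "\<epsilon> m = 1 / real (Suc m)" for m
  have \<epsilon>: "\<epsilon> m > 0" for m by (simp add: \<epsilon>_def)
  have \<epsilon>0: "\<epsilon> \<longlonglongrightarrow> 0" unfolding \<epsilon>_def by (rule lim_1_over_n[THEN LIMSEQ_Suc])
  define L where "L m = (\<integral>\<xi>. fourier g \<xi> * chi x \<xi> * gauss (\<epsilon> m *\<^sub>R \<xi>) \<partial>lborel)" for m
  have inner: "(\<integral>\<xi>. gauss (\<epsilon> m *\<^sub>R \<xi>) * chi v \<xi> \<partial>lborel) = of_real (1 / \<epsilon> m ^ CARD('n)) * c * gauss ((1 / \<epsilon> m) *\<^sub>R v)"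
    for m and v :: "real^'n"
  proof -
    have "(\<integral>\<xi>. gauss (\<epsilon> m *\<^sub>R \<xi>) * chi v \<xi> \<partial>lborel) =
      (\<integral>\<xi>. (\<lambda>\<xi>. gauss \<xi> * chi \<xi> ((1 / \<epsilon> m) *\<^sub>R v)) (0 + \<epsilon> m *\<^sub>R \<xi>) \<partial>lborel)"
      using \<epsilon>[of m] by (intro Bochner_Integration.integral_cong refl) (simp add: chi_scale[symmetric] chi_commute)
    also have "\<dots> = (\<integral>\<xi>. gauss \<xi> * chi \<xi> ((1 / \<epsilon> m) *\<^sub>R v) \<partial>lborel) /\<^sub>R \<bar>\<epsilon> m\<bar> ^ CARD('n)"
      using \<epsilon>[of m]
      by (subst integral_affine[where f = "\<lambda>\<xi>. gauss \<xi> * chi \<xi> ((1 / \<epsilon> m) *\<^sub>R v)"]) auto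
    also have "\<dots> = of_real (1 / \<epsilon> m ^ CARD('n)) * c * gauss ((1 / \<epsilon> m) *\<^sub>R v)"
      using \<epsilon>[of m] by (simp add: gaussian_fourier(2) c_def scaleR_conv_of_real inverse_eq_divide)
    finally show ?thesis .
  qed
  have intG: "integrable lborel (\<lambda>\<xi>::real^'n. gauss (\<epsilon> m *\<^sub>R \<xi>))" for m
    using integrable_affine_iff[of "\<epsilon> m" "gauss :: real^'n \<Rightarrow> complex" 0] gaussian_fourier(1) \<epsilon>[of m] by simp
  \<comment> \<open>After Fubini the inner integral is the transform of a dilated Gaussian. The
    substitution y = x + \<epsilon> v cancels its factor \<epsilon>^(-n), and the evenness of the
    Gaussian removes the sign of v.\<close>
  have L: "L m = (\<integral>v. c * (g (x + \<epsilon> m *\<^sub>R v) * gauss v) \<partial>lborel)" for m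
  proof -
    have "L m = (\<integral>\<xi>. (gauss (\<epsilon> m *\<^sub>R \<xi>) * chi x \<xi>) * (\<integral>y. g y * chi (- y) \<xi> \<partial>lborel) \<partial>lborel)"
      unfolding L_def by (simp add: fourier_eq_lborel mult_ac)
    also have "\<dots> = (\<integral>y. g y * (\<integral>\<xi>. (gauss (\<epsilon> m *\<^sub>R \<xi>) * chi x \<xi>) * chi (- y) \<xi> \<partial>lborel) \<partial>lborel)"
    proof (rule Fubini_bounded_kernel[OF _ intg, where e = "\<lambda>\<xi> y. chi (- y) \<xi>"])
      show "integrable lborel (\<lambda>\<xi>. gauss (\<epsilon> m *\<^sub>R \<xi>) * chi x \<xi>)"
        by (rule Bochner_Integration.integrable_bound[OF intG[of m]]) (simp_all add: norm_mult)
    qed (simp_all add: case_prod_beta')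
    also have "\<dots> = (\<integral>y. of_real (1 / \<epsilon> m ^ CARD('n)) * c * (g y * gauss ((1 / \<epsilon> m) *\<^sub>R (x - y))) \<partial>lborel)"
    proof (intro Bochner_Integration.integral_cong refl)
      fix y
      have e: "(\<integral>\<xi>. (gauss (\<epsilon> m *\<^sub>R \<xi>) * chi x \<xi>) * chi (- y) \<xi> \<partial>lborel) = (\<integral>\<xi>. gauss (\<epsilon> m *\<^sub>R \<xi>) * chi (x - y) \<xi> \<partial>lborel)"
        by (simp only: chi_diff mult.assoc)
      show "g y * (\<integral>\<xi>. (gauss (\<epsilon> m *\<^sub>R \<xi>) * chi x \<xi>) * chi (- y) \<xi> \<partial>lborel) =
          of_real (1 / \<epsilon> m ^ CARD('n)) * c * (g y * gauss ((1 / \<epsilon> m) *\<^sub>R (x - y)))"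
        unfolding e inner by (simp only: mult_ac)
    qed
    also have "\<dots> = of_real (1 / \<epsilon> m ^ CARD('n)) * c * (\<integral>y. g y * gauss ((1 / \<epsilon> m) *\<^sub>R (x - y)) \<partial>lborel)"
      by simp
    also have "(\<integral>y. g y * gauss ((1 / \<epsilon> m) *\<^sub>R (x - y)) \<partial>lborel) =
       of_real (\<epsilon> m ^ CARD('n)) * (\<integral>v. g (x + \<epsilon> m *\<^sub>R v) * gauss ((1 / \<epsilon> m) *\<^sub>R (x - (x + \<epsilon> m *\<^sub>R v))) \<partial>lborel)"
      using \<epsilon>[of m]
      by (subst integral_affine[where f = "\<lambda>y. g y * gauss ((1 / \<epsilon> m) *\<^sub>R (x - y))"])
        (auto simp: scaleR_conv_of_real[where 'a = complex])
    also have "(\<lambda>v. g (x + \<epsilon> m *\<^sub>R v) * gauss ((1 / \<epsilon> m) *\<^sub>R (x - (x + \<epsilon> m *\<^sub>R v)))) = (\<lambda>v. g (x + \<epsilon> m *\<^sub>R v) * gauss v)"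
      using \<epsilon>[of m] by (simp add: gauss_def)
    finally show ?thesis using \<epsilon>[of m] by simp
  qed
  have "L \<longlonglongrightarrow> (\<integral>\<xi>. fourier g \<xi> * chi x \<xi> \<partial>lborel)"
    unfolding L_def
  proof (rule integral_dominated_convergence[where w = "\<lambda>\<xi>. norm (fourier g \<xi>)"])
    show "AE \<xi> in lborel. (\<lambda>m. fourier g \<xi> * chi x \<xi> * gauss (\<epsilon> m *\<^sub>R \<xi>)) \<longlonglongrightarrow> fourier g \<xi> * chi x \<xi>"
    proof (rule AE_I2)
      fix \<xi> :: "real^'n"
      have "(\<lambda>m. gauss (\<epsilon> m *\<^sub>R \<xi>)) \<longlonglongrightarrow> gauss (0 *\<^sub>R \<xi>)"
        by (intro isCont_tendsto_compose[OF continuous_gauss] tendsto_intros \<epsilon>0)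
      then have "(\<lambda>m. fourier g \<xi> * chi x \<xi> * gauss (\<epsilon> m *\<^sub>R \<xi>)) \<longlonglongrightarrow> fourier g \<xi> * chi x \<xi> * gauss (0 *\<^sub>R \<xi>)"
        by (intro tendsto_intros)
      then show "(\<lambda>m. fourier g \<xi> * chi x \<xi> * gauss (\<epsilon> m *\<^sub>R \<xi>)) \<longlonglongrightarrow> fourier g \<xi> * chi x \<xi>"
        by (simp add: gauss_def)
    qed
    show "AE \<xi> in lborel. norm (fourier g \<xi> * chi x \<xi> * gauss (\<epsilon> m *\<^sub>R \<xi>)) \<le> norm (fourier g \<xi>)" for m
      by (rule AE_I2) (simp add: norm_mult mult_left_le)
  qed (use intF in auto)
  moreover have "L \<longlonglongrightarrow> (\<integral>v. c * (g x * gauss (v::real^'n)) \<partial>lborel)"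
    unfolding L
  proof -
    obtain B where B: "\<And>x. norm (g x) * (1 + norm x) ^ 0 \<le> B" using schwartz_decay[OF assms] by blast
    show "(\<lambda>m. \<integral>v. c * (g (x + \<epsilon> m *\<^sub>R v) * gauss v) \<partial>lborel) \<longlonglongrightarrow> (\<integral>v. c * (g x * gauss (v::real^'n)) \<partial>lborel)"
    proof (rule integral_dominated_convergence[where w = "\<lambda>v. norm c * (B * norm (gauss v))"])
      show "AE v in lborel. (\<lambda>m. c * (g (x + \<epsilon> m *\<^sub>R v) * gauss v)) \<longlonglongrightarrow> c * (g x * gauss v)"
      proof (rule AE_I2)
        fix v :: "real^'n"
        have c: "isCont g x"
          using schwartz_continuous[OF assms, of UNIV] by (simp add: continuous_on_eq_continuous_at)
        have "(\<lambda>m. x + \<epsilon> m *\<^sub>R v) \<longlonglongrightarrow> x + 0 *\<^sub>R v" by (intro tendsto_intros \<epsilon>0)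
        then have "(\<lambda>m. x + \<epsilon> m *\<^sub>R v) \<longlonglongrightarrow> x" by simp
        from isCont_tendsto_compose[OF c this] have "(\<lambda>m. g (x + \<epsilon> m *\<^sub>R v)) \<longlonglongrightarrow> g x" .
        then show "(\<lambda>m. c * (g (x + \<epsilon> m *\<^sub>R v) * gauss v)) \<longlonglongrightarrow> c * (g x * gauss v)"
          by (intro tendsto_intros)
      qed
      show "AE v in lborel. norm (c * (g (x + \<epsilon> m *\<^sub>R v) * gauss v)) \<le> norm c * (B * norm (gauss v))" for m
        using B by (intro AE_I2) (simp add: norm_mult mult_left_mono mult_right_mono)
      show "integrable lborel (\<lambda>v::real^'n. norm c * (B * norm (gauss v)))"
        using gaussian_fourier(1) by (intro integrable_mult_right integrable_norm)
    qed simp_all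
  qed
  ultimately have "(\<integral>\<xi>. fourier g \<xi> * chi x \<xi> \<partial>lborel) = (\<integral>v. c * (g x * gauss (v::real^'n)) \<partial>lborel)"
    by (rule LIMSEQ_unique)
  also have "\<dots> = c * (g x * (\<integral>v. gauss (v::real^'n) \<partial>lborel))" by simp
  also have "(\<integral>v. gauss (v::real^'n) \<partial>lborel) = c"
    using gaussian_fourier(2)[of "0 :: real^'n"] by (simp add: c_def gauss_def)
  also have "c * (g x * c) = of_real ((2 * pi) ^ CARD('n)) * g x"
    unfolding c2[symmetric] by (simp only: mult_ac)
  finally show ?thesis .
qed

section \<open>Tempered distributions and their Fourier multipliers\<close>

lemma tempered_add: "tempered u \<Longrightarrow> schwartz g \<Longrightarrow> schwartz h \<Longrightarrow> u (\<lambda>x. g x + h x) = u g + u h"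
  by (simp add: tempered_def)

lemma tempered_cmult: "tempered u \<Longrightarrow> schwartz g \<Longrightarrow> u (\<lambda>x. c * g x) = c * u g"
  by (simp add: tempered_def)

lemma tempered_diff: "tempered u \<Longrightarrow> schwartz g \<Longrightarrow> schwartz h \<Longrightarrow> u (\<lambda>x. g x - h x) = u g - u h"
  using tempered_add[of u g "\<lambda>x. -1 * h x"] tempered_cmult[of u h "-1"] schwartz_cmult[of h "-1"] by simp

lemma schwartz_zero: "schwartz (\<lambda>x. 0)"
proof (rule schwartz_coinduct[where X = "\<lambda>f. f = (\<lambda>x. 0)"])
  fix f :: "real^'a \<Rightarrow> complex" assume f: "f = (\<lambda>x. 0)"
  show "f differentiable at x" for x unfolding f by simp
  show "\<exists>C. \<forall>x. norm (f x) * (1 + norm x) ^ N \<le> C" for N unfolding f by auto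
  show "partial_deriv i f = (\<lambda>x. 0)" for i
    unfolding f by (rule ext) (rule partial_deriv_eqI[OF has_derivative_const])
qed simp

lemma schwartz_sum: "(\<And>a. a \<in> A \<Longrightarrow> schwartz (f a)) \<Longrightarrow> schwartz (\<lambda>x. \<Sum>a\<in>A. f a x)"
  by (induction A rule: infinite_finite_induct) (auto intro: schwartz_zero schwartz_add)

lemma tempered_zero: "tempered u \<Longrightarrow> u (\<lambda>x. 0) = 0"
  using tempered_cmult[OF _ schwartz_zero, where c = 0] by simp

lemma tempered_sum:
  assumes "tempered u" "\<And>a. a \<in> A \<Longrightarrow> schwartz (f a)"
  shows "u (\<lambda>x. \<Sum>a\<in>A. f a x) = (\<Sum>a\<in>A. u (f a))"
  using assms(2)
  by (induction A rule: infinite_finite_induct)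
    (auto simp: tempered_zero[OF assms(1)] tempered_add[OF assms(1)] schwartz_sum)

text \<open>The form of continuity used throughout: one number \<open>B\<close> that bounds all
  derivatives of order at most \<open>N\<close>, with weight (1 + |x|)^N, controls
  \<open>u g\<close>. Limits of \<open>u\<close> thus become uniform weighted estimates, without a
  topology on the Schwartz space.\<close>

lemma tempered_bound:
  fixes u :: "(real^'n \<Rightarrow> complex) \<Rightarrow> complex"
  assumes "tempered u"
  shows "\<exists>C N. C \<ge> 0 \<and> (\<forall>g B. schwartz g \<longrightarrow>
    (\<forall>is x. length is \<le> N \<longrightarrow> norm (partial_derivs is g x) * (1 + norm x) ^ N \<le> B) \<longrightarrow> norm (u g) \<le> C * B)"
proof -
  obtain C N where C: "\<And>g. schwartz g \<Longrightarrow>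
      norm (u g) \<le> C * (\<Sum>k\<le>N. \<Sum>is | length is \<le> N. schwartz_seminorm k is g)"
    using assms unfolding tempered_def by blast
  let ?L = "{is::'n list. length is \<le> N}"
  \<comment> \<open>The constant in the definition of \<open>tempered\<close> may be negative, hence
    the absolute value; the rest counts the finitely many pairs of a power and a list of
    directions.\<close>
  define K where "K = \<bar>C\<bar> * (real (Suc N) * real (card ?L))"
  have "norm (u g) \<le> K * B"
    if g: "schwartz g" and B: "\<And>is x. length is \<le> N \<Longrightarrow> norm (partial_derivs is g x) * (1 + norm x) ^ N \<le> B" for g B
  proof -
    have s: "schwartz_seminorm k is g \<le> B" if "k \<le> N" "length is \<le> N" for k "is"
      unfolding schwartz_seminorm_def
    proof (rule cSUP_least)
      fix x :: "real^'n"
      have "norm x ^ k \<le> (1 + norm x) ^ k" by (intro power_mono) auto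
      also have "\<dots> \<le> (1 + norm x) ^ N" using that by (intro power_increasing) auto
      finally have "norm x ^ k * norm (partial_derivs is g x) \<le> (1 + norm x) ^ N * norm (partial_derivs is g x)"
        by (intro mult_right_mono) auto
      then show "norm x ^ k * norm (partial_derivs is g x) \<le> B" using B[OF that(2), of x] by (simp add: mult.commute)
    qed simp
    have B0: "B \<ge> 0" by (rule order_trans[OF _ B[of "[]" 0]]) auto
    have s0: "0 \<le> schwartz_seminorm k is g" if "k \<le> N" "length is \<le> N" for k "is"
    proof -
      have "bdd_above (range (\<lambda>x. norm x ^ k * norm (partial_derivs is g x)))"
      proof -
        obtain a where "\<And>x. norm (norm x ^ k *\<^sub>R partial_derivs is g x) \<le> a"
          using g unfolding schwartz_def bounded_iff by blast
        then show ?thesis by (intro bdd_aboveI2[of _ _ a]) simp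
      qed
      then show ?thesis
        unfolding schwartz_seminorm_def by (intro cSUP_upper2[where x = 0]) auto
    qed
    have "norm (u g) \<le> C * (\<Sum>k\<le>N. \<Sum>is\<in>?L. schwartz_seminorm k is g)"
      using C[OF g] .
    also have "\<dots> \<le> \<bar>C\<bar> * (\<Sum>k\<le>N. \<Sum>is\<in>?L. schwartz_seminorm k is g)"
      using s0 by (intro mult_right_mono sum_nonneg) auto
    also have "\<dots> \<le> \<bar>C\<bar> * (\<Sum>k\<le>N. \<Sum>is\<in>?L. B)"
      using s by (intro mult_left_mono sum_mono) auto
    also have "\<dots> = K * B" by (simp add: K_def)
    finally show ?thesis .
  qed
  moreover have "K \<ge> 0" by (simp add: K_def)
  ultimately show ?thesis by blast
qed

section \<open>Fourier multipliers as pairings with translated kernels\<close>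

definition ker :: "(real^'n \<Rightarrow> complex) \<Rightarrow> real^'n \<Rightarrow> complex" where
  "ker b z = of_real (1 / (2 * pi) ^ CARD('n)) * fourier b z"

text \<open>This is b(D)u with the modulation in the symbol turned into a translation of a fixed
  Schwartz kernel. Continuity and growth in \<open>y\<close> then follow from general facts about
  translates.\<close>

definition fmult :: "(real^'n \<Rightarrow> complex) \<Rightarrow> ((real^'n \<Rightarrow> complex) \<Rightarrow> complex) \<Rightarrow> real^'n \<Rightarrow> complex" where
  "fmult b u y = u (\<lambda>z. ker b (z - y))"

lemma schwartz_ker: "schwartz b \<Longrightarrow> schwartz (ker b)"
  unfolding ker_def by (intro schwartz_cmult schwartz_fourier)

lemma schwartz_ker_translate: "schwartz b \<Longrightarrow> schwartz (\<lambda>z. ker b (z - y))"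
  by (intro schwartz_translate schwartz_ker)

lemma fourier_modulation:
  fixes a :: "real^'n \<Rightarrow> complex"
  assumes "schwartz a" "t \<noteq> 0"
  shows "fourier (\<lambda>\<xi>. a (t *\<^sub>R \<xi>) * exp (\<i> * complex_of_real (x \<bullet> \<xi>))) = (\<lambda>z. fourier (\<lambda>\<xi>. a (t *\<^sub>R \<xi>)) (z - x))"
proof
  fix z
  have s: "schwartz (\<lambda>\<xi>. a (t *\<^sub>R \<xi>))" using assms by (intro schwartz_dilate)
  note [measurable] = schwartz_measurable[OF s]
  show "fourier (\<lambda>\<xi>. a (t *\<^sub>R \<xi>) * exp (\<i> * complex_of_real (x \<bullet> \<xi>))) z = fourier (\<lambda>\<xi>. a (t *\<^sub>R \<xi>)) (z - x)"
    unfolding chi_def[symmetric]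
    by (simp add: fourier_eq_lborel chi_add_right chi_minus chi_commute[of _ x] mult_ac
        diff_conv_add_uminus[of z x] del: diff_conv_add_uminus add_uminus_conv_diff)
qed

lemma multiplier_eq_fmult:
  fixes a :: "real^'n \<Rightarrow> complex"
  assumes a: "schwartz a" and t: "t \<noteq> 0" and u: "tempered u"
  shows "multiplier a t u = fmult (\<lambda>\<xi>. a (t *\<^sub>R \<xi>)) u"
proof
  fix x
  have s: "schwartz (\<lambda>\<xi>. a (t *\<^sub>R \<xi>))" using assms by (intro schwartz_dilate)
  have "multiplier a t u x = of_real (1 / (2 * pi) ^ CARD('n)) * u (\<lambda>z. fourier (\<lambda>\<xi>. a (t *\<^sub>R \<xi>)) (z - x))"
    by (simp add: multiplier_def fourier_dist_def fourier_modulation[OF a t])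
  also have "\<dots> = fmult (\<lambda>\<xi>. a (t *\<^sub>R \<xi>)) u x"
    unfolding fmult_def ker_def
    by (rule tempered_cmult[OF u, symmetric]) (intro schwartz_translate schwartz_fourier s)
  finally show "multiplier a t u x = fmult (\<lambda>\<xi>. a (t *\<^sub>R \<xi>)) u x" .
qed

lemma ker_add: "schwartz a \<Longrightarrow> schwartz b \<Longrightarrow> ker (\<lambda>\<xi>. a \<xi> + b \<xi>) z = ker a z + ker b z"
  unfolding ker_def
  using integrable_mult_chi(3)[OF rapid_integrable[OF schwartz_rapid, of a]]
    integrable_mult_chi(3)[OF rapid_integrable[OF schwartz_rapid, of b]]
  by (simp add: fourier_eq_lborel schwartz_measurable schwartz_add distrib_left distrib_right)

lemma fmult_add:
  assumes "tempered u" "schwartz a" "schwartz b"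
  shows "fmult (\<lambda>\<xi>. a \<xi> + b \<xi>) u y = fmult a u y + fmult b u y"
  unfolding fmult_def ker_add[OF assms(2,3)]
  by (intro tempered_add assms schwartz_ker_translate)

text \<open>The factor \<open>min 1 (norm (y - y'))\<close> lets one estimate serve two purposes:
  for nearby translates it gives continuity through the Lipschitz bound, for distant ones it gives
  polynomial growth through the triangle inequality.\<close>

lemma schwartz_translate_diff_bound:
  fixes k :: "real^'n \<Rightarrow> complex"
  assumes "schwartz k"
  shows "\<exists>C\<ge>0. \<forall>z y y'. norm (k (z - y) - k (z - y')) * (1 + norm z) ^ N
    \<le> C * min 1 (norm (y - y')) * (1 + norm y + norm y') ^ N"
proof -
  obtain C1 where C1: "C1 \<ge> 0" "\<And>x h. norm h \<le> 1 \<Longrightarrow> norm (k (x + h) - k x) * (1 + norm x) ^ N \<le> C1 * norm h"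
    using schwartz_lipschitz[OF assms, of N] by blast
  obtain C2 where C2: "\<And>x. norm (k x) * (1 + norm x) ^ N \<le> C2" using schwartz_decay[OF assms] by blast
  have C20: "C2 \<ge> 0" by (rule order_trans[OF _ C2[of 0]]) simp
  have "norm (k (z - y) - k (z - y')) * (1 + norm z) ^ N
      \<le> (C1 + 2 * C2) * min 1 (norm (y - y')) * (1 + norm y + norm y') ^ N" for z y y'
  proof -
    let ?W = "(1 + norm y + norm y') ^ N"
    have W: "(1 + norm y) ^ N \<le> ?W" "(1 + norm y') ^ N \<le> ?W" by (intro power_mono; simp)+
    show ?thesis
    proof (cases "norm (y - y') \<le> 1")
      case True
      have "norm (k (z - y) - k (z - y')) * (1 + norm z) ^ N
          \<le> norm (k (z - y) - k (z - y')) * ((1 + norm (z - y')) ^ N * (1 + norm y') ^ N)"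
        by (intro mult_left_mono weight_split) auto
      also have "\<dots> = (norm (k ((z - y') + (y' - y)) - k (z - y')) * (1 + norm (z - y')) ^ N) * (1 + norm y') ^ N"
        by (simp add: mult.assoc)
      also have "\<dots> \<le> (C1 * norm (y' - y)) * (1 + norm y') ^ N"
        using True by (intro mult_right_mono C1) (auto simp: norm_minus_commute)
      also have "\<dots> \<le> (C1 * norm (y' - y)) * ?W" using C1 W by (intro mult_left_mono) auto
      also have "\<dots> \<le> ((C1 + 2 * C2) * norm (y' - y)) * ?W"
        using C20 by (intro mult_right_mono) auto
      finally show ?thesis using True by (simp add: norm_minus_commute)
    next
      case False
      have t: "norm (k (z - v)) * (1 + norm z) ^ N \<le> C2 * (1 + norm v) ^ N" for v
      proof -
        have "norm (k (z - v)) * (1 + norm z) ^ N \<le> norm (k (z - v)) * ((1 + norm (z - v)) ^ N * (1 + norm v) ^ N)"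
          by (intro mult_left_mono weight_split) auto
        also have "\<dots> = (norm (k (z - v)) * (1 + norm (z - v)) ^ N) * (1 + norm v) ^ N" by simp
        also have "\<dots> \<le> C2 * (1 + norm v) ^ N" by (intro mult_right_mono C2) auto
        finally show ?thesis .
      qed
      have "norm (k (z - y) - k (z - y')) * (1 + norm z) ^ N \<le> (norm (k (z - y)) + norm (k (z - y'))) * (1 + norm z) ^ N"
        by (intro mult_right_mono norm_triangle_ineq4) auto
      also have "\<dots> \<le> C2 * (1 + norm y) ^ N + C2 * (1 + norm y') ^ N"
        unfolding distrib_right by (intro add_mono t)
      also have "\<dots> \<le> C2 * ?W + C2 * ?W" using W C20 by (intro add_mono mult_left_mono) auto
      also have "\<dots> = 2 * C2 * ?W" by simp
      also have "\<dots> \<le> (C1 + 2 * C2) * ?W" using C1 by (intro mult_right_mono) auto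
      finally show ?thesis using False by simp
    qed
  qed
  then show ?thesis using C1(1) C20 by (intro exI[of _ "C1 + 2 * C2"]) auto
qed

lemma schwartz_translate_diff_bounds:
  fixes k :: "real^'n \<Rightarrow> complex"
  assumes "schwartz k"
  shows "\<exists>C\<ge>0. \<forall>is z y y'. length is \<le> N \<longrightarrow>
    norm (partial_derivs is k (z - y) - partial_derivs is k (z - y')) * (1 + norm z) ^ N
    \<le> C * min 1 (norm (y - y')) * (1 + norm y + norm y') ^ N"
proof -
  have "\<forall>is. \<exists>C. C \<ge> 0 \<and> (\<forall>z y y'. norm (partial_derivs is k (z - y) - partial_derivs is k (z - y')) * (1 + norm z) ^ N
    \<le> C * min 1 (norm (y - y')) * (1 + norm y + norm y') ^ N)"
    by (intro allI schwartz_translate_diff_bound schwartz_partials assms)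
  from choice[OF this] obtain C where C: "\<forall>is. C is \<ge> 0 \<and> (\<forall>z y y'. norm (partial_derivs is k (z - y) - partial_derivs is k (z - y')) * (1 + norm z) ^ N
    \<le> C is * min 1 (norm (y - y')) * (1 + norm y + norm y') ^ N)" ..
  let ?L = "{is::'n list. length is \<le> N}"
  have fin: "finite ?L" using finite_lists_length_le[of "UNIV::'n set" N] by simp
  have "norm (partial_derivs is k (z - y) - partial_derivs is k (z - y')) * (1 + norm z) ^ N
      \<le> (\<Sum>is\<in>?L. C is) * min 1 (norm (y - y')) * (1 + norm y + norm y') ^ N" if "length is \<le> N" for "is" z y y'
  proof -
    have "C is \<le> (\<Sum>is\<in>?L. C is)" using that C fin by (intro member_le_sum) auto
    then have "C is * min 1 (norm (y - y')) * (1 + norm y + norm y') ^ N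
        \<le> (\<Sum>is\<in>?L. C is) * min 1 (norm (y - y')) * (1 + norm y + norm y') ^ N"
      by (intro mult_right_mono) (auto simp: add_nonneg_nonneg)
    then show ?thesis using C order_trans by blast
  qed
  moreover have "(\<Sum>is\<in>?L. C is) \<ge> 0" using C by (intro sum_nonneg) auto
  ultimately show ?thesis by blast
qed

lemma tempered_translates_diff:
  fixes k :: "real^'n \<Rightarrow> complex"
  assumes u: "tempered u" and k: "schwartz k"
  shows "\<exists>C N. C \<ge> 0 \<and> (\<forall>y y'. norm (u (\<lambda>z. k (z - y)) - u (\<lambda>z. k (z - y')))
    \<le> C * min 1 (norm (y - y')) * (1 + norm y + norm y') ^ N)"
proof -
  obtain C N where C: "C \<ge> 0" and CB: "\<And>g B. schwartz g \<Longrightarrow>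
    (\<forall>is x. length is \<le> N \<longrightarrow> norm (partial_derivs is g x) * (1 + norm x) ^ N \<le> B) \<Longrightarrow> norm (u g) \<le> C * B"
    using tempered_bound[OF u] by blast
  obtain D where D: "D \<ge> 0" "\<And>is z y y'. length is \<le> N \<Longrightarrow>
    norm (partial_derivs is k (z - y) - partial_derivs is k (z - y')) * (1 + norm z) ^ N
    \<le> D * min 1 (norm (y - y')) * (1 + norm y + norm y') ^ N"
    using schwartz_translate_diff_bounds[OF k, of N] by blast
  have "norm (u (\<lambda>z. k (z - y)) - u (\<lambda>z. k (z - y'))) \<le> (C * D) * min 1 (norm (y - y')) * (1 + norm y + norm y') ^ N"
    for y y' :: "real^'n"
  proof -
    note s = schwartz_translate[OF k]
    have "norm (u (\<lambda>z. k (z - y) - k (z - y'))) \<le> C * (D * min 1 (norm (y - y')) * (1 + norm y + norm y') ^ N)"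
      by (rule CB) (auto simp: partial_derivs_diff s partial_derivs_translate k intro!: schwartz_diff s D(2))
    then show ?thesis using tempered_diff[OF u s s, of y y'] by (simp add: mult.assoc)
  qed
  then show ?thesis using C D(1) by (intro exI[of _ "C * D"] exI[of _ N]) auto
qed

lemma tempered_translates_growth:
  fixes k :: "real^'n \<Rightarrow> complex"
  assumes u: "tempered u" and k: "schwartz k"
  shows "\<exists>C N. C \<ge> 0 \<and> (\<forall>y. norm (u (\<lambda>z. k (z - y))) \<le> C * (1 + norm y) ^ N)"
proof -
  obtain C N where C: "C \<ge> 0" and D: "\<And>y y'. norm (u (\<lambda>z. k (z - y)) - u (\<lambda>z. k (z - y')))
    \<le> C * min 1 (norm (y - y')) * (1 + norm y + norm y') ^ N"
    using tempered_translates_diff[OF assms] by blast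
  let ?K = "norm (u k) + C"
  have "norm (u (\<lambda>z. k (z - y))) \<le> ?K * (1 + norm y) ^ N" for y :: "real^'n"
  proof -
    have "norm (u (\<lambda>z. k (z - y))) \<le> norm (u k) + norm (u (\<lambda>z. k (z - y)) - u k)"
      by (metis add.commute norm_triangle_sub)
    also have "norm (u (\<lambda>z. k (z - y)) - u k) \<le> C * min 1 (norm y) * (1 + norm y) ^ N"
      using D[of y 0] by simp
    also have "\<dots> \<le> C * 1 * (1 + norm y) ^ N"
      using C by (intro mult_right_mono mult_left_mono) auto
    also have "norm (u k) + \<dots> \<le> norm (u k) * (1 + norm y) ^ N + C * (1 + norm y) ^ N"
      by (simp add: mult_left_le_one_le mult_le_cancel_left1 one_le_power)
    finally show ?thesis by (simp add: distrib_right)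
  qed
  moreover have "?K \<ge> 0" using C by simp
  ultimately show ?thesis by blast
qed

lemma tempered_translates_continuous:
  fixes k :: "real^'n \<Rightarrow> complex"
  assumes u: "tempered u" and k: "schwartz k"
  shows "continuous_on S (\<lambda>y. u (\<lambda>z. k (z - y)))"
proof (rule continuous_at_imp_continuous_on, rule ballI)
  fix y :: "real^'n"
  obtain C N where C: "C \<ge> 0" and D: "\<And>y y'. norm (u (\<lambda>z. k (z - y)) - u (\<lambda>z. k (z - y')))
    \<le> C * min 1 (norm (y - y')) * (1 + norm y + norm y') ^ N"
    using tempered_translates_diff[OF assms] by blast
  have "((\<lambda>x. C * norm (x - y) * (1 + norm x + norm y) ^ N) \<longlongrightarrow> C * norm (y - y) * (1 + norm y + norm y) ^ N) (at y)"
    by (intro tendsto_intros)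
  then have lim: "((\<lambda>x. C * norm (x - y) * (1 + norm x + norm y) ^ N) \<longlongrightarrow> 0) (at y)" by simp
  have "((\<lambda>x. u (\<lambda>z. k (z - x)) - u (\<lambda>z. k (z - y))) \<longlongrightarrow> 0) (at y)"
  proof (rule Lim_null_comparison[OF always_eventually lim], rule allI)
    fix x
    have "C * min 1 (norm (x - y)) * (1 + norm x + norm y) ^ N \<le> C * norm (x - y) * (1 + norm x + norm y) ^ N"
      using C by (intro mult_right_mono mult_left_mono) (auto simp: add_nonneg_nonneg)
    then show "norm (u (\<lambda>z. k (z - x)) - u (\<lambda>z. k (z - y))) \<le> C * norm (x - y) * (1 + norm x + norm y) ^ N"
      using D[of x y] by linarith
  qed
  then show "isCont (\<lambda>y. u (\<lambda>z. k (z - y))) y"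
    unfolding isCont_def by (rule LIM_zero_cancel)
qed

section \<open>Pairing a distribution with a convolution\<close>

lemma partial_derivs_sum:
  assumes "finite A" "\<And>a. a \<in> A \<Longrightarrow> schwartz (f a)"
  shows "partial_derivs is (\<lambda>x. \<Sum>a\<in>A. f a x) = (\<lambda>x. \<Sum>a\<in>A. partial_derivs is (f a) x)"
  using assms
proof (induction A)
  case empty
  have "partial_derivs is (\<lambda>x. 0) = (\<lambda>x. 0)"
    using partial_derivs_cmult[OF schwartz_zero, of "is" 0] by simp
  then show ?case by simp
next
  case (insert a A)
  have "schwartz (f a)" "schwartz (\<lambda>x. \<Sum>a\<in>A. f a x)"
    using insert.prems by (auto intro: schwartz_sum)
  from partial_derivs_add[OF this] show ?case using insert by simp
qed

text \<open>A simple function has finitely many fibres, so sampling along it turns the integral into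
  a finite sum, to which the linearity of \<open>u\<close> applies.\<close>

lemma integral_simple_sample:
  fixes \<psi> :: "'a \<Rightarrow> complex"
  assumes s: "simple_function lborel s" and g: "integrable lborel (g :: real^'n \<Rightarrow> complex)"
  shows "(\<integral>y. \<psi> (s y) * g y \<partial>lborel) = (\<Sum>p\<in>range s. \<psi> p * (\<integral>y. indicator (s -` {p}) y * g y \<partial>lborel))"
proof -
  have fin: "finite (range s)" using s by (simp add: simple_function_def)
  have int: "integrable lborel (\<lambda>y. \<psi> p * (indicator (s -` {p}) y * g y))" if "p \<in> range s" for p
  proof -
    have "s -` {p} \<in> sets lborel" using s that unfolding simple_function_def by auto
    then have "integrable lborel (\<lambda>y. indicator (s -` {p}) y *\<^sub>R g y)"
      by (intro integrable_mult_indicator g)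
    moreover have "indicator (s -` {p}) y *\<^sub>R g y = indicator (s -` {p}) y * g y" for y
      by (simp add: indicator_def)
    ultimately show ?thesis by (intro integrable_mult_right) simp
  qed
  have "\<psi> (s y) * g y = (\<Sum>p\<in>range s. \<psi> p * (indicator (s -` {p}) y * g y))" for y
  proof -
    have "(\<Sum>p\<in>range s. \<psi> p * (indicator (s -` {p}) y * g y)) = (\<Sum>p\<in>range s. if p = s y then \<psi> p * g y else 0)"
      by (intro sum.cong refl) (auto simp: indicator_def)
    then show ?thesis using fin by simp
  qed
  then have "(\<integral>y. \<psi> (s y) * g y \<partial>lborel) = (\<integral>y. (\<Sum>p\<in>range s. \<psi> p * (indicator (s -` {p}) y * g y)) \<partial>lborel)"
    by simp
  also have "\<dots> = (\<Sum>p\<in>range s. \<integral>y. \<psi> p * (indicator (s -` {p}) y * g y) \<partial>lborel)"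
    by (rule Bochner_Integration.integral_sum) (rule int)
  finally show ?thesis by simp
qed

text \<open>The integral is a limit of the pairings of \<open>u\<close> with finite combinations of translates of \<open>k\<close>:
  only \<open>k\<close> is sampled, along simple functions converging to the identity, while \<open>g\<close> stays exact.\<close>

theorem tempered_conv:
  fixes k g :: "real^'n \<Rightarrow> complex"
  assumes u: "tempered u" and k: "schwartz k" and g: "rapid g"
  shows "(\<integral>y. u (\<lambda>z. k (z - y)) * g y \<partial>lborel) = u (conv k g)"
proof -
  define v where "v y = u (\<lambda>z. k (z - y))" for y
  have v_cont: "continuous_on UNIV v" unfolding v_def by (rule tempered_translates_continuous[OF u k])
  then have [measurable]: "v \<in> borel_measurable borel" by (rule borel_measurable_continuous_onI)
  note [measurable] = rapid_measurable[OF g]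
  have intg: "integrable lborel g" using g by (rule rapid_integrable)
  have "\<exists>F. (\<forall>m. simple_function lborel (F m)) \<and> (\<forall>x::real^'n. (\<lambda>m. F m x) \<longlonglongrightarrow> x) \<and>
      (\<forall>m x. dist (F m x) 0 \<le> 2 * dist x 0)"
    using borel_measurable_implies_sequence_metric[of "\<lambda>x::real^'n. x" lborel 0] by simp
  then obtain F where F': "(\<forall>m. simple_function lborel (F m)) \<and> (\<forall>x::real^'n. (\<lambda>m. F m x) \<longlonglongrightarrow> x) \<and>
      (\<forall>m x. dist (F m x) 0 \<le> 2 * dist x 0)" ..
  have F: "\<And>m. simple_function lborel (F m)" "\<And>x. (\<lambda>m. F m x) \<longlonglongrightarrow> x"
    "\<And>m x. dist (F m x) 0 \<le> 2 * dist x 0"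
    using F' by blast+
  have [measurable]: "F m \<in> borel_measurable borel" for m
    using borel_measurable_simple_function[OF F(1)] by simp
  \<comment> \<open>The Riemann sum of \<open>conv k g\<close>: each value \<open>p\<close> of the
    simple function contributes the translate of \<open>k\<close> by \<open>p\<close>, weighted by
    the integral of \<open>g\<close> over the fibre.\<close>
  define A where "A m = (\<lambda>z. \<Sum>p\<in>range (F m). (\<integral>y. indicator (F m -` {p}) y * g y \<partial>lborel) * k (z - p))" for m
  have sA: "schwartz (A m)" for m
    unfolding A_def by (intro schwartz_sum schwartz_cmult schwartz_translate k)
  have uA: "u (A m) = (\<integral>y. v (F m y) * g y \<partial>lborel)" for m
  proof -
    have "u (A m) = (\<Sum>p\<in>range (F m). u (\<lambda>z. (\<integral>y. indicator (F m -` {p}) y * g y \<partial>lborel) * k (z - p)))"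
      unfolding A_def by (rule tempered_sum[OF u]) (intro schwartz_cmult schwartz_translate k)
    also have "\<dots> = (\<Sum>p\<in>range (F m). v p * (\<integral>y. indicator (F m -` {p}) y * g y \<partial>lborel))"
      unfolding v_def tempered_cmult[OF u schwartz_translate[OF k]] by (simp only: mult.commute)
    also have "\<dots> = (\<integral>y. v (F m y) * g y \<partial>lborel)"
      by (rule integral_simple_sample[OF F(1) intg, symmetric])
    finally show ?thesis .
  qed
  have dA: "partial_derivs is (A m) z = (\<integral>y. partial_derivs is k (z - F m y) * g y \<partial>lborel)" for m "is" z
  proof -
    have "partial_derivs is (A m) z = (\<Sum>p\<in>range (F m).
        partial_derivs is (\<lambda>z. (\<integral>y. indicator (F m -` {p}) y * g y \<partial>lborel) * k (z - p)) z)"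
      unfolding A_def using simple_functionD(1)[OF F(1), of m]
      by (subst partial_derivs_sum) (auto intro!: schwartz_cmult schwartz_translate k)
    also have "\<dots> = (\<Sum>p\<in>range (F m). partial_derivs is k (z - p) * (\<integral>y. indicator (F m -` {p}) y * g y \<partial>lborel))"
      unfolding partial_derivs_cmult[OF schwartz_translate[OF k]] partial_derivs_translate[OF k]
      by (simp only: mult.commute)
    also have "\<dots> = (\<integral>y. partial_derivs is k (z - F m y) * g y \<partial>lborel)"
      by (rule integral_simple_sample[OF F(1) intg, symmetric])
    finally show ?thesis .
  qed
  obtain C N where C: "C \<ge> 0" and CB: "\<And>g B. schwartz g \<Longrightarrow>
    (\<forall>is x. length is \<le> N \<longrightarrow> norm (partial_derivs is g x) * (1 + norm x) ^ N \<le> B) \<Longrightarrow> norm (u g) \<le> C * B"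
    using tempered_bound[OF u] by blast
  obtain D where D: "D \<ge> 0" "\<And>is z y y'. length is \<le> N \<Longrightarrow>
    norm (partial_derivs is k (z - y) - partial_derivs is k (z - y')) * (1 + norm z) ^ N
    \<le> D * min 1 (norm (y - y')) * (1 + norm y + norm y') ^ N"
    using schwartz_translate_diff_bounds[OF k, of N] by blast
  \<comment> \<open>The simple functions satisfy |F m y| \<le> 2 |y|, so 1 + |y| + |F m y| \<le> 3
    (1 + |y|); this is the origin of 3^N. The function \<open>w\<close> dominates the sampling error
    simultaneously for all derivatives and all points \<open>z\<close>.\<close>
  define w where "w y = D * 3 ^ N * (norm (g y) * (1 + norm y) ^ N)" for y
  have w0: "w y \<ge> 0" for y using D(1) by (simp add: w_def)
  have [measurable]: "w \<in> borel_measurable borel" unfolding w_def by measurable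
  have intw: "integrable lborel w"
    unfolding w_def by (intro integrable_mult_right rapid_integrable_moment g)
  define B where "B m = (\<integral>y. min 1 (norm (y - F m y)) * w y \<partial>lborel)" for m
  have Fn: "norm (F m y) \<le> 2 * norm y" for m y using F(3)[of m y] by simp
  have intmin: "integrable lborel (\<lambda>y. min 1 (norm (y - F m y)) * w y)" for m
    by (rule Bochner_Integration.integrable_bound[OF intw]) (auto simp: abs_mult w0 mult_left_le_one_le)
  have intk: "integrable lborel (\<lambda>y. partial_derivs is k (z - F m y) * g y)" for "is" z m
  proof -
    obtain K where K: "\<And>x. norm (partial_derivs is k x) * (1 + norm x) ^ 0 \<le> K"
      using schwartz_decay[OF schwartz_partials[OF k]] by blast
    note [measurable] = schwartz_measurable[OF schwartz_partials[OF k, of "is"]]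
    show ?thesis
      by (rule rapid_integrable, rule rapid_mult_bounded[OF g, of _ K]) (use K in auto)
  qed
  have bound: "norm (u (conv k g) - u (A m)) \<le> C * B m" for m
  proof -
    have sc: "schwartz (conv k g)" using schwartz_conv[OF k g] .
    have "norm (u (\<lambda>z. conv k g z - A m z)) \<le> C * B m"
    proof (rule CB, intro schwartz_diff sc sA, intro allI impI)
      fix "is" :: "'n list" and z :: "real^'n" assume len: "length is \<le> N"
      have ic: "integrable lborel (\<lambda>y. partial_derivs is k (z - y) * g y)"
        by (intro integrable_conv schwartz_rapid schwartz_partials k g)
      have "partial_derivs is (\<lambda>z. conv k g z - A m z) z =
        (\<integral>y. partial_derivs is k (z - y) * g y - partial_derivs is k (z - F m y) * g y \<partial>lborel)"
        unfolding partial_derivs_diff[OF sc sA] partial_derivs_conv[OF k g] dA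
        unfolding conv_def by (rule Bochner_Integration.integral_diff[OF ic intk, symmetric])
      then have "norm (partial_derivs is (\<lambda>z. conv k g z - A m z) z) * (1 + norm z) ^ N =
        norm (\<integral>y. (1 + norm z) ^ N *\<^sub>R (partial_derivs is k (z - y) * g y - partial_derivs is k (z - F m y) * g y) \<partial>lborel)"
        by (simp add: mult.commute)
      also have "\<dots> \<le> B m"
        unfolding B_def
      proof (rule norm_integral_le[OF _ intmin])
        fix y
        let ?d = "partial_derivs is k (z - y) - partial_derivs is k (z - F m y)"
        have "norm ((1 + norm z) ^ N *\<^sub>R (partial_derivs is k (z - y) * g y - partial_derivs is k (z - F m y) * g y))
          = (norm ?d * (1 + norm z) ^ N) * norm (g y)"
          by (simp add: left_diff_distrib[symmetric] norm_mult)
        also have "\<dots> \<le> (D * min 1 (norm (y - F m y)) * (1 + norm y + norm (F m y)) ^ N) * norm (g y)"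
          by (intro mult_right_mono D(2) len) auto
        also have "\<dots> \<le> (D * min 1 (norm (y - F m y)) * (3 * (1 + norm y)) ^ N) * norm (g y)"
          using Fn[of m y] D(1) by (intro mult_right_mono mult_left_mono power_mono) (auto simp: add_nonneg_nonneg)
        also have "\<dots> = min 1 (norm (y - F m y)) * w y" unfolding w_def power_mult_distrib by (simp only: mult_ac)
        finally show "norm ((1 + norm z) ^ N *\<^sub>R (partial_derivs is k (z - y) * g y - partial_derivs is k (z - F m y) * g y))
          \<le> min 1 (norm (y - F m y)) * w y" .
      qed (intro integrable_scaleR_right Bochner_Integration.integrable_diff ic intk)
      finally show "norm (partial_derivs is (\<lambda>z. conv k g z - A m z) z) * (1 + norm z) ^ N \<le> B m" .
    qed
    then show ?thesis using tempered_diff[OF u sc sA, of m] by simp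
  qed
  have "B \<longlonglongrightarrow> (\<integral>y. 0 \<partial>(lborel :: (real^'n) measure))"
    unfolding B_def
  proof (rule integral_dominated_convergence[where w = w])
    show "AE y in lborel. (\<lambda>m. min 1 (norm (y - F m y)) * w y) \<longlonglongrightarrow> 0"
    proof (rule AE_I2)
      fix y
      have "(\<lambda>m. min 1 (norm (y - F m y)) * w y) \<longlonglongrightarrow> min 1 (norm (y - y)) * w y"
        by (intro tendsto_intros F(2))
      then show "(\<lambda>m. min 1 (norm (y - F m y)) * w y) \<longlonglongrightarrow> 0" by simp
    qed
    show "AE y in lborel. norm (min 1 (norm (y - F m y)) * w y) \<le> w y" for m
      by (rule AE_I2) (auto simp: abs_mult w0 mult_left_le_one_le)
  qed (use intw in auto)
  then have "(\<lambda>m. C * B m) \<longlonglongrightarrow> C * 0" by (intro tendsto_intros) simp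
  then have "(\<lambda>m. u (conv k g) - u (A m)) \<longlonglongrightarrow> 0"
    by (intro Lim_null_comparison[OF always_eventually[OF allI[OF bound]]]) simp
  then have "(\<lambda>m. u (conv k g) - (u (conv k g) - u (A m))) \<longlonglongrightarrow> u (conv k g) - 0"
    by (intro tendsto_diff tendsto_const)
  then have 1: "(\<lambda>m. \<integral>y. v (F m y) * g y \<partial>lborel) \<longlonglongrightarrow> u (conv k g)" by (simp add: uA)
  \<comment> \<open>The same Riemann sums seen from the other side: \<open>v\<close> is continuous
    and of polynomial growth, and the decay of \<open>g\<close> dominates.\<close>
  have 2: "(\<lambda>m. \<integral>y. v (F m y) * g y \<partial>lborel) \<longlonglongrightarrow> (\<integral>y. v y * g y \<partial>lborel)"
  proof -
    obtain K M where K: "K \<ge> 0" "\<And>y. norm (v y) \<le> K * (1 + norm y) ^ M"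
      using tempered_translates_growth[OF u k] unfolding v_def by blast
    show ?thesis
    proof (rule integral_dominated_convergence[where w = "\<lambda>y. K * 2 ^ M * (norm (g y) * (1 + norm y) ^ M)"])
      show "integrable lborel (\<lambda>y. K * 2 ^ M * (norm (g y) * (1 + norm y) ^ M))"
        by (intro integrable_mult_right rapid_integrable_moment g)
      show "AE y in lborel. (\<lambda>m. v (F m y) * g y) \<longlonglongrightarrow> v y * g y"
      proof (rule AE_I2)
        fix y
        have c: "isCont v y" using v_cont by (simp add: continuous_on_eq_continuous_at)
        show "(\<lambda>m. v (F m y) * g y) \<longlonglongrightarrow> v y * g y"
          by (intro tendsto_mult tendsto_const isCont_tendsto_compose[OF c F(2)])
      qed
      show "AE y in lborel. norm (v (F m y) * g y) \<le> K * 2 ^ M * (norm (g y) * (1 + norm y) ^ M)" for m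
      proof (rule AE_I2)
        fix y
        have "norm (v (F m y)) \<le> K * (1 + norm (F m y)) ^ M" by (rule K)
        also have "\<dots> \<le> K * (2 * (1 + norm y)) ^ M"
          using Fn[of m y] K(1) by (intro mult_left_mono power_mono) auto
        finally have "norm (v (F m y)) * norm (g y) \<le> K * (2 * (1 + norm y)) ^ M * norm (g y)"
          by (rule mult_right_mono) simp
        then show "norm (v (F m y) * g y) \<le> K * 2 ^ M * (norm (g y) * (1 + norm y) ^ M)"
          unfolding power_mult_distrib norm_mult by (simp only: mult_ac)
      qed
    qed simp_all
  qed
  show ?thesis using LIMSEQ_unique[OF 2 1] by (simp only: v_def)
qed

lemma fmult_continuous: "tempered u \<Longrightarrow> schwartz b \<Longrightarrow> continuous_on S (fmult b u)"
  unfolding fmult_def by (intro tempered_translates_continuous schwartz_ker)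

lemma fmult_measurable [measurable_dest]:
  "tempered u \<Longrightarrow> schwartz b \<Longrightarrow> fmult b u \<in> borel_measurable borel"
  by (intro borel_measurable_continuous_onI fmult_continuous)

lemma fmult_growth:
  "tempered u \<Longrightarrow> schwartz b \<Longrightarrow> \<exists>C N. C \<ge> 0 \<and> (\<forall>y. norm (fmult b u y) \<le> C * (1 + norm y) ^ N)"
  unfolding fmult_def by (intro tempered_translates_growth schwartz_ker)

lemma rapid_translate:
  assumes "rapid g" shows "rapid (\<lambda>y. g (y - x))"
  unfolding rapid_def
proof (intro conjI allI)
  note [measurable] = rapid_measurable[OF assms]
  show "(\<lambda>y. g (y - x)) \<in> borel_measurable borel" by measurable
  fix N
  obtain C where C: "\<And>y. norm (g y) * (1 + norm y) ^ N \<le> C"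
    using assms unfolding rapid_def by blast
  have "norm (g (y - x)) * (1 + norm y) ^ N \<le> C * (1 + norm x) ^ N" for y
  proof -
    have "norm (g (y - x)) * (1 + norm y) ^ N \<le> norm (g (y - x)) * ((1 + norm (y - x)) ^ N * (1 + norm x) ^ N)"
      by (intro mult_left_mono weight_split) auto
    also have "\<dots> = (norm (g (y - x)) * (1 + norm (y - x)) ^ N) * (1 + norm x) ^ N" by simp
    also have "\<dots> \<le> C * (1 + norm x) ^ N" by (intro mult_right_mono C) auto
    finally show ?thesis .
  qed
  then show "\<exists>C. \<forall>y. norm (g (y - x)) * (1 + norm y) ^ N \<le> C" by blast
qed

section \<open>Composition, dilation and uniform bounds of multipliers\<close>

lemma ker_inversion:
  assumes "schwartz a"
  shows "(\<integral>w. ker a w * chi \<xi> w \<partial>lborel) = a \<xi>"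
  unfolding ker_def mult.assoc using fourier_inversion[OF assms, of \<xi>] by simp

lemma ker_eq_integral:
  "schwartz b \<Longrightarrow> ker b z = of_real (1 / (2 * pi) ^ CARD('n)) * (\<integral>\<xi>. b \<xi> * chi (- \<xi>) z \<partial>lborel)"
  for z :: "real^'n"
  unfolding ker_def by (simp add: fourier_eq_lborel schwartz_measurable)

text \<open>Writing the kernel of \<open>b\<close> as an integral over frequencies and exchanging,
  the inner integral over \<open>y\<close> inverts the transform of \<open>a\<close> at \<xi>; so
  the symbols multiply.\<close>

lemma conv_ker:
  fixes a b c :: "real^'n \<Rightarrow> complex"
  assumes s: "schwartz a" "schwartz b" "schwartz c" and c: "\<And>\<xi>. c \<xi> = a \<xi> * b \<xi>"
  shows "conv (ker b) (\<lambda>y. ker a (y - x)) z = ker c (z - x)"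
proof -
  define \<kappa> where "\<kappa> = complex_of_real (1 / (2 * pi) ^ CARD('n))"
  have ra: "rapid (\<lambda>y. ker a (y - x))"
    by (intro rapid_translate schwartz_rapid schwartz_ker s)
  note [measurable] = schwartz_measurable[OF schwartz_ker[OF s(1)]]
  have "conv (ker b) (\<lambda>y. ker a (y - x)) z =
      (\<integral>y. \<kappa> * (ker a (y - x) * (\<integral>\<xi>. b \<xi> * chi (- \<xi>) (z - y) \<partial>lborel)) \<partial>lborel)"
    unfolding conv_def ker_eq_integral[OF s(2)] \<kappa>_def[symmetric] by (simp only: mult_ac)
  also have "\<dots> = \<kappa> * (\<integral>y. ker a (y - x) * (\<integral>\<xi>. b \<xi> * chi (- \<xi>) (z - y) \<partial>lborel) \<partial>lborel)"
    by simp
  also have "(\<integral>y. ker a (y - x) * (\<integral>\<xi>. b \<xi> * chi (- \<xi>) (z - y) \<partial>lborel) \<partial>lborel) =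
      (\<integral>\<xi>. b \<xi> * (\<integral>y. ker a (y - x) * chi (- \<xi>) (z - y) \<partial>lborel) \<partial>lborel)"
    by (rule Fubini_bounded_kernel)
      (auto simp: case_prod_beta' intro: rapid_integrable ra schwartz_rapid s)
  also have "\<dots> = (\<integral>\<xi>. c \<xi> * chi (- \<xi>) (z - x) \<partial>lborel)"
  proof (intro Bochner_Integration.integral_cong refl)
    fix \<xi>
    have e: "chi (- \<xi>) (z - y) = chi \<xi> (y - x) * chi (- \<xi>) (z - x)" for y
      using chi_add_right[of "- \<xi>" "x - y" "z - x"] chi_minus[of \<xi> "x - y"] by simp
    have "(\<integral>y. ker a (y - x) * chi (- \<xi>) (z - y) \<partial>lborel) =
        (\<integral>y. (ker a (y - x) * chi \<xi> (y - x)) * chi (- \<xi>) (z - x) \<partial>lborel)"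
      unfolding mult.assoc by (subst e) (rule refl)
    also have "\<dots> = (\<integral>y. ker a (y - x) * chi \<xi> (y - x) \<partial>lborel) * chi (- \<xi>) (z - x)"
      by simp
    also have "(\<integral>y. ker a (y - x) * chi \<xi> (y - x) \<partial>lborel) = (\<integral>w. ker a w * chi \<xi> w \<partial>lborel)"
      using integral_affine[of 1 "\<lambda>w. ker a w * chi \<xi> w" "- x"] by simp
    also have "\<dots> = a \<xi>" by (rule ker_inversion[OF s(1)])
    finally show "b \<xi> * (\<integral>y. ker a (y - x) * chi (- \<xi>) (z - y) \<partial>lborel) = c \<xi> * chi (- \<xi>) (z - x)"
      by (simp add: c)
  qed
  finally show ?thesis unfolding ker_eq_integral[OF s(3)] \<kappa>_def .
qed

lemma fmult_comp:
  fixes a b c :: "real^'n \<Rightarrow> complex"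
  assumes "tempered u" "schwartz a" "schwartz b" "schwartz c" "\<And>\<xi>. c \<xi> = a \<xi> * b \<xi>"
  shows "fmult c u x = (\<integral>y. fmult b u y * ker a (y - x) \<partial>lborel)"
proof -
  have "rapid (\<lambda>y. ker a (y - x))"
    by (intro rapid_translate schwartz_rapid schwartz_ker assms)
  moreover have "conv (ker b) (\<lambda>y. ker a (y - x)) = (\<lambda>z. ker c (z - x))"
    by (rule ext, rule conv_ker) (rule assms)+
  ultimately show ?thesis
    using tempered_conv[OF assms(1) schwartz_ker[OF assms(3)]] unfolding fmult_def by simp
qed

lemma ker_scale:
  fixes b :: "real^'n \<Rightarrow> complex"
  assumes "schwartz b" "s > 0"
  shows "ker (\<lambda>\<xi>. b ((1 / s) *\<^sub>R \<xi>)) z = of_real (s ^ CARD('n)) * ker b (s *\<^sub>R z)"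
proof -
  note [measurable] = schwartz_measurable[OF assms(1)]
  have sb: "schwartz (\<lambda>\<xi>. b ((1 / s) *\<^sub>R \<xi>))" using assms by (intro schwartz_dilate) auto
  have "(\<integral>\<xi>. b ((1 / s) *\<^sub>R \<xi>) * chi (- \<xi>) z \<partial>lborel) =
      (\<integral>\<xi>. (\<lambda>\<xi>. b \<xi> * chi (- \<xi>) (s *\<^sub>R z)) (0 + (1 / s) *\<^sub>R \<xi>) \<partial>lborel)"
    using assms(2) by (intro Bochner_Integration.integral_cong refl) (simp add: chi_def)
  also have "\<dots> = (\<integral>\<xi>. b \<xi> * chi (- \<xi>) (s *\<^sub>R z) \<partial>lborel) /\<^sub>R \<bar>1 / s\<bar> ^ CARD('n)"
    using assms(2) by (subst integral_affine[where f = "\<lambda>\<xi>. b \<xi> * chi (- \<xi>) (s *\<^sub>R z)"]) auto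
  also have "\<dots> = of_real (s ^ CARD('n)) * (\<integral>\<xi>. b \<xi> * chi (- \<xi>) (s *\<^sub>R z) \<partial>lborel)"
    using assms(2) by (simp add: scaleR_conv_of_real[where 'a = complex] field_simps)
  finally show ?thesis
    unfolding ker_eq_integral[OF assms(1)] ker_eq_integral[OF sb] by (simp only: mult_ac)
qed

text \<open>The invariance of the L^1 norm of the kernel under dilation of the symbol is what makes
  multiplier bounds independent of the scale.\<close>

lemma integral_norm_ker_scale:
  fixes b :: "real^'n \<Rightarrow> complex"
  assumes "schwartz b" "s > 0"
  shows "(\<integral>y. norm (ker (\<lambda>\<xi>. b ((1 / s) *\<^sub>R \<xi>)) (y - x)) \<partial>lborel) = (\<integral>w. norm (ker b w) \<partial>lborel)"
proof -
  note [measurable] = schwartz_measurable[OF schwartz_ker[OF assms(1)]]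
  have "(\<integral>y. norm (ker (\<lambda>\<xi>. b ((1 / s) *\<^sub>R \<xi>)) (y - x)) \<partial>lborel) =
      (\<integral>y. s ^ CARD('n) * (\<lambda>w. norm (ker b w)) (- (s *\<^sub>R x) + s *\<^sub>R y) \<partial>lborel)"
    unfolding ker_scale[OF assms] using assms(2)
    by (intro Bochner_Integration.integral_cong refl) (simp add: norm_mult scaleR_diff_right norm_power)
  also have "\<dots> = s ^ CARD('n) * ((\<integral>w. norm (ker b w) \<partial>lborel) /\<^sub>R \<bar>s\<bar> ^ CARD('n))"
    using assms(2) unfolding integral_mult_right_zero
    by (subst integral_affine[where f = "\<lambda>w. norm (ker b w)"]) auto
  finally show ?thesis using assms(2) by simp
qed

text \<open>Young's inequality for L^1 and L^\<infinity>. The constant refers to the undilated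
  symbol \<open>a\<close>, hence is the same for all \<open>s\<close>.\<close>

lemma fmult_bound:
  fixes a b c :: "real^'n \<Rightarrow> complex"
  assumes u: "tempered u" and s: "schwartz a" "schwartz b" "schwartz c" "s > 0"
    and c: "\<And>\<xi>. c \<xi> = a ((1 / s) *\<^sub>R \<xi>) * b \<xi>"
    and M: "\<And>y. norm (fmult b u y) \<le> M"
  shows "norm (fmult c u x) \<le> M * (\<integral>w. norm (ker a w) \<partial>lborel)"
proof -
  let ?a = "\<lambda>\<xi>. a ((1 / s) *\<^sub>R \<xi>)"
  have sa: "schwartz ?a" using s by (intro schwartz_dilate) auto
  have int: "integrable lborel (\<lambda>y. ker ?a (y - x))"
    by (intro rapid_integrable rapid_translate schwartz_rapid schwartz_ker sa)
  note [measurable] = fmult_measurable[OF u s(2)]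
  have "norm (fmult c u x) \<le> (\<integral>y. M * norm (ker ?a (y - x)) \<partial>lborel)"
    unfolding fmult_comp[OF u sa s(2,3) c]
  proof (rule norm_integral_le)
    show "integrable lborel (\<lambda>y. M * norm (ker ?a (y - x)))"
      by (intro integrable_mult_right integrable_norm int)
    show "integrable lborel (\<lambda>y. fmult b u y * ker ?a (y - x))"
      by (intro rapid_integrable rapid_mult_bounded[where C = M] rapid_translate schwartz_rapid schwartz_ker sa M) simp
    show "norm (fmult b u y * ker ?a (y - x)) \<le> M * norm (ker ?a (y - x))" for y
      by (simp add: norm_mult M mult_right_mono)
  qed
  then show ?thesis by (simp add: integral_norm_ker_scale[OF s(1,4)])
qed

text \<open>After rescaling to unit frequency the function reproduces itself under a kernel that no
  longer depends on \<open>s\<close>. Estimates derived from this formula therefore have constants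
  independent of the scale.\<close>

lemma fmult_rescaled_reproducing:
  fixes a b :: "real^'n \<Rightarrow> complex"
  assumes u: "tempered u" and s: "schwartz a" "schwartz b" "s > 0"
    and ab: "\<And>\<xi>. b \<xi> = a ((1 / s) *\<^sub>R \<xi>) * b \<xi>"
  shows "fmult b u ((1 / s) *\<^sub>R x) = (\<integral>y. fmult b u ((1 / s) *\<^sub>R y) * ker a (y - x) \<partial>lborel)"
proof -
  let ?a = "\<lambda>\<xi>. a ((1 / s) *\<^sub>R \<xi>)"
  have sa: "schwartz ?a" using s by (intro schwartz_dilate) auto
  note [measurable] = fmult_measurable[OF u s(2)] schwartz_measurable[OF schwartz_ker[OF s(1)]]
  have "fmult b u ((1 / s) *\<^sub>R x) = (\<integral>y. fmult b u y * ker ?a (y - (1 / s) *\<^sub>R x) \<partial>lborel)"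
    by (rule fmult_comp[OF u sa s(2,2) ab])
  also have "\<dots> = (\<integral>y. of_real (s ^ CARD('n)) * (\<lambda>y. fmult b u ((1 / s) *\<^sub>R y) * ker a (y - x)) (0 + s *\<^sub>R y) \<partial>lborel)"
    unfolding ker_scale[OF s(1,3)] using s(3)
    by (intro Bochner_Integration.integral_cong refl) (simp add: scaleR_diff_right)
  also have "\<dots> = of_real (s ^ CARD('n)) * ((\<integral>y. fmult b u ((1 / s) *\<^sub>R y) * ker a (y - x) \<partial>lborel) /\<^sub>R \<bar>s\<bar> ^ CARD('n))"
    using s(3) unfolding integral_mult_right_zero
    by (subst integral_affine[where f = "\<lambda>y. fmult b u ((1 / s) *\<^sub>R y) * ker a (y - x)"]) auto
  finally show ?thesis using s(3) by (simp add: scaleR_conv_of_real[where 'a = complex] field_simps)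
qed

text \<open>The kernels have integral b(0) = 1 and concentrate at scale 2^(-j), so in each weighted
  seminorm the convolution differs from \<open>g\<close> by O(2^(-j)). The continuity estimate of
  \<open>u\<close> transfers this to the pairing.\<close>

lemma tempered_approx_identity:
  fixes b g :: "real^'n \<Rightarrow> complex"
  assumes u: "tempered u" and b: "schwartz b" "b 0 = 1" and g: "schwartz g"
  shows "(\<lambda>j. u (conv (ker (\<lambda>\<xi>. b ((1 / 2 ^ j) *\<^sub>R \<xi>))) g)) \<longlonglongrightarrow> u g"
proof -
  let ?K = "\<lambda>j::nat. ker (\<lambda>\<xi>. b ((1 / 2 ^ j) *\<^sub>R \<xi>))"
  obtain C N where C: "C \<ge> 0" and CB: "\<And>g B. schwartz g \<Longrightarrow>
    (\<forall>is x. length is \<le> N \<longrightarrow> norm (partial_derivs is g x) * (1 + norm x) ^ N \<le> B) \<Longrightarrow> norm (u g) \<le> C * B"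
    using tempered_bound[OF u] by blast
  obtain D where D: "D \<ge> 0" "\<And>is z y y'. length is \<le> N \<Longrightarrow>
    norm (partial_derivs is g (z - y) - partial_derivs is g (z - y')) * (1 + norm z) ^ N
    \<le> D * min 1 (norm (y - y')) * (1 + norm y + norm y') ^ N"
    using schwartz_translate_diff_bounds[OF g, of N] by blast
  have sK: "schwartz (?K j)" for j by (intro schwartz_ker schwartz_dilate b) simp
  have rk: "rapid (ker b)" by (intro schwartz_rapid schwartz_ker b)
  note [measurable] = rapid_measurable[OF rk] schwartz_measurable[OF sK]
  define I where "I = (\<integral>w. norm (ker b w) * (1 + norm w) ^ Suc N \<partial>lborel)"
  have sub: "conv (?K j) h z = (\<integral>w. ker b w * h (z - (1 / 2 ^ j) *\<^sub>R w) \<partial>lborel)" if h: "schwartz h" for h j z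
  proof -
    note [measurable] = schwartz_measurable[OF h]
    have "(\<integral>w. ker b w * h (z - (1 / 2 ^ j) *\<^sub>R w) \<partial>lborel) =
      (\<integral>w. (\<lambda>y. ker b (2 ^ j *\<^sub>R (z - y)) * h y) (z + (- (1 / 2 ^ j)) *\<^sub>R w) \<partial>lborel)"
      by (intro Bochner_Integration.integral_cong refl) simp
    also have "\<dots> = (\<integral>y. ker b (2 ^ j *\<^sub>R (z - y)) * h y \<partial>lborel) /\<^sub>R \<bar>- (1 / 2 ^ j)\<bar> ^ CARD('n)"
      by (subst integral_affine[where f = "\<lambda>y. ker b (2 ^ j *\<^sub>R (z - y)) * h y"]) auto
    also have "\<dots> = (\<integral>y. of_real ((2 ^ j) ^ CARD('n)) * ker b (2 ^ j *\<^sub>R (z - y)) * h y \<partial>lborel)"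
      unfolding mult.assoc integral_mult_right_zero by (simp add: scaleR_conv_of_real[where 'a = complex] field_simps)
    also have "\<dots> = conv (?K j) h z"
      unfolding conv_def by (subst ker_scale[OF b(1)]) auto
    finally show ?thesis ..
  qed
  \<comment> \<open>Derivatives of a convolution fall on the left factor. They have to fall on
    \<open>g\<close> here, since the derivatives of the kernels blow up with
    \<open>j\<close>.\<close>
  have comm: "conv (?K j) g = conv g (?K j)" for j
  proof
    fix z
    note [measurable] = schwartz_measurable[OF g]
    show "conv (?K j) g z = conv g (?K j) z"
      unfolding conv_def
      using integral_affine[of "-1" "\<lambda>y. ?K j (z - y) * g y" z] by (simp add: mult.commute)
  qed
  have one: "(\<integral>w. ker b w \<partial>lborel) = 1" using ker_inversion[OF b(1), of 0] b(2) by simp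
  have intI: "integrable lborel (\<lambda>w. norm (ker b w) * (1 + norm w) ^ Suc N)"
    by (rule rapid_integrable_moment[OF rk])
  have sc: "schwartz (conv (?K j) g)" for j by (intro schwartz_conv sK schwartz_rapid g)
  have bound: "norm (u (conv (?K j) g) - u g) \<le> C * (D * (1 / 2 ^ j) * I)" for j
  proof -
    have "norm (u (\<lambda>z. conv (?K j) g z - g z)) \<le> C * (D * (1 / 2 ^ j) * I)"
    proof (rule CB, intro schwartz_diff sc g, intro allI impI)
      fix "is" :: "'n list" and z :: "real^'n" assume len: "length is \<le> N"
      let ?h = "partial_derivs is g"
      have sh: "schwartz ?h" using g by (rule schwartz_partials)
      note [measurable] = schwartz_measurable[OF sh]
      obtain B where B: "\<And>x. norm (?h x) * (1 + norm x) ^ 0 \<le> B" using schwartz_decay[OF sh] by blast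
      have i1: "integrable lborel (\<lambda>w. ?h (z - (1 / 2 ^ j) *\<^sub>R w) * ker b w)"
        by (rule rapid_integrable, rule rapid_mult_bounded[OF rk, of _ B]) (use B in auto)
      have i2: "integrable lborel (\<lambda>w. ?h z * ker b w)"
        by (intro integrable_mult_right rapid_integrable rk)
      have "partial_derivs is (conv (?K j) g) z = conv (?K j) ?h z"
      proof -
        have "partial_derivs is (conv (?K j) g) z = conv ?h (?K j) z"
          unfolding comm by (simp add: partial_derivs_conv[OF g schwartz_rapid[OF sK]])
        also have "\<dots> = conv (?K j) ?h z"
          unfolding conv_def
          using integral_affine[of "-1" "\<lambda>y. ?K j (z - y) * ?h y" z] by (simp add: mult.commute)
        finally show ?thesis .
      qed
      then have "partial_derivs is (\<lambda>z. conv (?K j) g z - g z) z = conv (?K j) ?h z - ?h z * (\<integral>w. ker b w \<partial>lborel)"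
        by (simp add: partial_derivs_diff[OF sc g] one)
      also have "\<dots> = (\<integral>w. ?h (z - (1 / 2 ^ j) *\<^sub>R w) * ker b w \<partial>lborel) - (\<integral>w. ?h z * ker b w \<partial>lborel)"
        unfolding sub[OF sh] integral_mult_right_zero by (simp add: mult.commute)
      also have "\<dots> = (\<integral>w. ?h (z - (1 / 2 ^ j) *\<^sub>R w) * ker b w - ?h z * ker b w \<partial>lborel)"
        by (rule Bochner_Integration.integral_diff[OF i1 i2, symmetric])
      finally have "norm (partial_derivs is (\<lambda>z. conv (?K j) g z - g z) z) * (1 + norm z) ^ N =
        norm (\<integral>w. (1 + norm z) ^ N *\<^sub>R (?h (z - (1 / 2 ^ j) *\<^sub>R w) * ker b w - ?h z * ker b w) \<partial>lborel)"
        by (simp add: mult.commute)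
      also have "\<dots> \<le> (\<integral>w. (D * (1 / 2 ^ j)) * (norm (ker b w) * (1 + norm w) ^ Suc N) \<partial>lborel)"
      proof (rule norm_integral_le)
        fix w :: "real^'n"
        let ?y = "(1 / 2 ^ j) *\<^sub>R w"
        have small: "(1 / 2 ^ j :: real) \<le> 1" by simp
        have ny: "norm ?y = (1 / 2 ^ j) * norm w" by simp
        have ny': "norm ?y \<le> norm w" unfolding ny by (intro mult_left_le_one_le) auto
        have "norm ((1 + norm z) ^ N *\<^sub>R (?h (z - ?y) * ker b w - ?h z * ker b w))
          = (norm (?h (z - ?y) - ?h (z - 0)) * (1 + norm z) ^ N) * norm (ker b w)"
          by (simp add: left_diff_distrib[symmetric] norm_mult)
        also have "\<dots> \<le> (D * min 1 (norm (?y - 0)) * (1 + norm ?y + norm (0::real^'n)) ^ N) * norm (ker b w)"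
          by (intro mult_right_mono D(2) len) auto
        also have "\<dots> \<le> (D * ((1 / 2 ^ j) * (1 + norm w)) * (1 + norm w) ^ N) * norm (ker b w)"
        proof (intro mult_right_mono mult_mono power_mono mult_left_mono)
          \<comment> \<open>Trading the minimum for 2^(-j) (1 + |w|) costs one power of the weight,
            hence the exponent \<open>Suc N\<close> in the moment \<open>I\<close>.\<close>
          show "min 1 (norm (?y - 0)) \<le> (1 / 2 ^ j) * (1 + norm w)"
            using ny by (simp add: min_def field_simps)
        qed (use ny' D(1) in auto)
        also have "\<dots> = (D * (1 / 2 ^ j)) * (norm (ker b w) * (1 + norm w) ^ Suc N)" by simp
        finally show "norm ((1 + norm z) ^ N *\<^sub>R (?h (z - ?y) * ker b w - ?h z * ker b w))
          \<le> (D * (1 / 2 ^ j)) * (norm (ker b w) * (1 + norm w) ^ Suc N)" .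
      qed (intro integrable_scaleR_right Bochner_Integration.integrable_diff i1 i2 integrable_mult_right intI)+
      also have "\<dots> = D * (1 / 2 ^ j) * I" unfolding I_def integral_mult_right_zero ..
      finally show "norm (partial_derivs is (\<lambda>z. conv (?K j) g z - g z) z) * (1 + norm z) ^ N \<le> D * (1 / 2 ^ j) * I" .
    qed
    then show ?thesis using tempered_diff[OF u sc g, of j] by simp
  qed
  have "(\<lambda>j. C * (D * (1 / 2 ^ j) * I)) \<longlonglongrightarrow> C * (D * 0 * I)"
    by (intro tendsto_intros LIMSEQ_divide_realpow_zero) simp
  then have "(\<lambda>j. u (conv (?K j) g) - u g) \<longlonglongrightarrow> 0"
    by (intro Lim_null_comparison[OF always_eventually[OF allI[OF bound]]]) simp
  then show ?thesis by (rule LIM_zero_cancel)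
qed

text \<open>The weight \<open>(1 + \<delta>|x|)\<^sup>N\<close> with small \<open>\<delta>\<close> makes the argument available before boundedness of \<open>H\<close>
  is known, without making \<open>\<rho>\<close> depend on the growth of \<open>H\<close>.\<close>

theorem local_constancy:
  fixes X :: "real^'n \<Rightarrow> complex"
  assumes X: "schwartz X"
  shows "\<exists>\<rho>>0. \<forall>H. H \<in> borel_measurable borel \<longrightarrow> (\<exists>C N. \<forall>y. norm (H y) \<le> C * (1 + norm y) ^ N) \<longrightarrow>
    (\<forall>x. H x = (\<integral>y. H y * X (y - x) \<partial>lborel)) \<longrightarrow>
    (\<forall>x1. \<exists>x0. \<forall>y\<in>cball x0 \<rho>. norm (H x1) \<le> 4 * norm (H y))"
proof -
  let ?n = "2 * CARD('n)"
  have "\<exists>C\<ge>0. \<forall>x h. norm h \<le> 1 \<longrightarrow> norm (X (x + h) - X x) * (1 + norm x) ^ M \<le> C * norm h" for M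
    by (rule schwartz_lipschitz[OF X])
  then have "\<forall>M. \<exists>C. 0 \<le> C \<and> (\<forall>x h. norm h \<le> 1 \<longrightarrow> norm (X (x + h) - X x) * (1 + norm x) ^ M \<le> C * norm h)"
    by auto
  from choice[OF this] obtain L where L': "\<forall>M. 0 \<le> L M \<and>
      (\<forall>x h. norm h \<le> 1 \<longrightarrow> norm (X (x + h) - X x) * (1 + norm x) ^ M \<le> L M * norm h)" ..
  then have L0: "\<And>M. L M \<ge> 0" and L: "\<And>M x h. norm h \<le> 1 \<Longrightarrow> norm (X (x + h) - X x) * (1 + norm x) ^ M \<le> L M * norm h"
    by auto
  define C0 where "C0 = L ?n * (\<integral>w. wt w \<partial>(lborel :: (real^'n) measure))"
  have C0: "C0 \<ge> 0" unfolding C0_def by (intro mult_nonneg_nonneg L0 integral_nonneg) (simp add: wt_pos less_imp_le)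
  \<comment> \<open>On the ball of radius \<rho> the oscillation will be at most a \<rho>
    \<omega>(x0) (C0 + 1), which this choice makes one eighth of a \<omega>(x0). It also ensures
    \<rho> \<le> 1, the range of the Lipschitz estimate.\<close>
  define \<rho> where "\<rho> = 1 / (8 * (C0 + 1))"
  have \<rho>: "\<rho> > 0" "\<rho> \<le> 1" "\<rho> * (C0 + 1) = 1 / 8" using C0 by (auto simp: \<rho>_def field_simps)
  show ?thesis
  proof (intro exI[of _ \<rho>] conjI \<rho>(1) allI impI)
    fix H :: "real^'n \<Rightarrow> complex" and x1 :: "real^'n"
    assume H[measurable]: "H \<in> borel_measurable borel"
      and gr: "\<exists>C N. \<forall>y. norm (H y) \<le> C * (1 + norm y) ^ N"
      and rep: "\<forall>x. H x = (\<integral>y. H y * X (y - x) \<partial>lborel)"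
    show "\<exists>x0. \<forall>y\<in>cball x0 \<rho>. norm (H x1) \<le> 4 * norm (H y)"
    proof (cases "H x1 = 0")
      case True then show ?thesis by auto
    next
      case False
      obtain C N where CN: "\<And>y. norm (H y) \<le> C * (1 + norm y) ^ N" using gr by blast
      \<comment> \<open>Two majorants of the Lipschitz constant of \<open>X\<close> are combined.
        The first keeps the integral of \<open>D\<close> below \<open>C0\<close>, independently of
        \<open>N\<close>; the second decays fast enough to be integrated against a weight of order
        \<open>N\<close>.\<close>
      define D where "D w = min (L ?n * wt w) (L (N + ?n) * wt w / (1 + norm w) ^ N)" for w :: "real^'n"
      have Dm[measurable]: "D \<in> borel_measurable borel" unfolding D_def by measurable
      have D0: "D w \<ge> 0" for w using L0 wt_pos[of w] by (simp add: D_def min_def divide_nonneg_nonneg less_imp_le)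
      have DX: "norm (X (w + h) - X w) \<le> D w * norm h" if "norm h \<le> 1" for w h
      proof -
        have p: "(1 + norm w) ^ ?n > 0" "(1 + norm w) ^ N > 0" by simp_all
        have "norm (X (w + h) - X w) \<le> L ?n * wt w * norm h"
          using L[OF that, of w ?n] p by (simp add: wt_def field_simps)
        moreover have "norm (X (w + h) - X w) \<le> L (N + ?n) * wt w / (1 + norm w) ^ N * norm h"
          using L[OF that, of w "N + ?n"] p by (simp add: wt_def power_add field_simps)
        ultimately show ?thesis by (simp add: D_def min_def)
      qed
      have Dint: "integrable lborel D"
        by (rule Bochner_Integration.integrable_bound[OF integrable_mult_right[OF integrable_wt, of "L ?n"]])
          (use D0 in \<open>auto simp: D_def min_def intro!: AE_I2\<close>)
      have DC0: "(\<integral>w. D w \<partial>lborel) \<le> C0"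
        unfolding C0_def integral_mult_right_zero[symmetric]
        by (intro integral_mono Dint integrable_mult_right integrable_wt) (simp add: D_def)
      define \<delta> where "\<delta> m = 1 / real (Suc m)" for m
      have \<delta>: "0 < \<delta> m" "\<delta> m \<le> 1" for m by (simp_all add: \<delta>_def)
      have \<delta>0: "\<delta> \<longlonglongrightarrow> 0" unfolding \<delta>_def by (rule lim_1_over_n[THEN LIMSEQ_Suc])
      have le: "1 + \<delta> m * norm w \<le> 1 + norm w" "0 \<le> 1 + \<delta> m * norm w" for m and w :: "real^'n"
        using \<delta>[of m] by (auto simp: mult_left_le_one_le intro!: add_nonneg_nonneg)
      have DN: "norm (D w * (1 + \<delta> m * norm w) ^ N) \<le> L (N + ?n) * wt w" for m w
      proof -
        have "D w * (1 + \<delta> m * norm w) ^ N \<le> (L (N + ?n) * wt w / (1 + norm w) ^ N) * (1 + norm w) ^ N"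
          using le[of m w] L0 wt_pos[of w] D0[of w]
          by (intro mult_mono power_mono) (auto simp: D_def less_imp_le)
        then show ?thesis using D0[of w] le[of m w] by simp
      qed
      have DNint: "integrable lborel (\<lambda>w. D w * (1 + \<delta> m * norm w) ^ N)" for m
        by (rule Bochner_Integration.integrable_bound[OF integrable_mult_right[OF integrable_wt, of "L (N + ?n)"]])
          (use DN L0 in \<open>auto simp: abs_mult abs_of_pos[OF wt_pos] intro!: AE_I2\<close>)
      have "(\<lambda>m. \<integral>w. D w * (1 + \<delta> m * norm w) ^ N \<partial>lborel) \<longlonglongrightarrow> (\<integral>w. D w * (1 + 0 * norm w) ^ N \<partial>lborel)"
      proof (rule integral_dominated_convergence[where w = "\<lambda>w. L (N + ?n) * wt w"])
        show "AE w in lborel. (\<lambda>m. D w * (1 + \<delta> m * norm w) ^ N) \<longlonglongrightarrow> D w * (1 + 0 * norm w) ^ N"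
          by (intro AE_I2 tendsto_intros \<delta>0)
        show "AE w in lborel. norm (D w * (1 + \<delta> m * norm w) ^ N) \<le> L (N + ?n) * wt w" for m
          by (rule AE_I2) (rule DN)
      qed (auto intro!: integrable_mult_right integrable_wt)
      then have "(\<lambda>m. \<integral>w. D w * (1 + \<delta> m * norm w) ^ N \<partial>lborel) \<longlonglongrightarrow> (\<integral>w. D w \<partial>lborel)" by simp
      then have ev1: "\<forall>\<^sub>F m in sequentially. (\<integral>w. D w * (1 + \<delta> m * norm w) ^ N \<partial>lborel) < C0 + 1"
        using DC0 by (intro order_tendstoD) auto
      have "(\<lambda>m. (1 + \<delta> m * norm x1) ^ N) \<longlonglongrightarrow> (1 + 0 * norm x1) ^ N" by (intro tendsto_intros \<delta>0)
      then have ev2: "\<forall>\<^sub>F m in sequentially. (1 + \<delta> m * norm x1) ^ N < 2"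
        by (intro order_tendstoD) auto
      \<comment> \<open>As the parameter of the weight tends to 0 the weight tends to 1. It is taken
        so small that the weighted integral of \<open>D\<close> stays below C0 + 1 and the weight at
        \<open>x1\<close> is below 2.\<close>
      obtain m where m1: "(\<integral>w. D w * (1 + \<delta> m * norm w) ^ N \<partial>lborel) < C0 + 1" and m2: "(1 + \<delta> m * norm x1) ^ N < 2"
        using eventually_happens[OF eventually_conj[OF ev1 ev2]] by auto
      define \<omega> where "\<omega> x = (1 + \<delta> m * norm x) ^ N" for x :: "real^'n"
      have \<omega>1: "\<omega> x \<ge> 1" for x unfolding \<omega>_def using \<delta>[of m] by (intro one_le_power) auto
      have \<omega>0: "\<omega> x > 0" for x using \<omega>1[of x] by linarith
      have [measurable]: "\<omega> \<in> borel_measurable borel" unfolding \<omega>_def by measurable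
      have \<omega>mult: "\<omega> z \<le> \<omega> x * \<omega> (z - x)" for x z :: "real^'n"
      proof -
        have "\<delta> m * norm z \<le> \<delta> m * norm x + \<delta> m * norm (z - x)"
          using \<delta>(1)[of m] norm_triangle_ineq[of x "z - x"] by (simp flip: distrib_left)
        moreover have "0 \<le> (\<delta> m * norm x) * (\<delta> m * norm (z - x))" using \<delta>(1)[of m] by simp
        ultimately have "1 + \<delta> m * norm z \<le> (1 + \<delta> m * norm x) * (1 + \<delta> m * norm (z - x))"
          by (simp add: distrib_left distrib_right)
        then have "(1 + \<delta> m * norm z) ^ N \<le> ((1 + \<delta> m * norm x) * (1 + \<delta> m * norm (z - x))) ^ N"
          using le(2)[of m z] by (intro power_mono)
        then show ?thesis unfolding \<omega>_def power_mult_distrib .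
      qed
      define a where "a = (SUP x. norm (H x) / \<omega> x)"
      have bdd: "bdd_above (range (\<lambda>x. norm (H x) / \<omega> x))"
      proof (rule bdd_aboveI2)
        fix x :: "real^'n"
        have "1 + norm x \<le> (1 / \<delta> m) * (1 + \<delta> m * norm x)" using \<delta>[of m] by (simp add: field_simps)
        then have "(1 + norm x) ^ N \<le> ((1 / \<delta> m) * (1 + \<delta> m * norm x)) ^ N" by (intro power_mono) auto
        also have "\<dots> = (1 / \<delta> m) ^ N * \<omega> x" unfolding \<omega>_def power_mult_distrib ..
        finally have "\<bar>C\<bar> * (1 + norm x) ^ N \<le> \<bar>C\<bar> * ((1 / \<delta> m) ^ N * \<omega> x)" by (rule mult_left_mono) simp
        moreover have "C * (1 + norm x) ^ N \<le> \<bar>C\<bar> * (1 + norm x) ^ N" by (intro mult_right_mono) auto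
        ultimately have "norm (H x) \<le> \<bar>C\<bar> * ((1 / \<delta> m) ^ N * \<omega> x)" using CN[of x] by linarith
        then show "norm (H x) / \<omega> x \<le> \<bar>C\<bar> * (1 / \<delta> m) ^ N" using \<omega>0[of x] by (simp add: divide_le_eq mult.assoc)
      qed
      have Ha: "norm (H x) \<le> a * \<omega> x" for x
      proof -
        have "norm (H x) / \<omega> x \<le> a" unfolding a_def by (rule cSUP_upper[OF UNIV_I bdd])
        then show ?thesis using \<omega>0[of x] by (simp add: divide_le_eq)
      qed
      have "norm (H x1) \<le> a * \<omega> x1" by (rule Ha)
      moreover have "a \<ge> 0" using order_trans[OF norm_ge_zero Ha[of x1]] \<omega>0[of x1] by (simp add: zero_le_mult_iff)
      moreover have "\<omega> x1 \<le> 2" using m2 by (simp add: \<omega>_def)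
      ultimately have a2: "norm (H x1) \<le> 2 * a" using mult_left_mono[of "\<omega> x1" 2 a] by linarith
      then have a0: "a > 0" using False by (smt (verit) zero_less_norm_iff)
      \<comment> \<open>The weighted supremum need not be attained, so three quarters of it is used.
        The resulting point \<open>x0\<close> bears no relation to \<open>x1\<close>.\<close>
      have "3 / 4 * a < (SUP x. norm (H x) / \<omega> x)" using a0 by (simp add: a_def[symmetric])
      then obtain x0 where x0: "3 / 4 * a < norm (H x0) / \<omega> x0"
        unfolding less_cSUP_iff[OF UNIV_not_empty bdd] by blast
      have "norm (H x1) \<le> 4 * norm (H y)" if y: "y \<in> cball x0 \<rho>" for y
      proof -
        have hy: "norm (x0 - y) \<le> \<rho>" using y by (simp add: dist_norm)
        have hy1: "norm (x0 - y) \<le> 1" using hy \<rho>(2) by linarith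
        have ri: "integrable lborel (\<lambda>z. H z * X (z - v))" for v
          by (intro rapid_integrable rapid_mult_poly[where C = C and M = N] rapid_translate schwartz_rapid X H CN)
        have "H y - H x0 = (\<integral>z. H z * X (z - y) - H z * X (z - x0) \<partial>lborel)"
          using rep Bochner_Integration.integral_diff[OF ri ri, of y x0] by metis
        also have "norm \<dots> \<le> (\<integral>z. (a * \<rho> * \<omega> x0) * (\<lambda>w. D w * (1 + \<delta> m * norm w) ^ N) (- x0 + 1 *\<^sub>R z) \<partial>lborel)"
        proof (rule norm_integral_le)
          show "integrable lborel (\<lambda>z. H z * X (z - y) - H z * X (z - x0))"
            by (intro Bochner_Integration.integrable_diff ri)
          show "integrable lborel (\<lambda>z. (a * \<rho> * \<omega> x0) * (\<lambda>w. D w * (1 + \<delta> m * norm w) ^ N) (- x0 + 1 *\<^sub>R z))"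
            using integrable_affine_iff[of 1 "\<lambda>w. D w * (1 + \<delta> m * norm w) ^ N" "- x0"] DNint[of m]
            by (intro integrable_mult_right) simp
          fix z
          have "norm (X (z - y) - X (z - x0)) \<le> D (z - x0) * norm (x0 - y)"
            using DX[OF hy1, of "z - x0"] by simp
          also have "\<dots> \<le> D (z - x0) * \<rho>" by (intro mult_left_mono hy D0)
          finally have "norm (H z) * norm (X (z - y) - X (z - x0)) \<le> (a * (\<omega> x0 * \<omega> (z - x0))) * (D (z - x0) * \<rho>)"
            using a0 \<omega>0 D0 \<rho>(1)
            by (intro mult_mono order_trans[OF Ha mult_left_mono[OF \<omega>mult]]) (auto simp: less_imp_le)
          then show "norm (H z * X (z - y) - H z * X (z - x0))
            \<le> (a * \<rho> * \<omega> x0) * (\<lambda>w. D w * (1 + \<delta> m * norm w) ^ N) (- x0 + 1 *\<^sub>R z)"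
            by (simp add: right_diff_distrib[symmetric] norm_mult mult_ac \<omega>_def[of "z - x0"])
        qed
        also have "\<dots> = (a * \<rho> * \<omega> x0) * (\<integral>w. D w * (1 + \<delta> m * norm w) ^ N \<partial>lborel)"
          unfolding integral_mult_right_zero
          by (subst integral_affine[where f = "\<lambda>w. D w * (1 + \<delta> m * norm w) ^ N"]) auto
        also have "\<dots> \<le> (a * \<rho> * \<omega> x0) * (C0 + 1)"
          using m1 a0 \<rho>(1) \<omega>0[of x0] by (intro mult_left_mono) (auto simp: less_imp_le)
        also have "\<dots> = a * \<omega> x0 * (\<rho> * (C0 + 1))" by (simp only: mult_ac)
        also have "\<dots> = a * \<omega> x0 / 8" by (simp add: \<rho>(3))
        finally have "norm (H y - H x0) \<le> a * \<omega> x0 / 8" .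
        moreover have "norm (H x0) \<le> norm (H y) + norm (H y - H x0)"
          by (metis norm_minus_commute norm_triangle_sub)
        moreover have "3 / 4 * (a * \<omega> x0) < norm (H x0)" using x0 \<omega>0[of x0] by (simp add: less_divide_eq mult.assoc)
        moreover have "a \<le> a * \<omega> x0" using a0 \<omega>1[of x0] by simp
        \<comment> \<open>At \<open>y\<close> at least 3/4 - 1/8 = 5/8 of a \<omega>(x0) \<ge> a
          survives, while |H x1| \<le> 2 a; and 2 is less than 4 times 5/8.\<close>
        ultimately show ?thesis using a2 a0 by linarith
      qed
      then show ?thesis by blast
    qed
  qed
qed

text \<open>A Bernstein inequality: the difference is taken on the kernel. The summand 2 in the
  constant covers distant points, where the trivial bound 2 M is already of the required
  form.\<close>

lemma reproducing_lipschitz: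
  fixes X :: "real^'n \<Rightarrow> complex"
  assumes X: "schwartz X"
  shows "\<exists>L\<ge>0. \<forall>H M. H \<in> borel_measurable borel \<longrightarrow> (\<forall>y. norm (H y) \<le> M) \<longrightarrow>
    (\<forall>x. H x = (\<integral>y. H y * X (y - x) \<partial>lborel)) \<longrightarrow> (\<forall>x x'. norm (H x - H x') \<le> L * M * norm (x - x'))"
proof -
  let ?n = "2 * CARD('n)"
  obtain L where L0: "L \<ge> 0" and L: "\<And>x h. norm h \<le> 1 \<Longrightarrow> norm (X (x + h) - X x) * (1 + norm x) ^ ?n \<le> L * norm h"
    using schwartz_lipschitz[OF X, of ?n] by blast
  define C0 where "C0 = L * (\<integral>w. wt w \<partial>(lborel :: (real^'n) measure))"
  have C0: "C0 \<ge> 0" unfolding C0_def by (intro mult_nonneg_nonneg L0 integral_nonneg) (simp add: wt_pos less_imp_le)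
  have main: "norm (H x - H x') \<le> (C0 + 2) * M * norm (x - x')"
    if H[measurable]: "H \<in> borel_measurable borel" and M: "\<And>y. norm (H y) \<le> M"
      and rep: "\<And>x. H x = (\<integral>y. H y * X (y - x) \<partial>lborel)" for H M x x'
  proof (cases "norm (x - x') \<le> 1")
    case True
    have M0: "M \<ge> 0" using order_trans[OF norm_ge_zero M] .
    have ri: "integrable lborel (\<lambda>z. H z * X (z - v))" for v
      by (intro rapid_integrable rapid_mult_bounded[where C = M] rapid_translate schwartz_rapid X H M)
    have "H x - H x' = (\<integral>z. H z * X (z - x) - H z * X (z - x') \<partial>lborel)"
      using rep Bochner_Integration.integral_diff[OF ri ri, of x x'] by metis
    also have "norm \<dots> \<le> (\<integral>z. (M * L * norm (x - x')) * wt (- x' + 1 *\<^sub>R z) \<partial>lborel)"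
    proof (rule norm_integral_le)
      show "integrable lborel (\<lambda>z. H z * X (z - x) - H z * X (z - x'))"
        by (intro Bochner_Integration.integrable_diff ri)
      show "integrable lborel (\<lambda>z. (M * L * norm (x - x')) * wt (- x' + 1 *\<^sub>R z))"
        using integrable_affine_iff[of 1 "wt :: real^'n \<Rightarrow> real" "- x'"] integrable_wt
        by (intro integrable_mult_right) simp
      fix z
      have "norm (x' - x) \<le> 1" using True by (simp add: norm_minus_commute)
      from L[OF this, of "z - x'"]
      have "norm (X (z - x) - X (z - x')) \<le> L * norm (x - x') * wt (z - x')"
        by (simp add: wt_def field_simps norm_minus_commute)
      then have "norm (H z) * norm (X (z - x) - X (z - x')) \<le> M * (L * norm (x - x') * wt (z - x'))"
        using M0 by (intro mult_mono M) auto
      then show "norm (H z * X (z - x) - H z * X (z - x')) \<le> (M * L * norm (x - x')) * wt (- x' + 1 *\<^sub>R z)"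
        by (simp add: right_diff_distrib[symmetric] norm_mult mult_ac)
    qed
    also have "\<dots> = C0 * M * norm (x - x')"
      unfolding integral_mult_right_zero
      by (subst integral_affine[where f = wt]) (auto simp: C0_def)
    also have "\<dots> \<le> (C0 + 2) * M * norm (x - x')" using M0 by (intro mult_right_mono) auto
    finally show ?thesis .
  next
    case False
    have M0: "M \<ge> 0" using order_trans[OF norm_ge_zero M] .
    have "norm (H x - H x') \<le> norm (H x) + norm (H x')" by (rule norm_triangle_ineq4)
    also have "\<dots> \<le> 2 * M * 1" using M[of x] M[of x'] by simp
    also have "\<dots> \<le> (C0 + 2) * M * norm (x - x')" using M0 C0 False by (intro mult_mono) auto
    finally show ?thesis .
  qed
  show ?thesis
  proof (intro exI[of _ "C0 + 2"] conjI allI impI)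
    show "0 \<le> C0 + 2" using C0 by simp
    fix H :: "real^'n \<Rightarrow> complex" and M x x'
    assume H: "H \<in> borel_measurable borel" "\<forall>y. norm (H y) \<le> M"
      "\<forall>x. H x = (\<integral>y. H y * X (y - x) \<partial>lborel)"
    show "norm (H x - H x') \<le> (C0 + 2) * M * norm (x - x')"
      by (rule main[OF H(1) H(2,3)[rule_format]])
  qed
qed

section \<open>Almost orthogonality against a band-limited bump\<close>

lemma borel_measurable_cnj [measurable]:
  assumes "f \<in> borel_measurable M" shows "(\<lambda>x. cnj (f x)) \<in> borel_measurable M"
proof -
  have "cnj \<in> borel_measurable borel"
    by (intro borel_measurable_continuous_onI continuous_on_cnj continuous_on_id)
  then show ?thesis by (rule measurable_compose[OF assms])
qed

lemma fourier_zero_pos: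
  fixes \<phi>0 :: "real^'n \<Rightarrow> real"
  assumes "TL_generator \<phi>0"
  shows "fourier (\<lambda>\<xi>. of_real (\<phi>0 \<xi>)) 0 \<noteq> 0"
proof -
  have s: "schwartz (\<lambda>\<xi>. complex_of_real (\<phi>0 \<xi>))" and nn: "\<And>\<xi>. 0 \<le> \<phi>0 \<xi>" and one: "\<And>\<xi>. \<xi> \<in> cball 0 1 \<Longrightarrow> \<phi>0 \<xi> = 1"
    using assms by (auto simp: TL_generator_def)
  have int: "integrable lborel \<phi>0"
    using integrable_Re[OF rapid_integrable[OF schwartz_rapid[OF s]]] by simp
  have "measure lborel (cball (0::real^'n) 1) = (\<integral>x. indicator (cball 0 1) x \<partial>(lborel::(real^'n) measure))" by simp
  also have "\<dots> \<le> (\<integral>x. \<phi>0 x \<partial>lborel)"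
  proof (rule integral_mono[OF _ int])
    show "integrable lborel (indicator (cball (0::real^'n) 1) :: _ \<Rightarrow> real)"
      by (rule integrable_real_indicator) (use emeasure_bounded_finite[OF bounded_cball, of "0::real^'n" 1] in auto)
    show "indicator (cball 0 1) x \<le> \<phi>0 x" for x
      by (cases "x \<in> cball 0 1") (simp_all add: one nn del: mem_cball mem_cball_0)
  qed
  finally have "0 < (\<integral>x. \<phi>0 x \<partial>lborel)"
    by (rule less_le_trans[OF content_cball_pos, rotated]) simp
  moreover have "fourier (\<lambda>\<xi>. of_real (\<phi>0 \<xi>)) 0 = of_real (\<integral>x. \<phi>0 x \<partial>lborel)"
    by (simp add: fourier_eq_lborel[OF schwartz_measurable[OF s]])
  ultimately show ?thesis by simp
qed

text \<open>The transform of |G|^2 is the autocorrelation of \<open>\<phi>0\<close>. Inversion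
  produces the product of \<open>\<phi>0\<close> at b and at v + b, and both points cannot lie in
  the ball of radius R once |v| > 2 R.\<close>

lemma fourier_square_spectrum:
  fixes \<phi>0 :: "real^'n \<Rightarrow> real"
  assumes s: "schwartz (\<lambda>\<xi>. complex_of_real (\<phi>0 \<xi>))" and supp: "\<And>\<xi>. R < norm \<xi> \<Longrightarrow> \<phi>0 \<xi> = 0"
    and v: "2 * R < norm v"
  defines "G \<equiv> fourier (\<lambda>\<xi>. complex_of_real (\<phi>0 \<xi>))"
  shows "(\<integral>w. G w * cnj (G w) * chi w v \<partial>lborel) = 0"
proof -
  have sG: "schwartz G" unfolding G_def by (rule schwartz_fourier[OF s])
  note [measurable] = schwartz_measurable[OF sG] schwartz_measurable[OF s]
  note intp = rapid_integrable[OF schwartz_rapid[OF s]]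
  have intG: "integrable lborel (\<lambda>w. G w * chi w v)"
    by (intro integrable_mult_chi rapid_integrable schwartz_rapid sG)
  have cG: "cnj (G w) = (\<integral>b. of_real (\<phi>0 b) * chi b w \<partial>lborel)" for w
    unfolding G_def fourier_eq_lborel[OF schwartz_measurable[OF s]]
    by (subst Bochner_Integration.integral_cnj[symmetric]) (simp add: cnj_chi)
  have "(\<integral>w. G w * cnj (G w) * chi w v \<partial>lborel) = (\<integral>w. (G w * chi w v) * (\<integral>b. of_real (\<phi>0 b) * chi b w \<partial>lborel) \<partial>lborel)"
    unfolding cG[symmetric] by (simp only: mult_ac)
  also have "\<dots> = (\<integral>b. of_real (\<phi>0 b) * (\<integral>w. (G w * chi w v) * chi b w \<partial>lborel) \<partial>lborel)"
    by (rule Fubini_bounded_kernel[OF intG intp]) (auto simp: case_prod_beta')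
  also have "\<dots> = (\<integral>b. (0::complex) \<partial>(lborel::(real^'n) measure))"
  proof (intro Bochner_Integration.integral_cong refl)
    fix b
    have "(\<integral>w. (G w * chi w v) * chi b w \<partial>lborel) = (\<integral>w. G w * chi (v + b) w \<partial>lborel)"
      by (simp only: chi_add chi_commute[of v] mult.assoc)
    also have "\<dots> = of_real ((2 * pi) ^ CARD('n)) * of_real (\<phi>0 (v + b))"
      unfolding G_def by (rule fourier_inversion[OF s])
    finally have e: "(\<integral>w. (G w * chi w v) * chi b w \<partial>lborel) = of_real ((2 * pi) ^ CARD('n)) * of_real (\<phi>0 (v + b))" .
    have "norm v \<le> norm (v + b) + norm b" using norm_triangle_ineq4[of "v + b" b] by simp
    then have "R < norm (v + b) \<or> R < norm b" using v by linarith
    then have "\<phi>0 (v + b) = 0 \<or> \<phi>0 b = 0" using supp by blast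
    then show "of_real (\<phi>0 b) * (\<integral>w. (G w * chi w v) * chi b w \<partial>lborel) = (0::complex)"
      unfolding e by auto
  qed
  finally show ?thesis by simp
qed

text \<open>A nonnegative weight that is large on a prescribed ball cannot have both compact support
  and compact spectrum. Compact spectrum is needed for orthogonality, so only rapid decay in space
  is asked, and positivity comes from squaring a Fourier transform.\<close>

lemma band_limited_bump:
  fixes \<phi>0 :: "real^'n \<Rightarrow> real"
  assumes "TL_generator \<phi>0"
  shows "\<exists>\<theta>::real^'n \<Rightarrow> real. (\<forall>y. 0 \<le> \<theta> y) \<and> \<theta> \<in> borel_measurable borel \<and> rapid (\<lambda>y. complex_of_real (\<theta> y)) \<and>
    (\<forall>y. norm y \<le> r \<longrightarrow> 1 \<le> \<theta> y) \<and>
    (\<forall>v. 1 < norm v \<longrightarrow> (\<integral>y. of_real (\<theta> y) * chi y v \<partial>lborel) = 0)"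
proof -
  have s: "schwartz (\<lambda>\<xi>. complex_of_real (\<phi>0 \<xi>))" and cl: "closure {\<xi>. \<phi>0 \<xi> \<noteq> 0} \<subseteq> cball 0 (3/2)"
    using assms by (auto simp: TL_generator_def)
  have supp: "\<phi>0 \<xi> = 0" if "3 / 2 < norm \<xi>" for \<xi>
  proof (rule ccontr)
    assume "\<phi>0 \<xi> \<noteq> 0"
    then have "\<xi> \<in> {\<xi>. \<phi>0 \<xi> \<noteq> 0}" by simp
    then have "\<xi> \<in> cball 0 (3/2)" by (rule subsetD[OF order_trans[OF closure_subset cl]])
    then show False using that by simp
  qed
  define G where "G = fourier (\<lambda>\<xi>. complex_of_real (\<phi>0 \<xi>))"
  have sG: "schwartz G" unfolding G_def by (rule schwartz_fourier[OF s])
  note [measurable] = schwartz_measurable[OF sG]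
  have G0: "G 0 \<noteq> 0" unfolding G_def by (rule fourier_zero_pos[OF assms])
  have "isCont G 0" using schwartz_continuous[OF sG, of UNIV] by (simp add: continuous_on_eq_continuous_at)
  moreover have "norm (G 0) / 2 > 0" using G0 by simp
  ultimately obtain d where d: "d > 0" "\<And>y. dist y 0 < d \<Longrightarrow> dist (G y) (G 0) < norm (G 0) / 2"
    unfolding continuous_at_eps_delta by blast
  \<comment> \<open>The squared transform has spectrum of radius 2 times 3/2 = 3, and \<epsilon>
    \<le> 1/3 shrinks it to the unit ball. The other bound keeps \<open>G\<close> at least half of
    \<open>G 0\<close> on the ball of radius \<open>r\<close>, which the factor K = 4 / |G 0|^2
    below then normalises to 1.\<close>
  define \<epsilon> where "\<epsilon> = min (1 / 3) (d / (\<bar>r\<bar> + 1))"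
  have \<epsilon>: "\<epsilon> > 0" using d(1) by (simp add: \<epsilon>_def)
  have \<epsilon>': "\<epsilon> \<le> 1 / 3" "\<epsilon> \<le> d / (\<bar>r\<bar> + 1)" unfolding \<epsilon>_def by (rule min.cobounded1, rule min.cobounded2)
  define K where "K = 4 / (norm (G 0))\<^sup>2"
  have K: "K > 0" using G0 by (simp add: K_def)
  define \<theta> where "\<theta> y = K * (norm (G (\<epsilon> *\<^sub>R y)))\<^sup>2" for y
  have \<theta>c: "complex_of_real (\<theta> y) = of_real K * (G (\<epsilon> *\<^sub>R y) * cnj (G (\<epsilon> *\<^sub>R y)))" for y
    unfolding \<theta>_def of_real_mult complex_norm_square ..
  have m[measurable]: "\<theta> \<in> borel_measurable borel" unfolding \<theta>_def by measurable
  show ?thesis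
  proof (intro exI[of _ \<theta>] conjI allI impI m)
    show "0 \<le> \<theta> y" for y using K by (simp add: \<theta>_def)
    show "rapid (\<lambda>y. complex_of_real (\<theta> y))"
    proof -
      have sGe: "schwartz (\<lambda>y. G (\<epsilon> *\<^sub>R y))" using \<epsilon> by (intro schwartz_dilate sG) simp
      obtain B where B: "\<And>x. norm (G x) * (1 + norm x) ^ 0 \<le> B" using schwartz_decay[OF sG] by blast
      have "rapid (\<lambda>y. (of_real K * cnj (G (\<epsilon> *\<^sub>R y))) * G (\<epsilon> *\<^sub>R y))"
      proof (rule rapid_mult_bounded[OF schwartz_rapid[OF sGe], of _ "K * B"])
        show "norm (of_real K * cnj (G (\<epsilon> *\<^sub>R y))) \<le> K * B" for y
          using B[of "\<epsilon> *\<^sub>R y"] K by (simp add: norm_mult)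
        show "(\<lambda>y. of_real K * cnj (G (\<epsilon> *\<^sub>R y))) \<in> borel_measurable borel" by measurable
      qed
      then show ?thesis unfolding \<theta>c by (simp only: mult_ac)
    qed
    show "1 \<le> \<theta> y" if "norm y \<le> r" for y
    proof -
      have "norm (\<epsilon> *\<^sub>R y) = \<epsilon> * norm y" using \<epsilon> by simp
      also have "\<dots> \<le> d / (\<bar>r\<bar> + 1) * norm y" using \<epsilon>'(2) by (intro mult_right_mono) auto
      also have "\<dots> < d / (\<bar>r\<bar> + 1) * (\<bar>r\<bar> + 1)"
        using that d(1) by (intro mult_strict_left_mono) auto
      also have "\<dots> = d" using abs_ge_zero[of r] by simp
      finally have "dist (G (\<epsilon> *\<^sub>R y)) (G 0) < norm (G 0) / 2" by (intro d(2)) simp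
      then have "norm (G 0) / 2 \<le> norm (G (\<epsilon> *\<^sub>R y))"
        using norm_triangle_sub[of "G 0" "G (\<epsilon> *\<^sub>R y)"] by (simp add: dist_norm norm_minus_commute)
      then have "(norm (G 0) / 2)\<^sup>2 \<le> (norm (G (\<epsilon> *\<^sub>R y)))\<^sup>2" by (intro power_mono) auto
      then have "K * (norm (G 0) / 2)\<^sup>2 \<le> \<theta> y" unfolding \<theta>_def using K by (intro mult_left_mono) auto
      then show ?thesis using G0 by (simp add: K_def power_divide)
    qed
    show "(\<integral>y. of_real (\<theta> y) * chi y v \<partial>lborel) = 0" if v: "1 < norm v" for v
    proof -
      let ?F = "\<lambda>w. of_real K * (G w * cnj (G w) * chi w ((1 / \<epsilon>) *\<^sub>R v))"
      have "norm ((1 / \<epsilon>) *\<^sub>R v) = norm v / \<epsilon>" using \<epsilon> by simp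
      moreover have "3 < norm v / \<epsilon>" using \<epsilon> \<epsilon>'(1) v by (simp add: less_divide_eq)
      ultimately have big: "2 * (3 / 2) < norm ((1 / \<epsilon>) *\<^sub>R v)" using \<epsilon> by simp
      have "(\<integral>y. of_real (\<theta> y) * chi y v \<partial>lborel) = (\<integral>y. ?F (0 + \<epsilon> *\<^sub>R y) \<partial>lborel)"
        using \<epsilon> by (intro Bochner_Integration.integral_cong refl) (simp add: \<theta>c chi_def)
      also have "\<dots> = (\<integral>w. ?F w \<partial>lborel) /\<^sub>R \<bar>\<epsilon>\<bar> ^ CARD('n)"
        using \<epsilon> by (subst integral_affine[where f = ?F]) auto
      also have "(\<integral>w. ?F w \<partial>lborel) = 0"
        unfolding integral_mult_right_zero G_def
        using fourier_square_spectrum[OF s supp big] by simp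
      finally show ?thesis by simp
    qed
  qed
qed

text \<open>Multiplication by \<Theta> moves frequencies by at most R, so the product of \<Theta>
  with the conjugated kernel of \<open>a\<close> has spectrum within distance R of the support of
  \<open>a\<close>. The multiplier \<open>b\<close> sees nothing there.\<close>

lemma spectral_orthogonality:
  fixes a b :: "real^'n \<Rightarrow> complex" and \<Theta> :: "real^'n \<Rightarrow> complex"
  assumes s: "schwartz a" "schwartz b" and \<Theta>: "rapid \<Theta>"
    and spec: "\<And>v. R < norm v \<Longrightarrow> (\<integral>y. \<Theta> y * chi y v \<partial>lborel) = 0"
    and sep: "\<And>\<xi> \<zeta>. a \<xi> \<noteq> 0 \<Longrightarrow> b \<zeta> \<noteq> 0 \<Longrightarrow> R < norm (\<zeta> - \<xi>)"
  shows "conv (ker b) (\<lambda>y. cnj (ker a (z - y)) * \<Theta> y) z' = 0"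
proof -
  define \<kappa> where "\<kappa> = complex_of_real (1 / (2 * pi) ^ CARD('n))"
  note [measurable] = rapid_measurable[OF \<Theta>] schwartz_measurable[OF s(1)] schwartz_measurable[OF schwartz_ker[OF s(1)]]
  have int\<Theta>: "integrable lborel \<Theta>" using \<Theta> by (rule rapid_integrable)
  have inta: "integrable lborel (\<lambda>\<xi>. cnj (a \<xi>))"
    using rapid_integrable[OF schwartz_rapid[OF s(1)]] by simp
  have ca: "cnj (ker a w) = \<kappa> * (\<integral>\<xi>. cnj (a \<xi>) * chi \<xi> w \<partial>lborel)" for w
    unfolding ker_eq_integral[OF s(1)] \<kappa>_def
    by (simp add: Bochner_Integration.integral_cnj[symmetric] cnj_chi)
  obtain B where B: "\<And>x. norm (ker a x) * (1 + norm x) ^ 0 \<le> B" using schwartz_decay[OF schwartz_ker[OF s(1)]] by blast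
  have rg: "rapid (\<lambda>y. cnj (ker a (z - y)) * \<Theta> y)"
    by (rule rapid_mult_bounded[OF \<Theta>, of _ B]) (use B in auto)
  have inner: "(\<integral>y. (cnj (ker a (z - y)) * \<Theta> y) * chi (- \<zeta>) (z' - y) \<partial>lborel) = 0" if \<zeta>: "b \<zeta> \<noteq> 0" for \<zeta>
  proof -
    have "(\<integral>y. (cnj (ker a (z - y)) * \<Theta> y) * chi (- \<zeta>) (z' - y) \<partial>lborel) =
      (\<integral>y. \<kappa> * ((\<Theta> y * chi (- \<zeta>) (z' - y)) * (\<integral>\<xi>. cnj (a \<xi>) * chi \<xi> (z - y) \<partial>lborel)) \<partial>lborel)"
      unfolding ca by (simp only: mult_ac)
    also have "\<dots> = \<kappa> * (\<integral>y. (\<Theta> y * chi (- \<zeta>) (z' - y)) * (\<integral>\<xi>. cnj (a \<xi>) * chi \<xi> (z - y) \<partial>lborel) \<partial>lborel)"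
      by simp
    also have "(\<integral>y. (\<Theta> y * chi (- \<zeta>) (z' - y)) * (\<integral>\<xi>. cnj (a \<xi>) * chi \<xi> (z - y) \<partial>lborel) \<partial>lborel) =
      (\<integral>\<xi>. cnj (a \<xi>) * (\<integral>y. (\<Theta> y * chi (- \<zeta>) (z' - y)) * chi \<xi> (z - y) \<partial>lborel) \<partial>lborel)"
    proof (rule Fubini_bounded_kernel[OF _ inta])
      show "integrable lborel (\<lambda>y. \<Theta> y * chi (- \<zeta>) (z' - y))"
        by (rule Bochner_Integration.integrable_bound[OF int\<Theta>]) (simp_all add: norm_mult)
    qed (auto simp: case_prod_beta')
    also have "\<dots> = (\<integral>\<xi>. (0::complex) \<partial>(lborel::(real^'n) measure))"
    proof (intro Bochner_Integration.integral_cong refl)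
      fix \<xi>
      \<comment> \<open>All dependence on \<open>y\<close> is collected into one character at the
        difference of the two frequencies, where the spectral condition on \<Theta> applies.\<close>
      have e: "chi (- \<zeta>) (z' - y) * chi \<xi> (z - y) = chi y (\<zeta> - \<xi>) * (chi (- \<zeta>) z' * chi \<xi> z)" for y
        unfolding chi_def exp_add[symmetric]
        by (rule arg_cong[of _ _ exp]) (simp add: inner_diff_right inner_commute algebra_simps)
      have "(\<integral>y. (\<Theta> y * chi (- \<zeta>) (z' - y)) * chi \<xi> (z - y) \<partial>lborel) =
         (\<integral>y. (\<Theta> y * chi y (\<zeta> - \<xi>)) * (chi (- \<zeta>) z' * chi \<xi> z) \<partial>lborel)"
        unfolding mult.assoc e ..
      also have "\<dots> = (\<integral>y. \<Theta> y * chi y (\<zeta> - \<xi>) \<partial>lborel) * (chi (- \<zeta>) z' * chi \<xi> z)"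
        by (rule integral_mult_left_zero)
      also have "cnj (a \<xi>) * \<dots> = 0"
        using sep[of \<xi> \<zeta>] spec[of "\<zeta> - \<xi>"] \<zeta> by (cases "a \<xi> = 0") auto
      finally show "cnj (a \<xi>) * (\<integral>y. (\<Theta> y * chi (- \<zeta>) (z' - y)) * chi \<xi> (z - y) \<partial>lborel) = 0" .
    qed
    finally show ?thesis by simp
  qed
  have "conv (ker b) (\<lambda>y. cnj (ker a (z - y)) * \<Theta> y) z' =
     (\<integral>y. \<kappa> * ((cnj (ker a (z - y)) * \<Theta> y) * (\<integral>\<zeta>. b \<zeta> * chi (- \<zeta>) (z' - y) \<partial>lborel)) \<partial>lborel)"
    unfolding conv_def ker_eq_integral[OF s(2)] \<kappa>_def[symmetric] by (simp only: mult_ac)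
  also have "\<dots> = \<kappa> * (\<integral>y. (cnj (ker a (z - y)) * \<Theta> y) * (\<integral>\<zeta>. b \<zeta> * chi (- \<zeta>) (z' - y) \<partial>lborel) \<partial>lborel)"
    by (rule integral_mult_right_zero)
  also have "(\<integral>y. (cnj (ker a (z - y)) * \<Theta> y) * (\<integral>\<zeta>. b \<zeta> * chi (- \<zeta>) (z' - y) \<partial>lborel) \<partial>lborel) =
     (\<integral>\<zeta>. b \<zeta> * (\<integral>y. (cnj (ker a (z - y)) * \<Theta> y) * chi (- \<zeta>) (z' - y) \<partial>lborel) \<partial>lborel)"
    by (rule Fubini_bounded_kernel)
      (auto simp: case_prod_beta' intro: rapid_integrable rg schwartz_rapid s)
  also have "\<dots> = (\<integral>\<zeta>. (0::complex) \<partial>(lborel::(real^'n) measure))"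
    by (intro Bochner_Integration.integral_cong refl) (use inner in force)
  finally show ?thesis by simp
qed

text \<open>Both multipliers are moved off \<open>u\<close> in turn. The integral is
  \<open>u\<close> applied to a convolution of \<open>ker a\<close> with the second piece times
  \<theta>; each value of this convolution is, up to conjugation, \<open>u\<close> applied to a
  convolution of \<open>ker b\<close>, which vanishes by spectral separation.\<close>

lemma fmult_orthogonal:
  fixes a b :: "real^'n \<Rightarrow> complex" and \<theta> :: "real^'n \<Rightarrow> real"
  assumes u: "tempered u" and s: "schwartz a" "schwartz b" and \<theta>: "rapid (\<lambda>y. complex_of_real (\<theta> y))"
    and spec: "\<And>v. R < norm v \<Longrightarrow> (\<integral>y. of_real (\<theta> y) * chi y v \<partial>lborel) = 0"
    and sep: "\<And>\<xi> \<zeta>. a \<xi> \<noteq> 0 \<Longrightarrow> b \<zeta> \<noteq> 0 \<Longrightarrow> R < norm (\<zeta> - \<xi>)"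
  shows "(\<integral>y. fmult a u y * (cnj (fmult b u y) * of_real (\<theta> y)) \<partial>lborel) = 0"
proof -
  note [measurable] = fmult_measurable[OF u s(1)] fmult_measurable[OF u s(2)]
    schwartz_measurable[OF schwartz_ker[OF s(1)]]
  obtain C N where CN: "\<And>y. norm (fmult b u y) \<le> C * (1 + norm y) ^ N"
    using fmult_growth[OF u s(2)] by blast
  have rg: "rapid (\<lambda>y. cnj (fmult b u y) * of_real (\<theta> y))"
    by (rule rapid_mult_poly[OF \<theta>, of _ C N]) (use CN in auto)
  obtain B where B: "\<And>x. norm (ker a x) * (1 + norm x) ^ 0 \<le> B" using schwartz_decay[OF schwartz_ker[OF s(1)]] by blast
  have "conv (ker a) (\<lambda>y. cnj (fmult b u y) * of_real (\<theta> y)) z = 0" for z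
  proof -
    have rz: "rapid (\<lambda>y. cnj (ker a (z - y)) * of_real (\<theta> y))"
      by (rule rapid_mult_bounded[OF \<theta>, of _ B]) (use B in auto)
    have "conv (ker a) (\<lambda>y. cnj (fmult b u y) * of_real (\<theta> y)) z =
      (\<integral>y. cnj (fmult b u y * (cnj (ker a (z - y)) * of_real (\<theta> y))) \<partial>lborel)"
      unfolding conv_def by (intro Bochner_Integration.integral_cong refl) (simp add: mult_ac)
    also have "\<dots> = cnj (\<integral>y. fmult b u y * (cnj (ker a (z - y)) * of_real (\<theta> y)) \<partial>lborel)"
      by (rule Bochner_Integration.integral_cnj)
    also have "(\<integral>y. fmult b u y * (cnj (ker a (z - y)) * of_real (\<theta> y)) \<partial>lborel) =
      u (conv (ker b) (\<lambda>y. cnj (ker a (z - y)) * of_real (\<theta> y)))"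
      unfolding fmult_def by (rule tempered_conv[OF u schwartz_ker[OF s(2)] rz])
    also have "conv (ker b) (\<lambda>y. cnj (ker a (z - y)) * of_real (\<theta> y)) = (\<lambda>z'. 0)"
      by (rule ext, rule spectral_orthogonality[OF s \<theta> spec sep])
    finally show ?thesis by (simp add: tempered_zero[OF u])
  qed
  then have "conv (ker a) (\<lambda>y. cnj (fmult b u y) * of_real (\<theta> y)) = (\<lambda>z. 0)" ..
  then show ?thesis
    using tempered_conv[OF u schwartz_ker[OF s(1)] rg] by (simp add: fmult_def tempered_zero[OF u])
qed

text \<open>In the expanded square only pairs with |i - j| \<le> 2 survive. Each is bounded by half
  the sum of the two diagonal terms, and every index has at most five such partners.\<close>

lemma almost_orthogonal_sum:
  fixes F :: "nat \<Rightarrow> 'a \<Rightarrow> complex" and \<theta> :: "'a \<Rightarrow> real"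
  assumes S: "finite S" and nn: "\<And>x. 0 \<le> \<theta> x"
    and int: "\<And>i j. i \<in> S \<Longrightarrow> j \<in> S \<Longrightarrow> integrable M (\<lambda>x. F i x * (cnj (F j x) * of_real (\<theta> x)))"
    and zero: "\<And>i j. i \<in> S \<Longrightarrow> j \<in> S \<Longrightarrow> j + 3 \<le> i \<Longrightarrow> (\<integral>x. F i x * (cnj (F j x) * of_real (\<theta> x)) \<partial>M) = 0"
  shows "integrable M (\<lambda>x. (norm (\<Sum>j\<in>S. F j x))\<^sup>2 * \<theta> x)"
    and "\<And>j. j \<in> S \<Longrightarrow> integrable M (\<lambda>x. (norm (F j x))\<^sup>2 * \<theta> x)"
    and "(\<integral>x. (norm (\<Sum>j\<in>S. F j x))\<^sup>2 * \<theta> x \<partial>M) \<le> 5 * (\<Sum>j\<in>S. \<integral>x. (norm (F j x))\<^sup>2 * \<theta> x \<partial>M)"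
proof -
  define c where "c i j = (\<integral>x. F i x * (cnj (F j x) * of_real (\<theta> x)) \<partial>M)" for i j
  define a where "a j = (\<integral>x. (norm (F j x))\<^sup>2 * \<theta> x \<partial>M)" for j
  have sq: "complex_of_real ((norm z)\<^sup>2 * t) = z * (cnj z * of_real t)" for z t
    unfolding of_real_mult complex_norm_square by (rule mult.assoc)
  have exp: "complex_of_real ((norm (\<Sum>j\<in>S. F j x))\<^sup>2 * \<theta> x) = (\<Sum>i\<in>S. \<Sum>j\<in>S. F i x * (cnj (F j x) * of_real (\<theta> x)))" for x
  proof -
    have e: "cnj (\<Sum>j\<in>S. F j x) * of_real (\<theta> x) = (\<Sum>j\<in>S. cnj (F j x) * of_real (\<theta> x))"
      by (simp add: sum_distrib_right)
    show ?thesis unfolding sq e by (rule sum_product)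
  qed
  have intS: "integrable M (\<lambda>x. complex_of_real ((norm (\<Sum>j\<in>S. F j x))\<^sup>2 * \<theta> x))"
    unfolding exp by (intro Bochner_Integration.integrable_sum int)
  show i1: "integrable M (\<lambda>x. (norm (\<Sum>j\<in>S. F j x))\<^sup>2 * \<theta> x)"
    using integrable_Re[OF intS] by simp
  show i2: "integrable M (\<lambda>x. (norm (F j x))\<^sup>2 * \<theta> x)" if "j \<in> S" for j
    using integrable_Re[OF int[OF that that, folded sq]] by simp
  have "complex_of_real (\<integral>x. (norm (\<Sum>j\<in>S. F j x))\<^sup>2 * \<theta> x \<partial>M) = (\<Sum>i\<in>S. \<Sum>j\<in>S. c i j)"
    unfolding integral_complex_of_real[symmetric] exp c_def
    by (subst Bochner_Integration.integral_sum; intro sum.cong refl Bochner_Integration.integrable_sum Bochner_Integration.integral_sum int)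
  then have "(\<integral>x. (norm (\<Sum>j\<in>S. F j x))\<^sup>2 * \<theta> x \<partial>M) = Re (\<Sum>i\<in>S. \<Sum>j\<in>S. c i j)"
    by (metis Re_complex_of_real)
  also have "\<dots> = (\<Sum>i\<in>S. \<Sum>j\<in>S. Re (c i j))" by simp
  also have "\<dots> \<le> (\<Sum>i\<in>S. \<Sum>j\<in>S. (if i \<le> j + 2 \<and> j \<le> i + 2 then a i / 2 + a j / 2 else 0))"
  proof (intro sum_mono)
    fix i j assume ij: "i \<in> S" "j \<in> S"
    show "Re (c i j) \<le> (if i \<le> j + 2 \<and> j \<le> i + 2 then a i / 2 + a j / 2 else 0)"
    proof (cases "i \<le> j + 2 \<and> j \<le> i + 2")
      case True
      have "Re (c i j) = (\<integral>x. Re (F i x * (cnj (F j x) * of_real (\<theta> x))) \<partial>M)"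
        unfolding c_def by (rule integral_Re[OF int[OF ij], symmetric])
      also have "\<dots> \<le> (\<integral>x. (norm (F i x))\<^sup>2 * \<theta> x / 2 + (norm (F j x))\<^sup>2 * \<theta> x / 2 \<partial>M)"
      proof (rule integral_mono)
        fix x
        have "Re (F i x * (cnj (F j x) * of_real (\<theta> x))) \<le> norm (F i x * (cnj (F j x) * of_real (\<theta> x)))"
          by (rule complex_Re_le_cmod)
        also have "\<dots> = (norm (F i x) * norm (F j x)) * \<theta> x" using nn by (simp add: norm_mult)
        also have "\<dots> \<le> ((norm (F i x))\<^sup>2 / 2 + (norm (F j x))\<^sup>2 / 2) * \<theta> x"
          using sum_squares_bound[of "norm (F i x)" "norm (F j x)"] by (intro mult_right_mono nn) auto
        finally show "Re (F i x * (cnj (F j x) * of_real (\<theta> x))) \<le> (norm (F i x))\<^sup>2 * \<theta> x / 2 + (norm (F j x))\<^sup>2 * \<theta> x / 2"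
          by (simp add: distrib_right)
      qed (intro integrable_Re int ij Bochner_Integration.integrable_add integrable_divide_zero i2 impI)+
      also have "\<dots> = a i / 2 + a j / 2"
        unfolding a_def using i2[OF ij(1)] i2[OF ij(2)] by simp
      finally show ?thesis using True by simp
    next
      case False
      have "c i j = 0"
      proof (cases "j + 3 \<le> i")
        case True then show ?thesis unfolding c_def by (rule zero[OF ij])
      next
        case False
        then have "i + 3 \<le> j" using \<open>\<not> (i \<le> j + 2 \<and> j \<le> i + 2)\<close> by linarith
        then have "c j i = 0" unfolding c_def by (rule zero[OF ij(2,1)])
        moreover have "c i j = cnj (c j i)"
          unfolding c_def Bochner_Integration.integral_cnj[symmetric]
          by (intro Bochner_Integration.integral_cong refl) (simp add: mult_ac)
        ultimately show ?thesis by simp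
      qed
      then show ?thesis using False by auto
    qed
  qed
  also have "\<dots> = (\<Sum>i\<in>S. \<Sum>j\<in>S. if i \<le> j + 2 \<and> j \<le> i + 2 then a i / 2 else 0) +
     (\<Sum>i\<in>S. \<Sum>j\<in>S. if i \<le> j + 2 \<and> j \<le> i + 2 then a j / 2 else 0)"
    unfolding sum.distrib[symmetric] by (intro sum.cong refl) auto
  also have "(\<Sum>i\<in>S. \<Sum>j\<in>S. if i \<le> j + 2 \<and> j \<le> i + 2 then a j / 2 else 0) =
      (\<Sum>i\<in>S. \<Sum>j\<in>S. if i \<le> j + 2 \<and> j \<le> i + 2 then a i / 2 else 0)"
    by (subst sum.swap) (intro sum.cong refl, auto)
  also have "(\<Sum>i\<in>S. \<Sum>j\<in>S. if i \<le> j + 2 \<and> j \<le> i + 2 then a i / 2 else 0) \<le> (\<Sum>i\<in>S. 5 * (a i / 2))"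
  proof (rule sum_mono)
    fix i assume "i \<in> S"
    have a0: "a i \<ge> 0" unfolding a_def by (intro integral_nonneg_AE AE_I2 mult_nonneg_nonneg nn) simp
    have "(\<Sum>j\<in>S. if i \<le> j + 2 \<and> j \<le> i + 2 then a i / 2 else 0) = (\<Sum>j\<in>{j\<in>S. i \<le> j + 2 \<and> j \<le> i + 2}. a i / 2)"
      by (rule sum.inter_filter[OF S, symmetric])
    also have "\<dots> = real (card {j\<in>S. i \<le> j + 2 \<and> j \<le> i + 2}) * (a i / 2)" by simp
    \<comment> \<open>Subtraction on \<open>nat\<close> truncates at 0, which only makes the
      interval smaller than five.\<close>
    also have "card {j\<in>S. i \<le> j + 2 \<and> j \<le> i + 2} \<le> card {i - 2..i + 2}"
      by (intro card_mono) auto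
    then have "real (card {j\<in>S. i \<le> j + 2 \<and> j \<le> i + 2}) * (a i / 2) \<le> 5 * (a i / 2)"
      using a0 by (intro mult_right_mono) auto
    finally show "(\<Sum>j\<in>S. if i \<le> j + 2 \<and> j \<le> i + 2 then a i / 2 else 0) \<le> 5 * (a i / 2)" .
  qed
  finally show "(\<integral>x. (norm (\<Sum>j\<in>S. F j x))\<^sup>2 * \<theta> x \<partial>M) \<le> 5 * (\<Sum>j\<in>S. \<integral>x. (norm (F j x))\<^sup>2 * \<theta> x \<partial>M)"
    by (simp add: a_def sum_distrib_left)
qed

lemma rapid_dilate:
  fixes g :: "real^'n \<Rightarrow> complex"
  assumes "rapid g" "c \<noteq> 0"
  shows "rapid (\<lambda>x. g (c *\<^sub>R x))"
  unfolding rapid_def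
proof (intro conjI allI)
  note [measurable] = rapid_measurable[OF assms(1)]
  show "(\<lambda>x. g (c *\<^sub>R x)) \<in> borel_measurable borel" by measurable
  fix N
  obtain C where C: "\<And>x. norm (g x) * (1 + norm x) ^ N \<le> C" using assms(1) unfolding rapid_def by blast
  have "norm (g (c *\<^sub>R x)) * (1 + norm x) ^ N \<le> (1 + 1 / \<bar>c\<bar>) ^ N * C" for x
  proof -
    have "1 + norm x \<le> (1 + 1 / \<bar>c\<bar>) * (1 + norm (c *\<^sub>R x))"
      using assms(2) by (simp add: distrib_left distrib_right)
    then have "(1 + norm x) ^ N \<le> ((1 + 1 / \<bar>c\<bar>) * (1 + norm (c *\<^sub>R x))) ^ N" by (intro power_mono) auto
    then have "norm (g (c *\<^sub>R x)) * (1 + norm x) ^ N \<le> norm (g (c *\<^sub>R x)) * ((1 + 1 / \<bar>c\<bar>) * (1 + norm (c *\<^sub>R x))) ^ N"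
      by (rule mult_left_mono) simp
    also have "\<dots> = (1 + 1 / \<bar>c\<bar>) ^ N * (norm (g (c *\<^sub>R x)) * (1 + norm (c *\<^sub>R x)) ^ N)"
      unfolding power_mult_distrib by (simp only: mult_ac)
    also have "\<dots> \<le> (1 + 1 / \<bar>c\<bar>) ^ N * C" by (intro mult_left_mono C zero_le_power) simp
    finally show ?thesis .
  qed
  then show "\<exists>C. \<forall>x. norm (g (c *\<^sub>R x)) * (1 + norm x) ^ N \<le> C" by blast
qed

lemma borel_measurable_vec_nth_comp [measurable]:
  fixes f :: "'a \<Rightarrow> real^'n"
  assumes "f \<in> borel_measurable M" shows "(\<lambda>x. f x $ i) \<in> borel_measurable M"
proof -
  have "(\<lambda>x::real^'n. x $ i) \<in> borel_measurable borel"
    by (intro borel_measurable_continuous_onI continuous_intros)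
  then show ?thesis by (rule measurable_compose[OF assms])
qed

section \<open>Dyadic cubes\<close>

text \<open>Membership of two points in a common dyadic cube of level \<open>k\<close> as a
  symmetric measurable relation, so that it can serve as the kernel of a double integral.\<close>

definition same_cube :: "nat \<Rightarrow> real^'n \<Rightarrow> real^'n \<Rightarrow> bool" where
  "same_cube k x y \<longleftrightarrow> (\<forall>i. \<lfloor>2 ^ k * x $ i\<rfloor> = \<lfloor>2 ^ k * y $ i\<rfloor>)"

lemma mem_dyadic_cube: "x \<in> dyadic_cube k m \<longleftrightarrow> (\<forall>i. \<lfloor>2 ^ k * x $ i\<rfloor> = m i)"
  unfolding dyadic_cube_def mem_Collect_eq floor_eq_iff
  by (simp add: divide_le_eq less_divide_eq mult.commute)

lemma same_cube_eq_dyadic: "{y. same_cube k x y} = dyadic_cube k (\<lambda>i. \<lfloor>2 ^ k * x $ i\<rfloor>)"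
  by (auto simp: same_cube_def mem_dyadic_cube)

lemma same_cube_sym: "same_cube k x y \<longleftrightarrow> same_cube k y x"
  by (auto simp: same_cube_def)

lemma sets_dyadic_cube [measurable]: "(dyadic_cube k m :: (real^'n) set) \<in> sets borel"
proof -
  have "Measurable.pred borel (\<lambda>x::real^'n. \<forall>i. of_int (m i) / 2 ^ k \<le> x $ i \<and> x $ i < (of_int (m i) + 1) / 2 ^ k)"
    by measurable
  then show ?thesis unfolding dyadic_cube_def by (simp add: pred_def)
qed

lemma emeasure_dyadic_cube: "emeasure lborel (dyadic_cube k m :: (real^'n) set) = ennreal (1 / (2 ^ k) ^ CARD('n))"
proof -
  define a b :: "real^'n" where "a = (\<chi> i. of_int (m i) / 2 ^ k)" and "b = (\<chi> i. (of_int (m i) + 1) / 2 ^ k)"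
  have le: "a \<bullet> e \<le> b \<bullet> e" "(b - a) \<bullet> e = 1 / 2 ^ k" if "e \<in> Basis" for e :: "real^'n"
    using that by (auto simp: Basis_vec_def a_def b_def inner_axis divide_simps)
  then have p: "(\<Prod>e\<in>(Basis::(real^'n) set). (b - a) \<bullet> e) = 1 / (2 ^ k) ^ CARD('n)"
    by (simp add: power_divide DIM_cart)
  have "box a b \<subseteq> dyadic_cube k m" "dyadic_cube k m \<subseteq> cbox a b"
    by (auto simp: mem_box_cart dyadic_cube_def a_def b_def less_imp_le)
  then have "emeasure lborel (box a b) \<le> emeasure lborel (dyadic_cube k m :: (real^'n) set)"
    "emeasure lborel (dyadic_cube k m :: (real^'n) set) \<le> emeasure lborel (cbox a b)"
    by (auto intro!: emeasure_mono)
  then show ?thesis using le p by (simp add: emeasure_lborel_box_eq emeasure_lborel_cbox_eq antisym)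
qed

lemma same_cube_dist:
  fixes x y :: "real^'n"
  assumes "same_cube k x y" shows "dist x y \<le> CARD('n) / 2 ^ k"
proof -
  have "\<bar>(x - y) $ i\<bar> \<le> 1 / 2 ^ k" for i
  proof -
    have "\<lfloor>2 ^ k * x $ i\<rfloor> = \<lfloor>2 ^ k * y $ i\<rfloor>" using assms by (simp add: same_cube_def)
    then have "\<bar>2 ^ k * x $ i - 2 ^ k * y $ i\<bar> \<le> 1" by linarith
    moreover have "2 ^ k * \<bar>(x - y) $ i\<bar> = \<bar>2 ^ k * x $ i - 2 ^ k * y $ i\<bar>"
      by (simp add: abs_mult right_diff_distrib[symmetric])
    ultimately show ?thesis by (simp add: field_simps)
  qed
  then have "(\<Sum>i\<in>UNIV. \<bar>(x - y) $ i\<bar>) \<le> (\<Sum>i\<in>(UNIV::'n set). 1 / 2 ^ k)" by (rule sum_mono)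
  then show ?thesis using norm_le_l1_cart[of "x - y"] by (simp add: dist_norm)
qed

text \<open>Each value at \<open>y\<close> is spread evenly over the points \<open>x\<close> of its
  cube, with \<open>c\<close> the inverse volume. Replacing W y by V x and exchanging the integrals
  leaves the average of \<open>h\<close> over the cube of \<open>x\<close>, at most
  \<open>A\<close>.\<close>

lemma cube_average_bound:
  fixes h W V :: "real^'n \<Rightarrow> ennreal"
  assumes [measurable]: "h \<in> borel_measurable borel" "W \<in> borel_measurable borel" "V \<in> borel_measurable borel"
    and avg: "\<And>m. (\<integral>\<^sup>+x\<in>dyadic_cube k m. h x \<partial>lborel) \<le> A * emeasure lborel (dyadic_cube k m :: (real^'n) set)"
    and WV: "\<And>x y. same_cube k x y \<Longrightarrow> W y \<le> V x"
  shows "(\<integral>\<^sup>+y. h y * W y \<partial>lborel) \<le> A * (\<integral>\<^sup>+x. V x \<partial>lborel)"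
proof -
  define c :: real where "c = (2 ^ k) ^ CARD('n)"
  have c: "ennreal c * ennreal (1 / (2 ^ k) ^ CARD('n)) = 1"
    by (subst ennreal_mult[symmetric]) (simp_all add: c_def)
  let ?I = "\<lambda>x y. indicator {p. same_cube k (fst p) (snd p)} (x, y) :: ennreal"
  have "Measurable.pred (borel \<Otimes>\<^sub>M borel) (\<lambda>p::(real^'n) \<times> (real^'n). \<forall>i. \<lfloor>2 ^ k * fst p $ i\<rfloor> = \<lfloor>2 ^ k * snd p $ i\<rfloor>)"
    by measurable
  then have [measurable]: "{p::(real^'n) \<times> (real^'n). same_cube k (fst p) (snd p)} \<in> sets (borel \<Otimes>\<^sub>M borel)"
    unfolding same_cube_def by (simp add: pred_def space_pair_measure)
  have Ieq: "?I x y = indicator (dyadic_cube k (\<lambda>i. \<lfloor>2 ^ k * x $ i\<rfloor>)) y"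
    "?I x y = indicator (dyadic_cube k (\<lambda>i. \<lfloor>2 ^ k * y $ i\<rfloor>)) x" for x y
    unfolding same_cube_eq_dyadic[symmetric] by (auto simp: indicator_def same_cube_sym)
  have "(\<integral>\<^sup>+y. h y * W y \<partial>lborel) = (\<integral>\<^sup>+y. \<integral>\<^sup>+x. ennreal c * (h y * W y * ?I x y) \<partial>lborel \<partial>lborel)"
  proof (rule nn_integral_cong)
    fix y :: "real^'n"
    have "(\<integral>\<^sup>+x. ennreal c * (h y * W y * ?I x y) \<partial>lborel) = ennreal c * (h y * W y * emeasure lborel (dyadic_cube k (\<lambda>i. \<lfloor>2 ^ k * y $ i\<rfloor>) :: (real^'n) set))"
      unfolding Ieq(2) by (simp add: nn_integral_cmult)
    also have "\<dots> = h y * W y * (ennreal c * ennreal (1 / (2 ^ k) ^ CARD('n)))"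
      unfolding emeasure_dyadic_cube by (simp only: mult_ac)
    also have "\<dots> = h y * W y" unfolding c by simp
    finally show "h y * W y = (\<integral>\<^sup>+x. ennreal c * (h y * W y * ?I x y) \<partial>lborel)" ..
  qed
  also have "\<dots> \<le> (\<integral>\<^sup>+y. \<integral>\<^sup>+x. ennreal c * (V x * (h y * ?I x y)) \<partial>lborel \<partial>lborel)"
    using WV by (intro nn_integral_mono mult_left_mono) (auto simp: indicator_def mult.commute intro!: mult_right_mono)
  also have "\<dots> = (\<integral>\<^sup>+x. \<integral>\<^sup>+y. ennreal c * (V x * (h y * ?I x y)) \<partial>lborel \<partial>lborel)"
    by (rule lborel_pair.Fubini') measurable
  also have "\<dots> = (\<integral>\<^sup>+x. ennreal c * (V x * (\<integral>\<^sup>+y\<in>dyadic_cube k (\<lambda>i. \<lfloor>2 ^ k * x $ i\<rfloor>). h y \<partial>lborel)) \<partial>lborel)"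
    unfolding Ieq(1) by (simp add: nn_integral_cmult)
  also have "\<dots> \<le> (\<integral>\<^sup>+x. ennreal c * (V x * (A * ennreal (1 / (2 ^ k) ^ CARD('n)))) \<partial>lborel)"
    using avg unfolding emeasure_dyadic_cube by (intro nn_integral_mono mult_left_mono) auto
  also have "\<dots> = (\<integral>\<^sup>+x. A * V x * (ennreal c * ennreal (1 / (2 ^ k) ^ CARD('n))) \<partial>lborel)"
    by (simp only: mult_ac)
  also have "\<dots> = A * (\<integral>\<^sup>+x. V x \<partial>lborel)" unfolding c by (simp add: nn_integral_cmult)
  finally show ?thesis .
qed

text \<open>The condition 1 / l \<le> 2^k says that the cubes are no larger than the scale of the
  bump, so after rescaling two points of one cube are at distance at most n. The majorant
  \<open>wt\<close> then changes only by the factor (1 + n)^(2 n), and \<open>K\<close> depends on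
  \<theta> alone.\<close>

lemma weighted_average_bound:
  fixes \<theta> :: "real^'n \<Rightarrow> real"
  assumes \<theta>: "rapid (\<lambda>y. complex_of_real (\<theta> y))" and [measurable]: "\<theta> \<in> borel_measurable borel"
  shows "\<exists>K\<ge>0. \<forall>h k A l a. h \<in> borel_measurable borel \<longrightarrow>
    (\<forall>m. (\<integral>\<^sup>+x\<in>dyadic_cube k m. h x \<partial>lborel) \<le> A * emeasure lborel (dyadic_cube k m :: (real^'n) set)) \<longrightarrow>
    0 < l \<longrightarrow> 1 / l \<le> 2 ^ k \<longrightarrow>
    (\<integral>\<^sup>+y. h y * ennreal (\<theta> ((1 / l) *\<^sub>R (y - a))) \<partial>lborel) \<le> A * ennreal (K * l ^ CARD('n))"
proof -
  obtain C where C: "C \<ge> 0" "\<And>x. norm (complex_of_real (\<theta> x)) * (1 + norm x) ^ 0 \<le> C * wt x"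
    using rapidE[OF \<theta>, of 0] by blast
  have C': "\<theta> x \<le> C * wt x" for x using C(2)[of x] by simp
  define K1 where "K1 = C * (1 + real CARD('n)) ^ (2 * CARD('n))"
  define I where "I = (\<integral>x. wt x \<partial>(lborel::(real^'n) measure))"
  have I0: "I \<ge> 0" unfolding I_def by (rule integral_nonneg_AE) (simp add: wt_pos less_imp_le)
  have I: "(\<integral>\<^sup>+x. ennreal (wt x) \<partial>(lborel::(real^'n) measure)) = ennreal I"
    unfolding I_def by (rule nn_integral_eq_integral[OF integrable_wt]) (simp add: wt_pos less_imp_le)
  have K1: "K1 \<ge> 0" using C(1) by (simp add: K1_def)
  show ?thesis
  proof (intro exI[of _ "K1 * I"] conjI allI impI)
    show "0 \<le> K1 * I" using K1 I0 by simp
    fix h :: "real^'n \<Rightarrow> ennreal" and k :: nat and A and l :: real and a :: "real^'n"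
    assume h: "h \<in> borel_measurable borel"
      and avg: "\<forall>m. (\<integral>\<^sup>+x\<in>dyadic_cube k m. h x \<partial>lborel) \<le> A * emeasure lborel (dyadic_cube k m :: (real^'n) set)"
      and l: "0 < l" "1 / l \<le> 2 ^ k"
    have "(\<integral>\<^sup>+y. h y * ennreal (\<theta> ((1 / l) *\<^sub>R (y - a))) \<partial>lborel)
        \<le> A * (\<integral>\<^sup>+x. ennreal (K1 * wt ((1 / l) *\<^sub>R (x - a))) \<partial>lborel)"
    proof (rule cube_average_bound[OF h _ _ avg[rule_format]])
      fix x y :: "real^'n" assume xy: "same_cube k x y"
      have "dist ((1 / l) *\<^sub>R (y - a)) ((1 / l) *\<^sub>R (x - a)) = (1 / l) * dist y x"
        using l(1) by (simp add: dist_norm scaleR_diff_right[symmetric])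
      also have "\<dots> \<le> 2 ^ k * (CARD('n) / 2 ^ k)"
        using same_cube_dist[OF xy] l by (intro mult_mono) (auto simp: dist_commute)
      finally have "dist ((1 / l) *\<^sub>R (y - a)) ((1 / l) *\<^sub>R (x - a)) \<le> CARD('n)" by simp
      then have "wt ((1 / l) *\<^sub>R (y - a)) \<le> (1 + real CARD('n)) ^ (2 * CARD('n)) * wt ((1 / l) *\<^sub>R (x - a))"
        by (rule wt_compare)
      then have "C * wt ((1 / l) *\<^sub>R (y - a)) \<le> C * ((1 + real CARD('n)) ^ (2 * CARD('n)) * wt ((1 / l) *\<^sub>R (x - a)))"
        using C(1) by (intro mult_left_mono) auto
      then show "ennreal (\<theta> ((1 / l) *\<^sub>R (y - a))) \<le> ennreal (K1 * wt ((1 / l) *\<^sub>R (x - a)))"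
        using C'[of "(1 / l) *\<^sub>R (y - a)"] by (intro ennreal_leI) (simp add: K1_def mult.assoc)
    qed measurable
    also have "(\<integral>\<^sup>+x. ennreal (K1 * wt ((1 / l) *\<^sub>R (x - a))) \<partial>lborel) = ennreal (K1 * I * l ^ CARD('n))"
    proof -
      have "(\<integral>\<^sup>+x. ennreal (K1 * wt ((1 / l) *\<^sub>R (x - a))) \<partial>lborel) =
          ennreal (\<bar>l\<bar> ^ CARD('n)) * (\<integral>\<^sup>+x. ennreal (K1 * wt ((1 / l) *\<^sub>R (a + l *\<^sub>R x - a))) \<partial>lborel)"
        using l(1) by (subst nn_integral_affine[of l _ a]) auto
      also have "(\<integral>\<^sup>+x. ennreal (K1 * wt ((1 / l) *\<^sub>R (a + l *\<^sub>R x - a))) \<partial>(lborel::(real^'n) measure)) = ennreal K1 * ennreal I"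
        using l(1) K1 by (simp add: ennreal_mult wt_pos less_imp_le nn_integral_cmult I)
      finally show ?thesis using l(1) K1 I0 by (simp add: ennreal_mult[symmetric] mult_ac)
    qed
    finally show "(\<integral>\<^sup>+y. h y * ennreal (\<theta> ((1 / l) *\<^sub>R (y - a))) \<partial>lborel) \<le> A * ennreal (K1 * I * l ^ CARD('n))" .
  qed
qed

section \<open>Littlewood--Paley pieces\<close>

abbreviation csym :: "(real^'n \<Rightarrow> real) \<Rightarrow> nat \<Rightarrow> real^'n \<Rightarrow> complex" where
  "csym \<phi>0 j \<equiv> \<lambda>\<xi>. complex_of_real (TL_symbol \<phi>0 j \<xi>)"

abbreviation clow :: "(real^'n \<Rightarrow> real) \<Rightarrow> nat \<Rightarrow> real^'n \<Rightarrow> complex" where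
  "clow \<phi>0 j \<equiv> \<lambda>\<xi>. complex_of_real (\<phi>0 ((1 / 2 ^ j) *\<^sub>R \<xi>))"

lemma TL_symbol_Suc: "TL_symbol \<phi>0 (Suc j) \<xi> = \<phi>0 ((1 / 2 ^ Suc j) *\<^sub>R \<xi>) - \<phi>0 ((1 / 2 ^ j) *\<^sub>R \<xi>)"
  by (simp add: TL_symbol_def)

context
  fixes \<phi>0 :: "real^'n \<Rightarrow> real"
  assumes gen: "TL_generator \<phi>0"
begin

lemma schwartz_generator: "schwartz (\<lambda>\<xi>. complex_of_real (\<phi>0 \<xi>))"
  using gen by (simp add: TL_generator_def)

lemma generator_eq_1: "norm \<xi> \<le> 1 \<Longrightarrow> \<phi>0 \<xi> = 1"
  using gen by (simp add: TL_generator_def)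

lemma generator_eq_0:
  assumes "3 / 2 < norm \<xi>" shows "\<phi>0 \<xi> = 0"
proof (rule ccontr)
  assume "\<phi>0 \<xi> \<noteq> 0"
  then have "\<xi> \<in> {\<xi>. \<phi>0 \<xi> \<noteq> 0}" by simp
  moreover have "closure {\<xi>. \<phi>0 \<xi> \<noteq> 0} \<subseteq> cball 0 (3/2)" using gen by (simp add: TL_generator_def)
  ultimately have "\<xi> \<in> cball 0 (3/2)" by (meson closure_subset subsetD)
  then show False using assms by simp
qed

lemma schwartz_clow: "schwartz (clow \<phi>0 j)"
  by (rule schwartz_dilate[OF schwartz_generator]) simp

lemma csym_Suc: "csym \<phi>0 (Suc j) = (\<lambda>\<xi>. clow \<phi>0 (Suc j) \<xi> - clow \<phi>0 j \<xi>)"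
  by (rule ext) (simp add: TL_symbol_Suc)

lemma csym_0: "csym \<phi>0 0 = clow \<phi>0 0"
  by (rule ext) (simp add: TL_symbol_def)

lemma schwartz_csym: "schwartz (csym \<phi>0 j)"
proof (cases j)
  case 0
  then show ?thesis using schwartz_clow[of 0] by (simp add: csym_0)
next
  case (Suc i)
  show ?thesis unfolding Suc csym_Suc by (intro schwartz_diff schwartz_clow)
qed

lemma TL_symbol_support:
  assumes "TL_symbol \<phi>0 j \<xi> \<noteq> 0"
  shows "norm \<xi> \<le> 3 / 2 * 2 ^ j" and "0 < j \<Longrightarrow> 2 ^ j < 2 * norm \<xi>"
proof -
  show "norm \<xi> \<le> 3 / 2 * 2 ^ j"
  proof (rule ccontr)
    assume "\<not> norm \<xi> \<le> 3 / 2 * 2 ^ j"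
    then have *: "3 / 2 * 2 ^ j < norm \<xi>" by simp
    then have 1: "3 / 2 < norm ((1 / 2 ^ j) *\<^sub>R \<xi>)" by (simp add: less_divide_eq)
    moreover have "norm (2 *\<^sub>R (1 / 2 ^ j) *\<^sub>R \<xi>) = 2 * norm ((1 / 2 ^ j) *\<^sub>R \<xi>)" by simp
    with 1 have "3 / 2 < norm (2 *\<^sub>R (1 / 2 ^ j) *\<^sub>R \<xi>)" by linarith
    ultimately have "TL_symbol \<phi>0 j \<xi> = 0"
      using generator_eq_0 by (cases "j = 0") (auto simp: TL_symbol_def)
    then show False using assms by simp
  qed
  show "2 ^ j < 2 * norm \<xi>" if "0 < j"
  proof (rule ccontr)
    assume "\<not> 2 ^ j < 2 * norm \<xi>"
    then have *: "2 * norm \<xi> \<le> 2 ^ j" by simp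
    then have "norm (2 *\<^sub>R (1 / 2 ^ j) *\<^sub>R \<xi>) \<le> 1" by (simp add: divide_le_eq)
    moreover have "norm \<xi> \<le> 2 ^ j" using * norm_ge_zero[of \<xi>] by linarith
    then have "norm ((1 / 2 ^ j) *\<^sub>R \<xi>) \<le> 1" by (simp add: divide_le_eq)
    ultimately have "TL_symbol \<phi>0 j \<xi> = 0"
      using generator_eq_1 that by (simp add: TL_symbol_def)
    then show False using assms by simp
  qed
qed

text \<open>The dilation is 2^(j+1) rather than 2^j because the symbol reaches out to 3/2 times 2^j,
  where \<open>\<phi>0\<close> dilated by 2^j need not equal 1.\<close>

lemma csym_reproduce: "csym \<phi>0 j \<xi> = (\<lambda>\<xi>. complex_of_real (\<phi>0 \<xi>)) ((1 / 2 ^ Suc j) *\<^sub>R \<xi>) * csym \<phi>0 j \<xi>"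
proof (cases "TL_symbol \<phi>0 j \<xi> = 0")
  case False
  then have "norm \<xi> \<le> 3 / 2 * 2 ^ j" by (rule TL_symbol_support)
  also have "\<dots> \<le> 2 ^ Suc j" by simp
  finally have "norm ((1 / 2 ^ Suc j) *\<^sub>R \<xi>) \<le> 1" by (simp add: divide_le_eq)
  then show ?thesis by (simp add: generator_eq_1)
qed simp

text \<open>For i \<ge> j + 3 the inner radius of the higher annulus is at least 4 times 2^j and the
  outer radius of the lower one is 3/2 times 2^j; the gap exceeds 2^j, the largest spectral radius
  allowed for the bump.\<close>

lemma TL_symbol_separated:
  assumes "TL_symbol \<phi>0 i \<xi> \<noteq> 0" "TL_symbol \<phi>0 j \<zeta> \<noteq> 0" "j + 3 \<le> i"
  shows "2 ^ j < norm (\<zeta> - \<xi>)"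
proof -
  have "(2::real) ^ (j + 3) \<le> 2 ^ i" using assms(3) by (intro power_increasing) auto
  then have "8 * 2 ^ j \<le> (2::real) ^ i" by (simp add: power_add)
  moreover have "2 ^ i < 2 * norm \<xi>" using assms by (intro TL_symbol_support) auto
  moreover have "norm \<zeta> \<le> 3 / 2 * 2 ^ j" using assms(2) by (rule TL_symbol_support)
  moreover have "norm \<xi> \<le> norm \<zeta> + norm (\<zeta> - \<xi>)" by (metis norm_minus_commute norm_triangle_sub)
  moreover have "(0::real) < 2 ^ j" by simp
  ultimately show ?thesis by linarith
qed

context
  fixes u :: "(real^'n \<Rightarrow> complex) \<Rightarrow> complex"
  assumes u: "tempered u"
begin

lemma TL_piece_eq_fmult: "TL_piece \<phi>0 j u = fmult (csym \<phi>0 j) u"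
  unfolding TL_piece_def by (subst multiplier_eq_fmult[OF schwartz_csym _ u]) auto

lemma TL_piece_continuous: "continuous_on S (TL_piece \<phi>0 j u)"
  unfolding TL_piece_eq_fmult by (rule fmult_continuous[OF u schwartz_csym])

lemma TL_piece_measurable: "TL_piece \<phi>0 j u \<in> borel_measurable borel"
  by (intro borel_measurable_continuous_onI TL_piece_continuous)

lemma sum_TL_piece: "(\<Sum>j<Suc J. TL_piece \<phi>0 j u x) = fmult (clow \<phi>0 J) u x"
proof (induction J)
  case 0
  then show ?case by (simp add: TL_piece_eq_fmult csym_0)
next
  case (Suc J)
  have "clow \<phi>0 (Suc J) = (\<lambda>\<xi>. clow \<phi>0 J \<xi> + csym \<phi>0 (Suc J) \<xi>)"
    by (rule ext) (simp add: TL_symbol_Suc)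
  then have "fmult (clow \<phi>0 (Suc J)) u x = fmult (\<lambda>\<xi>. clow \<phi>0 J \<xi> + csym \<phi>0 (Suc J) \<xi>) u x"
    by (simp only:)
  also have "\<dots> = fmult (clow \<phi>0 J) u x + fmult (csym \<phi>0 (Suc J)) u x"
    by (rule fmult_add[OF u schwartz_clow schwartz_csym])
  finally show ?case using Suc by (simp add: TL_piece_eq_fmult)
qed

lemma TL_piece_rescaled:
  "TL_piece \<phi>0 j u ((1 / 2 ^ Suc j) *\<^sub>R x) =
    (\<integral>y. TL_piece \<phi>0 j u ((1 / 2 ^ Suc j) *\<^sub>R y) * ker (\<lambda>\<xi>. complex_of_real (\<phi>0 \<xi>)) (y - x) \<partial>lborel)"
  unfolding TL_piece_eq_fmult
  by (rule fmult_rescaled_reproducing[OF u schwartz_generator schwartz_csym _ csym_reproduce]) simp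

text \<open>The bump dilated to scale \<open>l\<close> has spectrum in the ball of radius 1 / l
  \<le> 2^k \<le> 2^j for every index used, which is inside the gap between pieces three levels
  apart.\<close>

lemma TL_pieces_L2:
  fixes \<theta> :: "real^'n \<Rightarrow> real"
  assumes \<theta>: "rapid (\<lambda>y. complex_of_real (\<theta> y))" "\<theta> \<in> borel_measurable borel" "\<And>y. 0 \<le> \<theta> y"
    and spec: "\<And>v. 1 < norm v \<Longrightarrow> (\<integral>y. of_real (\<theta> y) * chi y v \<partial>lborel) = 0"
    and l: "0 < l" "1 / l \<le> 2 ^ k"
    and S: "finite S" "S \<subseteq> {k..}"
  shows "(\<integral>\<^sup>+y. ennreal ((norm (\<Sum>j\<in>S. TL_piece \<phi>0 j u y))\<^sup>2 * \<theta> ((1 / l) *\<^sub>R (y - a))) \<partial>lborel)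
    \<le> 5 * (\<Sum>j\<in>S. \<integral>\<^sup>+y. ennreal ((norm (TL_piece \<phi>0 j u y))\<^sup>2 * \<theta> ((1 / l) *\<^sub>R (y - a))) \<partial>lborel)"
proof -
  note [measurable] = \<theta>(2) TL_piece_measurable
  let ?\<theta> = "\<lambda>y. \<theta> ((1 / l) *\<^sub>R (y - a))"
  let ?F = "\<lambda>j. TL_piece \<phi>0 j u"
  have r\<theta>: "rapid (\<lambda>y. complex_of_real (?\<theta> y))"
    using rapid_translate[OF rapid_dilate[OF \<theta>(1), of "1 / l"], of a] l(1) by simp
  have spec': "(\<integral>y. of_real (?\<theta> y) * chi y v \<partial>lborel) = 0" if v: "1 / l < norm v" for v
  proof -
    have "(\<integral>y. of_real (?\<theta> y) * chi y v \<partial>lborel) = of_real (l ^ CARD('n)) * (\<integral>w. of_real (?\<theta> (a + l *\<^sub>R w)) * chi (a + l *\<^sub>R w) v \<partial>lborel)"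
      using l(1) by (subst integral_affine[where f = "\<lambda>y. of_real (?\<theta> y) * chi y v"])
        (auto simp: scaleR_conv_of_real[where 'a = complex])
    also have "(\<integral>w. of_real (?\<theta> (a + l *\<^sub>R w)) * chi (a + l *\<^sub>R w) v \<partial>lborel) =
        (\<integral>w. chi a v * (of_real (\<theta> w) * chi w (l *\<^sub>R v)) \<partial>lborel)"
      using l(1) by (intro Bochner_Integration.integral_cong refl) (simp add: chi_add chi_scale mult_ac)
    also have "\<dots> = 0"
      unfolding integral_mult_right_zero using spec[of "l *\<^sub>R v"] v l(1) by (simp add: divide_less_eq mult.commute)
    finally show ?thesis by simp
  qed
  have gr: "\<exists>C N. C \<ge> 0 \<and> (\<forall>y. norm (?F j y) \<le> C * (1 + norm y) ^ N)" for j
    unfolding TL_piece_eq_fmult by (rule fmult_growth[OF u schwartz_csym])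
  have int: "integrable lborel (\<lambda>y. ?F i y * (cnj (?F j y) * of_real (?\<theta> y)))" for i j
  proof -
    obtain C N where C: "\<And>y. norm (?F i y) \<le> C * (1 + norm y) ^ N" using gr by blast
    obtain D M where D: "\<And>y. norm (?F j y) \<le> D * (1 + norm y) ^ M" using gr by blast
    have "rapid (\<lambda>y. cnj (?F j y) * of_real (?\<theta> y))"
      by (rule rapid_mult_poly[OF r\<theta>, of _ D M]) (use D in auto)
    from rapid_mult_poly[OF this TL_piece_measurable C] show ?thesis by (rule rapid_integrable)
  qed
  have zero: "(\<integral>y. ?F i y * (cnj (?F j y) * of_real (?\<theta> y)) \<partial>lborel) = 0" if "i \<in> S" "j \<in> S" "j + 3 \<le> i" for i j
    unfolding TL_piece_eq_fmult
  proof (rule fmult_orthogonal[OF u schwartz_csym schwartz_csym r\<theta> spec'])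
    fix \<xi> \<zeta> assume "csym \<phi>0 i \<xi> \<noteq> 0" "csym \<phi>0 j \<zeta> \<noteq> 0"
    then have "2 ^ j < norm (\<zeta> - \<xi>)" using TL_symbol_separated[of i \<xi> j \<zeta>] that by simp
    moreover have "(2::real) ^ k \<le> 2 ^ j" using S(2) that(2) by (intro power_increasing) auto
    ultimately show "1 / l < norm (\<zeta> - \<xi>)" using l(2) by linarith
  qed
  note ao = almost_orthogonal_sum[OF S(1) \<theta>(3) int zero]
  have "(\<integral>\<^sup>+y. ennreal ((norm (\<Sum>j\<in>S. ?F j y))\<^sup>2 * ?\<theta> y) \<partial>lborel) = ennreal (\<integral>y. (norm (\<Sum>j\<in>S. ?F j y))\<^sup>2 * ?\<theta> y \<partial>lborel)"
    by (rule nn_integral_eq_integral[OF ao(1)]) (auto simp: \<theta>(3))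
  also have "\<dots> \<le> ennreal (5 * (\<Sum>j\<in>S. \<integral>y. (norm (?F j y))\<^sup>2 * ?\<theta> y \<partial>lborel))"
    by (rule ennreal_leI[OF ao(3)])
  also have "\<dots> = 5 * (\<Sum>j\<in>S. ennreal (\<integral>y. (norm (?F j y))\<^sup>2 * ?\<theta> y \<partial>lborel))"
    by (subst sum_ennreal) (auto simp: ennreal_mult' \<theta>(3) intro!: integral_nonneg_AE)
  also have "(\<Sum>j\<in>S. ennreal (\<integral>y. (norm (?F j y))\<^sup>2 * ?\<theta> y \<partial>lborel)) = (\<Sum>j\<in>S. \<integral>\<^sup>+y. ennreal ((norm (?F j y))\<^sup>2 * ?\<theta> y) \<partial>lborel)"
    by (intro sum.cong refl nn_integral_eq_integral[OF ao(2), symmetric]) (auto simp: \<theta>(3))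
  finally show ?thesis .
qed

end

end

section \<open>Convergence of the partial sums to a representing function\<close>

lemma nn_integral_lim_le:
  fixes g :: "nat \<Rightarrow> 'a \<Rightarrow> ennreal"
  assumes [measurable]: "\<And>i. g i \<in> borel_measurable M"
    and lim: "AE x in M. (\<lambda>i. g i x) \<longlonglongrightarrow> G x"
    and B: "\<forall>\<^sub>F i in sequentially. (\<integral>\<^sup>+x. g i x \<partial>M) \<le> B"
  shows "(\<integral>\<^sup>+x. G x \<partial>M) \<le> B"
proof -
  have "(\<integral>\<^sup>+x. G x \<partial>M) = (\<integral>\<^sup>+x. liminf (\<lambda>i. g i x) \<partial>M)"
    using lim by (intro nn_integral_cong_AE) (auto elim!: eventually_mono simp: lim_imp_Liminf)
  also have "\<dots> \<le> liminf (\<lambda>i. \<integral>\<^sup>+x. g i x \<partial>M)"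
    by (rule nn_integral_liminf) measurable
  also have "\<dots> \<le> B"
    using B by (intro order_trans[OF Liminf_le_Limsup Limsup_bounded]) auto
  finally show ?thesis .
qed

lemma nn_integral_wt: "(\<integral>\<^sup>+x. ennreal (wt x) \<partial>(lborel::(real^'n) measure)) < \<infinity>"
  using integrable_wt[where 'n = 'n] unfolding integrable_iff_bounded
  by (simp add: abs_of_pos[OF wt_pos])

text \<open>The pointwise inequality t \<le> \<delta> + t^2 / \<delta> takes the place of
  Cauchy--Schwarz; the parameter \<delta> is balanced against the L^2 bound later.\<close>

lemma weighted_L1_le_L2:
  fixes D :: "real^'n \<Rightarrow> complex"
  assumes [measurable]: "D \<in> borel_measurable borel" and \<delta>: "\<delta> > 0"
  shows "(\<integral>\<^sup>+x. ennreal (norm (D x) * wt x) \<partial>lborel) \<le>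
    ennreal (\<delta> * (\<integral>x. wt x \<partial>(lborel::(real^'n) measure))) + ennreal (1 / \<delta>) * (\<integral>\<^sup>+x. ennreal ((norm (D x))\<^sup>2 * wt x) \<partial>lborel)"
proof -
  have w: "0 \<le> wt x" for x :: "real^'n" using wt_pos[of x] by simp
  have "(\<integral>\<^sup>+x. ennreal (norm (D x) * wt x) \<partial>lborel) \<le>
    (\<integral>\<^sup>+x. ennreal \<delta> * ennreal (wt x) + ennreal (1 / \<delta>) * ennreal ((norm (D x))\<^sup>2 * wt x) \<partial>lborel)"
  proof (rule nn_integral_mono)
    fix x :: "real^'n"
    have "0 \<le> (norm (D x) - \<delta>)\<^sup>2" by simp
    also have "\<dots> = (norm (D x))\<^sup>2 + \<delta>\<^sup>2 - 2 * \<delta> * norm (D x)" by (simp add: power2_diff)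
    finally have "2 * (norm (D x) * \<delta>) \<le> \<delta>\<^sup>2 + (norm (D x))\<^sup>2" by (simp add: mult_ac)
    moreover have "0 \<le> norm (D x) * \<delta>" using \<delta> by simp
    ultimately have "norm (D x) * \<delta> \<le> \<delta>\<^sup>2 + (norm (D x))\<^sup>2" by linarith
    then have "norm (D x) \<le> \<delta> + 1 / \<delta> * (norm (D x))\<^sup>2"
      using \<delta> by (simp add: field_simps power2_eq_square)
    then have "norm (D x) * wt x \<le> (\<delta> + 1 / \<delta> * (norm (D x))\<^sup>2) * wt x"
      by (rule mult_right_mono) (rule w)
    then have "ennreal (norm (D x) * wt x) \<le> ennreal (\<delta> * wt x + 1 / \<delta> * ((norm (D x))\<^sup>2 * wt x))"
      by (intro ennreal_leI) (simp add: distrib_right mult.assoc)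
    also have "\<dots> = ennreal (\<delta> * wt x) + ennreal (1 / \<delta> * ((norm (D x))\<^sup>2 * wt x))"
      using \<delta> w by (intro ennreal_plus) auto
    also have "\<dots> = ennreal \<delta> * ennreal (wt x) + ennreal (1 / \<delta>) * ennreal ((norm (D x))\<^sup>2 * wt x)"
      using \<delta> w[of x] by (subst (1 2) ennreal_mult[symmetric]) auto
    finally show "ennreal (norm (D x) * wt x) \<le> ennreal \<delta> * ennreal (wt x) + ennreal (1 / \<delta>) * ennreal ((norm (D x))\<^sup>2 * wt x)" .
  qed
  also have "\<dots> = ennreal \<delta> * (\<integral>\<^sup>+x. ennreal (wt x) \<partial>(lborel::(real^'n) measure)) + ennreal (1 / \<delta>) * (\<integral>\<^sup>+x. ennreal ((norm (D x))\<^sup>2 * wt x) \<partial>lborel)"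
    by (subst nn_integral_add) (auto simp: nn_integral_cmult)
  also have "(\<integral>\<^sup>+x. ennreal (wt x) \<partial>(lborel::(real^'n) measure)) = ennreal (\<integral>x. wt x \<partial>(lborel::(real^'n) measure))"
    by (rule nn_integral_eq_integral[OF integrable_wt]) (simp add: w)
  also have "ennreal \<delta> * \<dots> = ennreal (\<delta> * (\<integral>x. wt x \<partial>(lborel::(real^'n) measure)))"
    using \<delta> w by (intro ennreal_mult[symmetric] integral_nonneg_AE) auto
  finally show ?thesis .
qed

context
  fixes \<phi>0 :: "real^'n \<Rightarrow> real" and u :: "(real^'n \<Rightarrow> complex) \<Rightarrow> complex"
  assumes gen: "TL_generator \<phi>0" and u: "tempered u"
begin

abbreviation psum :: "nat \<Rightarrow> real^'n \<Rightarrow> complex" where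
  "psum J x \<equiv> \<Sum>j<J. TL_piece \<phi>0 j u x"

lemma psum_diff: "I \<le> J \<Longrightarrow> psum J x - psum I x = (\<Sum>j\<in>{I..<J}. TL_piece \<phi>0 j u x)"
  using sum_diff_nat_ivl[of 0 I J "\<lambda>j. TL_piece \<phi>0 j u x"] by (simp add: atLeast0LessThan)

text \<open>The local square function bound at unit scale makes the partial sums a Cauchy sequence in \<open>L\<^sup>2\<close>
  with the weight \<open>wt\<close>: average the almost orthogonality estimate over all translates of the bump.\<close>

lemma psum_weighted_Cauchy:
  assumes B: "\<And>m. (\<integral>\<^sup>+x\<in>dyadic_cube 0 m. (\<Sum>j. ennreal ((norm (TL_piece \<phi>0 j u x))\<^sup>2)) \<partial>lborel)
      \<le> ennreal A * emeasure lborel (dyadic_cube 0 m :: (real^'n) set)"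
    and \<epsilon>: "0 < \<epsilon>"
  shows "\<exists>I0. \<forall>I\<ge>I0. \<forall>J\<ge>I. (\<integral>\<^sup>+x. ennreal ((norm (psum J x - psum I x))\<^sup>2 * wt x) \<partial>lborel) \<le> ennreal \<epsilon>"
    and "\<exists>R. \<forall>J. (\<integral>\<^sup>+x. ennreal ((norm (psum J x))\<^sup>2 * wt x) \<partial>lborel) \<le> ennreal R"
proof -
  note [measurable] = TL_piece_measurable[OF gen u]
  obtain \<theta> :: "real^'n \<Rightarrow> real" where \<theta>: "\<And>y. 0 \<le> \<theta> y" "\<theta> \<in> borel_measurable borel" "rapid (\<lambda>y. complex_of_real (\<theta> y))"
    "\<And>y. norm y \<le> 1 \<Longrightarrow> 1 \<le> \<theta> y" "\<And>v. 1 < norm v \<Longrightarrow> (\<integral>y. of_real (\<theta> y) * chi y v \<partial>lborel) = 0"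
    using band_limited_bump[OF gen, of 1] by auto
  note [measurable] = \<theta>(2)
  obtain K where K: "K \<ge> 0" and KB: "\<And>h k A l a. h \<in> borel_measurable borel \<Longrightarrow>
    (\<forall>m. (\<integral>\<^sup>+x\<in>dyadic_cube k m. h x \<partial>lborel) \<le> A * emeasure lborel (dyadic_cube k m :: (real^'n) set)) \<Longrightarrow>
    0 < l \<Longrightarrow> 1 / l \<le> 2 ^ k \<Longrightarrow>
    (\<integral>\<^sup>+y. h y * ennreal (\<theta> ((1 / l) *\<^sub>R (y - a))) \<partial>lborel) \<le> A * ennreal (K * l ^ CARD('n))"
    using weighted_average_bound[OF \<theta>(3,2)] by blast
  define h where "h x = (\<Sum>j. ennreal ((norm (TL_piece \<phi>0 j u x))\<^sup>2))" for x
  have [measurable]: "h \<in> borel_measurable borel" unfolding h_def by measurable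
  define e where "e j a = (\<integral>\<^sup>+y. ennreal ((norm (TL_piece \<phi>0 j u y))\<^sup>2 * \<theta> (y - a)) \<partial>lborel)" for j a
  have [measurable]: "e j \<in> borel_measurable borel" for j unfolding e_def by measurable
  have sum_e: "(\<Sum>j. e j a) \<le> ennreal A * ennreal K" for a
  proof -
    have "(\<Sum>j. e j a) = (\<integral>\<^sup>+y. (\<Sum>j. ennreal ((norm (TL_piece \<phi>0 j u y))\<^sup>2 * \<theta> (y - a))) \<partial>lborel)"
      unfolding e_def by (rule nn_integral_suminf[symmetric]) measurable
    also have "\<dots> = (\<integral>\<^sup>+y. h y * ennreal (\<theta> ((1 / 1) *\<^sub>R (y - a))) \<partial>lborel)"
    proof (rule nn_integral_cong)
      fix y
      have "ennreal ((norm (TL_piece \<phi>0 j u y))\<^sup>2 * \<theta> (y - a)) = ennreal ((norm (TL_piece \<phi>0 j u y))\<^sup>2) * ennreal (\<theta> (y - a))" for j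
        by (rule ennreal_mult) (simp_all add: \<theta>(1))
      then show "(\<Sum>j. ennreal ((norm (TL_piece \<phi>0 j u y))\<^sup>2 * \<theta> (y - a))) = h y * ennreal (\<theta> ((1 / 1) *\<^sub>R (y - a)))"
        unfolding h_def ennreal_suminf_multc[symmetric] by simp
    qed
    also have "\<dots> \<le> ennreal A * ennreal (K * 1 ^ CARD('n))"
      using B by (intro KB[of _ 0]) (simp_all add: h_def)
    finally show ?thesis by simp
  qed
  \<comment> \<open>The energy of the j-th piece against all translates of the bump, averaged with
    \<open>wt\<close>. The bound \<open>sum_e\<close> is uniform in the translate, so these energies
    are summable and a numerical series controls all tails.\<close>
  define E where "E j = (\<integral>\<^sup>+a. e j a * ennreal (wt a) \<partial>lborel)" for j
  have "(\<Sum>j. E j) = (\<integral>\<^sup>+a. (\<Sum>j. e j a * ennreal (wt a)) \<partial>lborel)"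
    unfolding E_def by (rule nn_integral_suminf[symmetric]) measurable
  also have "\<dots> \<le> (\<integral>\<^sup>+a. (ennreal A * ennreal K) * ennreal (wt a) \<partial>(lborel::(real^'n) measure))"
    unfolding ennreal_suminf_multc by (intro nn_integral_mono mult_right_mono sum_e) simp
  also have "\<dots> < \<infinity>" using nn_integral_wt[where 'n = 'n] by (simp add: nn_integral_cmult ennreal_mult_less_top)
  finally have Efin: "(\<Sum>j. E j) < \<infinity>" .
  have Ej: "E j < \<infinity>" for j
    by (rule ennreal_suminf_lessD[OF Efin])
  define e' where "e' j = enn2real (E j)" for j
  have e': "E j = ennreal (e' j)" "e' j \<ge> 0" for j using Ej[of j] by (auto simp: e'_def)
  have sume': "summable e'"
    using Efin e' by (intro summable_suminf_not_top) auto
  define v where "v = unit_ball_vol (real CARD('n))"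
  have v: "v > 0" unfolding v_def by (rule unit_ball_vol_pos) simp
  \<comment> \<open>The average of the translated bumps dominates \<open>c * wt\<close>: on the unit
    ball about \<open>y\<close> the bump is at least 1 and \<open>wt\<close> has lost at most the
    factor 2^(2n), while \<open>v\<close> is the volume of that ball.\<close>
  define c where "c = v / 2 ^ (2 * CARD('n))"
  have c: "c > 0" using v by (simp add: c_def)
  have \<omega>: "ennreal (c * wt y) \<le> (\<integral>\<^sup>+a. ennreal (\<theta> (y - a)) * ennreal (wt a) \<partial>lborel)" for y :: "real^'n"
  proof -
    have "ennreal (c * wt y) = (\<integral>\<^sup>+a. ennreal (wt y / 2 ^ (2 * CARD('n))) * indicator (cball y 1) a \<partial>lborel)"
    proof -
      have "(\<integral>\<^sup>+a. ennreal (wt y / 2 ^ (2 * CARD('n))) * indicator (cball y 1) a \<partial>lborel) =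
          ennreal (wt y / 2 ^ (2 * CARD('n))) * emeasure lborel (cball y 1)"
        by (rule nn_integral_cmult_indicator) simp
      also have "\<dots> = ennreal (wt y / 2 ^ (2 * CARD('n))) * ennreal v"
        by (simp add: emeasure_cball v_def DIM_cart)
      also have "\<dots> = ennreal (c * wt y)"
        using v wt_pos[of y] by (subst ennreal_mult[symmetric]) (auto simp: c_def less_imp_le)
      finally show ?thesis ..
    qed
    also have "\<dots> \<le> (\<integral>\<^sup>+a. ennreal (\<theta> (y - a)) * ennreal (wt a) \<partial>lborel)"
    proof (rule nn_integral_mono)
      fix a
      show "ennreal (wt y / 2 ^ (2 * CARD('n))) * indicator (cball y 1) a \<le> ennreal (\<theta> (y - a)) * ennreal (wt a)"
      proof (cases "a \<in> cball y 1")
        case True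
        then have "wt y \<le> (1 + 1) ^ (2 * CARD('n)) * wt a" by (intro wt_compare) simp
        then have "wt y / 2 ^ (2 * CARD('n)) \<le> wt a" by (simp add: divide_le_eq mult.commute)
        also have "\<dots> \<le> \<theta> (y - a) * wt a"
          using \<theta>(4)[of "y - a"] True wt_pos[of a] by (simp add: dist_norm)
        finally show ?thesis using True \<theta>(1) wt_pos[of a]
          by (simp add: ennreal_mult[symmetric] less_imp_le ennreal_leI)
      qed simp
    qed
    finally show ?thesis .
  qed
  have main: "(\<integral>\<^sup>+y. ennreal ((norm (psum J y - psum I y))\<^sup>2 * wt y) \<partial>lborel) \<le> ennreal (5 / c * (\<Sum>j\<in>{I..<J}. e' j))"
    if IJ: "I \<le> J" for I J
  proof -
    let ?D = "\<lambda>y. (norm (psum J y - psum I y))\<^sup>2"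
    have "ennreal c * (\<integral>\<^sup>+y. ennreal (?D y * wt y) \<partial>lborel) = (\<integral>\<^sup>+y. ennreal (?D y) * ennreal (c * wt y) \<partial>lborel)"
    proof (subst nn_integral_cmult[symmetric])
      show "(\<integral>\<^sup>+y. ennreal c * ennreal (?D y * wt y) \<partial>lborel) = (\<integral>\<^sup>+y. ennreal (?D y) * ennreal (c * wt y) \<partial>lborel)"
      proof (rule nn_integral_cong)
        fix y :: "real^'n"
        have "0 \<le> wt y" using wt_pos[of y] by simp
        then have "ennreal c * ennreal (?D y * wt y) = ennreal (c * (?D y * wt y))"
          "ennreal (?D y) * ennreal (c * wt y) = ennreal (?D y * (c * wt y))"
          using c by (simp_all add: ennreal_mult)
        then show "ennreal c * ennreal (?D y * wt y) = ennreal (?D y) * ennreal (c * wt y)"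
          by (simp only: mult_ac)
      qed
    qed measurable
    also have "\<dots> \<le> (\<integral>\<^sup>+y. ennreal (?D y) * (\<integral>\<^sup>+a. ennreal (\<theta> (y - a)) * ennreal (wt a) \<partial>lborel) \<partial>lborel)"
      by (intro nn_integral_mono mult_left_mono \<omega>) simp
    also have "\<dots> = (\<integral>\<^sup>+y. \<integral>\<^sup>+a. ennreal (?D y) * (ennreal (\<theta> (y - a)) * ennreal (wt a)) \<partial>lborel \<partial>lborel)"
      by (intro nn_integral_cong nn_integral_cmult[symmetric]) measurable
    also have "\<dots> = (\<integral>\<^sup>+a. \<integral>\<^sup>+y. ennreal (?D y) * (ennreal (\<theta> (y - a)) * ennreal (wt a)) \<partial>lborel \<partial>lborel)"
      by (rule lborel_pair.Fubini') measurable
    also have "\<dots> = (\<integral>\<^sup>+a. (\<integral>\<^sup>+y. ennreal (?D y * \<theta> ((1 / 1) *\<^sub>R (y - a))) \<partial>lborel) * ennreal (wt a) \<partial>lborel)"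
      by (intro nn_integral_cong, subst nn_integral_multc[symmetric])
        (auto simp: ennreal_mult \<theta>(1) mult.assoc)
    also have "\<dots> \<le> (\<integral>\<^sup>+a. (5 * (\<Sum>j\<in>{I..<J}. e j a)) * ennreal (wt a) \<partial>lborel)"
    proof (intro nn_integral_mono mult_right_mono)
      fix a
      show "(\<integral>\<^sup>+y. ennreal (?D y * \<theta> ((1 / 1) *\<^sub>R (y - a))) \<partial>lborel) \<le> 5 * (\<Sum>j\<in>{I..<J}. e j a)"
        using TL_pieces_L2[OF gen u \<theta>(3,2,1,5), of 1 0 "{I..<J}" a]
        by (simp add: psum_diff[OF IJ] e_def)
    qed simp
    also have "\<dots> = (\<integral>\<^sup>+a. 5 * (\<Sum>j\<in>{I..<J}. e j a * ennreal (wt a)) \<partial>lborel)"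
      by (simp add: sum_distrib_right mult.assoc)
    also have "\<dots> = 5 * (\<Sum>j\<in>{I..<J}. E j)"
      unfolding E_def by (subst nn_integral_cmult) (auto simp: nn_integral_sum)
    also have "\<dots> = ennreal (5 * (\<Sum>j\<in>{I..<J}. e' j))"
      using e' by (simp add: ennreal_mult' sum_nonneg)
    finally have "ennreal (1 / c) * (ennreal c * (\<integral>\<^sup>+y. ennreal (?D y * wt y) \<partial>lborel)) \<le> ennreal (1 / c) * ennreal (5 * (\<Sum>j\<in>{I..<J}. e' j))"
      by (rule mult_left_mono) simp
    moreover have "ennreal (1 / c) * ennreal c = 1" using c by (simp add: ennreal_mult[symmetric])
    ultimately show ?thesis using c e'(2)
      by (simp add: mult.assoc[symmetric] ennreal_mult[symmetric] sum_nonneg)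
  qed
  show "\<exists>I0. \<forall>I\<ge>I0. \<forall>J\<ge>I. (\<integral>\<^sup>+x. ennreal ((norm (psum J x - psum I x))\<^sup>2 * wt x) \<partial>lborel) \<le> ennreal \<epsilon>"
  proof -
    have "c * \<epsilon> / 5 > 0" using c \<epsilon> by simp
    then obtain I0 where I0: "\<And>I J. I \<ge> I0 \<Longrightarrow> norm (sum e' {I..<J}) < c * \<epsilon> / 5"
      using sume' unfolding summable_Cauchy by blast
    have "(\<integral>\<^sup>+x. ennreal ((norm (psum J x - psum I x))\<^sup>2 * wt x) \<partial>lborel) \<le> ennreal \<epsilon>" if "I \<ge> I0" "J \<ge> I" for I J
    proof -
      have "5 / c * sum e' {I..<J} \<le> 5 / c * (c * \<epsilon> / 5)"
        using I0[OF that(1), of J] c by (intro mult_left_mono) auto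
      then show ?thesis using c by (intro order_trans[OF main[OF that(2)] ennreal_leI]) simp
    qed
    then show ?thesis by blast
  qed
  show "\<exists>R. \<forall>J. (\<integral>\<^sup>+x. ennreal ((norm (psum J x))\<^sup>2 * wt x) \<partial>lborel) \<le> ennreal R"
  proof (intro exI[of _ "5 / c * suminf e'"] allI)
    fix J
    have le: "5 / c * (\<Sum>j\<in>{0..<J}. e' j) \<le> 5 / c * suminf e'"
      using c e'(2) sume' by (intro mult_left_mono sum_le_suminf) auto
    have "(\<integral>\<^sup>+x. ennreal ((norm (psum J x))\<^sup>2 * wt x) \<partial>lborel) \<le> ennreal (5 / c * (\<Sum>j\<in>{0..<J}. e' j))"
      using main[of 0 J] by simp
    then show "(\<integral>\<^sup>+x. ennreal ((norm (psum J x))\<^sup>2 * wt x) \<partial>lborel) \<le> ennreal (5 / c * suminf e')"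
      by (rule order_trans[OF _ ennreal_leI[OF le]])
  qed
qed

text \<open>The weighted L^2 Cauchy property gives one in L^1 with the density \<open>wt\<close>.
  Completeness is used through an almost everywhere convergent subsequence, and Fatou carries the
  estimate to the limit of the full sequence. The subsequence is kept in the conclusion because the
  oscillation bound needs pointwise limits.\<close>

lemma psum_limit:
  assumes B: "\<And>m. (\<integral>\<^sup>+x\<in>dyadic_cube 0 m. (\<Sum>j. ennreal ((norm (TL_piece \<phi>0 j u x))\<^sup>2)) \<partial>lborel)
      \<le> ennreal A * emeasure lborel (dyadic_cube 0 m :: (real^'n) set)"
  shows "\<exists>f r. f \<in> borel_measurable borel \<and> strict_mono r \<and> (AE x in lborel. (\<lambda>i. psum (r i) x) \<longlonglongrightarrow> f x) \<and>
    (\<forall>\<epsilon>>0. \<exists>I0. \<forall>I\<ge>I0. (\<integral>\<^sup>+x. ennreal (norm (f x - psum I x) * wt x) \<partial>lborel) \<le> ennreal \<epsilon>)"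
proof -
  note [measurable] = TL_piece_measurable[OF gen u]
  define W where "W = (\<integral>x. wt x \<partial>(lborel::(real^'n) measure))"
  have W: "W \<ge> 0" unfolding W_def by (rule integral_nonneg_AE) (simp add: wt_pos less_imp_le)
  have C1: "\<exists>I0. \<forall>I\<ge>I0. \<forall>J\<ge>I. (\<integral>\<^sup>+x. ennreal (norm (psum J x - psum I x) * wt x) \<partial>lborel) \<le> ennreal \<epsilon>" if \<epsilon>: "\<epsilon> > 0" for \<epsilon>
  proof -
    \<comment> \<open>Half of \<epsilon> pays for \<delta> times the mass of \<open>wt\<close>, the
      other half for the L^2 term divided by \<delta>; the summand 1 keeps the denominator
      positive.\<close>
    define \<delta> where "\<delta> = \<epsilon> / (2 * (W + 1))"
    have \<delta>: "\<delta> > 0" using \<epsilon> W by (simp add: \<delta>_def)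
    have \<delta>W: "\<delta> * W \<le> \<epsilon> / 2" using \<epsilon> W by (simp add: \<delta>_def field_simps)
    have "\<delta> * (\<epsilon> / 2) > 0" using \<delta> \<epsilon> by simp
    from psum_weighted_Cauchy(1)[OF B this] obtain I0 where
      I0: "\<And>I J. I \<ge> I0 \<Longrightarrow> J \<ge> I \<Longrightarrow> (\<integral>\<^sup>+x. ennreal ((norm (psum J x - psum I x))\<^sup>2 * wt x) \<partial>lborel) \<le> ennreal (\<delta> * (\<epsilon> / 2))"
      by auto
    have "(\<integral>\<^sup>+x. ennreal (norm (psum J x - psum I x) * wt x) \<partial>lborel) \<le> ennreal \<epsilon>" if "I \<ge> I0" "J \<ge> I" for I J
    proof -
      have "(\<integral>\<^sup>+x. ennreal (norm (psum J x - psum I x) * wt x) \<partial>lborel) \<le>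
        ennreal (\<delta> * W) + ennreal (1 / \<delta>) * (\<integral>\<^sup>+x. ennreal ((norm (psum J x - psum I x))\<^sup>2 * wt x) \<partial>lborel)"
        unfolding W_def by (rule weighted_L1_le_L2[OF _ \<delta>]) measurable
      also have "\<dots> \<le> ennreal (\<epsilon> / 2) + ennreal (1 / \<delta>) * ennreal (\<delta> * (\<epsilon> / 2))"
        by (intro add_mono ennreal_leI \<delta>W mult_left_mono I0 that) simp
      also have "\<dots> = ennreal \<epsilon>"
        using \<delta> \<epsilon> by (simp add: ennreal_mult[symmetric] ennreal_plus[symmetric] del: ennreal_plus)
      finally show ?thesis .
    qed
    then show ?thesis by blast
  qed
  let ?\<mu> = "density lborel (\<lambda>x::real^'n. ennreal (wt x))"
  have nn\<mu>: "(\<integral>\<^sup>+x. ennreal (norm (g x)) \<partial>?\<mu>) = (\<integral>\<^sup>+x. ennreal (norm (g x) * wt x) \<partial>lborel)"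
    if [measurable]: "g \<in> borel_measurable borel" for g :: "real^'n \<Rightarrow> complex"
    by (subst nn_integral_density)
      (auto simp: ennreal_mult wt_pos less_imp_le mult.commute intro!: nn_integral_cong)
  have int: "integrable ?\<mu> (psum J)" for J
  proof (rule integrableI_bounded)
    obtain R where R: "(\<integral>\<^sup>+x. ennreal ((norm (psum J x))\<^sup>2 * wt x) \<partial>lborel) \<le> ennreal R"
      using psum_weighted_Cauchy(2)[OF B, of 1] by auto
    have "(\<integral>\<^sup>+x. ennreal (norm (psum J x)) \<partial>?\<mu>) \<le> ennreal (1 * W) + ennreal (1 / 1) * (\<integral>\<^sup>+x. ennreal ((norm (psum J x))\<^sup>2 * wt x) \<partial>lborel)"
      unfolding W_def by (subst nn\<mu>, measurable) (rule weighted_L1_le_L2, auto)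
    also have "\<dots> \<le> ennreal (1 * W) + ennreal (1 / 1) * ennreal R"
      by (intro add_mono mult_left_mono R) auto
    also have "\<dots> < \<infinity>" by (simp add: ennreal_mult_less_top)
    finally show "(\<integral>\<^sup>+x. ennreal (norm (psum J x)) \<partial>?\<mu>) < \<infinity>" .
  qed measurable
  have "\<exists>N. \<forall>i\<ge>N. \<forall>j\<ge>N. LINT x|?\<mu>. norm (psum i x - psum j x) < \<epsilon>" if \<epsilon>: "\<epsilon> > 0" for \<epsilon>
  proof -
    obtain I0 where I0: "\<And>I J. I \<ge> I0 \<Longrightarrow> J \<ge> I \<Longrightarrow> (\<integral>\<^sup>+x. ennreal (norm (psum J x - psum I x) * wt x) \<partial>lborel) \<le> ennreal (\<epsilon> / 2)"
      using C1[of "\<epsilon> / 2"] \<epsilon> by auto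
    have *: "(LINT x|?\<mu>. norm (psum J x - psum I x)) < \<epsilon>" if "I \<ge> I0" "J \<ge> I" for I J
    proof -
      have "ennreal (LINT x|?\<mu>. norm (psum J x - psum I x)) = (\<integral>\<^sup>+x. ennreal (norm (psum J x - psum I x)) \<partial>?\<mu>)"
        by (rule nn_integral_eq_integral[symmetric])
          (auto intro!: integrable_norm Bochner_Integration.integrable_diff int)
      also have "\<dots> \<le> ennreal (\<epsilon> / 2)" by (subst nn\<mu>, measurable) (rule I0[OF that])
      finally have "(LINT x|?\<mu>. norm (psum J x - psum I x)) \<le> \<epsilon> / 2" using \<epsilon> by (simp add: ennreal_le_iff)
      then show ?thesis using \<epsilon> by simp
    qed
    have "(LINT x|?\<mu>. norm (psum i x - psum j x)) < \<epsilon>" if "i \<ge> I0" "j \<ge> I0" for i j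
    proof (cases "j \<le> i")
      case True then show ?thesis using *[of j i] that by simp
    next
      case False then show ?thesis using *[of i j] that by (simp add: norm_minus_commute)
    qed
    then show ?thesis by blast
  qed
  from cauchy_L1_AE_cauchy_subseq[of ?\<mu> psum, OF int this] obtain r where
    r: "strict_mono r" and cau: "AE x in ?\<mu>. Cauchy (\<lambda>i. psum (r i) x)" by blast
  define f where "f x = lim (\<lambda>i. psum (r i) x)" for x
  have [measurable]: "f \<in> borel_measurable borel"
    unfolding f_def by (rule borel_measurable_lim_metric) measurable
  have ae: "AE x in lborel. (\<lambda>i. psum (r i) x) \<longlonglongrightarrow> f x"
  proof -
    have "AE x in lborel. 0 < ennreal (wt (x::real^'n)) \<longrightarrow> Cauchy (\<lambda>i. psum (r i) x)"
      using cau by (subst (asm) AE_density) measurable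
    then show ?thesis
      by eventually_elim (auto simp: f_def wt_pos Cauchy_convergent_iff convergent_LIMSEQ_iff)
  qed
  have "\<exists>I0. \<forall>I\<ge>I0. (\<integral>\<^sup>+x. ennreal (norm (f x - psum I x) * wt x) \<partial>lborel) \<le> ennreal \<epsilon>" if \<epsilon>: "\<epsilon> > 0" for \<epsilon>
  proof -
    obtain I0 where I0: "\<And>I J. I \<ge> I0 \<Longrightarrow> J \<ge> I \<Longrightarrow> (\<integral>\<^sup>+x. ennreal (norm (psum J x - psum I x) * wt x) \<partial>lborel) \<le> ennreal \<epsilon>"
      using C1[OF \<epsilon>] by auto
    have "(\<integral>\<^sup>+x. ennreal (norm (f x - psum I x) * wt x) \<partial>lborel) \<le> ennreal \<epsilon>" if I: "I \<ge> I0" for I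
    proof (rule nn_integral_lim_le)
      show "(\<lambda>x. ennreal (norm (psum (r i) x - psum I x) * wt x)) \<in> borel_measurable lborel" for i by measurable
      show "AE x in lborel. (\<lambda>i. ennreal (norm (psum (r i) x - psum I x) * wt x)) \<longlonglongrightarrow> ennreal (norm (f x - psum I x) * wt x)"
        using ae by eventually_elim (intro tendsto_intros)
      show "\<forall>\<^sub>F i in sequentially. (\<integral>\<^sup>+x. ennreal (norm (psum (r i) x - psum I x) * wt x) \<partial>lborel) \<le> ennreal \<epsilon>"
        using eventually_ge_at_top[of I]
      proof eventually_elim
        case (elim i)
        have "I \<le> r i" using seq_suble[OF r, of i] elim by simp
        then show ?case by (rule I0[OF I])
      qed
    qed
    then show ?thesis by blast
  qed
  then show ?thesis using r ae by (intro exI[of _ f] exI[of _ r]) auto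
qed

text \<open>The pairing of the partial sums with \<open>g\<close> has two limits. As |g| \<le> C
  \<open>wt\<close>, convergence in weighted L^1 gives the pairing with \<open>f\<close>; as the
  sums telescope to a dilated low-pass multiplier, the approximate identity gives
  \<open>u g\<close>.\<close>

lemma represents_limit:
  assumes [measurable]: "f \<in> borel_measurable borel"
    and conv: "\<And>\<epsilon>. \<epsilon> > 0 \<Longrightarrow> \<exists>I0. \<forall>I\<ge>I0. (\<integral>\<^sup>+x. ennreal (norm (f x - psum I x) * wt x) \<partial>lborel) \<le> ennreal \<epsilon>"
  shows "represents f u"
  unfolding represents_def
proof (intro allI impI)
  note [measurable] = TL_piece_measurable[OF gen u]
  fix g :: "real^'n \<Rightarrow> complex" assume g: "schwartz g"
  note [measurable] = schwartz_measurable[OF g]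
  note sc = schwartz_clow[OF gen] and sg = schwartz_generator[OF gen]
  obtain C where C: "C \<ge> 0" "\<And>x. norm (g x) * (1 + norm x) ^ 0 \<le> C * wt x"
    using rapidE[OF schwartz_rapid[OF g], of 0] by blast
  have intS: "integrable lborel (\<lambda>x. psum (Suc I) x * g x)" for I
  proof -
    obtain D N where "\<And>y. norm (fmult (clow \<phi>0 I) u y) \<le> D * (1 + norm y) ^ N"
      using fmult_growth[OF u sc, of I] by blast
    then have "rapid (\<lambda>x. fmult (clow \<phi>0 I) u x * g x)"
      by (intro rapid_mult_poly[OF schwartz_rapid[OF g] fmult_measurable[OF u sc]])
    then show ?thesis unfolding sum_TL_piece[OF gen u] by (rule rapid_integrable)
  qed
  have nn: "(\<integral>\<^sup>+x. ennreal (norm ((f x - psum I x) * g x)) \<partial>lborel) \<le> ennreal (C * \<epsilon>)"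
    if "(\<integral>\<^sup>+x. ennreal (norm (f x - psum I x) * wt x) \<partial>lborel) \<le> ennreal \<epsilon>" "\<epsilon> > 0" for I \<epsilon>
  proof -
    have "(\<integral>\<^sup>+x. ennreal (norm ((f x - psum I x) * g x)) \<partial>lborel) \<le> (\<integral>\<^sup>+x. ennreal C * ennreal (norm (f x - psum I x) * wt x) \<partial>lborel)"
    proof (rule nn_integral_mono)
      fix x
      have "norm (f x - psum I x) * norm (g x) \<le> norm (f x - psum I x) * (C * wt x)"
        using C(2)[of x] by (intro mult_left_mono) auto
      then show "ennreal (norm ((f x - psum I x) * g x)) \<le> ennreal C * ennreal (norm (f x - psum I x) * wt x)"
        using C(1) wt_pos[of x] by (subst ennreal_mult[symmetric]) (auto simp: norm_mult mult_ac intro!: ennreal_leI)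
    qed
    also have "\<dots> = ennreal C * (\<integral>\<^sup>+x. ennreal (norm (f x - psum I x) * wt x) \<partial>lborel)"
      by (rule nn_integral_cmult) measurable
    also have "\<dots> \<le> ennreal C * ennreal \<epsilon>" by (intro mult_left_mono that) simp
    also have "\<dots> = ennreal (C * \<epsilon>)" using C(1) that by (simp add: ennreal_mult)
    finally show ?thesis .
  qed
  have intD: "integrable lborel (\<lambda>x. (f x - psum I x) * g x)"
    if "(\<integral>\<^sup>+x. ennreal (norm (f x - psum I x) * wt x) \<partial>lborel) \<le> ennreal \<epsilon>" "\<epsilon> > 0" for I \<epsilon>
    using nn[OF that] by (intro integrableI_bounded) (auto intro: le_less_trans)
  have intf: "integrable lborel (\<lambda>x. f x * g x)"
  proof -
    obtain I0 where I0: "\<And>I. I \<ge> I0 \<Longrightarrow> (\<integral>\<^sup>+x. ennreal (norm (f x - psum I x) * wt x) \<partial>lborel) \<le> ennreal 1"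
      using conv[of 1] by auto
    have "integrable lborel (\<lambda>x. (f x - psum (Suc I0) x) * g x + psum (Suc I0) x * g x)"
      by (intro Bochner_Integration.integrable_add intS intD[of _ 1] I0) auto
    then show ?thesis by (simp add: algebra_simps)
  qed
  have lim1: "(\<lambda>I. \<integral>x. psum (Suc I) x * g x \<partial>lborel) \<longlonglongrightarrow> (\<integral>x. f x * g x \<partial>lborel)"
  proof (rule LIMSEQ_I)
    fix e :: real assume e: "e > 0"
    define \<epsilon> where "\<epsilon> = e / (C + 1)"
    have \<epsilon>: "\<epsilon> > 0" "C * \<epsilon> < e" using e C(1) by (auto simp: \<epsilon>_def field_simps)
    obtain I0 where I0: "\<And>I. I \<ge> I0 \<Longrightarrow> (\<integral>\<^sup>+x. ennreal (norm (f x - psum I x) * wt x) \<partial>lborel) \<le> ennreal \<epsilon>"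
      using conv[OF \<epsilon>(1)] by auto
    have "norm ((\<integral>x. psum (Suc I) x * g x \<partial>lborel) - (\<integral>x. f x * g x \<partial>lborel)) < e" if "I \<ge> I0" for I
    proof -
      have I: "(\<integral>\<^sup>+x. ennreal (norm (f x - psum (Suc I) x) * wt x) \<partial>lborel) \<le> ennreal \<epsilon>"
        using that by (intro I0) simp
      have "(\<integral>x. f x * g x \<partial>lborel) - (\<integral>x. psum (Suc I) x * g x \<partial>lborel) = (\<integral>x. (f x - psum (Suc I) x) * g x \<partial>lborel)"
        unfolding left_diff_distrib
      by (rule Bochner_Integration.integral_diff[OF intf intS, symmetric])
      then have "norm ((\<integral>x. psum (Suc I) x * g x \<partial>lborel) - (\<integral>x. f x * g x \<partial>lborel)) = norm (\<integral>x. (f x - psum (Suc I) x) * g x \<partial>lborel)"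
        by (subst norm_minus_commute) (rule arg_cong[where f = norm])
      also have "ennreal \<dots> \<le> (\<integral>\<^sup>+x. ennreal (norm ((f x - psum (Suc I) x) * g x)) \<partial>lborel)"
        by (rule integral_norm_bound_ennreal[OF intD[OF I \<epsilon>(1)]])
      also have "\<dots> \<le> ennreal (C * \<epsilon>)" by (rule nn[OF I \<epsilon>(1)])
      finally have "norm ((\<integral>x. psum (Suc I) x * g x \<partial>lborel) - (\<integral>x. f x * g x \<partial>lborel)) \<le> C * \<epsilon>"
        using C(1) \<epsilon>(1) by (simp add: ennreal_le_iff)
      then show ?thesis using \<epsilon>(2) by linarith
    qed
    then show "\<exists>I0. \<forall>I\<ge>I0. norm ((\<integral>x. psum (Suc I) x * g x \<partial>lborel) - (\<integral>x. f x * g x \<partial>lborel)) < e" by blast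
  qed
  have "(\<integral>x. psum (Suc I) x * g x \<partial>lborel) = u (conv (ker (clow \<phi>0 I)) g)" for I
    unfolding sum_TL_piece[OF gen u] fmult_def
    by (rule tempered_conv[OF u schwartz_ker[OF sc] schwartz_rapid[OF g]])
  then have lim2: "(\<lambda>I. \<integral>x. psum (Suc I) x * g x \<partial>lborel) \<longlonglongrightarrow> u g"
    using tempered_approx_identity[OF u sg _ g] by (simp add: generator_eq_1[OF gen])
  have "u g = (\<integral>x. f x * g x \<partial>lborel)" by (rule LIMSEQ_unique[OF lim2 lim1])
  then show "integrable lebesgue (\<lambda>x. f x * g x) \<and> u g = dist_of_fun f g"
    unfolding dist_of_fun_def using intf by (auto simp: integrable_completion integral_completion)
qed

end

section \<open>The embedding in terms of the pieces\<close>

text \<open>All that the embedding needs to know about the Triebel--Lizorkin norm of \<open>u\<close>: \<open>M\<close> is a multiple of that norm, and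
  \<open>\<theta> = 1/r'\<close>.\<close>

definition piece_bounds ::
    "(real^'n \<Rightarrow> real) \<Rightarrow> real \<Rightarrow> real \<Rightarrow> ((real^'n \<Rightarrow> complex) \<Rightarrow> complex) \<Rightarrow> bool" where
  "piece_bounds \<phi>0 \<theta> M u \<longleftrightarrow>
    (\<forall>j x. norm (TL_piece \<phi>0 j u x) \<le> M) \<and>
    (\<forall>J x. (\<Sum>j<Suc J. norm (TL_piece \<phi>0 j u x)) \<le> M * real (Suc J) powr \<theta>) \<and>
    (\<forall>k m. (\<integral>\<^sup>+x\<in>dyadic_cube k m. (\<Sum>j. ennreal ((norm (TL_piece \<phi>0 (k + j) u x))\<^sup>2)) \<partial>lborel)
      \<le> ennreal (M\<^sup>2) * emeasure lborel (dyadic_cube k m :: (real^'n) set))"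

section \<open>Mean oscillation of the limit function\<close>

lemma TL_piece_lipschitz:
  fixes \<phi>0 :: "real^'n \<Rightarrow> real"
  assumes gen: "TL_generator \<phi>0"
  shows "\<exists>L\<ge>0. \<forall>u j M. tempered u \<longrightarrow> (\<forall>x. norm (TL_piece \<phi>0 j u x) \<le> M) \<longrightarrow>
    (\<forall>x y. norm (TL_piece \<phi>0 j u x - TL_piece \<phi>0 j u y) \<le> L * M * 2 ^ j * norm (x - y))"
proof -
  let ?X = "ker (\<lambda>\<xi>. complex_of_real (\<phi>0 \<xi>))"
  obtain L where L: "L \<ge> 0" and lip: "\<forall>H M. H \<in> borel_measurable borel \<longrightarrow> (\<forall>y. norm (H y) \<le> M) \<longrightarrow>
    (\<forall>x. H x = (\<integral>y. H y * ?X (y - x) \<partial>lborel)) \<longrightarrow> (\<forall>x x'. norm (H x - H x') \<le> L * M * norm (x - x'))"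
    using reproducing_lipschitz[OF schwartz_ker[OF schwartz_generator[OF gen]]] by blast
  \<comment> \<open>The Lipschitz estimate at unit scale is applied to the piece rescaled by
    2^(j+1); this is the origin of the factor 2.\<close>
  show ?thesis
  proof (intro exI[of _ "2 * L"] conjI allI impI)
    show "0 \<le> 2 * L" using L by simp
    fix u :: "(real^'n \<Rightarrow> complex) \<Rightarrow> complex" and j M x y
    assume u: "tempered u" and M: "\<forall>x. norm (TL_piece \<phi>0 j u x) \<le> M"
    note [measurable] = TL_piece_measurable[OF gen u]
    let ?H = "\<lambda>x. TL_piece \<phi>0 j u ((1 / 2 ^ Suc j) *\<^sub>R x)"
    have "norm (?H (2 ^ Suc j *\<^sub>R x) - ?H (2 ^ Suc j *\<^sub>R y)) \<le> L * M * norm (2 ^ Suc j *\<^sub>R x - 2 ^ Suc j *\<^sub>R y)"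
    proof (rule lip[rule_format])
      show "?H \<in> borel_measurable borel" by measurable
      show "norm (?H y) \<le> M" for y using M by blast
      show "?H x = (\<integral>y. ?H y * ?X (y - x) \<partial>lborel)" for x by (rule TL_piece_rescaled[OF gen u])
    qed
    then show "norm (TL_piece \<phi>0 j u x - TL_piece \<phi>0 j u y) \<le> 2 * L * M * 2 ^ j * norm (x - y)"
      by (simp add: scaleR_diff_right[symmetric] mult_ac)
  qed
qed

text \<open>Replacing an arbitrary constant by the average at most doubles the oscillation, because
  the distance of the two constants is itself bounded by the mean of |f - c|.\<close>

lemma oscillation_average:
  fixes f :: "real^'n \<Rightarrow> complex"
  assumes [measurable]: "f \<in> borel_measurable borel" "Q \<in> sets borel"
    and Q: "emeasure lborel Q = ennreal q" "q > 0"
    and X: "(\<integral>\<^sup>+x\<in>Q. ennreal (norm (f x - c)) \<partial>lborel) \<le> ennreal X" "X \<ge> 0"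
  shows "(\<integral>\<^sup>+x\<in>Q. ennreal (norm (f x - average Q f)) \<partial>lborel) \<le> ennreal (2 * X)"
proof -
  have iQ: "integrable lborel (\<lambda>x. indicator Q x *\<^sub>R c)"
    using Q by (intro integrable_scaleR_left integrable_real_indicator) auto
  have nn: "(\<integral>\<^sup>+x. ennreal (norm (indicator Q x *\<^sub>R (f x - c))) \<partial>lborel) = (\<integral>\<^sup>+x\<in>Q. ennreal (norm (f x - c)) \<partial>lborel)"
    by (intro nn_integral_cong) (auto simp: indicator_def)
  have ifc: "integrable lborel (\<lambda>x. indicator Q x *\<^sub>R (f x - c))"
  proof (rule integrableI_bounded)
    show "(\<integral>\<^sup>+x. ennreal (norm (indicator Q x *\<^sub>R (f x - c))) \<partial>lborel) < \<infinity>"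
      unfolding nn using X(1) by (rule le_less_trans) simp
  qed measurable
  have m: "measure lebesgue Q = q" "measure lborel Q = q"
    using Q by (simp_all add: measure_def emeasure_completion)
  have "(\<integral>x. indicator Q x *\<^sub>R (f x - c) \<partial>lborel) = (\<integral>x. indicator Q x *\<^sub>R f x \<partial>lborel) - q *\<^sub>R c"
  proof -
    have "(\<integral>x. indicator Q x *\<^sub>R f x \<partial>lborel) = (\<integral>x. indicator Q x *\<^sub>R (f x - c) + indicator Q x *\<^sub>R c \<partial>lborel)"
      by (simp add: scaleR_add_right[symmetric])
    also have "\<dots> = (\<integral>x. indicator Q x *\<^sub>R (f x - c) \<partial>lborel) + (\<integral>x. indicator Q x *\<^sub>R c \<partial>lborel)"
      by (rule Bochner_Integration.integral_add[OF ifc iQ])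
    also have "(\<integral>x. indicator Q x *\<^sub>R c \<partial>lborel) = q *\<^sub>R c"
      using Q m by simp
    finally show ?thesis by simp
  qed
  moreover have "average Q f = (\<integral>x. indicator Q x *\<^sub>R f x \<partial>lborel) /\<^sub>R q"
    unfolding average_def set_lebesgue_integral_def by (subst integral_completion) (simp_all add: m)
  ultimately have av: "q *\<^sub>R (average Q f - c) = (\<integral>x. indicator Q x *\<^sub>R (f x - c) \<partial>lborel)"
    using Q(2) by (simp add: scaleR_diff_right)
  have "q * norm (average Q f - c) = norm (q *\<^sub>R (average Q f - c))" using Q(2) by simp
  also have "\<dots> \<le> (\<integral>x. norm (indicator Q x *\<^sub>R (f x - c)) \<partial>lborel)"
    unfolding av by (rule integral_norm_bound)
  finally have "ennreal (q * norm (average Q f - c)) \<le> ennreal (\<integral>x. norm (indicator Q x *\<^sub>R (f x - c)) \<partial>lborel)"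
    by (rule ennreal_leI)
  also have "\<dots> = (\<integral>\<^sup>+x. ennreal (norm (indicator Q x *\<^sub>R (f x - c))) \<partial>lborel)"
    by (rule nn_integral_eq_integral[OF integrable_norm[OF ifc], symmetric]) simp
  also have "\<dots> \<le> ennreal X" unfolding nn by (rule X(1))
  finally have avX: "q * norm (average Q f - c) \<le> X" using X(2) by (simp add: ennreal_le_iff)
  have "(\<integral>\<^sup>+x\<in>Q. ennreal (norm (f x - average Q f)) \<partial>lborel) \<le>
      (\<integral>\<^sup>+x. ennreal (norm (f x - c)) * indicator Q x + ennreal (norm (average Q f - c)) * indicator Q x \<partial>lborel)"
  proof (rule nn_integral_mono)
    fix x
    have "norm (f x - average Q f) \<le> norm (f x - c) + norm (average Q f - c)"
      using norm_triangle_ineq4[of "f x - c" "average Q f - c"] by simp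
    then have "ennreal (norm (f x - average Q f)) \<le> ennreal (norm (f x - c)) + ennreal (norm (average Q f - c))"
      by (simp add: ennreal_plus[symmetric] ennreal_leI del: ennreal_plus)
    then show "ennreal (norm (f x - average Q f)) * indicator Q x \<le>
      ennreal (norm (f x - c)) * indicator Q x + ennreal (norm (average Q f - c)) * indicator Q x"
      by (simp add: indicator_def)
  qed
  also have "\<dots> = (\<integral>\<^sup>+x\<in>Q. ennreal (norm (f x - c)) \<partial>lborel) + ennreal (norm (average Q f - c)) * ennreal q"
    by (subst nn_integral_add) (auto simp: nn_integral_cmult_indicator Q(1))
  also have "\<dots> \<le> ennreal X + ennreal X"
    using avX Q(2) by (intro add_mono X(1)) (simp add: ennreal_mult[symmetric] mult.commute ennreal_leI)
  also have "\<dots> = ennreal (2 * X)" using X(2) by (simp add: ennreal_plus[symmetric] del: ennreal_plus)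
  finally show ?thesis .
qed

text \<open>The least admissible \<open>k\<close> is taken. Either it is 0, which covers all l \<ge>
  1, or its predecessor fails, which bounds 2^k l from above by 2.\<close>

lemma scale_exists:
  fixes l :: real
  assumes "0 < l"
  shows "\<exists>k::nat. 1 / l \<le> 2 ^ k \<and> (k = 0 \<or> 2 ^ k * l \<le> 2)"
proof -
  obtain k0 :: nat where "1 / l < 2 ^ k0" using real_arch_pow[of 2 "1 / l"] by auto
  then have ex: "\<exists>k::nat. 1 / l \<le> 2 ^ k" by (intro exI[of _ k0]) simp
  define k where "k = (LEAST k::nat. 1 / l \<le> 2 ^ k)"
  have k: "1 / l \<le> 2 ^ k" unfolding k_def by (rule LeastI_ex[OF ex])
  have k2: "2 ^ k * l \<le> 2" if k0: "k \<noteq> 0"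
  proof -
    obtain i where i: "k = Suc i" using k0 by (cases k) auto
    then have "\<not> 1 / l \<le> 2 ^ i" using not_less_Least[of i "\<lambda>k. 1 / l \<le> 2 ^ k"] unfolding k_def[symmetric] by simp
    then show ?thesis using assms by (simp add: i field_simps)
  qed
  show ?thesis using k k2 by (intro exI[of _ k]) (cases "k = 0"; simp)
qed

lemma emeasure_cube:
  fixes a :: "real^'n"
  assumes "0 < l"
  shows "emeasure lborel (cbox a (a + l *\<^sub>R (\<chi> i. 1))) = ennreal (l ^ CARD('n))"
proof -
  have le: "a \<bullet> e \<le> (a + l *\<^sub>R (\<chi> i. 1)) \<bullet> e" "(a + l *\<^sub>R (\<chi> i. 1) - a) \<bullet> e = l" if "e \<in> Basis" for e :: "real^'n"
    using that assms by (auto simp: Basis_vec_def inner_axis inner_add_left)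
  then have "(\<Prod>e\<in>(Basis::(real^'n) set). (a + l *\<^sub>R (\<chi> i. 1) - a) \<bullet> e) = l ^ CARD('n)"
    by (subst prod.cong[OF refl le(2)]) (auto simp: DIM_cart)
  then show ?thesis using le(1) by (simp add: emeasure_lborel_cbox_eq)
qed

text \<open>The constant subtracted on a cube is the low-frequency partial sum at its corner
  \<open>a\<close>. The high part is bounded in L^2 against the dilated bump and the low part by its
  Lipschitz constants, whose geometric sum is of order 2^k M and hence harmless on a cube of side
  about 2^(-k). The constant does not depend on the exponent \<theta> in
  \<open>piece_bounds\<close>.\<close>

lemma BMO_bound:
  fixes \<phi>0 :: "real^'n \<Rightarrow> real"
  assumes gen: "TL_generator \<phi>0"
  shows "\<exists>C\<ge>0. \<forall>u f r \<theta> M. tempered u \<longrightarrow> f \<in> borel_measurable borel \<longrightarrow> strict_mono r \<longrightarrow>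
    (AE x in lborel. (\<lambda>i. psum \<phi>0 u (r i) x) \<longlonglongrightarrow> f x) \<longrightarrow> 0 < M \<longrightarrow> piece_bounds \<phi>0 \<theta> M u \<longrightarrow>
    BMO_norm f \<le> ennreal (C * M)"
proof -
  obtain L where L: "L \<ge> 0" and lip: "\<And>u j M x y. tempered u \<Longrightarrow> (\<forall>x. norm (TL_piece \<phi>0 j u x) \<le> M) \<Longrightarrow>
    norm (TL_piece \<phi>0 j u x - TL_piece \<phi>0 j u y) \<le> L * M * 2 ^ j * norm (x - y)"
    using TL_piece_lipschitz[OF gen] by blast
  obtain \<eta> :: "real^'n \<Rightarrow> real" where \<eta>: "\<And>y. 0 \<le> \<eta> y" "\<eta> \<in> borel_measurable borel" "rapid (\<lambda>y. complex_of_real (\<eta> y))"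
    "\<And>y. norm y \<le> CARD('n) \<Longrightarrow> 1 \<le> \<eta> y" "\<And>v. 1 < norm v \<Longrightarrow> (\<integral>y. of_real (\<eta> y) * chi y v \<partial>lborel) = 0"
    using band_limited_bump[OF gen, of "CARD('n)"] by auto
  note [measurable] = \<eta>(2)
  obtain K where K: "K \<ge> 0" and KB: "\<And>h k A l a. h \<in> borel_measurable borel \<Longrightarrow>
    (\<forall>m. (\<integral>\<^sup>+x\<in>dyadic_cube k m. h x \<partial>lborel) \<le> A * emeasure lborel (dyadic_cube k m :: (real^'n) set)) \<Longrightarrow>
    0 < l \<Longrightarrow> 1 / l \<le> 2 ^ k \<Longrightarrow>
    (\<integral>\<^sup>+y. h y * ennreal (\<eta> ((1 / l) *\<^sub>R (y - a))) \<partial>lborel) \<le> A * ennreal (K * l ^ CARD('n))"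
    using weighted_average_bound[OF \<eta>(3,2)] by blast
  \<comment> \<open>The three summands come from splitting off the constant M / 2, from the
    variation of the low part, and from almost orthogonality divided by 2 M.\<close>
  define C1 where "C1 = 1 / 2 + 2 * CARD('n) * L + 5 * K / 2"
  have C1: "C1 \<ge> 0" using L K by (simp add: C1_def)
  show ?thesis
  proof (intro exI[of _ "2 * C1"] conjI allI impI)
    show "0 \<le> 2 * C1" using C1 by simp
    fix u f r \<theta> and M :: real
    assume u: "tempered u" and f[measurable]: "f \<in> borel_measurable borel" and r: "strict_mono r"
      and ae: "AE x in lborel. (\<lambda>i. psum \<phi>0 u (r i) x) \<longlonglongrightarrow> f x" and M: "0 < M" and pb: "piece_bounds \<phi>0 \<theta> M u"
    note [measurable] = TL_piece_measurable[OF gen u]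
    let ?F = "\<lambda>j. TL_piece \<phi>0 j u"
    have A: "\<forall>x. norm (?F j x) \<le> M" for j using pb by (simp add: piece_bounds_def)
    have B: "\<forall>m. (\<integral>\<^sup>+x\<in>dyadic_cube k m. (\<Sum>j. ennreal ((norm (?F (k + j) x))\<^sup>2)) \<partial>lborel)
      \<le> ennreal (M\<^sup>2) * emeasure lborel (dyadic_cube k m :: (real^'n) set)" for k
      using pb by (simp add: piece_bounds_def)
    show "BMO_norm f \<le> ennreal (2 * C1 * M)"
      unfolding BMO_norm_def
    proof (rule SUP_least)
      fix Q :: "(real^'n) set" assume "Q \<in> cubes"
      then obtain a l where Q: "Q = cbox a (a + l *\<^sub>R (\<chi> i. 1))" and l: "l > 0" unfolding cubes_def by blast
      have [measurable]: "Q \<in> sets borel" unfolding Q by simp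
      have eQ: "emeasure lborel Q = ennreal (l ^ CARD('n))" unfolding Q by (rule emeasure_cube[OF l])
      obtain k :: nat where k: "1 / l \<le> 2 ^ k" "k = 0 \<or> 2 ^ k * l \<le> 2" using scale_exists[OF l] by blast
      have near: "norm (y - a) \<le> CARD('n) * l" if "y \<in> Q" for y
      proof -
        have "\<bar>(y - a) $ i\<bar> \<le> l" for i
        proof -
          have "a $ i \<le> y $ i \<and> y $ i \<le> a $ i + l" using that by (auto simp: Q mem_box_cart)
          then show ?thesis using l by auto
        qed
        then have "(\<Sum>i\<in>UNIV. \<bar>(y - a) $ i\<bar>) \<le> (\<Sum>i\<in>(UNIV::'n set). l)" by (rule sum_mono)
        then show ?thesis using norm_le_l1_cart[of "y - a"] by simp
      qed
      let ?\<eta> = "\<lambda>y. \<eta> ((1 / l) *\<^sub>R (y - a))"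
      have \<eta>1: "1 \<le> ?\<eta> y" if "y \<in> Q" for y
        using near[OF that] l by (intro \<eta>(4)) (simp add: divide_le_eq)
      have tail: "(\<integral>\<^sup>+y. ennreal ((norm (psum \<phi>0 u J y - psum \<phi>0 u k y))\<^sup>2 * ?\<eta> y) \<partial>lborel) \<le> ennreal (5 * (M\<^sup>2 * (K * l ^ CARD('n))))"
        if J: "k \<le> J" for J
      proof -
        define e where "e j = (\<integral>\<^sup>+y. ennreal ((norm (?F j y))\<^sup>2 * ?\<eta> y) \<partial>lborel)" for j
        have "(\<integral>\<^sup>+y. ennreal ((norm (psum \<phi>0 u J y - psum \<phi>0 u k y))\<^sup>2 * ?\<eta> y) \<partial>lborel) \<le> 5 * (\<Sum>j\<in>{k..<J}. e j)"
          unfolding psum_diff[OF gen u J] e_def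
          by (rule TL_pieces_L2[OF gen u \<eta>(3,2,1,5) l k(1)]) auto
        also have "(\<Sum>j\<in>{k..<J}. e j) = (\<Sum>j<J - k. e (k + j))"
          by (rule sum.reindex_bij_witness[of _ "\<lambda>j. k + j" "\<lambda>j. j - k"]) auto
        also have "\<dots> \<le> (\<Sum>j. e (k + j))"
          by (rule sum_le_suminf) auto
        also have "(\<Sum>j. e (k + j)) = (\<integral>\<^sup>+y. (\<Sum>j. ennreal ((norm (?F (k + j) y))\<^sup>2 * ?\<eta> y)) \<partial>lborel)"
          unfolding e_def by (rule nn_integral_suminf[symmetric]) measurable
        also have "\<dots> = (\<integral>\<^sup>+y. (\<Sum>j. ennreal ((norm (?F (k + j) y))\<^sup>2)) * ennreal (?\<eta> y) \<partial>lborel)"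
          unfolding ennreal_suminf_multc[symmetric] by (simp add: ennreal_mult \<eta>(1))
        also have "\<dots> \<le> ennreal (M\<^sup>2) * ennreal (K * l ^ CARD('n))"
          by (rule KB[OF _ B l k(1)]) measurable
        finally have "(\<integral>\<^sup>+y. ennreal ((norm (psum \<phi>0 u J y - psum \<phi>0 u k y))\<^sup>2 * ?\<eta> y) \<partial>lborel) \<le>
          5 * (ennreal (M\<^sup>2) * ennreal (K * l ^ CARD('n)))" by (simp add: mult_left_mono)
        also have "\<dots> = ennreal (5 * (M\<^sup>2 * (K * l ^ CARD('n))))"
          using K l by (simp add: ennreal_mult)
        finally show ?thesis .
      qed
      \<comment> \<open>Fatou along the almost everywhere convergent subsequence; its indices
        eventually exceed \<open>k\<close>.\<close>
      have tailf: "(\<integral>\<^sup>+y. ennreal ((norm (f y - psum \<phi>0 u k y))\<^sup>2 * ?\<eta> y) \<partial>lborel) \<le> ennreal (5 * (M\<^sup>2 * (K * l ^ CARD('n))))"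
      proof (rule nn_integral_lim_le)
        show "(\<lambda>y. ennreal ((norm (psum \<phi>0 u (r i) y - psum \<phi>0 u k y))\<^sup>2 * ?\<eta> y)) \<in> borel_measurable lborel" for i
          by measurable
        show "AE y in lborel. (\<lambda>i. ennreal ((norm (psum \<phi>0 u (r i) y - psum \<phi>0 u k y))\<^sup>2 * ?\<eta> y))
            \<longlonglongrightarrow> ennreal ((norm (f y - psum \<phi>0 u k y))\<^sup>2 * ?\<eta> y)"
          using ae by eventually_elim (intro tendsto_intros)
        show "\<forall>\<^sub>F i in sequentially. (\<integral>\<^sup>+y. ennreal ((norm (psum \<phi>0 u (r i) y - psum \<phi>0 u k y))\<^sup>2 * ?\<eta> y) \<partial>lborel)
            \<le> ennreal (5 * (M\<^sup>2 * (K * l ^ CARD('n))))"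
          using eventually_ge_at_top[of k]
        proof eventually_elim
          case (elim i)
          have "k \<le> r i" using seq_suble[OF r, of i] elim by simp
          then show ?case by (rule tail)
        qed
      qed
      \<comment> \<open>For k = 0, the case of cubes of side at least 1, the low part is an empty
        sum; otherwise 2^k l \<le> 2 absorbs the Lipschitz constants.\<close>
      have low: "norm (psum \<phi>0 u k y - psum \<phi>0 u k a) \<le> 2 * CARD('n) * L * M" if y: "y \<in> Q" for y
      proof (cases "k = 0")
        case True then show ?thesis using L M by simp
      next
        case False
        have p2: "(\<Sum>j<k. (2::real) ^ j) \<le> 2 ^ k" by (induction k) auto
        have "norm (psum \<phi>0 u k y - psum \<phi>0 u k a) = norm (\<Sum>j<k. ?F j y - ?F j a)" by (simp add: sum_subtractf)
        also have "\<dots> \<le> (\<Sum>j<k. L * M * 2 ^ j * norm (y - a))"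
          by (intro sum_norm_le lip[OF u A])
        also have "\<dots> = L * M * norm (y - a) * (\<Sum>j<k. 2 ^ j)"
          by (simp add: sum_distrib_left mult_ac)
        also have "\<dots> \<le> L * M * norm (y - a) * 2 ^ k"
          using L M p2 by (intro mult_left_mono) auto
        also have "\<dots> \<le> L * M * (CARD('n) * l) * 2 ^ k"
          using L M near[OF y] by (intro mult_right_mono mult_left_mono) auto
        also have "\<dots> = (L * M * CARD('n)) * (2 ^ k * l)" by (simp only: mult_ac)
        also have "\<dots> \<le> (L * M * CARD('n)) * 2" using False k(2) L M by (intro mult_left_mono) auto
        finally show ?thesis by (simp add: mult_ac)
      qed
      define X where "X = C1 * M * l ^ CARD('n)"
      have X0: "X \<ge> 0" using C1 M l by (simp add: X_def)
      have "(\<integral>\<^sup>+y\<in>Q. ennreal (norm (f y - psum \<phi>0 u k a)) \<partial>lborel) \<le>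
        (\<integral>\<^sup>+y. ennreal ((1 / 2 + 2 * CARD('n) * L) * M) * indicator Q y +
          ennreal (1 / (2 * M)) * ennreal ((norm (f y - psum \<phi>0 u k y))\<^sup>2 * ?\<eta> y) \<partial>lborel)"
      proof (rule nn_integral_mono)
        fix y
        show "ennreal (norm (f y - psum \<phi>0 u k a)) * indicator Q y \<le>
          ennreal ((1 / 2 + 2 * CARD('n) * L) * M) * indicator Q y +
          ennreal (1 / (2 * M)) * ennreal ((norm (f y - psum \<phi>0 u k y))\<^sup>2 * ?\<eta> y)"
        proof (cases "y \<in> Q")
          case True
          let ?t = "norm (f y - psum \<phi>0 u k y)"
          have "norm (f y - psum \<phi>0 u k a) \<le> ?t + norm (psum \<phi>0 u k y - psum \<phi>0 u k a)"
            using norm_triangle_ineq[of "f y - psum \<phi>0 u k y" "psum \<phi>0 u k y - psum \<phi>0 u k a"] by simp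
          also have "\<dots> \<le> ?t + 2 * CARD('n) * L * M" using low[OF True] by simp
          \<comment> \<open>Weighting by M makes both resulting terms of size M on average, since
            the mean of ?t^2 is of order M^2.\<close>
          also have "?t \<le> M / 2 + 1 / (2 * M) * ?t\<^sup>2"
          proof -
            have "0 \<le> (?t - M)\<^sup>2" by simp
            also have "\<dots> = ?t\<^sup>2 + M\<^sup>2 - 2 * ?t * M" by (rule power2_diff)
            finally show ?thesis using M by (simp add: field_simps power2_eq_square)
          qed
          also have "1 / (2 * M) * ?t\<^sup>2 \<le> 1 / (2 * M) * (?t\<^sup>2 * ?\<eta> y)"
          proof (intro mult_left_mono)
            show "?t\<^sup>2 \<le> ?t\<^sup>2 * ?\<eta> y" using mult_left_mono[OF \<eta>1[OF True], of "?t\<^sup>2"] by simp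
          qed (use M in simp)
          finally have "norm (f y - psum \<phi>0 u k a) \<le> (1 / 2 + 2 * CARD('n) * L) * M + 1 / (2 * M) * (?t\<^sup>2 * ?\<eta> y)"
            by (simp add: distrib_right)
          then have "ennreal (norm (f y - psum \<phi>0 u k a)) \<le> ennreal ((1 / 2 + 2 * CARD('n) * L) * M + 1 / (2 * M) * (?t\<^sup>2 * ?\<eta> y))"
            by (rule ennreal_leI)
          also have "\<dots> = ennreal ((1 / 2 + 2 * CARD('n) * L) * M) + ennreal (1 / (2 * M) * (?t\<^sup>2 * ?\<eta> y))"
            using L M \<eta>(1) by (intro ennreal_plus) auto
          also have "ennreal (1 / (2 * M) * (?t\<^sup>2 * ?\<eta> y)) = ennreal (1 / (2 * M)) * ennreal (?t\<^sup>2 * ?\<eta> y)"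
            using M \<eta>(1) by (intro ennreal_mult) auto
          finally show ?thesis using True by simp
        qed simp
      qed
      also have "\<dots> = ennreal ((1 / 2 + 2 * CARD('n) * L) * M) * emeasure lborel Q +
          ennreal (1 / (2 * M)) * (\<integral>\<^sup>+y. ennreal ((norm (f y - psum \<phi>0 u k y))\<^sup>2 * ?\<eta> y) \<partial>lborel)"
        by (subst nn_integral_add) (auto simp: nn_integral_cmult_indicator nn_integral_cmult)
      also have "\<dots> \<le> ennreal ((1 / 2 + 2 * CARD('n) * L) * M) * ennreal (l ^ CARD('n)) +
          ennreal (1 / (2 * M)) * ennreal (5 * (M\<^sup>2 * (K * l ^ CARD('n))))"
        unfolding eQ by (intro add_left_mono mult_left_mono tailf) simp
      also have "\<dots> = ennreal ((1 / 2 + 2 * CARD('n) * L) * M * l ^ CARD('n) + 1 / (2 * M) * (5 * (M\<^sup>2 * (K * l ^ CARD('n)))))"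
      proof -
        have nn: "0 \<le> (1 / 2 + 2 * CARD('n) * L) * M" "0 \<le> l ^ CARD('n)" "0 \<le> 1 / (2 * M)" "0 \<le> 5 * (M\<^sup>2 * (K * l ^ CARD('n)))"
          using L K M l by auto
        show ?thesis
          unfolding ennreal_mult[OF nn(1,2), symmetric] ennreal_mult[OF nn(3,4), symmetric]
          by (rule ennreal_plus[symmetric]; intro mult_nonneg_nonneg nn)
      qed
      also have "(1 / 2 + 2 * CARD('n) * L) * M * l ^ CARD('n) + 1 / (2 * M) * (5 * (M\<^sup>2 * (K * l ^ CARD('n)))) = X"
        using M by (simp add: X_def C1_def field_simps power2_eq_square)
      finally have "(\<integral>\<^sup>+x\<in>Q. ennreal (norm (f x - average Q f)) \<partial>lborel) \<le> ennreal (2 * X)"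
        using X0 l by (intro oscillation_average[OF f _ eQ]) auto
      moreover have "(\<integral>\<^sup>+x\<in>Q. ennreal (norm (f x - average Q f)) \<partial>lebesgue) = (\<integral>\<^sup>+x\<in>Q. ennreal (norm (f x - average Q f)) \<partial>lborel)"
        by (rule nn_integral_completion) measurable
      moreover have "emeasure lebesgue Q = ennreal (l ^ CARD('n))"
        using eQ by (simp add: emeasure_completion)
      ultimately have "(\<integral>\<^sup>+x\<in>Q. ennreal (norm (f x - average Q f)) \<partial>lebesgue) / emeasure lebesgue Q \<le> ennreal (2 * X) / ennreal (l ^ CARD('n))"
        by (simp add: divide_right_mono_ennreal)
      also have "\<dots> = ennreal (2 * C1 * M)"
        using l X0 by (simp add: divide_ennreal X_def mult.assoc)
      finally show "(\<integral>\<^sup>+x\<in>Q. ennreal (norm (f x - average Q f)) \<partial>lebesgue) / emeasure lebesgue Q \<le> ennreal (2 * C1 * M)" .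
    qed
  qed
qed

text \<open>The symbol \<phi>(t \<xi>) lives where the low-pass symbol of level J equals 1, so
  \<phi>(tD)u is a multiplier applied to the sum of the pieces up to J. The kernel has an L^1 norm
  independent of t, and the number J + 1 of pieces is what the weight measures.\<close>

lemma multiplier_bound:
  fixes \<phi>0 :: "real^'n \<Rightarrow> real" and \<phi> :: "real^'n \<Rightarrow> complex"
  assumes gen: "TL_generator \<phi>0" and cut: "X_cutoff \<phi>" and \<theta>: "0 \<le> \<theta>" "\<theta> \<le> 1"
  shows "\<exists>C\<ge>0. \<forall>u M t x. tempered u \<longrightarrow> 0 < M \<longrightarrow> piece_bounds \<phi>0 \<theta> M u \<longrightarrow> 0 < t \<longrightarrow>
    norm (multiplier \<phi> t u x) \<le> C * M * (1 + log_plus (1 / t)) powr \<theta>"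
proof -
  define I where "I = (\<integral>w. norm (ker \<phi> w) \<partial>lborel)"
  have I: "I \<ge> 0" unfolding I_def by (rule integral_nonneg_AE) simp
  have s\<phi>: "schwartz \<phi>" and cl: "closure {\<xi>. \<phi> \<xi> \<noteq> 0} \<subseteq> cball 0 2" using cut by (auto simp: X_cutoff_def)
  have supp: "norm \<xi> \<le> 2" if "\<phi> \<xi> \<noteq> 0" for \<xi>
  proof -
    have "\<xi> \<in> {\<xi>. \<phi> \<xi> \<noteq> 0}" using that by simp
    then have "\<xi> \<in> cball 0 2" by (rule subsetD[OF order_trans[OF closure_subset cl]])
    then show ?thesis by simp
  qed
  show ?thesis
  proof (intro exI[of _ "4 * I"] conjI allI impI)
    show "0 \<le> 4 * I" using I by simp
    fix u :: "(real^'n \<Rightarrow> complex) \<Rightarrow> complex" and M t :: real and x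
    assume u: "tempered u" and M: "0 < M" and pb: "piece_bounds \<phi>0 \<theta> M u" and t: "0 < t"
    \<comment> \<open>The scale is t / 2 because the cutoff is supported in the ball of radius
      2.\<close>
    obtain J :: nat where J: "1 / (t / 2) \<le> 2 ^ J" "J = 0 \<or> 2 ^ J * (t / 2) \<le> 2"
      using scale_exists[of "t / 2"] t by auto
    have sc: "schwartz (clow \<phi>0 J)" by (rule schwartz_clow[OF gen])
    have st: "schwartz (\<lambda>\<xi>. \<phi> (t *\<^sub>R \<xi>))" using t by (intro schwartz_dilate s\<phi>) simp
    have "norm (fmult (\<lambda>\<xi>. \<phi> (t *\<^sub>R \<xi>)) u x) \<le> (M * real (Suc J) powr \<theta>) * I"
      unfolding I_def
    proof (rule fmult_bound[OF u s\<phi> sc st, of "1 / t"])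
      show "0 < 1 / t" using t by simp
      show "\<phi> (t *\<^sub>R \<xi>) = \<phi> ((1 / (1 / t)) *\<^sub>R \<xi>) * clow \<phi>0 J \<xi>" for \<xi>
      proof (cases "\<phi> (t *\<^sub>R \<xi>) = 0")
        case False
        then have "t * norm \<xi> \<le> 2" using supp[of "t *\<^sub>R \<xi>"] t by simp
        then have "norm \<xi> \<le> 1 / (t / 2)" using t by (simp add: field_simps)
        then have "norm \<xi> \<le> 2 ^ J" using J(1) by linarith
        then have "norm ((1 / 2 ^ J) *\<^sub>R \<xi>) \<le> 1" by (simp add: divide_le_eq)
        then show ?thesis by (simp add: generator_eq_1[OF gen])
      qed simp
      show "norm (fmult (clow \<phi>0 J) u y) \<le> M * real (Suc J) powr \<theta>" for y
      proof -
        have "norm (fmult (clow \<phi>0 J) u y) \<le> (\<Sum>j<Suc J. norm (TL_piece \<phi>0 j u y))"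
          unfolding sum_TL_piece[OF gen u, symmetric] by (rule norm_sum)
        also have "\<dots> \<le> M * real (Suc J) powr \<theta>" using pb unfolding piece_bounds_def by blast
        finally show ?thesis .
      qed
    qed
    also have "multiplier \<phi> t u = fmult (\<lambda>\<xi>. \<phi> (t *\<^sub>R \<xi>)) u"
      using t by (intro multiplier_eq_fmult[OF s\<phi> _ u]) simp
    then have "fmult (\<lambda>\<xi>. \<phi> (t *\<^sub>R \<xi>)) u x = multiplier \<phi> t u x" by simp
    finally have 1: "norm (multiplier \<phi> t u x) \<le> (M * real (Suc J) powr \<theta>) * I" .
    \<comment> \<open>Minimality of J gives 2^J \<le> 4 / t, hence (J - 2) ln 2 \<le> log_+ (1/t),
      and ln 2 \<ge> 1/2 gives J + 1 \<le> 3 + 2 log_+ (1/t).\<close>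
    have SJ: "real (Suc J) \<le> 4 * (1 + log_plus (1 / t))"
    proof (cases "J = 0")
      case True then show ?thesis using log_plus_nonneg[of "1 / t"] by simp
    next
      case False
      then have "2 ^ J \<le> 4 * (1 / t)" using J(2) t by (simp add: field_simps)
      then have "ln (2 ^ J) \<le> ln (4 * (1 / t))" using t by (subst ln_le_cancel_iff) auto
      also have "\<dots> = 2 * ln 2 + ln (1 / t)"
        using t ln_realpow[of 2 2] by (subst ln_mult_pos) auto
      finally have "real J * ln 2 \<le> 2 * ln 2 + log_plus (1 / t)"
        by (simp add: ln_realpow log_plus_def)
      moreover have "ln 2 \<ge> (1::real) / 2" using ln2_ge_two_thirds by simp
      moreover have "(real J - 2) * (1 / 2) \<le> (real J - 2) * ln 2 \<or> real J \<le> 2"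
        using \<open>ln 2 \<ge> (1::real) / 2\<close> by (cases "real J \<le> 2") (auto intro: mult_left_mono)
      ultimately show ?thesis using log_plus_nonneg[of "1 / t"] by (auto simp: algebra_simps)
    qed
    have "real (Suc J) powr \<theta> \<le> (4 * (1 + log_plus (1 / t))) powr \<theta>"
      using SJ \<theta> by (intro powr_mono2) auto
    also have "\<dots> = 4 powr \<theta> * (1 + log_plus (1 / t)) powr \<theta>"
      by (rule powr_mult)
    also have "\<dots> \<le> 4 powr 1 * (1 + log_plus (1 / t)) powr \<theta>"
      using \<theta> by (intro mult_right_mono powr_mono) auto
    finally have "real (Suc J) powr \<theta> \<le> 4 * (1 + log_plus (1 / t)) powr \<theta>" by simp
    then have "(M * real (Suc J) powr \<theta>) * I \<le> (M * (4 * (1 + log_plus (1 / t)) powr \<theta>)) * I"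
      using M I by (intro mult_right_mono mult_left_mono) auto
    then show "norm (multiplier \<phi> t u x) \<le> 4 * I * M * (1 + log_plus (1 / t)) powr \<theta>"
      using 1 by (simp add: mult_ac)
  qed
qed

text \<open>The two functionals agree only on Schwartz functions; the definition of
  \<open>multiplier\<close> evaluates them at a translated transform of a Schwartz symbol, which is
  one.\<close>

lemma multiplier_represents:
  fixes f :: "real^'n \<Rightarrow> complex"
  assumes "represents f u" "schwartz a" "t \<noteq> 0"
  shows "multiplier a t (dist_of_fun f) = multiplier a t u"
proof
  fix x
  have "schwartz (fourier (\<lambda>\<xi>. a (t *\<^sub>R \<xi>) * exp (\<i> * complex_of_real (x \<bullet> \<xi>))))"
    unfolding fourier_modulation[OF assms(2,3)]
    using assms by (intro schwartz_translate schwartz_fourier schwartz_dilate)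
  then show "multiplier a t (dist_of_fun f) x = multiplier a t u x"
    using assms(1) by (simp add: multiplier_def fourier_dist_def represents_def)
qed

lemma locally_integrable_weighted:
  fixes f :: "real^'n \<Rightarrow> complex"
  assumes [measurable]: "f \<in> borel_measurable borel" and fin: "(\<integral>\<^sup>+x. ennreal (norm (f x) * wt x) \<partial>lborel) < \<infinity>"
  shows "locally_integrable f"
  unfolding locally_integrable_def
proof (intro allI impI)
  fix S :: "(real^'n) set" assume S: "compact S"
  have [measurable]: "S \<in> sets borel" using S by (intro borel_compact)
  obtain R where R: "\<And>x. x \<in> S \<Longrightarrow> norm x \<le> R" using compact_imp_bounded[OF S] unfolding bounded_iff by blast
  define c where "c = (1 + \<bar>R\<bar>) ^ (2 * CARD('n)) / wt (0::real^'n)"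
  have c0: "c \<ge> 0" unfolding c_def using wt_pos[of "0::real^'n"] by (simp add: less_imp_le)
  have cw: "1 \<le> c * wt x" if "x \<in> S" for x
  proof -
    have "wt (0::real^'n) \<le> (1 + \<bar>R\<bar>) ^ (2 * CARD('n)) * wt x"
      using R[OF that] by (intro wt_compare) simp
    then show ?thesis using wt_pos[of "0::real^'n"] by (simp add: c_def field_simps)
  qed
  have "(\<integral>\<^sup>+x. ennreal (norm (indicator S x *\<^sub>R f x)) \<partial>lborel) \<le> (\<integral>\<^sup>+x. ennreal c * ennreal (norm (f x) * wt x) \<partial>lborel)"
  proof (rule nn_integral_mono)
    fix x
    show "ennreal (norm (indicator S x *\<^sub>R f x)) \<le> ennreal c * ennreal (norm (f x) * wt x)"
    proof (cases "x \<in> S")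
      case True
      have "norm (f x) * 1 \<le> norm (f x) * (c * wt x)" by (intro mult_left_mono cw True) simp
      then show ?thesis using True c0 wt_pos[of x]
        by (subst ennreal_mult[symmetric]) (auto simp: mult_ac intro!: ennreal_leI)
    qed simp
  qed
  also have "\<dots> = ennreal c * (\<integral>\<^sup>+x. ennreal (norm (f x) * wt x) \<partial>lborel)" by (rule nn_integral_cmult) measurable
  also have "\<dots> < \<infinity>" using fin by (simp add: ennreal_mult_less_top)
  finally have "integrable lborel (\<lambda>x. indicator S x *\<^sub>R f x)" by (intro integrableI_bounded) auto
  then show "f absolutely_integrable_on S"
    unfolding set_integrable_def by (subst integrable_completion) auto
qed

text \<open>The function \<open>f\<close> is fixed by \<open>u\<close> before the bound
  \<open>M\<close> is quantified. So the final estimate may be applied to every admissible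
  \<open>M\<close> and optimised, also when the norm is zero.\<close>

theorem embedding_from_piece_bounds:
  fixes \<phi> :: "real^'n \<Rightarrow> complex" and \<phi>0 :: "real^'n \<Rightarrow> real"
  assumes cut: "X_cutoff \<phi>" and gen: "TL_generator \<phi>0" and \<theta>: "0 \<le> \<theta>" "\<theta> \<le> 1"
  shows "\<exists>C>0. \<forall>u. tempered u \<longrightarrow> (\<exists>M>0. piece_bounds \<phi>0 \<theta> M u) \<longrightarrow>
    (\<exists>f. locally_integrable f \<and> represents f u \<and>
      (\<forall>M>0. piece_bounds \<phi>0 \<theta> M u \<longrightarrow> X_norm \<phi> (\<lambda>t. (1 + log_plus (1 / t)) powr \<theta>) f \<le> ennreal (C * M)))"
proof -
  obtain C1 where C1: "C1 \<ge> 0" and bmo: "\<And>u f r M. tempered u \<Longrightarrow> f \<in> borel_measurable borel \<Longrightarrow> strict_mono r \<Longrightarrow>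
    (AE x in lborel. (\<lambda>i. psum \<phi>0 u (r i) x) \<longlonglongrightarrow> f x) \<Longrightarrow> 0 < M \<Longrightarrow> piece_bounds \<phi>0 \<theta> M u \<Longrightarrow>
    BMO_norm f \<le> ennreal (C1 * M)"
    using BMO_bound[OF gen] by blast
  obtain C2 where C2: "C2 \<ge> 0" and mul: "\<And>u M t x. tempered u \<Longrightarrow> 0 < M \<Longrightarrow> piece_bounds \<phi>0 \<theta> M u \<Longrightarrow> 0 < t \<Longrightarrow>
    norm (multiplier \<phi> t u x) \<le> C2 * M * (1 + log_plus (1 / t)) powr \<theta>"
    using multiplier_bound[OF gen cut \<theta>] by blast
  have s\<phi>: "schwartz \<phi>" using cut by (simp add: X_cutoff_def)
  let ?w = "\<lambda>t. (1 + log_plus (1 / t)) powr \<theta>"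
  have w: "?w t > 0" for t using log_plus_nonneg[of "1 / t"] by simp
  show ?thesis
  proof (intro exI[of _ "C1 + C2 + 1"] conjI allI impI)
    show "0 < C1 + C2 + 1" using C1 C2 by simp
    fix u :: "(real^'n \<Rightarrow> complex) \<Rightarrow> complex"
    assume u: "tempered u" and ex: "\<exists>M>0. piece_bounds \<phi>0 \<theta> M u"
    then obtain M0 where M0: "M0 > 0" "piece_bounds \<phi>0 \<theta> M0 u" by blast
    have B: "(\<integral>\<^sup>+x\<in>dyadic_cube 0 m. (\<Sum>j. ennreal ((norm (TL_piece \<phi>0 j u x))\<^sup>2)) \<partial>lborel)
      \<le> ennreal (M0\<^sup>2) * emeasure lborel (dyadic_cube 0 m :: (real^'n) set)" for m
    proof -
      have "\<forall>k m. (\<integral>\<^sup>+x\<in>dyadic_cube k m. (\<Sum>j. ennreal ((norm (TL_piece \<phi>0 (k + j) u x))\<^sup>2)) \<partial>lborel)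
        \<le> ennreal (M0\<^sup>2) * emeasure lborel (dyadic_cube k m :: (real^'n) set)"
        using M0(2) unfolding piece_bounds_def by blast
      from this[rule_format, of 0 m] show ?thesis by simp
    qed
    obtain f r where f[measurable]: "f \<in> borel_measurable borel" and r: "strict_mono r"
      and ae: "AE x in lborel. (\<lambda>i. psum \<phi>0 u (r i) x) \<longlonglongrightarrow> f x"
      and conv: "\<And>\<epsilon>. \<epsilon> > 0 \<Longrightarrow> \<exists>I0. \<forall>I\<ge>I0. (\<integral>\<^sup>+x. ennreal (norm (f x - psum \<phi>0 u I x) * wt x) \<partial>lborel) \<le> ennreal \<epsilon>"
      using psum_limit[OF gen u B] by blast
    have rep: "represents f u" by (rule represents_limit[OF gen u f conv])
    have "locally_integrable f"
    proof (rule locally_integrable_weighted[OF f])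
      note [measurable] = TL_piece_measurable[OF gen u]
      obtain I where I: "(\<integral>\<^sup>+x. ennreal (norm (f x - psum \<phi>0 u I x) * wt x) \<partial>lborel) \<le> ennreal 1"
        using conv[of 1] by auto
      obtain R where R: "(\<integral>\<^sup>+x. ennreal ((norm (psum \<phi>0 u I x))\<^sup>2 * wt x) \<partial>lborel) \<le> ennreal R"
        using psum_weighted_Cauchy(2)[OF gen u B, of 1] by auto
      have "(\<integral>\<^sup>+x. ennreal (norm (f x) * wt x) \<partial>lborel) \<le>
        (\<integral>\<^sup>+x. ennreal (norm (f x - psum \<phi>0 u I x) * wt x) + ennreal (norm (psum \<phi>0 u I x) * wt x) \<partial>lborel)"
      proof (rule nn_integral_mono)
        fix x :: "real^'n"
        have w0: "0 \<le> wt x" using wt_pos[of x] by simp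
        have "norm (f x) * wt x \<le> (norm (f x - psum \<phi>0 u I x) + norm (psum \<phi>0 u I x)) * wt x"
          using norm_triangle_ineq[of "f x - psum \<phi>0 u I x" "psum \<phi>0 u I x"] w0 by (intro mult_right_mono) auto
        then have "ennreal (norm (f x) * wt x) \<le> ennreal (norm (f x - psum \<phi>0 u I x) * wt x + norm (psum \<phi>0 u I x) * wt x)"
          unfolding distrib_right by (rule ennreal_leI)
        also have "\<dots> = ennreal (norm (f x - psum \<phi>0 u I x) * wt x) + ennreal (norm (psum \<phi>0 u I x) * wt x)"
          using w0 by (intro ennreal_plus) auto
        finally show "ennreal (norm (f x) * wt x) \<le> ennreal (norm (f x - psum \<phi>0 u I x) * wt x) + ennreal (norm (psum \<phi>0 u I x) * wt x)" .
      qed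
      also have "\<dots> = (\<integral>\<^sup>+x. ennreal (norm (f x - psum \<phi>0 u I x) * wt x) \<partial>lborel) + (\<integral>\<^sup>+x. ennreal (norm (psum \<phi>0 u I x) * wt x) \<partial>lborel)"
        by (rule nn_integral_add) measurable
      also have "\<dots> \<le> ennreal 1 + (ennreal (1 * (\<integral>x. wt x \<partial>(lborel::(real^'n) measure))) + ennreal (1 / 1) * ennreal R)"
        by (intro add_mono I order_trans[OF weighted_L1_le_L2[where \<delta> = 1]] order_refl mult_left_mono R) auto
      also have "\<dots> < \<infinity>" by (simp add: ennreal_mult_less_top)
      finally show "(\<integral>\<^sup>+x. ennreal (norm (f x) * wt x) \<partial>lborel) < \<infinity>" .
    qed
    moreover have "X_norm \<phi> ?w f \<le> ennreal ((C1 + C2 + 1) * M)" if M: "M > 0" "piece_bounds \<phi>0 \<theta> M u" for M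
    proof -
      have "Linf_norm (multiplier \<phi> t (dist_of_fun f)) / ennreal (?w t) \<le> ennreal (C2 * M)" if t: "t \<in> {0<..}" for t
      proof -
        have t0: "t \<noteq> 0" using t by simp
        have st: "schwartz (\<lambda>\<xi>. \<phi> (t *\<^sub>R \<xi>))" using t by (intro schwartz_dilate s\<phi>) simp
        have eq: "multiplier \<phi> t (dist_of_fun f) = fmult (\<lambda>\<xi>. \<phi> (t *\<^sub>R \<xi>)) u"
          unfolding multiplier_represents[OF rep s\<phi> t0] by (rule multiplier_eq_fmult[OF s\<phi> t0 u])
        note [measurable] = fmult_measurable[OF u st]
        have "Linf_norm (multiplier \<phi> t (dist_of_fun f)) \<le> ennreal (C2 * M * ?w t)"
          unfolding Linf_norm_def
        proof (rule esssup_I)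
          show "(\<lambda>x. ennreal (norm (multiplier \<phi> t (dist_of_fun f) x))) \<in> borel_measurable lebesgue"
            unfolding eq by (rule measurable_completion) measurable
          show "AE x in lebesgue. ennreal (norm (multiplier \<phi> t (dist_of_fun f) x)) \<le> ennreal (C2 * M * ?w t)"
            unfolding multiplier_represents[OF rep s\<phi> t0]
            using mul[OF u M] t by (intro AE_I2 ennreal_leI) auto
        qed
        then have "Linf_norm (multiplier \<phi> t (dist_of_fun f)) / ennreal (?w t) \<le> ennreal (C2 * M * ?w t) / ennreal (?w t)"
          by (rule divide_right_mono_ennreal)
        also have "\<dots> = ennreal (C2 * M)" using w[of t] C2 M(1) by (simp add: divide_ennreal)
        finally show ?thesis .
      qed
      then have "X_norm \<phi> ?w f \<le> ennreal (C1 * M) + ennreal (C2 * M)"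
        unfolding X_norm_def by (intro add_mono bmo[OF u f r ae M] SUP_least)
      also have "\<dots> = ennreal (C1 * M + C2 * M)" using C1 C2 M by (simp add: ennreal_plus)
      also have "\<dots> \<le> ennreal ((C1 + C2 + 1) * M)" using M by (intro ennreal_leI) (simp add: distrib_right)
      finally show ?thesis .
    qed
    ultimately show "\<exists>f. locally_integrable f \<and> represents f u \<and>
      (\<forall>M>0. piece_bounds \<phi>0 \<theta> M u \<longrightarrow> X_norm \<phi> ?w f \<le> ennreal ((C1 + C2 + 1) * M))"
      using rep by (intro exI[of _ f]) simp
  qed
qed

section \<open>From the Triebel--Lizorkin norm to the pieces\<close>

text \<open>The radius at unit scale is shared by all pieces after rescaling by 2^(j+1), whence the
  half in the radius. Polynomial growth is all that is known about the piece at this point.\<close>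

lemma TL_piece_local_constancy:
  fixes \<phi>0 :: "real^'n \<Rightarrow> real"
  assumes gen: "TL_generator \<phi>0"
  shows "\<exists>\<rho>>0. \<forall>u j x. tempered u \<longrightarrow>
    (\<exists>x0. \<forall>y\<in>cball x0 (\<rho> / 2 ^ j). norm (TL_piece \<phi>0 j u x) \<le> 4 * norm (TL_piece \<phi>0 j u y))"
proof -
  let ?X = "ker (\<lambda>\<xi>. complex_of_real (\<phi>0 \<xi>))"
  obtain \<rho> where \<rho>: "\<rho> > 0" and loc: "\<forall>H. H \<in> borel_measurable borel \<longrightarrow> (\<exists>C N. \<forall>y. norm (H y) \<le> C * (1 + norm y) ^ N) \<longrightarrow>
    (\<forall>x. H x = (\<integral>y. H y * ?X (y - x) \<partial>lborel)) \<longrightarrow>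
    (\<forall>x1. \<exists>x0. \<forall>y\<in>cball x0 \<rho>. norm (H x1) \<le> 4 * norm (H y))"
    using local_constancy[OF schwartz_ker[OF schwartz_generator[OF gen]]] by blast
  show ?thesis
  proof (intro exI[of _ "\<rho> / 2"] conjI allI impI)
    show "0 < \<rho> / 2" using \<rho> by simp
    fix u :: "(real^'n \<Rightarrow> complex) \<Rightarrow> complex" and j x
    assume u: "tempered u"
    note [measurable] = TL_piece_measurable[OF gen u]
    let ?H = "\<lambda>x. TL_piece \<phi>0 j u ((1 / 2 ^ Suc j) *\<^sub>R x)"
    have Hm: "?H \<in> borel_measurable borel" by measurable
    have Hg: "\<exists>C N. \<forall>y. norm (?H y) \<le> C * (1 + norm y) ^ N"
    proof -
      obtain C N where C: "C \<ge> 0" "\<And>y. norm (TL_piece \<phi>0 j u y) \<le> C * (1 + norm y) ^ N"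
        using fmult_growth[OF u schwartz_csym[OF gen], of j] unfolding TL_piece_eq_fmult[OF gen u, symmetric] by blast
      have "norm (?H y) \<le> C * (1 + norm y) ^ N" for y
      proof -
        have "norm (((1::real) / 2 ^ Suc j) *\<^sub>R y) = (1 / 2 ^ Suc j) * norm y" by simp
        also have "\<dots> \<le> norm y"
        proof (intro mult_left_le_one_le)
          have "(1::real) \<le> 2 ^ Suc j" by (rule one_le_power) simp
          then show "1 / 2 ^ Suc j \<le> (1::real)" by (simp add: divide_le_eq)
        qed auto
        finally have "C * (1 + norm (((1::real) / 2 ^ Suc j) *\<^sub>R y)) ^ N \<le> C * (1 + norm y) ^ N"
          using C(1) by (intro mult_left_mono power_mono) auto
        then show ?thesis using C(2) order_trans by blast
      qed
      then show ?thesis by blast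
    qed
    have Hr: "\<forall>x. ?H x = (\<integral>y. ?H y * ?X (y - x) \<partial>lborel)" by (intro allI TL_piece_rescaled[OF gen u])
    have "\<exists>x0. \<forall>y\<in>cball x0 \<rho>. norm (?H (2 ^ Suc j *\<^sub>R x)) \<le> 4 * norm (?H y)"
      by (rule loc[rule_format, OF Hm Hg Hr[rule_format]])
    then obtain x0 where x0: "\<And>y. y \<in> cball x0 \<rho> \<Longrightarrow> norm (?H (2 ^ Suc j *\<^sub>R x)) \<le> 4 * norm (?H y)" by blast
    have "norm (TL_piece \<phi>0 j u x) \<le> 4 * norm (TL_piece \<phi>0 j u y)" if y: "y \<in> cball ((1 / 2 ^ Suc j) *\<^sub>R x0) (\<rho> / 2 / 2 ^ j)" for y
    proof -
      have "dist x0 (2 ^ Suc j *\<^sub>R y) = 2 ^ Suc j * dist ((1 / 2 ^ Suc j) *\<^sub>R x0) y"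
      proof -
        have "x0 - 2 ^ Suc j *\<^sub>R y = (2 ^ Suc j :: real) *\<^sub>R ((1 / 2 ^ Suc j) *\<^sub>R x0 - y)" by (simp add: scaleR_diff_right)
        then show ?thesis unfolding dist_norm by (simp del: power_Suc)
      qed
      also have "\<dots> \<le> 2 ^ Suc j * (\<rho> / 2 / 2 ^ j)" using y by (intro mult_left_mono) auto
      finally have "2 ^ Suc j *\<^sub>R y \<in> cball x0 \<rho>" by simp
      from x0[OF this] show ?thesis by simp
    qed
    then show "\<exists>x0. \<forall>y\<in>cball x0 (\<rho> / 2 / 2 ^ j). norm (TL_piece \<phi>0 j u x) \<le> 4 * norm (TL_piece \<phi>0 j u y)"
      by blast
  qed
qed

text \<open>Induction from the largest set downwards: all later sets together have measure at most
  4/3 of a quarter of the first, so most of the first set is disjoint from them and carries its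
  share of the integral. The second conjunct is what makes the induction go through.\<close>

lemma lacunary_sup_bound:
  fixes b :: "nat \<Rightarrow> 'a set" and c \<mu> :: "nat \<Rightarrow> real" and V :: "'a \<Rightarrow> ennreal"
  assumes [measurable]: "\<And>l. b l \<in> sets M" "V \<in> borel_measurable M"
    and \<mu>: "\<And>l. emeasure M (b l) = ennreal (\<mu> l)" "\<And>l. 0 \<le> \<mu> l" "\<And>l. \<mu> (Suc l) \<le> \<mu> l / 4"
    and c: "\<And>l. 0 \<le> c l" and V: "\<And>l x. x \<in> b l \<Longrightarrow> ennreal (c l) \<le> V x"
  shows "ennreal (\<Sum>l<L. c l * \<mu> l) \<le> 2 * (\<integral>\<^sup>+x\<in>(\<Union>l<L. b l). V x \<partial>M) \<and>
    (0 < L \<longrightarrow> emeasure M (\<Union>l<L. b l) \<le> ennreal (4 / 3 * \<mu> 0))"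
  using assms
proof (induction L arbitrary: b c \<mu>)
  case 0 then show ?case by simp
next
  case (Suc L)
  note [measurable] = Suc.prems(1,2)
  let ?U' = "\<Union>l<L. b (Suc l)" and ?U = "\<Union>l<Suc L. b l"
  let ?E = "b 0 - ?U'"
  have IH: "ennreal (\<Sum>l<L. c (Suc l) * \<mu> (Suc l)) \<le> 2 * (\<integral>\<^sup>+x\<in>?U'. V x \<partial>M) \<and>
      (0 < L \<longrightarrow> emeasure M ?U' \<le> ennreal (4 / 3 * \<mu> (Suc 0)))"
    by (rule Suc.IH[of "\<lambda>l. b (Suc l)" "\<lambda>l. \<mu> (Suc l)" "\<lambda>l. c (Suc l)"]) (use Suc.prems in auto)
  have U': "emeasure M ?U' \<le> ennreal (\<mu> 0 / 3)"
  proof (cases "L = 0")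
    case False
    then have "emeasure M ?U' \<le> ennreal (4 / 3 * \<mu> (Suc 0))" using IH by simp
    also have "\<dots> \<le> ennreal (\<mu> 0 / 3)" using Suc.prems(5)[of 0] by (intro ennreal_leI) simp
    finally show ?thesis .
  qed simp
  have Ueq: "?U = ?E \<union> ?U'" by (auto simp: lessThan_Suc_eq_insert_0)
  \<comment> \<open>Two thirds of the set remain after the later ones are removed; one half is
    enough and gives the factor 2.\<close>
  have E: "ennreal (\<mu> 0 / 2) \<le> emeasure M ?E"
  proof -
    have "ennreal (\<mu> 0) = emeasure M (b 0)" using Suc.prems(3) by simp
    also have "\<dots> \<le> emeasure M (?E \<union> ?U')" by (intro emeasure_mono) auto
    also have "\<dots> \<le> emeasure M ?E + emeasure M ?U'" by (intro emeasure_subadditive) measurable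
    also have "\<dots> \<le> emeasure M ?E + ennreal (\<mu> 0 / 3)" by (intro add_left_mono U')
    finally have 1: "ennreal (\<mu> 0) \<le> emeasure M ?E + ennreal (\<mu> 0 / 3)" .
    have "emeasure M ?E \<le> emeasure M (b 0)" by (intro emeasure_mono) auto
    then have "emeasure M ?E \<le> ennreal (\<mu> 0)" using Suc.prems(3) by simp
    then obtain e where e: "emeasure M ?E = ennreal e" "0 \<le> e"
      by (metis ennreal_cases ennreal_neq_top top.extremum_unique)
    have "\<mu> 0 \<le> e + \<mu> 0 / 3"
      using 1 e(2) Suc.prems(4)[of 0] unfolding e(1) by (simp add: ennreal_plus[symmetric] ennreal_le_iff del: ennreal_plus)
    then show ?thesis unfolding e(1) using Suc.prems(4)[of 0] by (intro ennreal_leI) simp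
  qed
  have "ennreal (\<Sum>l<Suc L. c l * \<mu> l) = ennreal (c 0 * \<mu> 0) + ennreal (\<Sum>l<L. c (Suc l) * \<mu> (Suc l))"
    unfolding sum.lessThan_Suc_shift using Suc.prems(4,6) by (intro ennreal_plus mult_nonneg_nonneg sum_nonneg) auto
  also have "ennreal (c 0 * \<mu> 0) = 2 * (ennreal (c 0) * ennreal (\<mu> 0 / 2))"
    using Suc.prems(4)[of 0] Suc.prems(6)[of 0]
    by (simp add: ennreal_mult[symmetric] flip: ennreal_numeral)
  also have "2 * (ennreal (c 0) * ennreal (\<mu> 0 / 2)) \<le> 2 * (\<integral>\<^sup>+x\<in>?E. V x \<partial>M)"
  proof (intro mult_left_mono)
    have "ennreal (c 0) * ennreal (\<mu> 0 / 2) \<le> ennreal (c 0) * emeasure M ?E" by (intro mult_left_mono E) simp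
    also have "\<dots> = (\<integral>\<^sup>+x. ennreal (c 0) * indicator ?E x \<partial>M)" by (rule nn_integral_cmult_indicator[symmetric]) measurable
    also have "\<dots> \<le> (\<integral>\<^sup>+x\<in>?E. V x \<partial>M)"
      using Suc.prems(7)[of _ 0] by (intro nn_integral_mono) (auto simp: indicator_def)
    finally show "ennreal (c 0) * ennreal (\<mu> 0 / 2) \<le> (\<integral>\<^sup>+x\<in>?E. V x \<partial>M)" .
  qed simp
  also have "2 * (\<integral>\<^sup>+x\<in>?E. V x \<partial>M) + ennreal (\<Sum>l<L. c (Suc l) * \<mu> (Suc l)) \<le>
      2 * (\<integral>\<^sup>+x\<in>?E. V x \<partial>M) + 2 * (\<integral>\<^sup>+x\<in>?U'. V x \<partial>M)"
    using IH by (intro add_left_mono) simp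
  also have "\<dots> = 2 * (\<integral>\<^sup>+x. V x * indicator ?E x + V x * indicator ?U' x \<partial>M)"
    by (subst nn_integral_add) (auto simp: distrib_left)
  also have "(\<integral>\<^sup>+x. V x * indicator ?E x + V x * indicator ?U' x \<partial>M) = (\<integral>\<^sup>+x\<in>?U. V x \<partial>M)"
    unfolding Ueq by (intro nn_integral_cong) (auto simp: indicator_def)
  finally have 1: "ennreal (\<Sum>l<Suc L. c l * \<mu> l) \<le> 2 * (\<integral>\<^sup>+x\<in>?U. V x \<partial>M)"
    by (simp add: add_right_mono)
  have "emeasure M ?U \<le> emeasure M (b 0) + emeasure M ?U'"
  proof -
    have "?U = b 0 \<union> ?U'" by (auto simp: lessThan_Suc_eq_insert_0)
    then show ?thesis by (simp only:) (intro emeasure_subadditive; measurable)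
  qed
  also have "\<dots> \<le> ennreal (\<mu> 0) + ennreal (\<mu> 0 / 3)" using U' Suc.prems(3)[of 0] by (intro add_mono) auto
  also have "\<dots> = ennreal (4 / 3 * \<mu> 0)"
    using Suc.prems(4)[of 0] by (simp add: ennreal_plus[symmetric] del: ennreal_plus)
  finally show ?case using 1 by simp
qed

text \<open>Frequency by frequency, \<open>|f\<^sub>j|\<close> stays comparable to its value at \<open>x\<^sub>j\<close> on a ball of radius comparable to \<open>2\<^sup>-\<^sup>j\<close>.
  Within a parity class of \<open>j\<close> these balls are lacunary in measure, so they can be made disjoint.\<close>

lemma Jawerth_bound:
  fixes \<phi>0 :: "real^'n \<Rightarrow> real"
  assumes gen: "TL_generator \<phi>0" and p: "0 < p"
  shows "\<exists>C>0. \<forall>u J x T. tempered u \<longrightarrow> 0 \<le> T \<longrightarrow>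
    (\<integral>\<^sup>+y. (SUP j. ennreal (2 ^ (j * CARD('n)) * norm (TL_piece \<phi>0 j u y) powr p)) \<partial>lborel) \<le> ennreal T \<longrightarrow>
    (\<Sum>j<J. norm (TL_piece \<phi>0 j u (x j)) powr p) \<le> C * T"
proof -
  obtain \<rho> where \<rho>: "\<rho> > 0" and loc: "\<And>u j x. tempered u \<Longrightarrow>
    (\<exists>x0. \<forall>y\<in>cball x0 (\<rho> / 2 ^ j). norm (TL_piece \<phi>0 j u x) \<le> 4 * norm (TL_piece \<phi>0 j u y))"
    using TL_piece_local_constancy[OF gen] by blast
  define v where "v = unit_ball_vol (real CARD('n)) * \<rho> ^ CARD('n)"
  have v: "v > 0" unfolding v_def using \<rho> by (intro mult_pos_pos unit_ball_vol_pos zero_less_power) auto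
  \<comment> \<open>Two parity classes and the factor 2 of the lacunary bound give 4;
    \<open>4 powr p\<close> comes from comparability on the balls and 1 / v from their normalised
    volume.\<close>
  define C where "C = 4 * 4 powr p / v"
  have C: "C > 0" using v by (simp add: C_def)
  show ?thesis
  proof (intro exI[of _ C] conjI C allI impI)
    fix u :: "(real^'n \<Rightarrow> complex) \<Rightarrow> complex" and J and x :: "nat \<Rightarrow> real^'n" and T :: real
    assume u: "tempered u" and T: "0 \<le> T"
      and V: "(\<integral>\<^sup>+y. (SUP j. ennreal (2 ^ (j * CARD('n)) * norm (TL_piece \<phi>0 j u y) powr p)) \<partial>lborel) \<le> ennreal T"
    note [measurable] = TL_piece_measurable[OF gen u]
    let ?f = "\<lambda>j. TL_piece \<phi>0 j u"
    let ?V = "\<lambda>y. SUP j. ennreal (2 ^ (j * CARD('n)) * norm (?f j y) powr p)"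
    have "\<forall>j. \<exists>x0. \<forall>y\<in>cball x0 (\<rho> / 2 ^ j). norm (?f j (x j)) \<le> 4 * norm (?f j y)"
      using loc[OF u] by blast
    from choice[OF this] obtain z where z: "\<forall>j. \<forall>y\<in>cball (z j) (\<rho> / 2 ^ j). norm (?f j (x j)) \<le> 4 * norm (?f j y)" ..
    define g where "g j = norm (?f j (x j)) powr p" for j
    have g0: "g j \<ge> 0" for j by (simp add: g_def)
    \<comment> \<open>A lower bound for the maximal function on the j-th ball. The weight 2^(jn)
      cancels the volume \<open>\<mu> j\<close>, so \<open>c j * \<mu> j\<close> is a fixed multiple
      of \<open>g j\<close>.\<close>
    define c where "c j = 2 ^ (j * CARD('n)) * (g j / 4 powr p)" for j
    define \<mu> where "\<mu> j = v / 2 ^ (j * CARD('n))" for j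
    have cV: "ennreal (c j) \<le> ?V y" if "y \<in> cball (z j) (\<rho> / 2 ^ j)" for j y
    proof -
      have "norm (?f j (x j)) powr p \<le> (4 * norm (?f j y)) powr p"
        using z that p by (intro powr_mono2) auto
      then have "g j \<le> 4 powr p * norm (?f j y) powr p" unfolding g_def by (simp add: powr_mult)
      then have "g j / 4 powr p \<le> norm (?f j y) powr p" by (simp add: divide_le_eq mult.commute)
      then have "c j \<le> 2 ^ (j * CARD('n)) * norm (?f j y) powr p" unfolding c_def by (intro mult_left_mono) auto
      then have "ennreal (c j) \<le> ennreal (2 ^ (j * CARD('n)) * norm (?f j y) powr p)" by (rule ennreal_leI)
      also have "\<dots> \<le> ?V y" by (rule SUP_upper) simp
      finally show ?thesis .
    qed
    have em: "emeasure lborel (cball (z j) (\<rho> / 2 ^ j)) = ennreal (\<mu> j)" for j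
      using \<rho> by (simp add: emeasure_cball \<mu>_def v_def DIM_cart power_divide power_mult[symmetric])
    have half: "(\<Sum>l<L. g (2 * l + e)) \<le> 2 * 4 powr p / v * T" for e L
    proof -
      have "ennreal (\<Sum>l<L. c (2 * l + e) * \<mu> (2 * l + e)) \<le>
        2 * (\<integral>\<^sup>+y\<in>(\<Union>l<L. cball (z (2 * l + e)) (\<rho> / 2 ^ (2 * l + e))). ?V y \<partial>lborel)"
      proof (rule lacunary_sup_bound[where c = "\<lambda>l. c (2 * l + e)" and \<mu> = "\<lambda>l. \<mu> (2 * l + e)", THEN conjunct1])
        \<comment> \<open>Two levels shrink the volume by 2^(2n) \<ge> 4. One level would give only
          a factor 2 in dimension one, hence the parity classes.\<close>
        show "\<mu> (2 * Suc l + e) \<le> \<mu> (2 * l + e) / 4" for l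
        proof -
          have "(2::real) ^ (2 * CARD('n)) \<ge> 2 ^ 2" by (intro power_increasing) (auto simp: Suc_le_eq)
          then have "\<mu> (2 * l + e) / 2 ^ (2 * CARD('n)) \<le> \<mu> (2 * l + e) / 4"
            using v by (intro divide_left_mono) (auto simp: \<mu>_def)
          moreover have "\<mu> (2 * Suc l + e) = \<mu> (2 * l + e) / 2 ^ (2 * CARD('n))"
            by (simp add: \<mu>_def power_add[symmetric] distrib_right algebra_simps)
          ultimately show ?thesis by simp
        qed
        show "emeasure lborel (cball (z (2 * l + e)) (\<rho> / 2 ^ (2 * l + e))) = ennreal (\<mu> (2 * l + e))" for l by (rule em)
        show "0 \<le> \<mu> (2 * l + e)" for l using v by (simp add: \<mu>_def)
        show "0 \<le> c (2 * l + e)" for l using g0 by (simp add: c_def)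
        show "ennreal (c (2 * l + e)) \<le> ?V y" if "y \<in> cball (z (2 * l + e)) (\<rho> / 2 ^ (2 * l + e))" for l y
          by (rule cV[OF that])
      qed measurable
      also have "\<dots> \<le> 2 * (\<integral>\<^sup>+y. ?V y \<partial>lborel)"
        by (intro mult_left_mono nn_integral_mono) (auto simp: indicator_def)
      also have "\<dots> \<le> 2 * ennreal T" by (intro mult_left_mono V) simp
      also have "\<dots> = ennreal (2 * T)" using T by (simp add: ennreal_mult)
      finally have "(\<Sum>l<L. c (2 * l + e) * \<mu> (2 * l + e)) \<le> 2 * T" using T by (simp add: ennreal_le_iff)
      moreover have "c j * \<mu> j = v / 4 powr p * g j" for j by (simp add: c_def \<mu>_def)
      ultimately have "v / 4 powr p * (\<Sum>l<L. g (2 * l + e)) \<le> 2 * T" by (simp add: sum_distrib_left)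
      then show ?thesis using v by (simp add: field_simps)
    qed
    have split: "(\<Sum>j<2 * L. g j) = (\<Sum>l<L. g (2 * l + 0)) + (\<Sum>l<L. g (2 * l + 1))" for L
      by (induction L) simp_all
    have "(\<Sum>j<J. g j) \<le> (\<Sum>j<2 * J. g j)" using g0 by (intro sum_mono2) auto
    also have "\<dots> \<le> 2 * 4 powr p / v * T + 2 * 4 powr p / v * T" unfolding split by (intro add_mono half)
    also have "\<dots> = C * T" by (simp add: C_def)
    finally show "(\<Sum>j<J. norm (?f j (x j)) powr p) \<le> C * T" by (simp add: g_def)
  qed
qed

section \<open>Finite p: from the maximal function to the piece bounds\<close>

lemma le_enn2realI:
  assumes "ennreal a \<le> X" "X \<noteq> \<infinity>" "0 \<le> a" shows "a \<le> enn2real X"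
  using assms by (cases X) (auto simp: ennreal_le_iff)

text \<open>Each term is bounded by the l^q norm of the sequence, and s p = n turns 2^(jsp) into
  2^(jn), the inverse volume of a ball at scale 2^(-j).\<close>

lemma TL_norm_fin_maximal:
  fixes \<phi>0 :: "real^'n \<Rightarrow> real" and s p :: real
  assumes gen: "TL_generator \<phi>0" and u: "tempered u"
    and fin: "TL_norm_fin \<phi>0 s p q u < \<infinity>" and p: "0 < p" "s * p = CARD('n)" and q: "0 < q"
  shows "(\<integral>\<^sup>+y. (SUP j. ennreal (2 ^ (j * CARD('n)) * norm (TL_piece \<phi>0 j u y) powr p)) \<partial>lborel)
    \<le> ennreal (enn2real (TL_norm_fin \<phi>0 s p q u) powr p)"
proof -
  note [measurable] = TL_piece_measurable[OF gen u]
  let ?f = "\<lambda>j. TL_piece \<phi>0 j u"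
  define G where "G x = (if q = \<infinity> then (SUP j. ennreal (2 powr (real j * s) * norm (?f j x)))
     else epowr (\<Sum>j. ennreal (2 powr (real j * s * enn2real q) * norm (?f j x) powr enn2real q)) (1 / enn2real q))" for x
  define I where "I = (\<integral>\<^sup>+x. epowr (G x) p \<partial>lebesgue)"
  have T: "TL_norm_fin \<phi>0 s p q u = epowr I (1 / p)"
    unfolding TL_norm_fin_def Lp_norm_def I_def G_def ..
  have I: "I \<noteq> \<infinity>" using fin unfolding T by (auto simp: epowr_def)
  then have Tr: "enn2real (TL_norm_fin \<phi>0 s p q u) powr p = enn2real I"
    unfolding T using p(1) by (simp add: epowr_def powr_powr)
  have G: "ennreal (2 powr (real j * s) * norm (?f j x)) \<le> G x" for j x
  proof (cases "q = \<infinity>")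
    case True
    show ?thesis unfolding G_def if_P[OF True] by (rule SUP_upper) simp
  next
    case False
    define r where "r = enn2real q"
    have r: "r > 0" using q False unfolding r_def by (simp add: enn2real_positive_iff less_top)
    define S where "S = (\<Sum>j. ennreal (2 powr (real j * s * r) * norm (?f j x) powr r))"
    have GS: "G x = epowr S (1 / r)" using False by (simp add: G_def S_def r_def)
    show ?thesis
    proof (cases "S = \<infinity>")
      case True then show ?thesis by (simp add: GS epowr_def)
    next
      case fS: False
      have "ennreal (2 powr (real j * s * r) * norm (?f j x) powr r) \<le> S"
      proof -
        define F where "F j = ennreal (2 powr (real j * s * r) * norm (?f j x) powr r)" for j
        have "(\<Sum>i\<in>{j}. F i) \<le> (\<Sum>i. F i)" by (rule sum_le_suminf) auto
        then have "F j \<le> (\<Sum>i. F i)" by simp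
        then show ?thesis by (simp only: S_def F_def)
      qed
      then have "2 powr (real j * s * r) * norm (?f j x) powr r \<le> enn2real S"
        using fS by (intro le_enn2realI) auto
      then have "(2 powr (real j * s * r) * norm (?f j x) powr r) powr (1 / r) \<le> enn2real S powr (1 / r)"
        using r by (intro powr_mono2) auto
      moreover have "(2 powr (real j * s * r) * norm (?f j x) powr r) powr (1 / r) = 2 powr (real j * s) * norm (?f j x)"
        using r by (simp add: powr_mult powr_powr)
      ultimately show ?thesis unfolding GS using fS by (simp add: epowr_def ennreal_leI)
    qed
  qed
  have "(SUP j. ennreal (2 ^ (j * CARD('n)) * norm (?f j y) powr p)) \<le> epowr (G y) p" for y
  proof (rule SUP_least)
    fix j
    show "ennreal (2 ^ (j * CARD('n)) * norm (?f j y) powr p) \<le> epowr (G y) p"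
    proof (cases "G y = \<infinity>")
      case True then show ?thesis by (simp add: epowr_def)
    next
      case False
      have "2 powr (real j * s) * norm (?f j y) \<le> enn2real (G y)"
        using G[of j y] False by (intro le_enn2realI) auto
      then have "(2 powr (real j * s) * norm (?f j y)) powr p \<le> enn2real (G y) powr p"
        using p(1) by (intro powr_mono2) auto
      moreover have "(2 powr (real j * s) * norm (?f j y)) powr p = 2 ^ (j * CARD('n)) * norm (?f j y) powr p"
        using p by (simp add: powr_mult powr_powr mult.assoc powr_realpow[symmetric])
      ultimately show ?thesis using False by (simp add: epowr_def ennreal_leI)
    qed
  qed
  then have "(\<integral>\<^sup>+y. (SUP j. ennreal (2 ^ (j * CARD('n)) * norm (?f j y) powr p)) \<partial>lebesgue) \<le> I"
    unfolding I_def by (rule nn_integral_mono)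
  then show ?thesis unfolding Tr using I
    by (subst (asm) nn_integral_completion) (auto simp: less_top)
qed

lemma powr_le_iff_base:
  fixes a b p :: real
  assumes "0 < p" "0 \<le> a" "0 \<le> b" "a powr p \<le> b powr p" shows "a \<le> b"
proof (rule ccontr)
  assume "\<not> a \<le> b"
  then have "b powr p < a powr p" using assms by (intro powr_less_mono2) auto
  then show False using assms by simp
qed

lemma powr_le_1_plus:
  fixes X a :: real
  assumes "0 \<le> X" "0 \<le> a" "a \<le> 1" shows "X powr a \<le> 1 + X"
proof (cases "X \<le> 1")
  case True
  have "X powr a \<le> 1 powr a" using assms True by (intro powr_mono2) auto
  then show ?thesis using assms by simp
next
  case False
  then have "X powr a \<le> X powr 1" using assms by (intro powr_mono) auto
  then show ?thesis using assms by simp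
qed

text \<open>For p \<ge> 1 this is Hoelder's inequality, obtained from t \<le> 1 + t^p for the terms
  divided by \<open>D\<close>. For p < 1 the terms divided by M lie in [0, 1], where t \<le> t^p,
  and the exponent of N is 0.\<close>

lemma sum_le_power_mean:
  fixes a :: "nat \<Rightarrow> real"
  assumes p: "0 < p" and M: "0 < M" and a: "\<And>j. 0 \<le> a j" "\<And>j. a j \<le> M" and S: "(\<Sum>j<N. a j powr p) \<le> M powr p" and N: "0 < N"
  shows "(\<Sum>j<N. a j) \<le> 2 * M * real N powr (1 - 1 / max 1 p)"
proof (cases "1 \<le> p")
  case True
  \<comment> \<open>This size balances the two contributions: each sums to M N^(1 - 1/p), whence the
    factor 2.\<close>
  define D where "D = M * real N powr (- 1 / p)"
  have D: "D > 0" using M N by (simp add: D_def)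
  have Dp: "D powr p = M powr p / real N"
  proof -
    have "D powr p = M powr p * real N powr (- 1 / p * p)" unfolding D_def by (simp only: powr_mult powr_powr)
    also have "- 1 / p * p = - 1" using p by simp
    finally show ?thesis using N by (simp add: powr_minus_divide)
  qed
  have "a j \<le> D + D * (a j powr p * (real N / M powr p))" for j
  proof -
    have "a j / D \<le> 1 + (a j / D) powr p"
    proof (cases "a j / D \<le> 1")
      case True then show ?thesis by (simp add: add_increasing2)
    next
      case False
      then have "(a j / D) powr 1 \<le> (a j / D) powr p" using \<open>1 \<le> p\<close> by (intro powr_mono) auto
      then show ?thesis using False a(1)[of j] D by simp
    qed
    also have "(a j / D) powr p = a j powr p * (real N / M powr p)"
      using a(1)[of j] D by (simp add: powr_divide Dp)
    finally show ?thesis using D by (simp add: field_simps)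
  qed
  then have "(\<Sum>j<N. a j) \<le> (\<Sum>j<N. D + D * (a j powr p * (real N / M powr p)))" by (rule sum_mono)
  also have "\<dots> = real N * D + D * ((\<Sum>j<N. a j powr p) * (real N / M powr p))"
    by (simp only: sum.distrib sum_distrib_left sum_distrib_right) simp
  also have "\<dots> \<le> real N * D + D * (M powr p * (real N / M powr p))"
    using D S by (intro add_left_mono mult_left_mono mult_right_mono) auto
  also have "\<dots> = 2 * (real N * D)" using M by simp
  also have "real N * D = M * real N powr (1 - 1 / max 1 p)"
  proof -
    have "real N powr (1 + - 1 / p) = real N * real N powr (- 1 / p)" using N by (simp only: powr_add) simp
    then show ?thesis using True by (simp add: D_def max_def mult_ac)
  qed
  finally show ?thesis by simp
next
  case False
  have "a j \<le> M * (a j powr p / M powr p)" for j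
  proof -
    have "(a j / M) powr 1 \<le> (a j / M) powr p"
      using False M a[of j] by (intro powr_mono') (auto simp: divide_le_eq)
    then have "a j / M \<le> a j powr p / M powr p" using M a(1)[of j] by (simp add: powr_divide)
    then show ?thesis using M by (simp add: field_simps)
  qed
  then have "(\<Sum>j<N. a j) \<le> (\<Sum>j<N. M * (a j powr p / M powr p))" by (rule sum_mono)
  also have "\<dots> = M * ((\<Sum>j<N. a j powr p) / M powr p)" by (simp add: sum_distrib_left sum_divide_distrib)
  also have "\<dots> \<le> M * (M powr p / M powr p)" using S M by (intro mult_left_mono divide_right_mono) auto
  also have "\<dots> \<le> 2 * M * real N powr (1 - 1 / max 1 p)" using False M N by (simp add: max_def)
  finally show ?thesis .
qed

text \<open>Here \<open>V\<close> is the value at a point of the maximal function whose \<open>L\<^sup>1\<close> norm is the \<open>p\<close>-th power of the norm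
  of \<open>F\<^bsup>n/p\<^esup>\<^bsub>p,\<infinity>\<^esub>\<close>; bounding \<open>a\<^sub>j\<^sup>2\<close> by \<open>M\<^bsup>2 - min p 2\<^esup> a\<^sub>j\<^bsup>min p 2\<^esup>\<close> makes the sum geometric, so that \<open>q\<close> plays no role.\<close>

lemma square_function_fin:
  fixes a :: "nat \<Rightarrow> real" and V :: ennreal
  assumes p: "0 < p" and M: "0 < M" and d: "0 < d" and a: "\<And>j. 0 \<le> a j" "\<And>j. a j \<le> M"
    and V: "\<And>j. ennreal (2 ^ ((k + j) * d) * a j powr p) \<le> V"
  shows "(\<Sum>j. ennreal ((a j)\<^sup>2)) \<le> ennreal (M\<^sup>2 / (1 - 2 powr - (real d * (min p 2 / p)))) * (1 + ennreal (1 / (2 ^ k) ^ d / M powr p) * V)"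
proof -
  \<comment> \<open>Raising the bound for the p-th power to \<sigma> \<le> 1 yields exponent min p
    2. It leaves the geometric ratio 2^(-d \<sigma>), and \<open>powr_le_1_plus\<close> makes the
    dependence on \<open>V\<close> linear, so that it can be integrated.\<close>
  define \<sigma> where "\<sigma> = min p 2 / p"
  have \<sigma>: "0 < \<sigma>" "\<sigma> \<le> 1" "p * \<sigma> = min p 2" using p by (auto simp: \<sigma>_def min_def divide_le_eq)
  define g where "g = 2 powr - (real d * \<sigma>)"
  have g: "0 < g" "g < 1" using \<sigma> d by (auto simp: g_def powr_less_one)
  define b where "b = 1 / (2 ^ k) ^ d / M powr p"
  have b: "b > 0" using M by (simp add: b_def)
  have K: "M\<^sup>2 / (1 - g) > 0" using M g by simp
  have "(\<Sum>j. ennreal ((a j)\<^sup>2)) \<le> ennreal (M\<^sup>2 / (1 - g)) * (1 + ennreal b * V)"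
  proof (cases V)
    case top
    have "ennreal b * V = \<top>" using b top by (simp add: ennreal_mult_top)
    moreover have "ennreal (M\<^sup>2 / (1 - g)) \<noteq> 0" using K by (simp only: ennreal_eq_0_iff not_le)
    ultimately show ?thesis by (simp add: ennreal_mult_top del: ennreal_eq_0_iff)
  next
    case (real v)
    define X where "X = b * v"
    have X: "X \<ge> 0" using b real by (simp add: X_def)
    have dec: "(a j)\<^sup>2 \<le> M\<^sup>2 * (1 + X) * g ^ j" for j
    proof -
      have "2 ^ ((k + j) * d) * a j powr p \<le> v" using V[of j] real by (simp add: ennreal_le_iff)
      then have "a j powr p \<le> v / 2 ^ ((k + j) * d)" by (simp add: field_simps)
      then have "(a j / M) powr p \<le> v / 2 ^ ((k + j) * d) / M powr p"
        using a(1)[of j] M by (subst powr_divide) (auto intro!: divide_right_mono simp del: divide_divide_eq_left)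
      also have "\<dots> = X * (1 / 2 ^ (j * d))"
        by (simp add: X_def b_def power_add power_mult[symmetric] distrib_right)
      finally have "((a j / M) powr p) powr \<sigma> \<le> (X * (1 / 2 ^ (j * d))) powr \<sigma>"
        using \<sigma> by (intro powr_mono2) auto
      also have "\<dots> = X powr \<sigma> * (1 / 2 ^ (j * d)) powr \<sigma>" by (rule powr_mult)
      also have "(1 / 2 ^ (j * d)) powr \<sigma> = g ^ j"
      proof -
        have "(1 / 2 ^ (j * d)) = (2::real) powr - (real (j * d))" by (simp only: powr_minus_divide powr_realpow zero_less_numeral)
        then have "(1 / 2 ^ (j * d)) powr \<sigma> = 2 powr (- (real (j * d)) * \<sigma>)" by (simp only: powr_powr)
        also have "- (real (j * d)) * \<sigma> = real j * (- (real d * \<sigma>))" by simp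
        also have "2 powr \<dots> = g ^ j" unfolding g_def by (simp add: powr_realpow[symmetric] powr_powr mult.commute)
        finally show ?thesis .
      qed
      finally have "(a j / M) powr min p 2 \<le> X powr \<sigma> * g ^ j" by (simp add: powr_powr \<sigma>(3))
      also have "\<dots> \<le> (1 + X) * g ^ j"
        using powr_le_1_plus[OF X, of \<sigma>] \<sigma> g by (intro mult_right_mono) auto
      finally have 1: "(a j / M) powr min p 2 \<le> (1 + X) * g ^ j" .
      have "(a j / M) powr 2 \<le> (a j / M) powr min p 2"
        using a[of j] M by (intro powr_mono') (auto simp: divide_le_eq)
      moreover have "(a j / M) powr 2 = (a j / M)\<^sup>2" using a(1)[of j] M by simp
      ultimately have "(a j / M)\<^sup>2 \<le> (1 + X) * g ^ j" using 1 by linarith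
      then show ?thesis using M by (simp add: power_divide divide_le_eq mult_ac)
    qed
    have "(\<lambda>j. M\<^sup>2 * (1 + X) * g ^ j) sums (M\<^sup>2 * (1 + X) * (1 / (1 - g)))"
      using g by (intro sums_mult geometric_sums) auto
    then have "(\<Sum>j. ennreal (M\<^sup>2 * (1 + X) * g ^ j)) = ennreal (M\<^sup>2 * (1 + X) * (1 / (1 - g)))"
      using X g by (intro suminf_ennreal_eq) auto
    moreover have "(\<Sum>j. ennreal ((a j)\<^sup>2)) \<le> (\<Sum>j. ennreal (M\<^sup>2 * (1 + X) * g ^ j))"
      using dec by (intro suminf_le ennreal_leI) auto
    moreover have "ennreal (M\<^sup>2 / (1 - g)) * (1 + ennreal b * V) = ennreal (M\<^sup>2 * (1 + X) * (1 / (1 - g)))"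
    proof -
      have "1 + ennreal b * V = ennreal (1 + X)"
        using b real by (simp add: X_def ennreal_mult ennreal_plus)
      then show ?thesis using K X by (simp add: ennreal_mult[symmetric] del: ennreal_plus)
    qed
    ultimately show ?thesis by simp
  qed
  then show ?thesis by (simp add: g_def \<sigma>_def b_def)
qed

text \<open>The square function is bounded by a constant plus a multiple of the maximal function.
  Restricting to levels j \<ge> k supplies the factor 2^(-kn) in front of the latter, so its global
  integral already contributes no more than the volume of the cube.\<close>

lemma piece_bounds_fin:
  fixes \<phi>0 :: "real^'n \<Rightarrow> real" and s p :: real
  assumes gen: "TL_generator \<phi>0" and p: "0 < p" "s * p = CARD('n)" and q: "0 < q"
  shows "\<exists>C>0. \<forall>u M. tempered u \<longrightarrow> TL_norm_fin \<phi>0 s p q u < \<infinity> \<longrightarrow> 0 < M \<longrightarrow>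
    C * enn2real (TL_norm_fin \<phi>0 s p q u) \<le> M \<longrightarrow> piece_bounds \<phi>0 (1 - 1 / max 1 p) M u"
proof -
  obtain CJ where CJ: "CJ > 0" and Jaw: "\<And>u J x T. tempered u \<Longrightarrow> 0 \<le> T \<Longrightarrow>
    (\<integral>\<^sup>+y. (SUP j. ennreal (2 ^ (j * CARD('n)) * norm (TL_piece \<phi>0 j u y) powr p)) \<partial>lborel) \<le> ennreal T \<Longrightarrow>
    (\<Sum>j<J. norm (TL_piece \<phi>0 j u (x j)) powr p) \<le> CJ * T"
    using Jawerth_bound[OF gen p(1)] by blast
  define g where "g = 2 powr - (real CARD('n) * (min p 2 / p))"
  have g: "0 < g" "g < 1" using p by (auto simp: g_def powr_less_one)
  define K where "K = 1 / (1 - g)"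
  have K: "K \<ge> 1" using g by (simp add: K_def)
  define A where "A = max 1 (CJ powr (1 / p))"
  have A: "A \<ge> 1" "CJ powr (1 / p) \<le> A" by (simp_all add: A_def)
  show ?thesis
  proof (intro exI[of _ "2 * K * A"] conjI allI impI)
    show "0 < 2 * K * A" using K A by simp
    fix u :: "(real^'n \<Rightarrow> complex) \<Rightarrow> complex" and M :: real
    assume u: "tempered u" and fin: "TL_norm_fin \<phi>0 s p q u < \<infinity>" and M: "0 < M"
      and le: "2 * K * A * enn2real (TL_norm_fin \<phi>0 s p q u) \<le> M"
    note [measurable] = TL_piece_measurable[OF gen u]
    define T where "T = enn2real (TL_norm_fin \<phi>0 s p q u)"
    have T: "T \<ge> 0" by (simp add: T_def)
    \<comment> \<open>\<open>A\<close> ensures that both T \<le> M0 and CJ T^p \<le> M0^p. The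
      factor 2 K, with K \<ge> 1 the sum of the geometric series, absorbs the constants of Hoelder's
      inequality and of the square function.\<close>
    define M0 where "M0 = M / (2 * K)"
    have M0: "M0 > 0" "M = 2 * K * M0" using M K by (auto simp: M0_def)
    have AT: "A * T \<le> M0" using le K unfolding M0_def T_def by (simp add: field_simps)
    have TM: "T \<le> M0" using AT A(1) mult_right_mono[OF A(1) T] by simp
    have CT: "CJ * T powr p \<le> M0 powr p"
    proof -
      have "CJ powr (1 / p) * T \<le> A * T" by (intro mult_right_mono A T)
      then have "CJ powr (1 / p) * T \<le> M0" using AT by linarith
      then have "(CJ powr (1 / p) * T) powr p \<le> M0 powr p" using p(1) T by (intro powr_mono2) auto
      then show ?thesis using p(1) CJ by (simp add: powr_mult powr_powr)
    qed
    let ?f = "\<lambda>j. TL_piece \<phi>0 j u"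
    let ?V = "\<lambda>y. SUP j. ennreal (2 ^ (j * CARD('n)) * norm (?f j y) powr p)"
    have V: "(\<integral>\<^sup>+y. ?V y \<partial>lborel) \<le> ennreal (T powr p)"
      unfolding T_def by (rule TL_norm_fin_maximal[OF gen u fin p q])
    have S: "(\<Sum>j<J. norm (?f j (x j)) powr p) \<le> M0 powr p" for J x
      using Jaw[OF u _ V, of x J] CT by simp
    have A0: "norm (?f j x) \<le> M0" for j x
    proof -
      have "norm (?f j x) powr p \<le> (\<Sum>i<Suc j. norm (?f i x) powr p)"
        by (rule member_le_sum[of j]) simp_all
      also have "\<dots> \<le> M0 powr p" by (rule S)
      finally have "norm (?f j x) powr p \<le> M0 powr p" .
      then show ?thesis by (rule powr_le_iff_base[OF p(1) norm_ge_zero less_imp_le[OF M0(1)]])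
    qed
    have MM: "M0 \<le> M" "2 * M0 \<le> M" using M0 K mult_right_mono[of 1 K M0] by auto
    show "piece_bounds \<phi>0 (1 - 1 / max 1 p) M u"
      unfolding piece_bounds_def
    proof (intro conjI allI)
      show "norm (?f j x) \<le> M" for j x using A0[of j x] MM by linarith
      show "(\<Sum>j<Suc J. norm (?f j x)) \<le> M * real (Suc J) powr (1 - 1 / max 1 p)" for J x
      proof -
        have "(\<Sum>j<Suc J. norm (?f j x)) \<le> 2 * M0 * real (Suc J) powr (1 - 1 / max 1 p)"
          by (rule sum_le_power_mean[OF p(1) M0(1) _ A0 S]) auto
        also have "\<dots> \<le> M * real (Suc J) powr (1 - 1 / max 1 p)" using MM by (intro mult_right_mono) auto
        finally show ?thesis .
      qed
      fix k and m :: "'n \<Rightarrow> int"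
      define Q :: "(real^'n) set" where "Q = dyadic_cube k m"
      have [measurable]: "Q \<in> sets borel" by (simp add: Q_def)
      define e :: real where "e = 1 / (2 ^ k) ^ CARD('n)"
      have e: "e > 0" "emeasure lborel Q = ennreal e" by (simp_all add: e_def Q_def emeasure_dyadic_cube)
      \<comment> \<open>The normalisation is such that \<open>b\<close> times the integral of the
        maximal function is at most \<open>e\<close>, the volume of the cube.\<close>
      define b where "b = e / M0 powr p"
      have b: "b > 0" using e M0 by (simp add: b_def)
      have pt: "(\<Sum>j. ennreal ((norm (?f (k + j) y))\<^sup>2)) \<le> ennreal (M0\<^sup>2 * K) * (1 + ennreal b * ?V y)" for y
      proof -
        have "(\<Sum>j. ennreal ((norm (?f (k + j) y))\<^sup>2)) \<le>
            ennreal (M0\<^sup>2 / (1 - 2 powr - (real CARD('n) * (min p 2 / p)))) * (1 + ennreal (1 / (2 ^ k) ^ CARD('n) / M0 powr p) * ?V y)"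
          by (rule square_function_fin[OF p(1) M0(1) _ _ A0]) (auto intro: SUP_upper)
        then show ?thesis by (simp add: K_def g_def b_def e_def)
      qed
      have "(\<integral>\<^sup>+x\<in>Q. (\<Sum>j. ennreal ((norm (?f (k + j) x))\<^sup>2)) \<partial>lborel) \<le>
        (\<integral>\<^sup>+x. ennreal (M0\<^sup>2 * K) * (indicator Q x + ennreal b * ?V x) \<partial>lborel)"
      proof (rule nn_integral_mono)
        fix y
        show "(\<Sum>j. ennreal ((norm (?f (k + j) y))\<^sup>2)) * indicator Q y \<le> ennreal (M0\<^sup>2 * K) * (indicator Q y + ennreal b * ?V y)"
          using pt[of y] by (cases "y \<in> Q") auto
      qed
      also have "\<dots> = ennreal (M0\<^sup>2 * K) * (\<integral>\<^sup>+x. indicator Q x + ennreal b * ?V x \<partial>lborel)"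
        by (rule nn_integral_cmult) measurable
      also have "(\<integral>\<^sup>+x. indicator Q x + ennreal b * ?V x \<partial>lborel) = (\<integral>\<^sup>+x. indicator Q x \<partial>lborel) + (\<integral>\<^sup>+x. ennreal b * ?V x \<partial>lborel)"
        by (rule nn_integral_add) measurable
      also have "(\<integral>\<^sup>+x. ennreal b * ?V x \<partial>lborel) = ennreal b * (\<integral>\<^sup>+x. ?V x \<partial>lborel)"
        by (rule nn_integral_cmult) measurable
      also have "(\<integral>\<^sup>+x. indicator Q x \<partial>lborel) = ennreal e" using e by simp
      also have "ennreal (M0\<^sup>2 * K) * (ennreal e + ennreal b * (\<integral>\<^sup>+x. ?V x \<partial>lborel)) \<le> ennreal (M0\<^sup>2 * K) * (ennreal e + ennreal e)"
      proof (intro mult_left_mono add_left_mono)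
        have "ennreal b * (\<integral>\<^sup>+x. ?V x \<partial>lborel) \<le> ennreal b * ennreal (T powr p)" by (intro mult_left_mono V) simp
        also have "\<dots> = ennreal (b * T powr p)" using b by (simp add: ennreal_mult)
        also have "b * T powr p \<le> b * M0 powr p" using b T TM p(1) by (intro mult_left_mono powr_mono2) auto
        then have "ennreal (b * T powr p) \<le> ennreal (b * M0 powr p)" by (rule ennreal_leI)
        also have "b * M0 powr p = e" using M0 by (simp add: b_def)
        finally show "ennreal b * (\<integral>\<^sup>+x. ?V x \<partial>lborel) \<le> ennreal e" .
      qed simp_all
      also have "\<dots> = ennreal (2 * K * M0\<^sup>2) * ennreal e"
        using e K by (simp add: ennreal_plus[symmetric] ennreal_mult[symmetric] mult_ac del: ennreal_plus)
      also have "\<dots> \<le> ennreal (M\<^sup>2) * ennreal e"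
      proof (intro mult_right_mono ennreal_leI)
        have "(2 * K * M0\<^sup>2) * 1 \<le> (2 * K * M0\<^sup>2) * (2 * K)" using K by (intro mult_left_mono) auto
        then show "2 * K * M0\<^sup>2 \<le> M\<^sup>2" unfolding M0(2) by (simp add: power2_eq_square mult_ac)
      qed simp
      finally show "(\<integral>\<^sup>+x\<in>dyadic_cube k m. (\<Sum>j. ennreal ((norm (?f (k + j) x))\<^sup>2)) \<partial>lborel)
        \<le> ennreal (M\<^sup>2) * emeasure lborel (dyadic_cube k m :: (real^'n) set)"
        by (simp add: e(2)[symmetric] Q_def)
    qed
  qed
qed

section \<open>Infinite p: from the norm on dyadic cubes to the piece bounds\<close>

lemma same_cube_mono:
  assumes "same_cube (j + i) x y" shows "same_cube j x y"
  unfolding same_cube_def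
proof
  fix a
  have *: "\<lfloor>2 ^ j * t\<rfloor> = \<lfloor>2 ^ (j + i) * t\<rfloor> div 2 ^ i" for t :: real
  proof -
    have "2 ^ j * t = 2 ^ (j + i) * t / real_of_int (2 ^ i)" by (simp add: power_add)
    also have "\<lfloor>\<dots>\<rfloor> = \<lfloor>2 ^ (j + i) * t\<rfloor> div 2 ^ i" by (rule floor_divide_real_eq_div) simp
    finally show ?thesis .
  qed
  show "\<lfloor>2 ^ j * x $ a\<rfloor> = \<lfloor>2 ^ j * y $ a\<rfloor>" using assms unfolding same_cube_def * by simp
qed

lemma TL_norm_inf_cube:
  fixes \<phi>0 :: "real^'n \<Rightarrow> real"
  assumes gen: "TL_generator \<phi>0" and u: "tempered u" and fin: "TL_norm_inf \<phi>0 0 q u < \<infinity>" and q: "0 < q"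
  shows "(\<integral>\<^sup>+x\<in>dyadic_cube k m. (\<Sum>j. ennreal (norm (TL_piece \<phi>0 (k + j) u x) powr q)) \<partial>lborel)
    \<le> ennreal (enn2real (TL_norm_inf \<phi>0 0 q u) powr q) * emeasure lborel (dyadic_cube k m :: (real^'n) set)"
proof -
  note [measurable] = TL_piece_measurable[OF gen u]
  define e where "e = 1 / (2 ^ k :: real) ^ CARD('n)"
  have e: "e > 0" "emeasure lborel (dyadic_cube k m :: (real^'n) set) = ennreal e" by (simp_all add: e_def emeasure_dyadic_cube)
  have e': "emeasure lebesgue (dyadic_cube k m :: (real^'n) set) = ennreal e"
    using e(2) by (simp add: emeasure_completion)
  define I where "I = (\<integral>\<^sup>+x\<in>dyadic_cube k m. (\<Sum>j. ennreal (norm (TL_piece \<phi>0 (k + j) u x) powr q)) \<partial>lborel)"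
  have I: "(\<integral>\<^sup>+x\<in>dyadic_cube k m. (\<Sum>j. ennreal (2 powr (real (k + j) * 0 * q) * norm (TL_piece \<phi>0 (k + j) u x) powr q)) \<partial>lebesgue) = I"
    unfolding I_def by (subst nn_integral_completion) simp_all
  let ?T = "TL_norm_inf \<phi>0 0 q u"
  define G where "G k' m' = epowr (
        (\<integral>\<^sup>+x\<in>dyadic_cube k' m'. (\<Sum>j. ennreal (2 powr (real (k' + j) * 0 * q) *
            norm (TL_piece \<phi>0 (k' + j) u x) powr q)) \<partial>lebesgue)
        / emeasure lebesgue (dyadic_cube k' m' :: (real^'n) set)) (1 / q)" for k' m'
  have "epowr (I / ennreal e) (1 / q) = (case (k, m) of (k, m) \<Rightarrow> G k m)" by (simp only: G_def I e' prod.case)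
  also have "\<dots> \<le> (SUP (k, m) \<in> UNIV. G k m)" by (rule SUP_upper) simp
  also have "\<dots> \<le> Linf_norm (TL_piece \<phi>0 0 u) + (SUP (k, m) \<in> UNIV. G k m)"
    by (rule add_increasing) simp_all
  also have "\<dots> = ?T" unfolding TL_norm_inf_def G_def ..
  finally have le: "epowr (I / ennreal e) (1 / q) \<le> ?T" .
  then have nt: "I / ennreal e \<noteq> \<infinity>" using fin by (auto simp: epowr_def top_unique)
  then have "enn2real (I / ennreal e) powr (1 / q) \<le> enn2real ?T"
    using le fin by (intro le_enn2realI) (auto simp: epowr_def)
  then have "(enn2real (I / ennreal e) powr (1 / q)) powr q \<le> enn2real ?T powr q"
    using q by (intro powr_mono2) auto
  then have "enn2real (I / ennreal e) \<le> enn2real ?T powr q" using q by (simp add: powr_powr)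
  then have "I / ennreal e \<le> ennreal (enn2real ?T powr q)"
    using nt ennreal_leI[of "enn2real (I / ennreal e)" "enn2real ?T powr q"]
    by (simp add: ennreal_enn2real less_top)
  then have "(I / ennreal e) * ennreal e \<le> ennreal (enn2real ?T powr q) * ennreal e" by (rule mult_right_mono) simp
  moreover have "(I / ennreal e) * ennreal e = I"
    using e(1) by (simp add: ennreal_divide_times mult_divide_eq_ennreal)
  ultimately show ?thesis unfolding e(2) I_def[symmetric] by simp
qed

text \<open>The ball of near constancy contains a cube that is \<open>i\<close> levels below level
  \<open>j\<close>. Its parent cube of level \<open>j\<close> has volume larger by the fixed factor
  \<open>B\<close>, so the local norm there controls the supremum of |f_j|. Counting pieces gives
  exponent 1, and q \<le> 2 allows the surplus power of |f_j| to be bounded by this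
  supremum.\<close>

lemma piece_bounds_inf:
  fixes \<phi>0 :: "real^'n \<Rightarrow> real"
  assumes gen: "TL_generator \<phi>0" and q: "0 < q" "q \<le> 2"
  shows "\<exists>C>0. \<forall>u M. tempered u \<longrightarrow> TL_norm_inf \<phi>0 0 q u < \<infinity> \<longrightarrow> 0 < M \<longrightarrow>
    C * enn2real (TL_norm_inf \<phi>0 0 q u) \<le> M \<longrightarrow> piece_bounds \<phi>0 1 M u"
proof -
  obtain \<rho> where \<rho>: "\<rho> > 0" and loc: "\<And>u j x. tempered u \<Longrightarrow>
    (\<exists>x0. \<forall>y\<in>cball x0 (\<rho> / 2 ^ j). norm (TL_piece \<phi>0 j u x) \<le> 4 * norm (TL_piece \<phi>0 j u y))"
    using TL_piece_local_constancy[OF gen] by blast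
  \<comment> \<open>A cube \<open>i\<close> levels below level \<open>j\<close> has diameter at most
    n 2^(-i-j), which must not exceed the radius \<rho> 2^(-j) of near constancy.\<close>
  obtain i :: nat where i: "CARD('n) / \<rho> < 2 ^ i" using real_arch_pow[of 2 "CARD('n) / \<rho>"] by auto
  have i\<rho>: "CARD('n) / 2 ^ i \<le> \<rho>" using i \<rho> by (simp add: field_simps)
  define B where "B = ((2::real) ^ i) ^ CARD('n)"
  have B: "B > 0" by (simp add: B_def)
  define C where "C = max 1 (4 * B powr (1 / q))"
  have C: "C \<ge> 1" "4 * B powr (1 / q) \<le> C" by (simp_all add: C_def)
  show ?thesis
  proof (intro exI[of _ C] conjI allI impI)
    show "0 < C" using C by simp
    fix u :: "(real^'n \<Rightarrow> complex) \<Rightarrow> complex" and M :: real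
    assume u: "tempered u" and fin: "TL_norm_inf \<phi>0 0 q u < \<infinity>" and M: "0 < M"
      and le: "C * enn2real (TL_norm_inf \<phi>0 0 q u) \<le> M"
    note [measurable] = TL_piece_measurable[OF gen u]
    define T where "T = enn2real (TL_norm_inf \<phi>0 0 q u)"
    have T: "T \<ge> 0" by (simp add: T_def)
    have TM: "T \<le> M" using le C(1) mult_right_mono[OF C(1) T] unfolding T_def by simp
    let ?f = "\<lambda>j. TL_piece \<phi>0 j u"
    have cube: "(\<integral>\<^sup>+x\<in>dyadic_cube k m. (\<Sum>j. ennreal (norm (?f (k + j) x) powr q)) \<partial>lborel)
      \<le> ennreal (T powr q) * emeasure lborel (dyadic_cube k m :: (real^'n) set)" for k m
      unfolding T_def by (rule TL_norm_inf_cube[OF gen u fin q(1)])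
    have A: "norm (?f j x) \<le> M" for j x
    proof -
      obtain x0 where x0: "\<And>y. y \<in> cball x0 (\<rho> / 2 ^ j) \<Longrightarrow> norm (?f j x) \<le> 4 * norm (?f j y)"
        using loc[OF u, of j x] by blast
      define Q where "Q = dyadic_cube j (\<lambda>i. \<lfloor>2 ^ j * x0 $ i\<rfloor>)"
      define Q' where "Q' = dyadic_cube (j + i) (\<lambda>a. \<lfloor>2 ^ (j + i) * x0 $ a\<rfloor>)"
      have [measurable]: "Q \<in> sets borel" "Q' \<in> sets borel" by (simp_all add: Q_def Q'_def)
      have sub: "Q' \<subseteq> Q"
        unfolding Q_def Q'_def same_cube_eq_dyadic[symmetric] using same_cube_mono by auto
      have near: "norm (?f j x) / 4 \<le> norm (?f j y)" if "y \<in> Q'" for y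
      proof -
        have "same_cube (j + i) x0 y" using that unfolding Q'_def same_cube_eq_dyadic[symmetric] by simp
        then have "dist x0 y \<le> CARD('n) / 2 ^ (j + i)" by (rule same_cube_dist)
        also have "\<dots> = (CARD('n) / 2 ^ i) / 2 ^ j" by (simp add: power_add)
        also have "\<dots> \<le> \<rho> / 2 ^ j" by (intro divide_right_mono i\<rho>) simp
        finally have "norm (?f j x) \<le> 4 * norm (?f j y)" by (intro x0) simp
        then show ?thesis by simp
      qed
      define c where "c = (norm (?f j x) / 4) powr q"
      have "ennreal c * emeasure lborel Q' = (\<integral>\<^sup>+y. ennreal c * indicator Q' y \<partial>lborel)"
        by (rule nn_integral_cmult_indicator[symmetric]) measurable
      also have "\<dots> \<le> (\<integral>\<^sup>+y\<in>Q. (\<Sum>l. ennreal (norm (?f (j + l) y) powr q)) \<partial>lborel)"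
      proof (rule nn_integral_mono)
        fix y
        show "ennreal c * indicator Q' y \<le> (\<Sum>l. ennreal (norm (?f (j + l) y) powr q)) * indicator Q y"
        proof (cases "y \<in> Q'")
          case True
          have "c \<le> norm (?f j y) powr q" unfolding c_def using near[OF True] q by (intro powr_mono2) auto
          then have "ennreal c \<le> ennreal (norm (?f (j + 0) y) powr q)" by (intro ennreal_leI) simp
          also have "\<dots> \<le> (\<Sum>l. ennreal (norm (?f (j + l) y) powr q))"
          proof -
            define F where "F l = ennreal (norm (?f (j + l) y) powr q)" for l
            have "(\<Sum>l\<in>{0}. F l) \<le> (\<Sum>l. F l)" by (rule sum_le_suminf) auto
            then have "F 0 \<le> (\<Sum>l. F l)" by simp
            then show ?thesis by (simp only: F_def)
          qed
          finally show ?thesis using True sub by auto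
        qed simp
      qed
      also have "\<dots> \<le> ennreal (T powr q) * emeasure lborel Q" unfolding Q_def by (rule cube)
      finally have "ennreal (c * (1 / (2 ^ (j + i)) ^ CARD('n))) \<le> ennreal (T powr q * (1 / (2 ^ j) ^ CARD('n)))"
        unfolding Q_def Q'_def emeasure_dyadic_cube by (subst (1 2) ennreal_mult) (auto simp: c_def)
      then have "c * (1 / (2 ^ (j + i)) ^ CARD('n)) \<le> T powr q * (1 / (2 ^ j) ^ CARD('n))"
        by (subst (asm) ennreal_le_iff) auto
      moreover have "((2::real) ^ (j + i)) ^ CARD('n) = (2 ^ j) ^ CARD('n) * B"
        by (simp add: B_def power_add power_mult_distrib)
      ultimately have "c \<le> T powr q * B" using B by (simp add: field_simps)
      also have "T powr q * B = (T * B powr (1 / q)) powr q" using q B T by (simp add: powr_mult powr_powr)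
      finally have "norm (?f j x) / 4 \<le> T * B powr (1 / q)"
        unfolding c_def by (rule powr_le_iff_base[OF q(1), rotated 2]) (simp_all add: T)
      then have "norm (?f j x) \<le> (4 * B powr (1 / q)) * T" by (simp add: mult_ac)
      also have "\<dots> \<le> C * T" by (intro mult_right_mono C T)
      also have "\<dots> \<le> M" using le by (simp add: T_def)
      finally show ?thesis .
    qed
    show "piece_bounds \<phi>0 1 M u"
      unfolding piece_bounds_def
    proof (intro conjI allI)
      show "norm (?f j x) \<le> M" for j x by (rule A)
      show "(\<Sum>j<Suc J. norm (?f j x)) \<le> M * real (Suc J) powr 1" for J x
      proof -
        have "(\<Sum>j<Suc J. norm (?f j x)) \<le> (\<Sum>j<Suc J. M)" by (intro sum_mono A)
        then show ?thesis by (simp add: mult.commute)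
      qed
      fix k and m :: "'n \<Rightarrow> int"
      let ?Q = "dyadic_cube k m :: (real^'n) set"
      have "(\<integral>\<^sup>+x\<in>?Q. (\<Sum>j. ennreal ((norm (?f (k + j) x))\<^sup>2)) \<partial>lborel) \<le>
        (\<integral>\<^sup>+x. ennreal (M powr (2 - q)) * ((\<Sum>j. ennreal (norm (?f (k + j) x) powr q)) * indicator ?Q x) \<partial>lborel)"
      proof (rule nn_integral_mono)
        fix x
        have "ennreal ((norm (?f (k + j) x))\<^sup>2) \<le> ennreal (M powr (2 - q)) * ennreal (norm (?f (k + j) x) powr q)" for j
        proof -
          \<comment> \<open>The case of value 0 is separate because \<open>powr\<close> at base 0 is
            0 for every exponent, also when 2 - q = 0.\<close>
          have "(norm (?f (k + j) x))\<^sup>2 = norm (?f (k + j) x) powr (2 - q) * norm (?f (k + j) x) powr q"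
            by (cases "?f (k + j) x = 0") (simp_all add: powr_add[symmetric])
          also have "\<dots> \<le> M powr (2 - q) * norm (?f (k + j) x) powr q"
            using q A by (intro mult_right_mono powr_mono2) auto
          finally show ?thesis by (subst ennreal_mult[symmetric]) (auto intro: ennreal_leI)
        qed
        then have "(\<Sum>j. ennreal ((norm (?f (k + j) x))\<^sup>2)) \<le> (\<Sum>j. ennreal (M powr (2 - q)) * ennreal (norm (?f (k + j) x) powr q))"
          by (intro suminf_le) auto
        also have "\<dots> = ennreal (M powr (2 - q)) * (\<Sum>j. ennreal (norm (?f (k + j) x) powr q))"
          by (rule ennreal_suminf_cmult)
        finally show "(\<Sum>j. ennreal ((norm (?f (k + j) x))\<^sup>2)) * indicator ?Q x \<le>
          ennreal (M powr (2 - q)) * ((\<Sum>j. ennreal (norm (?f (k + j) x) powr q)) * indicator ?Q x)"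
          unfolding mult.assoc[symmetric] by (rule mult_right_mono) simp
      qed
      also have "\<dots> = ennreal (M powr (2 - q)) * (\<integral>\<^sup>+x\<in>?Q. (\<Sum>j. ennreal (norm (?f (k + j) x) powr q)) \<partial>lborel)"
        by (rule nn_integral_cmult) measurable
      also have "\<dots> \<le> ennreal (M powr (2 - q)) * (ennreal (M powr q) * emeasure lborel ?Q)"
      proof (intro mult_left_mono order_trans[OF cube] mult_right_mono ennreal_leI)
        show "T powr q \<le> M powr q" using q T TM by (intro powr_mono2) auto
      qed simp_all
      also have "\<dots> = ennreal (M powr (2 - q) * M powr q) * emeasure lborel ?Q"
        by (simp add: ennreal_mult mult.assoc)
      also have "M powr (2 - q) * M powr q = M\<^sup>2" using M by (simp add: powr_add[symmetric])
      finally show "(\<integral>\<^sup>+x\<in>?Q. (\<Sum>j. ennreal ((norm (?f (k + j) x))\<^sup>2)) \<partial>lborel) \<le> ennreal (M\<^sup>2) * emeasure lborel ?Q" .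
    qed
  qed
qed

section \<open>The embedding theorem\<close>

lemma TL_norm_piece_bounds:
  fixes \<phi>0 :: "real^'n \<Rightarrow> real"
  assumes gen: "TL_generator \<phi>0"
    and pq: "(0 < p \<and> p < \<infinity> \<and> 0 < q) \<or> (p = \<infinity> \<and> 0 < q \<and> q \<le> 2)"
    and s: "s = (if p = \<infinity> then 0 else real CARD('n) / enn2real p)"
    and r: "r = max 1 p"
  shows "\<exists>C>0. \<forall>u M. tempered u \<longrightarrow> TL_norm \<phi>0 s p q u < \<infinity> \<longrightarrow> 0 < M \<longrightarrow>
    C * enn2real (TL_norm \<phi>0 s p q u) \<le> M \<longrightarrow> piece_bounds \<phi>0 (enn2real (1 - 1 / r)) M u"
    and "0 \<le> enn2real (1 - 1 / r)" "enn2real (1 - 1 / r) \<le> 1"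
proof -
  have "1 - 1 / r \<le> 1" by (rule diff_le_self_ennreal)
  then have "enn2real (1 - 1 / r) \<le> enn2real 1" by (rule enn2real_mono) simp
  then show "0 \<le> enn2real (1 - 1 / r)" "enn2real (1 - 1 / r) \<le> 1" by simp_all
  show "\<exists>C>0. \<forall>u M. tempered u \<longrightarrow> TL_norm \<phi>0 s p q u < \<infinity> \<longrightarrow> 0 < M \<longrightarrow>
    C * enn2real (TL_norm \<phi>0 s p q u) \<le> M \<longrightarrow> piece_bounds \<phi>0 (enn2real (1 - 1 / r)) M u"
  proof (cases "p = \<infinity>")
    case True
    then have q: "0 < q" "q \<le> 2" using pq by auto
    have q2: "enn2real q \<le> 2" using enn2real_mono[OF q(2)] by simp
    have "q < \<top>" using q(2) by (rule le_less_trans) simp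
    then have q0: "0 < enn2real q" using q(1) by (simp add: enn2real_positive_iff)
    \<comment> \<open>In \<open>ennreal\<close> the quotient 1 / \<infinity> is 0, so the conjugate
      exponent needs no separate convention.\<close>
    have "enn2real (1 - 1 / r) = 1" using True r by simp
    moreover have "s = 0" "TL_norm \<phi>0 s p q u = TL_norm_inf \<phi>0 s (enn2real q) u" for u
      using True s by (simp_all add: TL_norm_def)
    ultimately show ?thesis using piece_bounds_inf[OF gen q0 q2] by simp
  next
    case False
    then have p: "0 < p" "p < \<top>" and q: "0 < q" using pq by (auto simp: less_top)
    define P where "P = enn2real p"
    have P: "P > 0" "p = ennreal P" using p by (auto simp: P_def enn2real_positive_iff)
    have "r = ennreal (max 1 P)" using P(2) r P(1) by (cases "1 \<le> P") (auto simp: max_def)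
    then have "1 - 1 / r = 1 - ennreal (1 / max 1 P)"
      by (simp add: divide_ennreal ennreal_1[symmetric] del: ennreal_1)
    also have "\<dots> = ennreal (1 - 1 / max 1 P)"
      by (simp add: ennreal_minus ennreal_1[symmetric] del: ennreal_1)
    finally have "enn2real (1 - 1 / r) = 1 - 1 / max 1 P"
      by (simp add: max_def)
    moreover have "TL_norm \<phi>0 s p q u = TL_norm_fin \<phi>0 s P q u" for u
      using False by (simp add: TL_norm_def P_def)
    moreover have "s * P = CARD('n)" using s False P(1) by (simp add: P_def)
    ultimately show ?thesis using piece_bounds_fin[OF gen P(1) _ q, of s] by simp
  qed
qed

text \<open>Elements of the source are functionals and those of the target are functions, so the
  embedding sends \<open>u\<close> to a function representing it.\<close>

theorem theorem3p1:
  fixes \<phi> :: "real^'n \<Rightarrow> complex" and \<phi>0 :: "real^'n \<Rightarrow> real"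
    and p q r :: ennreal and s :: real and w :: "real \<Rightarrow> real"
  assumes "X_cutoff \<phi>" and "TL_generator \<phi>0"
    and "(0 < p \<and> p < \<infinity> \<and> 0 < q) \<or> (p = \<infinity> \<and> 0 < q \<and> q \<le> 2)"
    and "s = (if p = \<infinity> then 0 else real CARD('n) / enn2real p)"
    and "r = max 1 p"
    and "w = (\<lambda>t. (1 + log_plus (1 / t)) powr enn2real (1 - 1 / r))"
  shows "\<exists>C>0. \<forall>u \<in> TL_space \<phi>0 s p q. \<exists>f \<in> X_space \<phi> w.
           represents f u \<and> X_norm \<phi> w f \<le> ennreal C * TL_norm \<phi>0 s p q u"
proof -
  define \<theta> where "\<theta> = enn2real (1 - 1 / r)"
  note tl = TL_norm_piece_bounds[OF assms(2-5), folded \<theta>_def]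
  obtain C1 where C1: "C1 > 0" and pb: "\<And>u M. tempered u \<Longrightarrow> TL_norm \<phi>0 s p q u < \<infinity> \<Longrightarrow> 0 < M \<Longrightarrow>
    C1 * enn2real (TL_norm \<phi>0 s p q u) \<le> M \<Longrightarrow> piece_bounds \<phi>0 \<theta> M u"
    using tl(1) by blast
  obtain C2 where C2: "C2 > 0" and emb: "\<And>u. tempered u \<Longrightarrow> (\<exists>M>0. piece_bounds \<phi>0 \<theta> M u) \<Longrightarrow>
    (\<exists>f. locally_integrable f \<and> represents f u \<and>
      (\<forall>M>0. piece_bounds \<phi>0 \<theta> M u \<longrightarrow> X_norm \<phi> (\<lambda>t. (1 + log_plus (1 / t)) powr \<theta>) f \<le> ennreal (C2 * M)))"
    using embedding_from_piece_bounds[OF assms(1,2) tl(2,3)] by blast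
  have w: "w = (\<lambda>t. (1 + log_plus (1 / t)) powr \<theta>)" by (simp add: assms(6) \<theta>_def)
  show ?thesis
  proof (intro exI[of _ "C2 * C1"] conjI ballI)
    show "0 < C2 * C1" using C1 C2 by simp
    fix u assume "u \<in> TL_space \<phi>0 s p q"
    then have u: "tempered u" and fin: "TL_norm \<phi>0 s p q u < \<infinity>" by (auto simp: TL_space_def)
    define T where "T = enn2real (TL_norm \<phi>0 s p q u)"
    have T: "T \<ge> 0" "TL_norm \<phi>0 s p q u = ennreal T" using fin by (auto simp: T_def less_top)
    \<comment> \<open>The piece bounds are used with a positive constant, but the norm may be 0.
      Adding an arbitrary e > 0 keeps the constant positive and is removed in the limit.\<close>
    have pbe: "piece_bounds \<phi>0 \<theta> (C1 * T + e) u" if "e > 0" for e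
      using that C1 T(1) by (intro pb[OF u fin]) (auto simp: T_def[symmetric] add_nonneg_pos)
    have pos: "0 < C1 * T + e" if "e > 0" for e using that C1 T(1) by (simp add: add_nonneg_pos)
    from emb[OF u] pbe[of 1] pos[of 1] obtain f where f: "locally_integrable f" "represents f u"
      and X: "\<And>M. M > 0 \<Longrightarrow> piece_bounds \<phi>0 \<theta> M u \<Longrightarrow> X_norm \<phi> w f \<le> ennreal (C2 * M)"
      unfolding w by fastforce
    have "X_norm \<phi> w f \<le> ennreal (C2 * C1 * T)"
    proof (rule ennreal_le_epsilon)
      fix e :: real assume e: "e > 0"
      have e2: "e / C2 > 0" using e C2 by simp
      have "X_norm \<phi> w f \<le> ennreal (C2 * (C1 * T + e / C2))" by (rule X[OF pos[OF e2] pbe[OF e2]])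
      also have "\<dots> = ennreal (C2 * C1 * T) + ennreal e"
        using C1 C2 T(1) e by (subst ennreal_plus[symmetric]) (auto simp: distrib_left)
      finally show "X_norm \<phi> w f \<le> ennreal (C2 * C1 * T) + ennreal e" .
    qed
    then have le: "X_norm \<phi> w f \<le> ennreal (C2 * C1) * TL_norm \<phi>0 s p q u"
      using C1 C2 T by (simp add: ennreal_mult)
    also have "\<dots> < \<infinity>" using T(2) by (simp add: ennreal_mult_less_top)
    finally have "f \<in> X_space \<phi> w" using f(1) by (simp add: X_space_def)
    then show "\<exists>f\<in>X_space \<phi> w. represents f u \<and> X_norm \<phi> w f \<le> ennreal (C2 * C1) * TL_norm \<phi>0 s p q u"
      using f(2) le by blast
  qed
qed

end
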